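(* Let $D\subset\mathbb C^n$ be a bounded convex visible domain with Dini-smooth boundary. Then for any $p\in\partial D$ and any neighborhoods $V\Subset U$ of $p$ with $D\cap U$ connected, there exists $C>0$ such that for all $z,w\in D\cap V$ with $z\neq w$ and all $X\in\mathbb C^n$ one has $$\frac{k_{D\cap U}(z,w)}{c_D(z,w)}\le 1+C f_D(z,w),$$ $$k_{D\cap U}(z,w)-c_D(z,w)\le C g_D(z,w),$$ $$\kappa_{D\cap U}(z;X)\le(1+C\delta_D(z)^2)\,\gamma_D(z;X)\le\gamma_D(z;X)+C\delta_D(z)|X|.$$
   Context: Let $\mathbb D\subset\mathbb C$ be the open unit disc, let $\mathcal O(A,B)$ denote the set of holomorphic maps from $A$ to $B$, and let $\tanh^{-1}t=\frac12\log\frac{1+t}{1-t}$. For a domain $D\subset\mathbb C^n$, $z,w\in D$, $X\in\mathbb C^n$: - Lempert function: $l_D(z,w)=\inf\{\tanh^{-1}|\alpha|:\exists\varphi\in\mathcal O(\mathbb D,D)\text{ with }\varphi(0)=z,\ \varphi(\alpha)=w\}$. - Kobayashi distance: $k_D$ is the largest pseudodistance on $D$ not exceeding $l_D$. - Kobayashi metric: $\kappa_D(z;X)=\inf\{|\alpha|:\exists\varphi\in\mathcal O(\mathbb D,D)\text{ with }\varphi(0)=z,\ \alpha\varphi'(0)=X\}$. - Carathéodory distance: $c_D(z,w)=\sup\{\tanh^{-1}|f(w)|:f\in\mathcal O(D,\mathbb D),\ f(z)=0\}$. - Carathéodory metric: $\gamma_D(z;X)=\sup\{|f'(z)X|:f\in\mathcal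 O(D,\mathbb D)\}$. Set $\delta_D(z)=\mathrm{dist}(z,\partial D)$ (Euclidean distance), $h(x)=\dfrac{x(1+x)}{\log(1+x)}$ for $x>0$, and $$f_D(z,w)=\delta_D(z)\delta_D(w)\,h\!\left(\frac{|z-w|}{\delta_D(z)^{1/2}\delta_D(w)^{1/2}}\right),\qquad g_D(z,w)=|z-w|\left(|z-w|+\delta_D(z)^{1/2}\delta_D(w)^{1/2}\right).$$ The boundary $\partial D$ is Dini-smooth if it is $\mathcal C^1$-smooth and its inner unit normal vector is a Dini-continuous function on $\partial D$, i.e. its modulus of continuity $\omega$ satisfies $\int_0^1\frac{\omega(t)}{t}\,dt<\infty$. A real geodesic of $D$ is a curve $\psi:[a,b]\to D$ with $k_D(\psi(s),\psi(t))=|s-t|$ for all $s,t\in[a,b]$. A bounded domain $D$ that is complete with respect to $k_D$ (every bounded convex domain is) is called visible if for any $\varepsilon>0$ there is $K\Subset D$ that intersects (the image of) every real geodesic $\psi$ of $D$ with Euclidean diameter $\mathrm{diam}(\psi)>\varepsilon$. *)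

theory Defs
  imports "HOL-Analysis.Analysis"
begin

definition domain_on :: "'a::topological_space set \<Rightarrow> bool" where
  "domain_on D \<longleftrightarrow> open D \<and> connected D \<and> D \<noteq> {}"

definition compactly_contained :: "'a::topological_space set \<Rightarrow> 'a set \<Rightarrow> bool" where
  "compactly_contained K U \<longleftrightarrow> compact (closure K) \<and> closure K \<subseteq> U"

definition disc_maps :: "(complex ^ 'n) set \<Rightarrow> (complex \<Rightarrow> complex ^ 'n) set" where
  "disc_maps D = {\<phi>. (\<forall>i. (\<lambda>\<zeta>. \<phi> \<zeta> $ i) holomorphic_on ball 0 1) \<and> \<phi> ` ball 0 1 \<subseteq> D}"

definition disc_deriv :: "(complex \<Rightarrow> complex ^ 'n) \<Rightarrow> complex \<Rightarrow> complex ^ 'n" where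
  "disc_deriv \<phi> \<zeta> = (\<chi> i. deriv (\<lambda>\<xi>. \<phi> \<xi> $ i) \<zeta>)"

text \<open>Holomorphy in several variables means that the real Frechet derivative exists and is
  complex linear; \<open>*s\<close> is multiplication by a complex scalar.\<close>

definition maps_to_disc :: "(complex ^ 'n) set \<Rightarrow> (complex ^ 'n \<Rightarrow> complex) set" where
  "maps_to_disc D = {f. (\<forall>z\<in>D. \<exists>f'. (f has_derivative f') (at z) \<and>
                             (\<forall>c v. f' (c *s v) = c * f' v)) \<and>
                        f ` D \<subseteq> ball 0 1}"

text \<open>The value is infinite if no analytic disc joins the two points.\<close>

definition lempert :: "(complex ^ 'n) set \<Rightarrow> complex ^ 'n \<Rightarrow> complex ^ 'n \<Rightarrow> ereal" where
  "lempert D z w =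
     Inf {ereal (artanh (norm \<alpha>)) | \<alpha>.
            \<alpha> \<in> ball 0 1 \<and> (\<exists>\<phi>\<in>disc_maps D. \<phi> 0 = z \<and> \<phi> \<alpha> = w)}"

definition pseudodistance_on :: "'a set \<Rightarrow> ('a \<Rightarrow> 'a \<Rightarrow> real) \<Rightarrow> bool" where
  "pseudodistance_on D d \<longleftrightarrow>
     (\<forall>x\<in>D. \<forall>y\<in>D. 0 \<le> d x y \<and> d x y = d y x) \<and> (\<forall>x\<in>D. d x x = 0) \<and>
     (\<forall>x\<in>D. \<forall>y\<in>D. \<forall>z\<in>D. d x z \<le> d x y + d y z)"

text \<open>The pointwise supremum of the pseudodistances below the Lempert function is again one
  (it is finite when \<open>D\<close> is a domain), hence the largest. The value 0 off \<open>D\<close> makes the function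
  nonnegative and symmetric everywhere, as the locale \<open>Metric_space\<close> requires.\<close>

definition kobayashi_dist :: "(complex ^ 'n) set \<Rightarrow> complex ^ 'n \<Rightarrow> complex ^ 'n \<Rightarrow> real" where
  "kobayashi_dist D z w =
     (if z \<in> D \<and> w \<in> D
      then Sup {d z w | d. pseudodistance_on D d \<and>
                           (\<forall>x\<in>D. \<forall>y\<in>D. ereal (d x y) \<le> lempert D x y)}
      else 0)"

definition kobayashi_metric :: "(complex ^ 'n) set \<Rightarrow> complex ^ 'n \<Rightarrow> complex ^ 'n \<Rightarrow> real" where
  "kobayashi_metric D z X =
     Inf {norm \<alpha> | \<alpha> :: complex. \<exists>\<phi>\<in>disc_maps D. \<phi> 0 = z \<and> \<alpha> *s disc_deriv \<phi> 0 = X}"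

definition caratheodory_dist :: "(complex ^ 'n) set \<Rightarrow> complex ^ 'n \<Rightarrow> complex ^ 'n \<Rightarrow> real" where
  "caratheodory_dist D z w = Sup {artanh (norm (f w)) | f. f \<in> maps_to_disc D \<and> f z = 0}"

definition caratheodory_metric :: "(complex ^ 'n) set \<Rightarrow> complex ^ 'n \<Rightarrow> complex ^ 'n \<Rightarrow> real" where
  "caratheodory_metric D z X = Sup {norm (frechet_derivative f (at z) X) | f. f \<in> maps_to_disc D}"

definition bdist :: "'a::metric_space set \<Rightarrow> 'a \<Rightarrow> real" where
  "bdist D z = infdist z (frontier D)"

definition h_fun :: "real \<Rightarrow> real" where
  "h_fun x = x * (1 + x) / ln (1 + x)"

definition f_fun :: "'a::real_normed_vector set \<Rightarrow> 'a \<Rightarrow> 'a \<Rightarrow> real" where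
  "f_fun D z w =
     bdist D z * bdist D w * h_fun (norm (z - w) / (sqrt (bdist D z) * sqrt (bdist D w)))"

definition g_fun :: "'a::real_normed_vector set \<Rightarrow> 'a \<Rightarrow> 'a \<Rightarrow> real" where
  "g_fun D z w = norm (z - w) * (norm (z - w) + sqrt (bdist D z) * sqrt (bdist D w))"

text \<open>\<open>r\<close> is a \<open>C\<^sup>1\<close> defining function of \<open>D\<close> in the open set \<open>U\<close>, with nowhere vanishing
  gradient \<open>g\<close>.\<close>

definition C1_defining :: "'a::euclidean_space set \<Rightarrow> 'a set \<Rightarrow> ('a \<Rightarrow> real) \<Rightarrow> ('a \<Rightarrow> 'a) \<Rightarrow> bool" where
  "C1_defining D U r g \<longleftrightarrow>
     open U \<and> D \<inter> U = {x \<in> U. r x < 0} \<and> continuous_on U g \<and>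
     (\<forall>x\<in>U. g x \<noteq> 0 \<and> (r has_derivative (\<lambda>v. g x \<bullet> v)) (at x))"

definition C1_boundary :: "'a::euclidean_space set \<Rightarrow> bool" where
  "C1_boundary D \<longleftrightarrow> (\<forall>p\<in>frontier D. \<exists>U r g. p \<in> U \<and> C1_defining D U r g)"

definition inner_unit_normal :: "'a::euclidean_space set \<Rightarrow> 'a \<Rightarrow> 'a \<Rightarrow> bool" where
  "inner_unit_normal D p \<nu> \<longleftrightarrow>
     (\<exists>U r g. p \<in> U \<and> C1_defining D U r g \<and> \<nu> = - (g p /\<^sub>R norm (g p)))"

definition modulus_of_continuity ::
    "'a::metric_space set \<Rightarrow> ('a \<Rightarrow> 'b::metric_space) \<Rightarrow> real \<Rightarrow> ennreal" where
  "modulus_of_continuity S \<nu> t =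
     Sup {ennreal (dist (\<nu> x) (\<nu> y)) | x y. x \<in> S \<and> y \<in> S \<and> dist x y \<le> t}"

definition Dini_continuous_on :: "'a::metric_space set \<Rightarrow> ('a \<Rightarrow> 'b::metric_space) \<Rightarrow> bool" where
  "Dini_continuous_on S \<nu> \<longleftrightarrow>
     (\<integral>\<^sup>+t\<in>{0<..1}. modulus_of_continuity S \<nu> t / ennreal t \<partial>lborel) < \<infinity>"

definition Dini_smooth_boundary :: "'a::euclidean_space set \<Rightarrow> bool" where
  "Dini_smooth_boundary D \<longleftrightarrow>
     C1_boundary D \<and>
     (\<exists>\<nu>. (\<forall>p\<in>frontier D. inner_unit_normal D p (\<nu> p)) \<and> Dini_continuous_on (frontier D) \<nu>)"

definition real_geodesic :: "(complex ^ 'n) set \<Rightarrow> real \<Rightarrow> real \<Rightarrow> (real \<Rightarrow> complex ^ 'n) \<Rightarrow> bool" where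
  "real_geodesic D a b \<psi> \<longleftrightarrow>
     a \<le> b \<and> continuous_on {a..b} \<psi> \<and> \<psi> ` {a..b} \<subseteq> D \<and>
     (\<forall>s\<in>{a..b}. \<forall>t\<in>{a..b}. kobayashi_dist D (\<psi> s) (\<psi> t) = \<bar>s - t\<bar>)"

definition visible_domain :: "(complex ^ 'n) set \<Rightarrow> bool" where
  "visible_domain D \<longleftrightarrow>
     domain_on D \<and> bounded D \<and> Metric_space.mcomplete D (kobayashi_dist D) \<and>
     (\<forall>\<epsilon>>0. \<exists>K. compactly_contained K D \<and>
        (\<forall>a b \<psi>. real_geodesic D a b \<psi> \<and> diameter (\<psi> ` {a..b}) > \<epsilon> \<longrightarrow>
           \<psi> ` {a..b} \<inter> K \<noteq> {}))"

end

theory Submission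
  imports Defs "HOL-Complex_Analysis.Complex_Analysis"
begin

no_notation fps_nth (infixl "$" 75)

text \<open>Lempert's theorem gives complex geodesics of \<open>D\<close>: analytic discs along which Kobayashi and
  Caratheodory distance both equal the Poincare distance. It is obtained by duality: if no disc
  realizes an extremal value, a positive functional separates the constant \<open>1\<close> from all discs, and its
  Cauchy transform yields a function whose roots define a competing holomorphic function on \<open>D\<close>.

  Take a geodesic through \<open>z, w \<in> D \<inter> V\<close>. By visibility, any stretch of it leading
  out of \<open>U\<close> passes through a fixed compact set, say at the image of \<open>\<i>\<close> in a half-plane
  parametrization in which \<open>z\<close> corresponds to \<open>\<i> y\<close>. Almost additivity of the hyperbolic distance
  along the stretch then keeps the part of the half-plane mapped outside \<open>U\<close> at distance at least
  \<open>r\<close> from \<open>0\<close>, with \<open>r\<close> independent of \<open>z, w\<close>. Composing with the conformal map of a half-disc of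
  radius \<open>r\<close> onto the half-plane costs only a second order term, a multiple of
  \<open>y Im b sinh \<rho> cosh \<rho>\<close>, where \<open>b\<close> corresponds to \<open>w\<close> and \<open>\<rho>\<close> is the distance. Comparison with
  half-spaces bounds heights by boundary distances, and Dini smoothness, through analytic discs in
  the normal direction, gives \<open>exp \<rho> \<le> 1 + C x\<close> with \<open>x = |z - w| / (\<delta>(z) \<delta>(w))^(1/2)\<close>.
  Together they give the estimates near the boundary; elsewhere they hold for cruder reasons.\<close>

section \<open>The Poincare distance\<close>

text \<open>What shapes the proof is the size of the loss: it has to be of order \<delta>(z)
  \<delta>(w), and a bounded additive error is far too coarse near the boundary. Hence the half-disc
  is compared with the half-plane through the explicit map \<open>hmap\<close>, whose effect on
  sinh^2 of the distance is an exact formula. Bounded errors are tolerated at two places only. In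
  locating the exit from U they merely influence the radius r. In the dichotomy of
  \<open>localization\<close>, either both parameters lie in the half-disc of radius r/2, or
  \<delta>(z) \<delta>(w) exp(2 k_D(z,w)) is bounded below. In the latter case z and w are a
  definite distance apart or both deep in D, and f and g dominate the error.

  The duality works with all bounded functions on the circle and a merely finitely additive
  functional; only its Cauchy and Poisson transforms are used. Its output falls short of extremality
  by a factor r < 1, removed by letting r tend to 1. Extremal discs then come from normal families,
  and equality in the Schwarz lemma spreads extremality from one pair of points, or one direction,
  to the whole disc.\<close>

definition pdisc :: "complex \<Rightarrow> complex \<Rightarrow> real" where
  "pdisc a b = cmod ((a - b) / (1 - cnj a * b))"

definition rho :: "complex \<Rightarrow> complex \<Rightarrow> real" where
  "rho a b = artanh (pdisc a b)"

lemma artanh_mono: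
  fixes x y :: real
  assumes "0 \<le> x" "x \<le> y" "y < 1"
  shows "artanh x \<le> artanh y"
proof -
  have "(1 + x) / (1 - x) \<le> (1 + y) / (1 - y)"
    using assms by (simp add: divide_simps) (simp add: algebra_simps)
  moreover have "0 < (1 + x) / (1 - x)" using assms by simp
  ultimately show ?thesis unfolding artanh_def by (simp add: divide_right_mono)
qed

lemma artanh_nonneg: "0 \<le> x \<Longrightarrow> x < 1 \<Longrightarrow> 0 \<le> artanh (x::real)"
  using artanh_mono[of 0 x] by simp

lemma tanh_artanh:
  fixes x :: real
  assumes "\<bar>x\<bar> < 1"
  shows "tanh (artanh x) = x"
proof -
  define q where "q = (1 + x) / (1 - x)"
  have q: "q > 0" using assms unfolding q_def by (auto simp: zero_less_divide_iff)
  have "exp (- 2 * artanh x) = inverse q"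
    using q by (simp add: artanh_def flip: q_def) (simp add: exp_minus)
  then have "tanh (artanh x) = (1 - inverse q) / (1 + inverse q)"
    by (simp add: tanh_real_altdef)
  also have "\<dots> = (q - 1) / (q + 1)" using q by (simp add: divide_simps)
  also have "\<dots> = x" using assms unfolding q_def by (simp add: divide_simps split: if_splits)
  finally show ?thesis .
qed

lemma artanh_le_iff:
  fixes x y :: real
  assumes "\<bar>x\<bar> < 1" "\<bar>y\<bar> < 1"
  shows "artanh x \<le> artanh y \<longleftrightarrow> x \<le> y"
proof
  assume "artanh x \<le> artanh y"
  then show "x \<le> y" using tanh_artanh[OF assms(1)] tanh_artanh[OF assms(2)]
    by (metis tanh_real_le_iff)
next
  assume "x \<le> y"
  then show "artanh x \<le> artanh y" using tanh_artanh[OF assms(1)] tanh_artanh[OF assms(2)]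
    by (metis tanh_real_le_iff)
qed

lemma artanh_add:
  fixes s t :: real
  assumes "0 \<le> s" "s < 1" "0 \<le> t" "t < 1"
  shows "artanh ((s + t) / (1 + s * t)) = artanh s + artanh t"
proof -
  have "tanh (artanh s + artanh t) = (s + t) / (1 + s * t)"
    using assms by (simp add: tanh_add tanh_artanh cosh_real_nonzero)
  then show ?thesis by (metis artanh_tanh_real)
qed

lemma norm_1_minus_cnj_mult: 
  "(cmod (1 - cnj a * b))\<^sup>2 - (cmod (a - b))\<^sup>2 = (1 - (cmod a)\<^sup>2) * (1 - (cmod b)\<^sup>2)"
  unfolding cmod_power2 by (simp add: algebra_simps power2_eq_square)

lemma one_minus_cnj_mult_nonzero:
  assumes "cmod a < 1" "cmod b < 1"
  shows "1 - cnj a * b \<noteq> 0"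
proof
  assume "1 - cnj a * b = 0"
  then have "cmod a * cmod b = 1" by (metis complex_mod_cnj eq_iff_diff_eq_0 norm_mult norm_one)
  moreover have "cmod a * cmod b < 1 * 1" using assms by (intro mult_strict_mono') auto
  ultimately show False by simp
qed

lemma pdisc_sq:
  assumes "cmod a < 1" "cmod b < 1"
  shows "1 - (pdisc a b)\<^sup>2 = (1 - (cmod a)\<^sup>2) * (1 - (cmod b)\<^sup>2) / (cmod (1 - cnj a * b))\<^sup>2"
  using one_minus_cnj_mult_nonzero[OF assms] norm_1_minus_cnj_mult[of a b]
  by (simp add: pdisc_def norm_divide power_divide divide_simps)

lemma pdisc_nonneg [simp]: "0 \<le> pdisc a b" by (simp add: pdisc_def)

lemma pdisc_commute: "pdisc a b = pdisc b a"
proof -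
  have "cnj (1 - cnj a * b) = 1 - cnj b * a" by (simp add: mult.commute)
  then have "cmod (1 - cnj a * b) = cmod (1 - cnj b * a)" by (metis complex_mod_cnj)
  then show ?thesis by (simp add: pdisc_def norm_divide norm_minus_commute)
qed

lemma pdisc_less_1:
  assumes "cmod a < 1" "cmod b < 1"
  shows "pdisc a b < 1"
proof -
  have "(cmod a)\<^sup>2 < 1" "(cmod b)\<^sup>2 < 1" using assms by (auto simp: abs_square_less_1)
  then have "0 < 1 - (pdisc a b)\<^sup>2"
    unfolding pdisc_sq[OF assms] using one_minus_cnj_mult_nonzero[OF assms] by simp
  then have "(pdisc a b)\<^sup>2 < 1\<^sup>2" by simp
  then show ?thesis by (rule power_less_imp_less_base) simp
qed

lemma pdisc_0 [simp]: "pdisc a a = 0" "pdisc 0 b = cmod b" "pdisc a 0 = cmod a"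
  by (simp_all add: pdisc_def norm_divide)

text \<open>For given moduli the extreme case is that of opposite rays: by \<open>pdisc_sq\<close>,
  \<open>pdisc\<close> is largest when |1 - cnj a * b| is, and this is at most 1 + |a| |b|.\<close>

lemma pdisc_le_add:
  assumes "cmod a < 1" "cmod b < 1"
  shows "pdisc a b \<le> (cmod a + cmod b) / (1 + cmod a * cmod b)"
proof -
  define s t where "s = cmod a" and "t = cmod b"
  have st: "0 \<le> s" "s < 1" "0 \<le> t" "t < 1" using assms by (auto simp: s_def t_def)
  have ss: "s\<^sup>2 < 1" "t\<^sup>2 < 1" using st by (auto simp: abs_square_less_1)
  have "cmod (1 - cnj a * b) \<le> 1 + s * t"
    unfolding s_def t_def by (metis complex_mod_cnj norm_mult norm_one norm_triangle_ineq4)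
  then have "(cmod (1 - cnj a * b))\<^sup>2 \<le> (1 + s * t)\<^sup>2" by (simp add: power_mono)
  then have "(1 - s\<^sup>2) * (1 - t\<^sup>2) / (1 + s * t)\<^sup>2 \<le> 1 - (pdisc a b)\<^sup>2"
    unfolding pdisc_sq[OF assms] s_def[symmetric] t_def[symmetric]
    using ss one_minus_cnj_mult_nonzero[OF assms]
    by (intro divide_left_mono) (auto intro!: mult_pos_pos add_pos_nonneg simp: st)
  moreover have "1 - ((s + t) / (1 + s * t))\<^sup>2 = (1 - s\<^sup>2) * (1 - t\<^sup>2) / (1 + s * t)\<^sup>2"
  proof -
    have "1 + s * t \<noteq> 0" using mult_nonneg_nonneg[OF st(1) st(3)] by linarith
    then have "(1 + s * t)\<^sup>2 \<noteq> 0" by simp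
    then have "1 - ((s + t) / (1 + s * t))\<^sup>2 = ((1 + s * t)\<^sup>2 - (s + t)\<^sup>2) / (1 + s * t)\<^sup>2"
      by (simp add: power_divide diff_divide_distrib)
    also have "(1 + s * t)\<^sup>2 - (s + t)\<^sup>2 = (1 - s\<^sup>2) * (1 - t\<^sup>2)"
      by (simp add: algebra_simps power2_eq_square)
    finally show ?thesis .
  qed
  ultimately have "(pdisc a b)\<^sup>2 \<le> ((s + t) / (1 + s * t))\<^sup>2" by simp
  then show ?thesis unfolding s_def t_def by (rule power2_le_imp_le) (auto intro!: divide_nonneg_nonneg)
qed

lemma pdisc_Moebius: "pdisc a b = cmod (Moebius_function 0 a b)"
  by (simp add: pdisc_def Moebius_function_def norm_divide norm_minus_commute)

lemma Schwarz_Pick: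
  assumes holf: "f holomorphic_on ball 0 1" and f1: "\<And>z. cmod z < 1 \<Longrightarrow> cmod (f z) < 1"
    and ab: "cmod a < 1" "cmod b < 1"
  shows "pdisc (f a) (f b) \<le> pdisc a b"
proof -
  define g where "g = (\<lambda>z. Moebius_function 0 (f a) (f (Moebius_function 0 (-a) z)))"
  have M: "Moebius_function 0 (-a) ` ball 0 1 \<subseteq> ball 0 1"
    using Moebius_function_norm_lt_1[of "-a"] ab by auto
  have "g holomorphic_on ball 0 1"
    unfolding g_def
    using holomorphic_on_compose_gen[OF holomorphic_on_compose_gen[OF Moebius_function_holomorphic[of "-a" 0] holf M]
        Moebius_function_holomorphic[of "f a" 0]] ab f1 M by (force simp: o_def)
  moreover have "g 0 = 0" by (simp add: g_def Moebius_function_of_zero Moebius_function_eq_zero)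
  moreover have "cmod (g z) < 1" if "cmod z < 1" for z
    unfolding g_def using that ab f1 Moebius_function_norm_lt_1 by (metis norm_minus_cancel)
  moreover have "cmod (Moebius_function 0 a b) < 1" using Moebius_function_norm_lt_1 ab by blast
  ultimately have "cmod (g (Moebius_function 0 a b)) \<le> cmod (Moebius_function 0 a b)"
    by (rule Schwarz_Lemma)
  moreover have "Moebius_function 0 (-a) (Moebius_function 0 a b) = b"
    using ab by (intro Moebius_function_compose) auto
  ultimately show ?thesis by (simp add: g_def pdisc_Moebius)
qed

text \<open>The automorphism taking b to 0 reduces the claim to \<open>pdisc_le_add\<close>;
  Schwarz-Pick for the inverse automorphism controls the pair a, c. Through
  \<open>artanh_add\<close> this is the triangle inequality for \<open>rho\<close>.\<close>

lemma pdisc_triangle: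
  assumes "cmod a < 1" "cmod b < 1" "cmod c < 1"
  shows "pdisc a c \<le> (pdisc a b + pdisc b c) / (1 + pdisc a b * pdisc b c)"
proof -
  let ?M = "Moebius_function 0 b" and ?N = "Moebius_function 0 (-b)"
  have Mlt: "cmod (?M z) < 1" "cmod (?N z) < 1" if "cmod z < 1" for z
    using that assms Moebius_function_norm_lt_1[of b z] Moebius_function_norm_lt_1[of "-b" z] by auto
  have inv: "?N (?M z) = z" if "cmod z < 1" for z
    using that assms by (intro Moebius_function_compose) auto
  have "pdisc (?N (?M a)) (?N (?M c)) \<le> pdisc (?M a) (?M c)"
    using assms Mlt by (intro Schwarz_Pick Moebius_function_holomorphic) auto
  then have "pdisc a c \<le> pdisc (?M a) (?M c)" using inv assms by simp
  also have "\<dots> \<le> (cmod (?M a) + cmod (?M c)) / (1 + cmod (?M a) * cmod (?M c))"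
    using assms Mlt by (intro pdisc_le_add) auto
  finally show ?thesis by (simp add: pdisc_Moebius[of b] pdisc_commute[of a b])
qed

lemma rho_commute: "rho a b = rho b a" by (simp add: rho_def pdisc_commute)

lemma rho_nonneg: "cmod a < 1 \<Longrightarrow> cmod b < 1 \<Longrightarrow> 0 \<le> rho a b"
  by (simp add: rho_def artanh_nonneg pdisc_less_1)

lemma rho_0 [simp]: "rho a a = 0" "rho 0 a = artanh (cmod a)" "rho a 0 = artanh (cmod a)"
  by (simp_all add: rho_def)

lemma rho_triangle:
  assumes "cmod a < 1" "cmod b < 1" "cmod c < 1"
  shows "rho a c \<le> rho a b + rho b c"
proof -
  define s t where "s = pdisc a b" and "t = pdisc b c"
  have st: "0 \<le> s" "s < 1" "0 \<le> t" "t < 1" using assms by (auto simp: s_def t_def pdisc_less_1)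
  have "s + t < 1 + s * t" using mult_pos_pos[of "1 - s" "1 - t"] st by (simp add: algebra_simps)
  then have "(s + t) / (1 + s * t) < 1" using st by (simp add: divide_simps add_pos_nonneg)
  then have "artanh (pdisc a c) \<le> artanh ((s + t) / (1 + s * t))"
    using pdisc_triangle[OF assms] by (intro artanh_mono) (auto simp: s_def t_def)
  then show ?thesis by (simp add: artanh_add st rho_def flip: s_def t_def)
qed

lemma rho_contract:
  assumes "f holomorphic_on ball 0 1" "\<And>z. cmod z < 1 \<Longrightarrow> cmod (f z) < 1"
    "cmod a < 1" "cmod b < 1"
  shows "rho (f a) (f b) \<le> rho a b"
  unfolding rho_def using Schwarz_Pick[OF assms] assms
  by (intro artanh_mono) (auto intro: pdisc_less_1)

lemma norm_tanh_less_1: "cmod (of_real (tanh s)) < 1"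
  using tanh_real_bounds[of s] by (simp add: abs_if)

text \<open>So tanh parametrizes the real diameter by arc length, which later turns complex
  geodesics into real ones.\<close>

lemma rho_tanh: "rho (of_real (tanh s)) (of_real (tanh t)) = \<bar>s - t\<bar>"
proof -
  have c: "1 - tanh s * tanh t \<noteq> 0"
    using one_minus_cnj_mult_nonzero[OF norm_tanh_less_1[of s] norm_tanh_less_1[of t]]
    by (metis complex_cnj_complex_of_real of_real_1 of_real_diff of_real_eq_0_iff of_real_mult)
  have "(tanh s - tanh t) / (1 - tanh s * tanh t) = tanh (s - t)"
    using tanh_add[of s "-t"] by (simp add: cosh_real_nonzero)
  then have "pdisc (of_real (tanh s)) (of_real (tanh t)) = \<bar>tanh (s - t)\<bar>"
    unfolding pdisc_def
    by (metis complex_cnj_complex_of_real norm_of_real of_real_1 of_real_diff of_real_divide of_real_mult)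
  then have "rho (of_real (tanh s)) (of_real (tanh t)) = artanh \<bar>tanh (s - t)\<bar>" by (simp add: rho_def)
  also have "\<bar>tanh (s - t)\<bar> = tanh \<bar>s - t\<bar>" using tanh_minus[of "s - t"] by (simp add: abs_if)
  finally show ?thesis by (simp only: artanh_tanh_real)
qed

section \<open>Invariant distances and metrics\<close>

text \<open>The Hermitian product. Its real part is the real inner product of the type, so a real
  separating hyperplane immediately yields a complex linear, hence holomorphic, functional.\<close>

definition cpair :: "complex ^ 'n \<Rightarrow> complex ^ 'n \<Rightarrow> complex" where
  "cpair w v = (\<Sum>i\<in>UNIV. w $ i * cnj (v $ i))"

lemma Re_cpair: "Re (cpair w v) = w \<bullet> v"
  by (simp add: cpair_def inner_vec_def inner_complex_def)

lemma cpair_scale [simp]: "cpair (c *s w) v = c * cpair w v"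
  by (simp add: cpair_def sum_distrib_left mult.assoc)

lemma cpair_scaleR [simp]: "cpair (r *\<^sub>R w) v = of_real r * cpair w v"
  by (simp add: cpair_def sum_distrib_left scaleR_conv_of_real[where 'a = complex] mult.assoc)

lemma cpair_add [simp]: "cpair (w + w') v = cpair w v + cpair w' v"
  by (simp add: cpair_def sum.distrib algebra_simps)

lemma cpair_diff [simp]: "cpair (w - w') v = cpair w v - cpair w' v"
  by (simp add: cpair_def sum_subtractf algebra_simps)

lemma cpair_self: "cpair v v = of_real ((norm v)\<^sup>2)"
proof -
  have "v $ i * cnj (v $ i) = of_real ((cmod (v $ i))\<^sup>2)" for i
    by (simp add: complex_mult_cnj cmod_power2)
  then have "cpair v v = of_real (\<Sum>i\<in>UNIV. (cmod (v $ i))\<^sup>2)" by (simp add: cpair_def)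
  also have "(\<Sum>i\<in>UNIV. (cmod (v $ i))\<^sup>2) = (norm v)\<^sup>2"
    by (simp add: norm_vec_def L2_set_def real_sqrt_pow2 sum_nonneg)
  finally show ?thesis .
qed

lemma norm_vec_scale: "norm (c *s (x :: complex ^ 'n)) = cmod c * norm x"
  by (simp add: norm_vec_def L2_set_def norm_mult power_mult_distrib sum_distrib_left[symmetric] real_sqrt_mult)

lemma norm_cpair_le: "cmod (cpair w v) \<le> norm w * norm v"
proof (cases "cpair w v = 0")
  case False
  define u where "u = cnj (cpair w v) / of_real (cmod (cpair w v))"
  have u: "cmod u = 1" using False by (simp add: u_def norm_divide)
  have "u * cpair w v = of_real (cmod (cpair w v))"
    unfolding u_def using False complex_norm_square[of "cpair w v"] by (simp add: power2_eq_square field_simps)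
  then have "cmod (cpair w v) = Re (cpair (u *s w) v)" by simp
  also have "\<dots> \<le> norm (u *s w) * norm v" unfolding Re_cpair by (rule norm_cauchy_schwarz)
  finally show ?thesis by (simp add: norm_vec_scale u)
qed simp

lemma bounded_linear_cpair: "bounded_linear (\<lambda>w. cpair w v)"
  by (rule bounded_linear_intro[where K = "norm v"]) (auto simp: norm_cpair_le scaleR_conv_of_real[where 'a = complex])

lemma has_derivative_cpair: "((\<lambda>w. cpair w v) has_derivative (\<lambda>w. cpair w v)) F"
  by (rule bounded_linear_imp_has_derivative[OF bounded_linear_cpair])

lemma holomorphic_vec_has_derivative:
  fixes \<phi> :: "complex \<Rightarrow> complex ^ 'n"
  assumes hol: "\<And>i. (\<lambda>\<zeta>. \<phi> \<zeta> $ i) holomorphic_on S" and S: "open S" "\<zeta> \<in> S"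
  shows "(\<phi> has_derivative (\<lambda>h. h *s disc_deriv \<phi> \<zeta>)) (at \<zeta>)"
proof -
  have "((\<lambda>x. \<phi> x \<bullet> b) has_derivative (\<lambda>h. (h *s disc_deriv \<phi> \<zeta>) \<bullet> b)) (at \<zeta>)" if b: "b \<in> Basis" for b :: "complex^'n"
  proof -
    obtain i u where bu: "b = axis i u" using b by (auto simp: Basis_vec_def)
    have "((\<lambda>x. \<phi> x $ i) has_derivative (*) (deriv (\<lambda>x. \<phi> x $ i) \<zeta>)) (at \<zeta>)"
      using holomorphic_derivI[OF hol S] by (simp add: has_field_derivative_def)
    then have "((\<lambda>x. \<phi> x $ i \<bullet> u) has_derivative (\<lambda>h. (deriv (\<lambda>x. \<phi> x $ i) \<zeta> * h) \<bullet> u)) (at \<zeta>)"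
      by (rule has_derivative_inner_left)
    then show ?thesis by (simp add: bu inner_axis disc_deriv_def mult.commute)
  qed
  then show ?thesis by (subst has_derivative_componentwise_within) auto
qed

lemma disc_maps_has_derivative:
  assumes "\<phi> \<in> disc_maps D" "cmod \<zeta> < 1"
  shows "(\<phi> has_derivative (\<lambda>h. h *s disc_deriv \<phi> \<zeta>)) (at \<zeta>)"
  using assms by (intro holomorphic_vec_has_derivative[where S = "ball 0 1"]) (auto simp: disc_maps_def)

lemma disc_deriv_eq:
  assumes "(\<phi> has_derivative (\<lambda>h. h *s v)) (at \<zeta>)"
  shows "disc_deriv \<phi> \<zeta> = v"
proof -
  have "((\<lambda>x. \<phi> x $ i) has_field_derivative v $ i) (at \<zeta>)" for i
    using bounded_linear.has_derivative[OF bounded_linear_vec_nth assms, of i]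
    by (simp add: has_field_derivative_def) (simp add: mult_commute_abs)
  then show ?thesis by (simp add: disc_deriv_def vec_eq_iff DERIV_imp_deriv)
qed

lemma disc_maps_compose:
  assumes "\<phi> \<in> disc_maps D" "m holomorphic_on ball 0 1" "\<And>z. cmod z < 1 \<Longrightarrow> cmod (m z) < 1"
  shows "\<phi> \<circ> m \<in> disc_maps D"
proof -
  have m: "m ` ball 0 1 \<subseteq> ball 0 1" using assms(3) by auto
  have "((\<lambda>\<zeta>. \<phi> \<zeta> $ i) \<circ> m) holomorphic_on ball 0 1" for i
    using assms(1,2) m by (intro holomorphic_on_compose_gen) (auto simp: disc_maps_def)
  moreover have "\<phi> (m z) \<in> D" if "cmod z < 1" for z
    using assms(1) assms(3)[OF that] by (auto simp: disc_maps_def)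
  ultimately show ?thesis by (auto simp: disc_maps_def o_def)
qed

text \<open>Discs in \<open>lempert\<close> are based at 0; precomposing with the automorphism that
  sends 0 to a removes this normalization.\<close>

lemma lempert_le_rho:
  assumes \<phi>: "\<phi> \<in> disc_maps D" and ab: "cmod a < 1" "cmod b < 1"
  shows "lempert D (\<phi> a) (\<phi> b) \<le> ereal (rho a b)"
proof -
  let ?N = "Moebius_function 0 (-a)" and ?\<beta> = "Moebius_function 0 a b"
  have 1: "\<phi> \<circ> ?N \<in> disc_maps D"
    using ab Moebius_function_norm_lt_1[of "-a"] by (intro disc_maps_compose[OF \<phi>] Moebius_function_holomorphic) auto
  have 2: "cmod ?\<beta> < 1" using ab Moebius_function_norm_lt_1 by blast
  have 3: "(\<phi> \<circ> ?N) 0 = \<phi> a" by (simp add: Moebius_function_of_zero)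
  have 4: "(\<phi> \<circ> ?N) ?\<beta> = \<phi> b" using ab Moebius_function_compose[of "-a" a b] by simp
  have "rho a b = artanh (cmod ?\<beta>)" by (simp add: rho_def pdisc_Moebius)
  then show ?thesis unfolding lempert_def
    using 1 2 3 4 by (intro Inf_lower CollectI exI[of _ ?\<beta>] conjI bexI[of _ "\<phi> \<circ> ?N"]) auto
qed

section \<open>The Kobayashi distance as the largest competitor below the Lempert function\<close>

definition below_lempert :: "(complex ^ 'n) set \<Rightarrow> (complex ^ 'n \<Rightarrow> complex ^ 'n \<Rightarrow> real) \<Rightarrow> bool" where
  "below_lempert D d \<longleftrightarrow> pseudodistance_on D d \<and> (\<forall>x\<in>D. \<forall>y\<in>D. ereal (d x y) \<le> lempert D x y)"

lemma disc_maps_in: "\<phi> \<in> disc_maps D \<Longrightarrow> cmod a < 1 \<Longrightarrow> \<phi> a \<in> D"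
  by (auto simp: disc_maps_def)

lemma below_lempert_rho:
  assumes "below_lempert D d" "\<phi> \<in> disc_maps D" "cmod a < 1" "cmod b < 1"
  shows "d (\<phi> a) (\<phi> b) \<le> rho a b"
  using assms lempert_le_rho[OF assms(2-)] disc_maps_in[OF assms(2)] unfolding below_lempert_def
  by (meson dual_order.trans ereal_less_eq(3))

lemma below_lempert_sym: "below_lempert D d \<Longrightarrow> x \<in> D \<Longrightarrow> y \<in> D \<Longrightarrow> d x y = d y x"
  and below_lempert_triangle: "below_lempert D d \<Longrightarrow> x \<in> D \<Longrightarrow> y \<in> D \<Longrightarrow> z \<in> D \<Longrightarrow> d x z \<le> d x y + d y z"
  and below_lempert_refl: "below_lempert D d \<Longrightarrow> x \<in> D \<Longrightarrow> d x x = 0"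
  by (auto simp: below_lempert_def pseudodistance_on_def)

lemma linear_disc:
  assumes "ball z r \<subseteq> D" "norm v \<le> r" "r > 0"
  shows "(\<lambda>\<zeta>. z + \<zeta> *s v) \<in> disc_maps D"
proof -
  have "z + \<zeta> *s v \<in> D" if "cmod \<zeta> < 1" for \<zeta>
  proof -
    have "norm (\<zeta> *s v) \<le> cmod \<zeta> * r" using assms(2) by (simp add: norm_vec_scale mult_left_mono)
    also have "\<dots> < r" using that assms by simp
    finally show ?thesis using assms(1) by (auto simp: dist_norm)
  qed
  then show ?thesis by (auto simp: disc_maps_def intro!: holomorphic_intros)
qed

lemma below_lempert_ball:
  assumes d: "below_lempert D d" and D: "ball z r \<subseteq> D" and w: "norm (w - z) < r"
  shows "d z w \<le> artanh (norm (w - z) / r)"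
proof (cases "w = z")
  case True
  have "r > 0" using w norm_ge_zero[of "w - z"] by linarith
  then have "z \<in> D" using D by auto
  then show ?thesis using True below_lempert_refl[OF d] by simp
next
  case False
  let ?n = "norm (w - z)"
  have r: "r > 0" using w norm_ge_zero[of "w - z"] by linarith
  define v where "v = (r / ?n) *\<^sub>R (w - z)"
  have v: "norm v \<le> r" using False r by (simp add: v_def)
  have \<phi>: "(\<lambda>\<zeta>. z + \<zeta> *s v) \<in> disc_maps D" using D v r by (rule linear_disc)
  have "complex_of_real (?n / r) *s v = w - z"
    using False r by (simp add: v_def vec_eq_iff scaleR_conv_of_real[where 'a = complex])
  then show ?thesis
    using below_lempert_rho[OF d \<phi>, of 0 "of_real (?n / r)"] w r by (simp add: norm_divide)
qed

text \<open>A supremum of reals says nothing without an upper bound. Having a bound common to all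
  competitors is an equivalence relation between points whose classes are open by the estimate on
  balls, so connectedness leaves one class.\<close>

lemma below_lempert_bounded:
  fixes D :: "(complex ^ 'n) set"
  assumes D: "open D" "connected D" and zw: "z \<in> D" "w \<in> D"
  shows "\<exists>B. \<forall>d. below_lempert D d \<longrightarrow> d z w \<le> B"
proof (rule connected_equivalence_relation[OF D(2) zw])
  show "\<exists>B. \<forall>d. below_lempert D d \<longrightarrow> d y x \<le> B"
    if "\<exists>B. \<forall>d. below_lempert D d \<longrightarrow> d x y \<le> B" "x \<in> D" "y \<in> D" for x y
    using that below_lempert_sym by metis
  show "\<exists>B. \<forall>d. below_lempert D d \<longrightarrow> d x z \<le> B"
    if xy: "\<exists>B. \<forall>d. below_lempert D d \<longrightarrow> d x y \<le> B"
      and yz: "\<exists>B. \<forall>d. below_lempert D d \<longrightarrow> d y z \<le> B" and in_D: "x \<in> D" "y \<in> D" "z \<in> D" for x y z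
  proof -
    obtain B1 B2 where "\<forall>d. below_lempert D d \<longrightarrow> d x y \<le> B1" "\<forall>d. below_lempert D d \<longrightarrow> d y z \<le> B2"
      using xy yz by blast
    then have "d x z \<le> B1 + B2" if "below_lempert D d" for d
      using that below_lempert_triangle[OF that in_D] by (smt (verit))
    then show ?thesis by blast
  qed
  fix a assume a: "a \<in> D"
  obtain r where r: "r > 0" "ball a r \<subseteq> D" using D a openE by blast
  have "d a x \<le> artanh (1 / 2)" if "below_lempert D d" "x \<in> ball a (r/2)" for d x
  proof -
    have n: "norm (x - a) < r / 2" using that by (simp add: dist_norm norm_minus_commute)
    then have "d a x \<le> artanh (norm (x - a) / r)" using r by (intro below_lempert_ball[OF that(1)]) auto
    also have "\<dots> \<le> artanh (1 / 2)" using n r by (intro artanh_mono) (auto simp: field_simps)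
    finally show ?thesis .
  qed
  then show "\<exists>T. openin (top_of_set D) T \<and> a \<in> T \<and> (\<forall>x\<in>T. \<exists>B. \<forall>d. below_lempert D d \<longrightarrow> d a x \<le> B)"
    using r by (intro exI[of _ "ball a (r/2)"] conjI ballI exI[of _ "artanh (1/2)"]) (auto intro!: open_subset)
qed

context
  fixes D :: "(complex ^ 'n) set"
  assumes D: "open D" "connected D"
begin

lemma kobayashi_upper:
  assumes "z \<in> D" "w \<in> D" "below_lempert D d"
  shows "d z w \<le> kobayashi_dist D z w"
proof -
  obtain B where "\<forall>d. below_lempert D d \<longrightarrow> d z w \<le> B" using below_lempert_bounded D assms by blast
  then have "bdd_above {d z w | d. pseudodistance_on D d \<and> (\<forall>x\<in>D. \<forall>y\<in>D. ereal (d x y) \<le> lempert D x y)}"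
    by (intro bdd_aboveI[of _ B]) (auto simp: below_lempert_def)
  then show ?thesis using assms unfolding kobayashi_dist_def
    by (auto intro!: cSup_upper simp: below_lempert_def)
qed

lemma below_lempert_0: "below_lempert D (\<lambda>_ _. 0)"
  unfolding below_lempert_def pseudodistance_on_def lempert_def
  by (auto intro!: Inf_greatest artanh_nonneg)

lemma kobayashi_least:
  assumes "z \<in> D" "w \<in> D" "\<And>d. below_lempert D d \<Longrightarrow> d z w \<le> B"
  shows "kobayashi_dist D z w \<le> B"
proof -
  have "Sup {d z w | d. below_lempert D d} \<le> B"
    using assms below_lempert_0 by (intro cSup_least) auto
  then show ?thesis using assms by (simp add: kobayashi_dist_def below_lempert_def)
qed

text \<open>The supremum is itself a competitor, so all inequalities valid for competitors apply to
  it.\<close>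

lemma below_lempert_kobayashi: "below_lempert D (kobayashi_dist D)"
proof -
  have nn: "0 \<le> kobayashi_dist D x y" if "x \<in> D" "y \<in> D" for x y
    using kobayashi_upper[OF that below_lempert_0] by simp
  have sym: "kobayashi_dist D x y \<le> kobayashi_dist D y x" if "x \<in> D" "y \<in> D" for x y
    using that by (intro kobayashi_least) (auto simp: below_lempert_sym[of D _ x y] intro: kobayashi_upper)
  have refl: "kobayashi_dist D x x = 0" if "x \<in> D" for x
    using that nn[of x x] kobayashi_least[of x x 0] below_lempert_refl by (metis order.refl antisym)
  have tri: "kobayashi_dist D x z \<le> kobayashi_dist D x y + kobayashi_dist D y z" if "x \<in> D" "y \<in> D" "z \<in> D" for x y z
  proof (rule kobayashi_least[OF that(1,3)])
    fix d assume d: "below_lempert D d"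
    show "d x z \<le> kobayashi_dist D x y + kobayashi_dist D y z"
      using kobayashi_upper[OF that(1,2) d] kobayashi_upper[OF that(2,3) d] below_lempert_triangle[OF d that] by linarith
  qed
  have "ereal (kobayashi_dist D x y) \<le> lempert D x y" if xy: "x \<in> D" "y \<in> D" for x y
    unfolding lempert_def
  proof (rule Inf_greatest, clarify)
    fix \<alpha> \<phi> assume *: "\<alpha> \<in> ball 0 1" "\<phi> \<in> disc_maps D" "x = \<phi> 0" "y = \<phi> \<alpha>"
    have "kobayashi_dist D x y \<le> artanh (cmod \<alpha>)"
      using xy below_lempert_rho[OF _ *(2), of _ 0 \<alpha>] * by (intro kobayashi_least) auto
    then show "ereal (kobayashi_dist D (\<phi> 0) (\<phi> \<alpha>)) \<le> ereal (artanh (cmod \<alpha>))" using * by simp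
  qed
  then show ?thesis unfolding below_lempert_def pseudodistance_on_def
    using nn sym refl tri by (auto intro: antisym)
qed

lemmas kobayashi_triangle = below_lempert_triangle[OF below_lempert_kobayashi]
lemmas kobayashi_sym = below_lempert_sym[OF below_lempert_kobayashi]
lemmas kobayashi_refl = below_lempert_refl[OF below_lempert_kobayashi]
lemmas kobayashi_le_rho = below_lempert_rho[OF below_lempert_kobayashi]
lemmas kobayashi_ball = below_lempert_ball[OF below_lempert_kobayashi]

lemma kobayashi_nonneg: "x \<in> D \<Longrightarrow> y \<in> D \<Longrightarrow> 0 \<le> kobayashi_dist D x y"
  using below_lempert_kobayashi by (auto simp: below_lempert_def pseudodistance_on_def)

lemma kobayashi_bounded_compact:
  assumes K: "compact K" "K \<subseteq> D"
  obtains B where "\<And>z w. z \<in> K \<Longrightarrow> w \<in> K \<Longrightarrow> kobayashi_dist D z w \<le> B"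
proof (cases "K = {}")
  case True then show ?thesis using that by blast
next
  case False
  then obtain o' where o: "o' \<in> K" by blast
  have "\<forall>z\<in>K. \<exists>r>0. ball z r \<subseteq> D" using K D openE by blast
  then obtain r where r: "\<And>z. z \<in> K \<Longrightarrow> r z > 0 \<and> ball z (r z) \<subseteq> D" by metis
  obtain F where F: "F \<subseteq> K" "finite F" "K \<subseteq> (\<Union>z\<in>F. ball z (r z / 2))"
    using compactE_image[OF K(1), of K "\<lambda>z. ball z (r z / 2)"] r by force
  \<comment> \<open>The sum is a convenient majorant of the maximum over the finitely many centres;
    artanh (1/2) covers the step from a centre to a point of its half-size ball.\<close>
  define B where "B = (\<Sum>f\<in>F. kobayashi_dist D o' f) + artanh (1 / 2)"
  have *: "kobayashi_dist D o' z \<le> B" if z: "z \<in> K" for z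
  proof -
    obtain f where f: "f \<in> F" "z \<in> ball f (r f / 2)" using F z by blast
    then have fr: "r f > 0" "ball f (r f) \<subseteq> D" "f \<in> D" using F r K by blast+
    have n: "norm (z - f) < r f / 2" using f by (simp add: dist_norm norm_minus_commute)
    then have "kobayashi_dist D f z \<le> artanh (norm (z - f) / r f)" using fr by (intro kobayashi_ball) auto
    also have "\<dots> \<le> artanh (1 / 2)" using n fr by (intro artanh_mono) (auto simp: field_simps)
    finally have 1: "kobayashi_dist D f z \<le> artanh (1 / 2)" .
    have "kobayashi_dist D o' f \<le> (\<Sum>f\<in>F. kobayashi_dist D o' f)"
      using F f o K by (intro member_le_sum kobayashi_nonneg) auto
    moreover have "o' \<in> D" "z \<in> D" using o z K by auto
    ultimately show ?thesis using 1 kobayashi_triangle[of o' f z] fr unfolding B_def by linarith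
  qed
  have "kobayashi_dist D z w \<le> 2 * B" if "z \<in> K" "w \<in> K" for z w
    using that * kobayashi_triangle[of z o' w] kobayashi_sym[of z o'] o K by (smt (verit) subsetD)
  then show ?thesis using that by blast
qed

end

section \<open>The Kobayashi metric and holomorphic functions into the disc\<close>

lemma kobayashi_metric_le:
  assumes "\<phi> \<in> disc_maps D" "\<alpha> *s disc_deriv \<phi> 0 = X"
  shows "kobayashi_metric D (\<phi> 0) X \<le> cmod \<alpha>"
  unfolding kobayashi_metric_def using assms
  by (intro cInf_lower bdd_belowI[of _ 0]) auto

lemma kobayashi_metric_ball:
  assumes "ball z r \<subseteq> D" "r > 0"
  shows "kobayashi_metric D z X \<le> norm X / r"
proof (cases "X = 0")
  case True
  have "(\<lambda>\<zeta>. z + \<zeta> *s 0) \<in> disc_maps D" using assms by (intro linear_disc) auto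
  then show ?thesis using kobayashi_metric_le[of "\<lambda>\<zeta>. z + \<zeta> *s 0" D 0 X] True by simp
next
  case False
  define v where "v = (r / norm X) *\<^sub>R X"
  have "(\<lambda>\<zeta>. z + \<zeta> *s v) \<in> disc_maps D" using assms by (intro linear_disc) (auto simp: v_def)
  moreover have "disc_deriv (\<lambda>\<zeta>. z + \<zeta> *s v) 0 = v"
    unfolding disc_deriv_def vec_eq_iff by (auto intro!: DERIV_imp_deriv derivative_eq_intros)
  moreover have "of_real (norm X / r) *s v = X"
    using False assms by (simp add: v_def vec_eq_iff scaleR_conv_of_real[where 'a = complex])
  ultimately have "kobayashi_metric D ((\<lambda>\<zeta>. z + \<zeta> *s v) 0) X \<le> cmod (of_real (norm X / r))"
    by (intro kobayashi_metric_le) auto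
  then show ?thesis using assms by (simp add: norm_divide)
qed

lemma maps_to_disc_compose_disc:
  assumes "f \<in> maps_to_disc D" "\<phi> \<in> disc_maps D" "cmod \<zeta> < 1"
  shows "((f \<circ> \<phi>) has_field_derivative frechet_derivative f (at (\<phi> \<zeta>)) (disc_deriv \<phi> \<zeta>)) (at \<zeta>)"
proof -
  obtain f' where f': "(f has_derivative f') (at (\<phi> \<zeta>))" "\<And>c v. f' (c *s v) = c * f' v"
    using assms disc_maps_in[OF assms(2,3)] unfolding maps_to_disc_def by blast
  have "((f \<circ> \<phi>) has_derivative (f' \<circ> (\<lambda>h. h *s disc_deriv \<phi> \<zeta>))) (at \<zeta>)"
    by (rule diff_chain_at[OF disc_maps_has_derivative[OF assms(2,3)] f'(1)])
  then have "((f \<circ> \<phi>) has_field_derivative f' (disc_deriv \<phi> \<zeta>)) (at \<zeta>)"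
    by (simp add: has_field_derivative_def o_def f'(2) mult_commute_abs)
  then show ?thesis by (simp add: frechet_derivative_at[OF f'(1), symmetric])
qed

lemma maps_to_disc_holomorphic:
  assumes "f \<in> maps_to_disc D" "\<phi> \<in> disc_maps D"
  shows "(f \<circ> \<phi>) holomorphic_on ball 0 1"
  using maps_to_disc_compose_disc[OF assms] unfolding holomorphic_on_def
  by (meson field_differentiable_def has_field_derivative_at_within mem_ball_0)

lemma maps_to_disc_norm: "f \<in> maps_to_disc D \<Longrightarrow> z \<in> D \<Longrightarrow> cmod (f z) < 1"
  by (auto simp: maps_to_disc_def)

lemma zero_maps_to_disc: "(\<lambda>_. 0) \<in> maps_to_disc D"
  unfolding maps_to_disc_def by (auto intro!: exI[of _ "\<lambda>_. 0"])

text \<open>Schwarz-Pick along each analytic disc. Pullbacks of the Poincare distance are thus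
  competitors, which is the reason for c_D \<le> k_D.\<close>

lemma below_lempert_maps_to_disc:
  assumes f: "f \<in> maps_to_disc D"
  shows "below_lempert D (\<lambda>z w. rho (f z) (f w))"
proof -
  have "ereal (rho (f x) (f y)) \<le> lempert D x y" if "x \<in> D" "y \<in> D" for x y
    unfolding lempert_def
  proof (rule Inf_greatest, clarify)
    fix \<alpha> \<phi> assume *: "\<alpha> \<in> ball 0 1" "\<phi> \<in> disc_maps D" "x = \<phi> 0" "y = \<phi> \<alpha>"
    have "rho ((f \<circ> \<phi>) 0) ((f \<circ> \<phi>) \<alpha>) \<le> rho 0 \<alpha>"
      using maps_to_disc_norm[OF f] disc_maps_in[OF *(2)] *(1)
      by (intro rho_contract maps_to_disc_holomorphic[OF f *(2)]) auto
    then show "ereal (rho (f (\<phi> 0)) (f (\<phi> \<alpha>))) \<le> ereal (artanh (cmod \<alpha>))" by simp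
  qed
  then show ?thesis
    unfolding below_lempert_def pseudodistance_on_def
    by (auto simp: rho_commute maps_to_disc_norm[OF f] intro: rho_nonneg rho_triangle)
qed

lemma maps_to_disc_postcompose:
  assumes f: "f \<in> maps_to_disc D" and m: "m holomorphic_on ball 0 1" "\<And>z. cmod z < 1 \<Longrightarrow> cmod (m z) < 1"
  shows "m \<circ> f \<in> maps_to_disc D"
proof -
  have "\<exists>f'. (m \<circ> f has_derivative f') (at z) \<and> (\<forall>c v. f' (c *s v) = c * f' v)" if z: "z \<in> D" for z
  proof -
    obtain f' where f': "(f has_derivative f') (at z)" "\<And>c v. f' (c *s v) = c * f' v"
      using f z unfolding maps_to_disc_def by blast
    have "(m has_field_derivative deriv m (f z)) (at (f z))"
      using m(1) maps_to_disc_norm[OF f z] by (intro holomorphic_derivI[where S = "ball 0 1"]) auto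
    then have "(m \<circ> f has_derivative ((*) (deriv m (f z)) \<circ> f')) (at z)"
      unfolding has_field_derivative_def by (intro diff_chain_at f')
    then show ?thesis by (intro exI conjI) (auto simp: f'(2))
  qed
  then show ?thesis using m(2) maps_to_disc_norm[OF f] by (auto simp: maps_to_disc_def)
qed

context
  fixes D :: "(complex ^ 'n) set"
  assumes D: "open D" "connected D"
begin

lemma rho_le_kobayashi: "f \<in> maps_to_disc D \<Longrightarrow> z \<in> D \<Longrightarrow> w \<in> D \<Longrightarrow> rho (f z) (f w) \<le> kobayashi_dist D z w"
  using kobayashi_upper[OF D _ _ below_lempert_maps_to_disc] by blast

text \<open>Postcomposition with an automorphism restores the normalization f z = 0. The bound by
  k_D makes the supremum legitimate.\<close>

lemma rho_le_caratheodory: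
  assumes f: "f \<in> maps_to_disc D" and zw: "z \<in> D" "w \<in> D"
  shows "rho (f z) (f w) \<le> caratheodory_dist D z w"
proof -
  let ?g = "Moebius_function 0 (f z) \<circ> f"
  have n: "cmod (f z) < 1" using maps_to_disc_norm f zw by blast
  have g: "?g \<in> maps_to_disc D"
    using n by (intro maps_to_disc_postcompose[OF f] Moebius_function_holomorphic Moebius_function_norm_lt_1) auto
  have "bdd_above {artanh (cmod (f w)) | f. f \<in> maps_to_disc D \<and> f z = 0}"
    using rho_le_kobayashi[OF _ zw] by (intro bdd_aboveI[of _ "kobayashi_dist D z w"]) fastforce
  moreover have "rho (f z) (f w) = artanh (cmod (?g w))" by (simp add: rho_def pdisc_Moebius)
  ultimately show ?thesis unfolding caratheodory_dist_def using g
    by (auto intro!: cSup_upper exI[of _ ?g] simp: Moebius_function_eq_zero)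
qed

lemma caratheodory_le_kobayashi:
  assumes zw: "z \<in> D" "w \<in> D"
  shows "caratheodory_dist D z w \<le> kobayashi_dist D z w"
proof -
  have "(\<lambda>_. 0) \<in> maps_to_disc D" by (rule zero_maps_to_disc)
  then show ?thesis unfolding caratheodory_dist_def
    using rho_le_kobayashi[OF _ zw] by (intro cSup_least) fastforce+
qed

end

lemma Schwarz_Pick_deriv_0:
  assumes holg: "g holomorphic_on ball 0 1" and g1: "\<And>z. cmod z < 1 \<Longrightarrow> cmod (g z) < 1"
  shows "cmod (deriv g 0) \<le> 1"
proof -
  define w where "w = g 0"
  let ?M = "Moebius_function 0 w"
  have w: "cmod w < 1" using g1 by (simp add: w_def)
  have w2: "(cmod w)\<^sup>2 < 1" using w by (simp add: abs_square_less_1)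
  have nz: "1 - cnj w * w \<noteq> 0" using one_minus_cnj_mult_nonzero[OF w w] .
  have "((\<lambda>z. (z - w) / (1 - cnj w * z)) has_field_derivative 1 / (1 - cnj w * w)) (at w)"
    using nz by (auto intro!: derivative_eq_intros)
  then have M: "(?M has_field_derivative 1 / (1 - cnj w * w)) (at (g 0))"
    by (simp add: Moebius_function_def[abs_def] w_def)
  have "(g has_field_derivative deriv g 0) (at 0)"
    by (intro holomorphic_derivI[OF holg]) auto
  then have "((?M \<circ> g) has_field_derivative 1 / (1 - cnj w * w) * deriv g 0) (at 0)"
    by (rule DERIV_chain[where f = ?M and g = g, OF M])
  then have d1: "deriv (?M \<circ> g) 0 = 1 / (1 - cnj w * w) * deriv g 0" by (rule DERIV_imp_deriv)
  have d2: "cmod (deriv (?M \<circ> g) 0) \<le> 1"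
  proof (rule Schwarz_Lemma(2)[where \<xi> = 0])
    show "?M \<circ> g holomorphic_on ball 0 1"
      using g1 w by (intro holomorphic_on_compose_gen[OF holg Moebius_function_holomorphic]) auto
  qed (use g1 w Moebius_function_norm_lt_1 in \<open>auto simp: Moebius_function_eq_zero w_def\<close>)
  define t where "t = 1 - (cmod w)\<^sup>2"
  have t: "1 - cnj w * w = of_real t"
    using complex_norm_square[of w] by (simp add: t_def mult.commute)
  have "deriv g 0 = (1 - cnj w * w) * deriv (?M \<circ> g) 0" unfolding d1 using nz by simp
  then have *: "deriv g 0 = deriv (?M \<circ> g) 0 * of_real t" "t > 0" "cmod (deriv (?M \<circ> g) 0) \<le> 1"
    using w2 d2 unfolding t by (auto simp: t_def mult.commute)
  have "cmod (deriv g 0) = cmod (deriv (?M \<circ> g) 0) * t" using *(2) by (subst *(1)) (simp add: norm_mult)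
  also have "\<dots> \<le> 1 * t" using * by (intro mult_right_mono) auto
  finally have "cmod (deriv g 0) \<le> 1 - (cmod w)\<^sup>2" by (simp add: t_def)
  then show ?thesis by (smt (verit) zero_le_power2)
qed

lemma caratheodory_metric_bounded:
  assumes z: "ball z r \<subseteq> D" "r > 0" and f: "f \<in> maps_to_disc D"
  shows "cmod (frechet_derivative f (at z) X) \<le> norm X / r"
proof -
  obtain f' where f': "(f has_derivative f') (at z)" "\<And>c v. f' (c *s v) = c * f' v"
    using f subsetD[OF z(1), of z] z(2) unfolding maps_to_disc_def by auto
  have fr: "frechet_derivative f (at z) = f'" by (simp add: frechet_derivative_at[OF f'(1), symmetric])
  show ?thesis
  proof (cases "X = 0")
    case True
    then show ?thesis using has_derivative_linear[OF f'(1)] linear_0 fr by fastforce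
  next
    case False
    define v where "v = (r / norm X) *\<^sub>R X"
    have "norm v \<le> r" using z by (simp add: v_def)
    with z have \<phi>: "(\<lambda>\<zeta>. z + \<zeta> *s v) \<in> disc_maps D" by (intro linear_disc) auto
    have dd: "disc_deriv (\<lambda>\<zeta>. z + \<zeta> *s v) 0 = v"
      unfolding disc_deriv_def vec_eq_iff by (auto intro!: DERIV_imp_deriv derivative_eq_intros)
    define g where "g = f \<circ> (\<lambda>\<zeta>. z + \<zeta> *s v)"
    have g: "g holomorphic_on ball 0 1" "(g has_field_derivative f' v) (at 0)"
      using maps_to_disc_holomorphic[OF f \<phi>] maps_to_disc_compose_disc[OF f \<phi>, of 0] dd fr by (auto simp: g_def)
    have g1: "cmod (g x) < 1" if "cmod x < 1" for x
      using that maps_to_disc_norm[OF f disc_maps_in[OF \<phi>]] by (auto simp: g_def)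
    have "cmod (deriv g 0) \<le> 1" using g(1) g1 by (rule Schwarz_Pick_deriv_0)
    then have "cmod (f' v) \<le> 1" using DERIV_imp_deriv[OF g(2)] by simp
    moreover have "f' v = of_real (r / norm X) * f' X"
      using linear_scale[OF has_derivative_linear[OF f'(1)]] by (simp add: v_def scaleR_conv_of_real[where 'a = complex])
    ultimately show ?thesis using False z fr by (simp add: norm_mult norm_divide field_simps)
  qed
qed

lemma caratheodory_metric_le_ball:
  assumes z: "ball z r \<subseteq> D" "r > 0"
  shows "caratheodory_metric D z X \<le> norm X / r"
proof -
  have "(\<lambda>_. 0) \<in> maps_to_disc D" by (rule zero_maps_to_disc)
  then show ?thesis unfolding caratheodory_metric_def
    using caratheodory_metric_bounded[OF z] by (intro cSup_least) auto
qed

lemma caratheodory_metric_ge: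
  assumes z: "ball z r \<subseteq> D" "r > 0" and f: "f \<in> maps_to_disc D"
  shows "cmod (frechet_derivative f (at z) X) \<le> caratheodory_metric D z X"
  unfolding caratheodory_metric_def
  using caratheodory_metric_bounded[OF z] f
  by (intro cSup_upper bdd_aboveI[of _ "norm X / r"]) auto

text \<open>These rescaled linear functions make both Caratheodory quantities nondegenerate on a
  bounded domain.\<close>

lemma cpair_maps_to_disc:
  assumes D: "D \<subseteq> ball 0 R" and v: "v \<noteq> 0" 
  shows "(\<lambda>w. cpair w v / of_real (R * norm v)) \<in> maps_to_disc D"
proof -
  have "cmod (cpair w v / of_real (R * norm v)) < 1" if "w \<in> D" for w
  proof -
    have w: "norm w < R" using D that by auto
    then have R: "R > 0" using norm_ge_zero[of w] by linarith
    have "cmod (cpair w v) \<le> norm w * norm v" by (rule norm_cpair_le)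
    also have "\<dots> < R * norm v" using w v by simp
    finally show ?thesis using R v by (simp add: norm_divide norm_mult)
  qed
  moreover have "((\<lambda>w. cpair w v / of_real (R * norm v)) has_derivative (\<lambda>w. cpair w v / of_real (R * norm v))) (at z)" for z
    by (intro bounded_linear.has_derivative[OF bounded_linear_divide] has_derivative_cpair)
  ultimately show ?thesis unfolding maps_to_disc_def by (auto intro!: exI)
qed

lemma caratheodory_metric_lower:
  assumes D: "D \<subseteq> ball 0 R" "ball z r \<subseteq> D" "r > 0"
  shows "norm X / R \<le> caratheodory_metric D z X"
proof (cases "X = 0")
  case True
  have "(\<lambda>_. 0) \<in> maps_to_disc D" by (rule zero_maps_to_disc)
  then have "cmod (frechet_derivative (\<lambda>_. 0) (at z) X) \<le> caratheodory_metric D z X"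
    using D by (intro caratheodory_metric_ge)
  then show ?thesis using True by simp
next
  case False
  have "z \<in> ball 0 R" using D subsetD[OF D(2), of z] by auto
  then have R: "R > 0" using norm_ge_zero[of z] unfolding mem_ball_0 by linarith
  define f where "f = (\<lambda>w. cpair w X / of_real (R * norm X))"
  have f: "f \<in> maps_to_disc D" unfolding f_def by (rule cpair_maps_to_disc[OF D(1) False])
  have "(f has_derivative f) (at z)" unfolding f_def
    by (intro bounded_linear.has_derivative[OF bounded_linear_divide] has_derivative_cpair)
  then have "frechet_derivative f (at z) = f" by (rule frechet_derivative_at[symmetric])
  moreover have "cmod (f X) = norm X / R"
    using False R by (simp add: f_def cpair_self norm_divide norm_mult power2_eq_square)
  ultimately show ?thesis using caratheodory_metric_ge[OF D(2,3) f, of X] by simp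
qed

lemma artanh_ge: "0 \<le> x \<Longrightarrow> x < 1 \<Longrightarrow> x \<le> artanh (x::real)"
proof -
  assume x: "0 \<le> x" "x < 1"
  have "tanh x \<le> x" 
  proof -
    have "tanh x - tanh 0 \<le> 1 * (x - 0)"
    proof (cases "x = 0")
      case False
      have "\<exists>z>0. z < x \<and> tanh x - tanh 0 = (x - 0) * (1 - (tanh z)\<^sup>2)"
        using x False by (intro MVT2) (auto intro!: derivative_eq_intros)
      then show ?thesis using x by (auto simp: mult_left_le)
    qed simp
    then show ?thesis by simp
  qed
  then show "x \<le> artanh x" using tanh_artanh[of x] x by (metis abs_of_nonneg tanh_real_le_iff)
qed

text \<open>Test with the linear function in the direction z - w; since |1 - cnj a * b| \<le> 2 in
  the disc, half the Euclidean distance of the values bounds \<open>pdisc\<close> from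
  below.\<close>

lemma caratheodory_lower:
  assumes D: "D \<subseteq> ball 0 R" "open D" "connected D" and zw: "z \<in> D" "w \<in> D"
  shows "norm (z - w) / (2 * R) \<le> caratheodory_dist D z w"
proof (cases "z = w")
  case True
  have "(\<lambda>_. 0) \<in> maps_to_disc D" by (rule zero_maps_to_disc)
  then show ?thesis using True rho_le_caratheodory[OF D(2,3) _ zw] by fastforce
next
  case False
  define X where "X = z - w"
  have X: "X \<noteq> 0" using False by (simp add: X_def)
  have "z \<in> ball 0 R" using D zw by auto
  then have R: "R > 0" using norm_ge_zero[of z] unfolding mem_ball_0 by linarith
  define f where "f = (\<lambda>w. cpair w X / of_real (R * norm X))"
  have f: "f \<in> maps_to_disc D" unfolding f_def by (rule cpair_maps_to_disc[OF D(1) X])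
  have "f z - f w = cpair X X / of_real (R * norm X)" by (simp add: f_def X_def diff_divide_distrib)
  then have 1: "cmod (f z - f w) = norm X / R"
    using X R by (simp add: cpair_self norm_divide norm_mult power2_eq_square)
  have n: "cmod (f z) < 1" "cmod (f w) < 1" using maps_to_disc_norm[OF f] zw by auto
  have "cmod (1 - cnj (f z) * f w) \<le> 1 + cmod (f z) * cmod (f w)"
    by (metis complex_mod_cnj norm_mult norm_one norm_triangle_ineq4)
  also have "\<dots> \<le> 1 + 1 * 1" using n by (intro add_left_mono mult_mono) auto
  finally have "cmod (f z - f w) / 2 \<le> pdisc (f z) (f w)"
    unfolding pdisc_def norm_divide using one_minus_cnj_mult_nonzero[OF n]
    by (intro divide_left_mono) auto
  also have "\<dots> \<le> rho (f z) (f w)" unfolding rho_def using pdisc_less_1[OF n] by (intro artanh_ge) auto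
  also have "\<dots> \<le> caratheodory_dist D z w" by (rule rho_le_caratheodory[OF D(2,3) f zw])
  finally show ?thesis using 1 by (simp add: X_def)
qed

section \<open>An extension theorem for positive functionals\<close>

text \<open>The cone C orders V with order unit e. A maximal cone P above C that omits -e is total
  (it contains F or -F for every F), so each F determines a Dedekind cut in the multiples of e, and
  S F is the cut point.\<close>

lemma Riesz_extension:
  fixes V C :: "('b \<Rightarrow> 'v::real_vector) set" and e :: "'b \<Rightarrow> 'v"
  assumes V: "(\<lambda>_. 0) \<in> V" "\<And>F G. F \<in> V \<Longrightarrow> G \<in> V \<Longrightarrow> (\<lambda>x. F x + G x) \<in> V"
      "\<And>F c. F \<in> V \<Longrightarrow> (\<lambda>x. c *\<^sub>R F x) \<in> V"
    and CV: "C \<subseteq> V" and C0: "(\<lambda>_. 0) \<in> C" and eC: "e \<in> C"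
    and C: "\<And>F G. F \<in> C \<Longrightarrow> G \<in> C \<Longrightarrow> (\<lambda>x. F x + G x) \<in> C"
      "\<And>F c. F \<in> C \<Longrightarrow> c \<ge> 0 \<Longrightarrow> (\<lambda>x. c *\<^sub>R F x) \<in> C"
    and unit: "\<And>F. F \<in> V \<Longrightarrow> \<exists>t. (\<lambda>x. t *\<^sub>R e x - F x) \<in> C"
    and me: "(\<lambda>x. - e x) \<notin> C"
  obtains S :: "('b \<Rightarrow> 'v) \<Rightarrow> real" where
    "\<And>F G. F \<in> V \<Longrightarrow> G \<in> V \<Longrightarrow> S (\<lambda>x. F x + G x) = S F + S G"
    "\<And>F c. F \<in> V \<Longrightarrow> S (\<lambda>x. c *\<^sub>R F x) = c * S F"
    "\<And>F. F \<in> C \<Longrightarrow> 0 \<le> S F" "S e = 1"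
proof -
  define good where "good = (\<lambda>P. C \<subseteq> P \<and> P \<subseteq> V \<and> (\<lambda>x. - e x) \<notin> P \<and>
     (\<forall>F\<in>P. \<forall>G\<in>P. (\<lambda>x. F x + G x) \<in> P) \<and> (\<forall>F\<in>P. \<forall>c\<ge>0. (\<lambda>x. c *\<^sub>R F x) \<in> P))"
  have gC: "good C" unfolding good_def using CV C me by auto
  have "\<exists>P\<in>Collect good. \<forall>X\<in>Collect good. P \<subseteq> X \<longrightarrow> X = P"
  proof (rule subset_Zorn)
    fix \<C> assume ch: "subset.chain (Collect good) \<C>"
    show "\<exists>U\<in>Collect good. \<forall>X\<in>\<C>. X \<subseteq> U"
    proof (cases "\<C> = {}")
      case True then show ?thesis using gC by blast
    next
      case False
      have g: "good P" if "P \<in> \<C>" for P using ch that by (auto simp: subset.chain_def)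
      have "good (\<Union>\<C>)"
        unfolding good_def
      proof (intro conjI ballI allI impI)
        fix F G assume "F \<in> \<Union>\<C>" "G \<in> \<Union>\<C>"
        then obtain P Q where PQ: "P \<in> \<C>" "Q \<in> \<C>" "F \<in> P" "G \<in> Q" by blast
        then have "P \<subseteq> Q \<or> Q \<subseteq> P" using ch by (auto simp: subset.chain_def)
        then obtain R where "R \<in> \<C>" "F \<in> R" "G \<in> R" using PQ by blast
        then show "(\<lambda>x. F x + G x) \<in> \<Union>\<C>" using g[of R] unfolding good_def by blast
      qed (use False g in \<open>unfold good_def, blast+\<close>)
      then show ?thesis by blast
    qed
  qed
  then obtain P where gP: "good P" and max: "\<And>X. good X \<Longrightarrow> P \<subseteq> X \<Longrightarrow> X = P" by blast
  have P: "C \<subseteq> P" "P \<subseteq> V" "(\<lambda>x. - e x) \<notin> P" "\<And>F G. F \<in> P \<Longrightarrow> G \<in> P \<Longrightarrow> (\<lambda>x. F x + G x) \<in> P"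
    "\<And>F c. F \<in> P \<Longrightarrow> c \<ge> 0 \<Longrightarrow> (\<lambda>x. c *\<^sub>R F x) \<in> P"
    using gP unfolding good_def by blast+
  have V': "(\<lambda>x. a *\<^sub>R F x + b *\<^sub>R G x) \<in> V" if "F \<in> V" "G \<in> V" for F G a b
    using V(2)[OF V(3)[OF that(1), of a] V(3)[OF that(2), of b]] .
  have P': "(\<lambda>x. a *\<^sub>R F x + b *\<^sub>R G x) \<in> P" if "F \<in> P" "G \<in> P" "a \<ge> 0" "b \<ge> 0" for F G a b
    using P(4)[OF P(5)[OF that(1,3)] P(5)[OF that(2,4)]] .
  have neg: "\<not> (\<lambda>x. t *\<^sub>R e x) \<in> P" if "t < 0" for t
  proof
    assume "(\<lambda>x. t *\<^sub>R e x) \<in> P"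
    from P(5)[OF this, of "- 1 / t"] that P(3) show False by (simp add: divide_nonpos_neg)
  qed
  \<comment> \<open>The cone generated by P and F satisfies every requirement except possibly the
    omission of -e. By maximality it must contain -e, and s = 0 would put -e into P.\<close>
  have adj: "\<exists>k\<in>P. \<exists>s>0. \<forall>x. - e x = k x + s *\<^sub>R F x" if F: "F \<in> V" "F \<notin> P" for F
  proof -
    define X where "X = {H. \<exists>k\<in>P. \<exists>s\<ge>0. H = (\<lambda>x. k x + s *\<^sub>R F x)}"
    have X2: "(\<lambda>x. k x + s *\<^sub>R F x) \<in> X" if "k \<in> P" "s \<ge> 0" for k s using that by (auto simp: X_def)
    have PX: "P \<subseteq> X" using X2[of _ 0] by auto
    have FX: "F \<in> X" using X2[of "\<lambda>_. 0" 1] P(1) C0 by auto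
    have XV: "X \<subseteq> V" using V'[OF _ F(1), of _ 1] P(2) by (auto simp: X_def)
    have "\<not> good X" using max[OF _ PX] FX F by blast
    moreover have "(\<lambda>x. A x + B x) \<in> X" if AB: "A \<in> X" "B \<in> X" for A B
    proof -
      obtain k s k' s' where *: "A = (\<lambda>x. k x + s *\<^sub>R F x)" "B = (\<lambda>x. k' x + s' *\<^sub>R F x)" "k \<in> P" "k' \<in> P" "s \<ge> 0" "s' \<ge> 0"
        using AB by (auto simp: X_def)
      then have "(\<lambda>x. A x + B x) = (\<lambda>x. (k x + k' x) + (s + s') *\<^sub>R F x)" by (auto simp: algebra_simps)
      then show ?thesis using X2[OF P(4)[OF *(3,4)], of "s + s'"] * by simp
    qed
    moreover have "(\<lambda>x. c *\<^sub>R A x) \<in> X" if A: "A \<in> X" "c \<ge> 0" for A c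
    proof -
      obtain k s where *: "A = (\<lambda>x. k x + s *\<^sub>R F x)" "k \<in> P" "s \<ge> 0"
        using A by (auto simp: X_def)
      then have "(\<lambda>x. c *\<^sub>R A x) = (\<lambda>x. c *\<^sub>R k x + (c * s) *\<^sub>R F x)" by (auto simp: algebra_simps)
      then show ?thesis using X2[OF P(5)[OF *(2) A(2)], of "c * s"] * A by simp
    qed
    ultimately have "(\<lambda>x. - e x) \<in> X" using PX P(1) XV unfolding good_def by blast
    then obtain k s where ks: "(\<lambda>x. - e x) = (\<lambda>x. k x + s *\<^sub>R F x)" "k \<in> P" "s \<ge> 0" by (auto simp: X_def)
    have "s \<noteq> 0" using ks P(3) by auto
    then show ?thesis using ks by (metis order_le_less)
  qed
  \<comment> \<open>Otherwise both F and -F can be adjoined; weighting the two representations of -e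
    by s' and s cancels F and leaves a negative multiple of e in P.\<close>
  have total: "F \<in> P \<or> (\<lambda>x. - F x) \<in> P" if F: "F \<in> V" for F
  proof (rule ccontr)
    assume "\<not> ?thesis"
    then have "F \<notin> P" "(\<lambda>x. - F x) \<notin> P" by auto
    moreover have "(\<lambda>x. - F x) \<in> V" using V(3)[OF F, of "-1"] by simp
    ultimately obtain k s k' s' where *: "k \<in> P" "s > 0" "\<And>x. - e x = k x + s *\<^sub>R F x"
       "k' \<in> P" "s' > 0" "\<And>x. - e x = k' x + s' *\<^sub>R (- F x)"
      using adj[OF F] adj[of "\<lambda>x. - F x"] by metis
    have "(- (s + s')) *\<^sub>R e x = s' *\<^sub>R k x + s *\<^sub>R k' x" for x
    proof -
      have "(- (s + s')) *\<^sub>R e x = s' *\<^sub>R (- e x) + s *\<^sub>R (- e x)" by (simp add: algebra_simps)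
      also have "\<dots> = s' *\<^sub>R (k x + s *\<^sub>R F x) + s *\<^sub>R (k' x + s' *\<^sub>R (- F x))" using * by metis
      finally show ?thesis by (simp add: algebra_simps)
    qed
    then have "(\<lambda>x. (- (s + s')) *\<^sub>R e x) \<in> P" using P'[OF *(1,4), of s' s] * by simp
    then show False using neg[of "- (s + s')"] * by simp
  qed
  have eV: "e \<in> V" using eC CV by blast
  \<comment> \<open>The lower half of the cut. Since P need not be closed, \<open>lo\<close>,
    \<open>hi\<close> and \<open>eqI\<close> speak only of t strictly below or above the cut
    point.\<close>
  define A where "A = (\<lambda>F. {t. (\<lambda>x. F x - t *\<^sub>R e x) \<in> P})"
  define S where "S = (\<lambda>F. Sup (A F))"
  have A_V: "(\<lambda>x. F x - t *\<^sub>R e x) \<in> V" if "F \<in> V" for F t using V'[OF that eV, of 1 "- t"] by simp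
  have cmp: "t \<le> u" if "(\<lambda>x. F x - t *\<^sub>R e x) \<in> P" "(\<lambda>x. u *\<^sub>R e x - F x) \<in> P" for F t u
    using P(4)[OF that] neg[of "u - t"] by (force simp: algebra_simps)
  have ne: "A F \<noteq> {}" and bdd: "bdd_above (A F)" if F: "F \<in> V" for F
  proof -
    obtain t where "(\<lambda>x. t *\<^sub>R e x - F x) \<in> P" using unit[OF F] P(1) by blast
    then show "bdd_above (A F)" using cmp[of F _ t] by (auto simp: A_def intro!: bdd_aboveI[of _ t])
    have "(\<lambda>x. - F x) \<in> V" using V(3)[OF F, of "-1"] by simp
    then obtain t where "(\<lambda>x. t *\<^sub>R e x - (- F x)) \<in> P" using unit P(1) by blast
    then have "- t \<in> A F" by (simp add: A_def add.commute)
    then show "A F \<noteq> {}" by blast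
  qed
  have lo: "(\<lambda>x. F x - t *\<^sub>R e x) \<in> P" if F: "F \<in> V" and t: "t < S F" for F t
  proof -
    obtain u where u: "u \<in> A F" "t < u" using t less_cSup_iff[OF ne[OF F] bdd[OF F]] by (auto simp: S_def)
    have "(\<lambda>x. 1 *\<^sub>R (F x - u *\<^sub>R e x) + (u - t) *\<^sub>R e x) \<in> P"
      using u P(1) eC by (intro P') (auto simp: A_def)
    then show ?thesis by (simp add: algebra_simps)
  qed
  have hi: "(\<lambda>x. t *\<^sub>R e x - F x) \<in> P" if F: "F \<in> V" and t: "S F < t" for F t
  proof -
    have "t \<notin> A F" using t cSup_upper[OF _ bdd[OF F], of t] by (auto simp: S_def)
    then show ?thesis using total[OF A_V[OF F, of t]] by (auto simp: A_def)
  qed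
  have eqI: "S F = s" if F: "F \<in> V" and l: "\<And>t. t < s \<Longrightarrow> (\<lambda>x. F x - t *\<^sub>R e x) \<in> P"
    and h: "\<And>t. t > s \<Longrightarrow> (\<lambda>x. t *\<^sub>R e x - F x) \<in> P" for F s
  proof (rule antisym)
    show "S F \<le> s"
    proof (rule field_le_epsilon)
      fix \<epsilon> :: real assume "\<epsilon> > 0"
      then have "S F - \<epsilon>/2 \<le> s + \<epsilon>/2" using cmp[OF lo[OF F, of "S F - \<epsilon>/2"] h[of "s + \<epsilon>/2"]] by simp
      then show "S F \<le> s + \<epsilon>" by simp
    qed
    show "s \<le> S F"
    proof (rule field_le_epsilon)
      fix \<epsilon> :: real assume "\<epsilon> > 0"
      then have "s - \<epsilon>/2 \<le> S F + \<epsilon>/2" using cmp[OF l[of "s - \<epsilon>/2"] hi[OF F, of "S F + \<epsilon>/2"]] by simp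
      then show "s \<le> S F + \<epsilon>" by simp
    qed
  qed
  have add: "S (\<lambda>x. F x + G x) = S F + S G" if F: "F \<in> V" and G: "G \<in> V" for F G
  proof (rule eqI)
    show "(\<lambda>x. F x + G x) \<in> V" by (rule V(2)[OF F G])
    fix t
    show "(\<lambda>x. F x + G x - t *\<^sub>R e x) \<in> P" if t: "t < S F + S G"
    proof -
      define d where "d = (S F + S G - t) / 2"
      have "d > 0" using t by (simp add: d_def)
      then have "(\<lambda>x. (F x - (S F - d) *\<^sub>R e x) + (G x - (S G - d) *\<^sub>R e x)) \<in> P"
        by (intro P(4) lo F G) auto
      moreover have "t = (S F - d) + (S G - d)" by (simp add: d_def field_simps)
      ultimately show ?thesis by (simp only: scaleR_left_distrib) (simp add: algebra_simps)
    qed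
    show "(\<lambda>x. t *\<^sub>R e x - (F x + G x)) \<in> P" if t: "t > S F + S G"
    proof -
      define d where "d = (t - S F - S G) / 2"
      have "d > 0" using t by (simp add: d_def)
      then have "(\<lambda>x. ((S F + d) *\<^sub>R e x - F x) + ((S G + d) *\<^sub>R e x - G x)) \<in> P"
        by (intro P(4) hi F G) auto
      moreover have "t = (S F + d) + (S G + d)" by (simp add: d_def field_simps)
      ultimately show ?thesis by (simp only: scaleR_left_distrib) (simp add: algebra_simps)
    qed
  qed
  have P_e: "(\<lambda>x. t *\<^sub>R e x) \<in> P" if "t \<ge> 0" for t using P(5)[of e t] P(1) eC that by blast
  have S0: "S (\<lambda>_. 0) = 0"
    by (rule eqI[OF V(1)]) (use P_e[of "- t" for t] P_e in auto)
  have Se: "S e = 1"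
    by (rule eqI[OF eV]) (use P_e[of "1 - t" for t] P_e[of "t - 1" for t] in \<open>auto simp: algebra_simps\<close>)
  have pos: "S (\<lambda>x. c *\<^sub>R F x) = c * S F" if F: "F \<in> V" and c: "c > 0" for F c
  proof (rule eqI)
    show "(\<lambda>x. c *\<^sub>R F x) \<in> V" by (rule V(3)[OF F])
    fix t
    show "(\<lambda>x. c *\<^sub>R F x - t *\<^sub>R e x) \<in> P" if t: "t < c * S F"
      using P(5)[OF lo[OF F, of "t / c"], of c] t c by (simp add: field_simps algebra_simps)
    show "(\<lambda>x. t *\<^sub>R e x - c *\<^sub>R F x) \<in> P" if t: "c * S F < t"
      using P(5)[OF hi[OF F, of "t / c"], of c] t c by (simp add: field_simps algebra_simps)
  qed
  have minus: "S (\<lambda>x. - F x) = - S F" if F: "F \<in> V" for F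
    using add[OF F V(3)[OF F, of "-1"]] S0 by simp
  have scale: "S (\<lambda>x. c *\<^sub>R F x) = c * S F" if F: "F \<in> V" for F c
  proof (cases c "0::real" rule: linorder_cases)
    case less
    then show ?thesis using minus[OF V(3)[OF F, of "-c"]] pos[OF F, of "-c"] by simp
  qed (use S0 pos[OF F] in auto)
  have "0 \<le> S F" if F: "F \<in> C" for F
  proof (rule ccontr)
    assume "\<not> 0 \<le> S F"
    then have *: "S F < S F / 2" "S F / 2 < 0" by auto
    have "(\<lambda>x. (S F / 2) *\<^sub>R e x - F x) \<in> P" using * F CV by (intro hi) auto
    from cmp[OF _ this, of 0] show False using * P(1) F by auto
  qed
  then show ?thesis using that add scale Se by blast
qed

section \<open>Holomorphic roots\<close>

text \<open>No conjugation, unlike \<open>cpair\<close>: the second argument will be a holomorphic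
  vector function and the pairing has to stay holomorphic in it.\<close>

definition bilin :: "complex ^ 'n \<Rightarrow> complex ^ 'n \<Rightarrow> complex" where
  "bilin w a = (\<Sum>i\<in>UNIV. w $ i * a $ i)"

lemma bilin_cpair: "bilin w a = cpair w (\<chi> i. cnj (a $ i))"
  by (simp add: bilin_def cpair_def)

lemma bilin_diff [simp]: "bilin (w - w') a = bilin w a - bilin w' a"
  and bilin_scale [simp]: "bilin (c *s w) a = c * bilin w a"
  and bilin_scaleR [simp]: "bilin (r *\<^sub>R w) a = of_real r * bilin w a"
  by (simp_all add: bilin_cpair)

lemma bilin_0 [simp]: "bilin 0 a = 0" "bilin w 0 = 0"
  by (simp_all add: bilin_def)

lemma bilin_scale_right [simp]: "bilin w (c *s a) = c * bilin w a"
  by (simp add: bilin_def sum_distrib_left mult.left_commute)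

lemma bilin_add_right: "bilin w (a + b) = bilin w a + bilin w b"
  by (simp add: bilin_def sum.distrib algebra_simps)

lemma bilin_diff_right: "bilin w (a - b) = bilin w a - bilin w b"
  by (simp add: bilin_def sum_subtractf algebra_simps)

lemma norm_bilin_le: "cmod (bilin w a) \<le> norm w * norm a"
  using norm_cpair_le[of w "\<chi> i. cnj (a $ i)"] by (simp add: bilin_cpair norm_vec_def L2_set_def)

lemma bilin_holomorphic [holomorphic_intros]:
  "(\<And>i. (\<lambda>\<eta>. K \<eta> $ i) holomorphic_on S) \<Longrightarrow> (\<lambda>\<eta>. bilin w (K \<eta>)) holomorphic_on S"
  unfolding bilin_def by (intro holomorphic_intros)

text \<open>Maximum modulus for exp f. The inequality stays strict inside because the maximum of Re
  f over the compact circle is attained and hence negative.\<close>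

lemma Re_neg_maximum_principle:
  assumes hol: "f holomorphic_on ball 0 r" and cont: "continuous_on (cball 0 r) f" and r: "0 < r"
    and neg: "\<And>\<eta>. cmod \<eta> = r \<Longrightarrow> Re (f \<eta>) < 0" and \<eta>: "cmod \<eta> \<le> r"
  shows "Re (f \<eta>) < 0"
proof -
  have "continuous_on (sphere 0 r) (\<lambda>\<eta>. Re (f \<eta>))"
    by (intro continuous_intros continuous_on_subset[OF cont]) auto
  moreover have "sphere (0::complex) r \<noteq> {}" using r by simp
  ultimately obtain x where x: "x \<in> sphere 0 r" "\<And>y. y \<in> sphere 0 r \<Longrightarrow> Re (f y) \<le> Re (f x)"
    using continuous_attains_sup[OF compact_sphere] by metis
  have "cmod (exp (f \<eta>)) \<le> exp (Re (f x))"
  proof (rule maximum_modulus_frontier[of "\<lambda>\<eta>. exp (f \<eta>)" "cball 0 r"])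
    show "(\<lambda>\<eta>. exp (f \<eta>)) holomorphic_on interior (cball 0 r)"
      using hol by (intro holomorphic_intros) auto
    show "continuous_on (closure (cball 0 r)) (\<lambda>\<eta>. exp (f \<eta>))"
      using cont by (auto intro!: continuous_intros)
    show "cmod (exp (f z)) \<le> exp (Re (f x))" if "z \<in> frontier (cball 0 r)" for z
      using that x(2)[of z] by simp
  qed (use \<eta> in auto)
  then show ?thesis using neg[of x] x by simp
qed

lemma factor_root:
  assumes hol: "F holomorphic_on ball 0 1" and a: "cmod a < 1" "F a = 0"
  obtains E where "E holomorphic_on ball 0 1" "\<And>\<eta>. cmod \<eta> < 1 \<Longrightarrow> F \<eta> = (\<eta> - a) * E \<eta>"
proof -
  have "(\<lambda>\<eta>. if \<eta> = a then deriv F a else (F \<eta> - F a) / (\<eta> - a)) holomorphic_on ball 0 1"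
    using a by (intro pole_lemma hol) auto
  then show ?thesis by (rule that) (use a in auto)
qed

text \<open>On \<open>cmod \<eta> = r\<close> the quotient of \<open>\<eta>\<close> by \<open>(\<eta> - a) * (1 - cnj a * \<eta> / r\<^sup>2)\<close> is positive, so
  one root at a time can be divided out without losing the sign condition.\<close>

lemma simple_root:
  assumes hol: "F holomorphic_on ball 0 1" and r: "0 < r" "r < 1"
    and neg: "\<And>\<eta>. cmod \<eta> = r \<Longrightarrow> Re (F \<eta> / \<eta>) < 0"
  obtains a E where "cmod a < r" "F a = 0" "E holomorphic_on ball 0 1"
    "\<And>\<eta>. cmod \<eta> < 1 \<Longrightarrow> F \<eta> = (\<eta> - a) * E \<eta>" "\<And>\<eta>. cmod \<eta> \<le> r \<Longrightarrow> E \<eta> \<noteq> 0"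
proof -
  have nz: "F \<eta> \<noteq> 0" if "cmod \<eta> = r" for \<eta> using neg[OF that] by auto
  \<comment> \<open>If F had no zero, \<eta> / F \<eta> would be holomorphic with negative real part
    on the circle, hence also at 0, where it vanishes.\<close>
  have "\<exists>a. cmod a < r \<and> F a = 0"
  proof (rule ccontr)
    assume no: "\<not> ?thesis"
    have nz': "F \<eta> \<noteq> 0" if "cmod \<eta> \<le> r" for \<eta> using that no nz[of \<eta>] by force
    have cb: "cball 0 r \<subseteq> ball (0::complex) 1" using r by auto
    have holf: "(\<lambda>\<eta>. \<eta> / F \<eta>) holomorphic_on cball 0 r"
      using nz' by (intro holomorphic_intros holomorphic_on_subset[OF hol cb]) auto
    have h1: "(\<lambda>\<eta>. \<eta> / F \<eta>) holomorphic_on ball 0 r"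
      by (rule holomorphic_on_subset[OF holf]) auto
    have h2: "Re (\<eta> / F \<eta>) < 0" if "cmod \<eta> = r" for \<eta>
      using neg[OF that] by (simp add: Re_complex_div_lt_0 mult.commute)
    have "Re (0 / F 0) < 0"
      by (rule Re_neg_maximum_principle[OF h1 holomorphic_on_imp_continuous_on[OF holf] r(1) h2])
        (use r in simp_all)
    then show False by simp
  qed
  then obtain a where a: "cmod a < r" "F a = 0" by blast
  have a1: "cmod a < 1" using a r by simp
  obtain E where E: "E holomorphic_on ball 0 1" "\<And>\<eta>. cmod \<eta> < 1 \<Longrightarrow> F \<eta> = (\<eta> - a) * E \<eta>"
    using factor_root[OF hol a1 a(2)] by blast
  \<comment> \<open>The zero of this factor is the reflection of a in the circle of radius r and
    lies outside the closed disc.\<close>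
  have den: "1 - cnj a * \<eta> / r\<^sup>2 \<noteq> 0" if "cmod \<eta> \<le> r" for \<eta>
  proof
    assume "1 - cnj a * \<eta> / r\<^sup>2 = 0"
    then have "cnj a * \<eta> = of_real (r\<^sup>2)" using r by (simp add: field_simps)
    then have "cmod a * cmod \<eta> = r\<^sup>2" by (metis complex_mod_cnj norm_mult norm_of_real abs_power2)
    moreover have "cmod a * cmod \<eta> \<le> cmod a * r" using that by (intro mult_left_mono) auto
    moreover have "cmod a * r < r * r" using a r by simp
    ultimately show False by (auto simp: power2_eq_square)
  qed
  \<comment> \<open>The maximum principle carries the sign from the circle into the disc, so E has
    no zero there: the root a is simple and the only one.\<close>
  have "Re (E \<eta> / (1 - cnj a * \<eta> / r\<^sup>2)) < 0" if "cmod \<eta> \<le> r" for \<eta>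
  proof (rule Re_neg_maximum_principle[where f = "\<lambda>\<eta>. E \<eta> / (1 - cnj a * \<eta> / r\<^sup>2)", OF _ _ r(1) _ that])
    have cb: "cball 0 r \<subseteq> ball (0::complex) 1" using r by auto
    have "(\<lambda>\<eta>. E \<eta> / (1 - cnj a * \<eta> / r\<^sup>2)) holomorphic_on cball 0 r"
      using den by (intro holomorphic_intros holomorphic_on_subset[OF E(1) cb]) auto
    then show "(\<lambda>\<eta>. E \<eta> / (1 - cnj a * \<eta> / r\<^sup>2)) holomorphic_on ball 0 r"
       "continuous_on (cball 0 r) (\<lambda>\<eta>. E \<eta> / (1 - cnj a * \<eta> / r\<^sup>2))"
      by (auto intro: holomorphic_on_subset holomorphic_on_imp_continuous_on)
    fix \<eta> assume \<eta>: "cmod \<eta> = r"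
    have ne: "\<eta> \<noteq> a" "\<eta> \<noteq> 0" using \<eta> a r by auto
    have r2: "of_real (r\<^sup>2) = \<eta> * cnj \<eta>" using \<eta> complex_norm_square[of \<eta>] by simp
    have "of_real (r\<^sup>2) \<noteq> (0::complex)" using r by simp
    then have "(1 - cnj a * \<eta> / of_real (r\<^sup>2)) = (of_real (r\<^sup>2) - cnj a * \<eta>) / of_real (r\<^sup>2)"
      by (simp add: diff_divide_distrib del: of_real_power)
    also have "of_real (r\<^sup>2) - cnj a * \<eta> = \<eta> * cnj (\<eta> - a)" unfolding r2 by (simp add: algebra_simps)
    finally have "(1 - cnj a * \<eta> / r\<^sup>2) = \<eta> * cnj (\<eta> - a) / of_real (r\<^sup>2)" .
    moreover have "E \<eta> = F \<eta> / (\<eta> - a)" using E(2)[of \<eta>] \<eta> r ne by simp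
    ultimately have "E \<eta> / (1 - cnj a * \<eta> / r\<^sup>2) = F \<eta> / \<eta> * (of_real (r\<^sup>2) / ((\<eta> - a) * cnj (\<eta> - a)))"
      by simp
    also have "\<dots> = F \<eta> / \<eta> * of_real (r\<^sup>2 / (cmod (\<eta> - a))\<^sup>2)"
      using complex_norm_square[of "\<eta> - a"] by simp
    finally have *: "E \<eta> / (1 - cnj a * \<eta> / r\<^sup>2) = F \<eta> / \<eta> * of_real (r\<^sup>2 / (cmod (\<eta> - a))\<^sup>2)" .
    have "r\<^sup>2 / (cmod (\<eta> - a))\<^sup>2 > 0" using r ne by simp
    then show "Re (E \<eta> / (1 - cnj a * \<eta> / r\<^sup>2)) < 0" 
      unfolding * using neg[OF \<eta>] by (simp only: Re_complex_of_real times_complex.sel Im_complex_of_real mult_zero_right diff_zero) (rule mult_neg_pos)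
  qed
  then have "E \<eta> \<noteq> 0" if "cmod \<eta> \<le> r" for \<eta> using that by fastforce
  then show ?thesis using that a E by blast
qed

text \<open>For fixed \<eta> the equation is affine in w. Inserting the root for y into the
  factorization for w therefore gives an exact formula for f y - f w; it yields first a Lipschitz
  bound and then the derivative, with the values of E bounded away from 0 by compactness.\<close>

lemma root_family:
  fixes K :: "complex \<Rightarrow> complex ^ 'n" and W :: "(complex ^ 'n) set"
  assumes K: "\<And>i. (\<lambda>\<eta>. K \<eta> $ i) holomorphic_on ball 0 1" and J: "J holomorphic_on ball 0 1"
    and r: "0 < r" "r < 1" and W: "open W"
    and neg: "\<And>w \<eta>. w \<in> W \<Longrightarrow> cmod \<eta> = r \<Longrightarrow> Re ((bilin w (K \<eta>) - J \<eta>) / \<eta>) < 0"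
  obtains f E where "\<And>w. w \<in> W \<Longrightarrow> cmod (f w) < r"
    "\<And>w \<eta>. w \<in> W \<Longrightarrow> cmod \<eta> \<le> r \<Longrightarrow> bilin w (K \<eta>) = J \<eta> \<Longrightarrow> f w = \<eta>"
    "\<And>w. w \<in> W \<Longrightarrow> bilin w (K (f w)) = J (f w)"
    "\<And>w. w \<in> W \<Longrightarrow> (f has_derivative (\<lambda>x. - bilin x (K (f w)) / E w)) (at w)"
    "\<And>w. w \<in> W \<Longrightarrow> E w \<noteq> 0"
    "\<And>w. w \<in> W \<Longrightarrow> ((\<lambda>\<eta>. bilin w (K \<eta>) - J \<eta>) has_field_derivative E w) (at (f w))"
proof -
  define P where "P = (\<lambda>w a E. cmod a < r \<and> bilin w (K a) - J a = 0 \<and> E holomorphic_on ball 0 1 \<and>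
    (\<forall>\<eta>. cmod \<eta> < 1 \<longrightarrow> bilin w (K \<eta>) - J \<eta> = (\<eta> - a) * E \<eta>) \<and> (\<forall>\<eta>. cmod \<eta> \<le> r \<longrightarrow> E \<eta> \<noteq> 0))"
  have "\<exists>a E. P w a E" if w: "w \<in> W" for w
  proof -
    have "(\<lambda>\<eta>. bilin w (K \<eta>) - J \<eta>) holomorphic_on ball 0 1" using K J by (intro holomorphic_intros)
    then obtain a E where "cmod a < r" "bilin w (K a) - J a = 0" "E holomorphic_on ball 0 1"
      "\<And>\<eta>. cmod \<eta> < 1 \<Longrightarrow> bilin w (K \<eta>) - J \<eta> = (\<eta> - a) * E \<eta>" "\<And>\<eta>. cmod \<eta> \<le> r \<Longrightarrow> E \<eta> \<noteq> 0"
      by (rule simple_root[OF _ r neg[OF w]]) blast+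
    then show ?thesis unfolding P_def by blast
  qed
  then obtain f E where "\<And>w. w \<in> W \<Longrightarrow> P w (f w) (E w)" by metis
  then have f: "\<And>w. w \<in> W \<Longrightarrow> cmod (f w) < r" "\<And>w. w \<in> W \<Longrightarrow> bilin w (K (f w)) - J (f w) = 0"
    and E: "\<And>w. w \<in> W \<Longrightarrow> E w holomorphic_on ball 0 1"
     "\<And>w \<eta>. w \<in> W \<Longrightarrow> cmod \<eta> < 1 \<Longrightarrow> bilin w (K \<eta>) - J \<eta> = (\<eta> - f w) * E w \<eta>"
     "\<And>w \<eta>. w \<in> W \<Longrightarrow> cmod \<eta> \<le> r \<Longrightarrow> E w \<eta> \<noteq> 0"
    unfolding P_def by blast+
  have cb: "cball 0 r \<subseteq> ball (0::complex) 1" using r by auto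
  have "continuous_on (cball 0 r) (\<lambda>\<eta>. \<chi> i. K \<eta> $ i)"
    using K by (intro continuous_on_vec_lambda holomorphic_on_imp_continuous_on) (auto intro: holomorphic_on_subset[OF _ cb])
  then have Kc: "continuous_on (cball 0 r) K" by simp
  show ?thesis
  proof (rule that[of f "\<lambda>w. E w (f w)"])
    fix w assume w: "w \<in> W"
    have f1: "cmod (f w) < 1" using f(1)[OF w] r by simp
    show "cmod (f w) < r" "bilin w (K (f w)) = J (f w)" "E w (f w) \<noteq> 0"
      using f[OF w] E(3)[OF w] by auto
    show "f w = \<eta>" if "cmod \<eta> \<le> r" "bilin w (K \<eta>) = J \<eta>" for \<eta>
      using that E(2)[OF w, of \<eta>] E(3)[OF w, of \<eta>] r by simp
    have "((\<lambda>\<eta>. (\<eta> - f w) * E w \<eta>) has_field_derivative E w (f w)) (at (f w))"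
    proof -
      have "(E w has_field_derivative deriv (E w) (f w)) (at (f w))"
        using E(1)[OF w] f1 by (intro holomorphic_derivI[where S = "ball 0 1"]) auto
      then show ?thesis by (auto intro!: derivative_eq_intros)
    qed
    then show "((\<lambda>\<eta>. bilin w (K \<eta>) - J \<eta>) has_field_derivative E w (f w)) (at (f w))"
      by (rule has_field_derivative_transform_within_open[where S = "ball 0 1"]) (use f1 E(2)[OF w] in auto)
    define \<Phi> where "\<Phi> = (\<lambda>\<eta>. (- 1 / E w \<eta>) *s K \<eta>)"
    have Ec: "continuous_on (cball 0 r) (E w)"
      by (intro holomorphic_on_imp_continuous_on holomorphic_on_subset[OF E(1)[OF w] cb])
    have \<Phi>c: "continuous_on (cball 0 r) \<Phi>"
      unfolding \<Phi>_def vector_scalar_mult_def using E(3)[OF w] Ec Kc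
      by (intro continuous_intros) auto
    obtain B where B: "\<And>\<eta>. cmod \<eta> \<le> r \<Longrightarrow> norm (\<Phi> \<eta>) \<le> B" "B > 0"
    proof -
      have "bounded (\<Phi> ` cball 0 r)" using \<Phi>c by (intro compact_imp_bounded compact_continuous_image) auto
      then obtain B where "B > 0" "\<And>y. y \<in> \<Phi> ` cball 0 r \<Longrightarrow> norm y \<le> B" by (metis bounded_pos)
      then show ?thesis by (intro that[of B]) auto
    qed
    \<comment> \<open>Only the factor E for the base point w enters; y contributes solely through
      its root f y. Continuity of \<open>\<Phi>\<close> then makes \<open>\<Phi> (f w)\<close> the
      derivative.\<close>
    have step: "f y - f w = bilin (y - w) (\<Phi> (f y))" if y: "y \<in> W" for y
    proof -
      have h: "bilin w (K (f y)) - J (f y) = (f y - f w) * E w (f y)"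
        using f(1)[OF y] r by (intro E(2)[OF w]) linarith
      have "bilin (y - w) (K (f y)) + (f y - f w) * E w (f y) = bilin y (K (f y)) - J (f y)"
        unfolding bilin_diff h[symmetric] by simp
      then have "bilin (y - w) (K (f y)) + (f y - f w) * E w (f y) = 0" unfolding f(2)[OF y] .
      then have "(f y - f w) * E w (f y) = - bilin (y - w) (K (f y))" by (simp only: eq_neg_iff_add_eq_0 add.commute)
      then show ?thesis using E(3)[OF w, of "f y"] f(1)[OF y] unfolding \<Phi>_def bilin_scale_right
        by (simp add: field_simps)
    qed
    have lip: "cmod (f y - f w) \<le> B * norm (y - w)" if y: "y \<in> W" for y
    proof -
      have "cmod (f y - f w) \<le> norm (y - w) * norm (\<Phi> (f y))" unfolding step[OF y] by (rule norm_bilin_le)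
      also have "\<dots> \<le> norm (y - w) * B" using B(1)[of "f y"] f(1)[OF y] by (intro mult_left_mono) auto
      finally show ?thesis by (simp add: mult.commute)
    qed
    have "(f has_derivative (\<lambda>x. bilin x (\<Phi> (f w)))) (at w)"
      unfolding has_derivative_at_alt
    proof (intro conjI allI impI)
      show "bounded_linear (\<lambda>x. bilin x (\<Phi> (f w)))" unfolding bilin_cpair by (rule bounded_linear_cpair)
      fix e :: real assume e: "e > 0"
      have "f w \<in> cball 0 r" using f(1)[OF w] by simp
      then obtain d where d: "d > 0" "\<And>x. x \<in> cball 0 r \<Longrightarrow> dist x (f w) < d \<Longrightarrow> dist (\<Phi> x) (\<Phi> (f w)) < e"
        using \<Phi>c e unfolding continuous_on_iff by metis
      obtain d' where d': "d' > 0" "ball w d' \<subseteq> W" using W w openE by blast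
      show "\<exists>d>0. \<forall>y. norm (y - w) < d \<longrightarrow> norm (f y - f w - bilin (y - w) (\<Phi> (f w))) \<le> e * norm (y - w)"
      proof (intro exI[of _ "min d' (d / B)"] conjI allI impI)
        fix y assume y: "norm (y - w) < min d' (d / B)"
        then have yW: "y \<in> W" using d' by (auto simp: dist_norm norm_minus_commute)
        have "cmod (f y - f w) \<le> B * norm (y - w)" by (rule lip[OF yW])
        also have "\<dots> < d" using y B by (simp add: field_simps)
        finally have "dist (\<Phi> (f y)) (\<Phi> (f w)) < e" using f(1)[OF yW] by (intro d) (auto simp: dist_norm)
        then have "norm (y - w) * norm (\<Phi> (f y) - \<Phi> (f w)) \<le> norm (y - w) * e"
          by (intro mult_left_mono) (auto simp: dist_norm)
        moreover have "f y - f w - bilin (y - w) (\<Phi> (f w)) = bilin (y - w) (\<Phi> (f y) - \<Phi> (f w))"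
          by (simp add: step[OF yW] bilin_diff_right)
        ultimately show "norm (f y - f w - bilin (y - w) (\<Phi> (f w))) \<le> e * norm (y - w)"
          using norm_bilin_le[of "y - w" "\<Phi> (f y) - \<Phi> (f w)"] by (simp add: mult.commute)
      qed (use d d' B in auto)
    qed
    then show "(f has_derivative (\<lambda>x. - bilin x (K (f w)) / E w (f w))) (at w)"
      unfolding \<Phi>_def bilin_scale_right by (simp add: divide_inverse mult.commute)
  qed
qed

section \<open>Duality for analytic discs\<close>

text \<open>Arbitrary bounded functions on the circle, without measurability, so that the algebraic
  extension theorem applies directly. Functions are total, but only their values on the circle are
  meant to matter.\<close>

definition circ_bdd :: "(complex \<Rightarrow> 'a::real_normed_vector) \<Rightarrow> bool" where
  "circ_bdd k \<longleftrightarrow> bounded (k ` sphere 0 1)"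

lemma circ_bddI: "(\<And>\<zeta>. cmod \<zeta> = 1 \<Longrightarrow> norm (k \<zeta>) \<le> M) \<Longrightarrow> circ_bdd k"
  unfolding circ_bdd_def by (intro boundedI[of _ M]) auto

lemma circ_bddE:
  assumes "circ_bdd k"
  obtains M where "M > 0" "\<And>\<zeta>. cmod \<zeta> = 1 \<Longrightarrow> norm (k \<zeta>) \<le> M"
proof -
  obtain M where "M > 0" "\<And>x. x \<in> k ` sphere 0 1 \<Longrightarrow> norm x \<le> M"
    using assms unfolding circ_bdd_def by (metis bounded_pos)
  then show ?thesis by (intro that[of M]) auto
qed

lemma circ_bdd_continuous: "continuous_on (sphere 0 1) k \<Longrightarrow> circ_bdd k"
  unfolding circ_bdd_def by (intro compact_imp_bounded compact_continuous_image) auto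

lemma circ_bdd_add: "circ_bdd k \<Longrightarrow> circ_bdd l \<Longrightarrow> circ_bdd (\<lambda>\<zeta>. k \<zeta> + l \<zeta>)"
  unfolding circ_bdd_def by (rule bounded_plus_comp)

lemma circ_bdd_mult: "circ_bdd k \<Longrightarrow> circ_bdd (\<lambda>\<zeta>. c * k \<zeta>)" for k :: "complex \<Rightarrow> complex"
proof -
  assume "circ_bdd k"
  then obtain M where "\<And>\<zeta>. cmod \<zeta> = 1 \<Longrightarrow> norm (k \<zeta>) \<le> M" using circ_bddE by blast
  then show ?thesis by (intro circ_bddI[of _ "cmod c * M"]) (auto simp: norm_mult mult_left_mono)
qed

lemma circ_bdd_scaleR: "circ_bdd k \<Longrightarrow> circ_bdd (\<lambda>\<zeta>. c *\<^sub>R k \<zeta>)"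
proof -
  assume "circ_bdd k"
  then obtain M where "\<And>\<zeta>. cmod \<zeta> = 1 \<Longrightarrow> norm (k \<zeta>) \<le> M" using circ_bddE by blast
  then show ?thesis by (intro circ_bddI[of _ "\<bar>c\<bar> * M"]) (auto simp: mult_left_mono)
qed

locale circle_functional =
  fixes \<Lambda> :: "(complex \<Rightarrow> complex) \<Rightarrow> real" and B :: real
  assumes add: "circ_bdd k \<Longrightarrow> circ_bdd l \<Longrightarrow> \<Lambda> (\<lambda>\<zeta>. k \<zeta> + l \<zeta>) = \<Lambda> k + \<Lambda> l"
    and scale: "circ_bdd k \<Longrightarrow> \<Lambda> (\<lambda>\<zeta>. of_real c * k \<zeta>) = c * \<Lambda> k"
    and bound: "circ_bdd k \<Longrightarrow> (\<And>\<zeta>. cmod \<zeta> = 1 \<Longrightarrow> cmod (k \<zeta>) \<le> M) \<Longrightarrow> \<bar>\<Lambda> k\<bar> \<le> B * M"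
begin

text \<open>The complex linear functional with real part \<open>\<Lambda>\<close>.\<close>

definition \<tau> :: "(complex \<Rightarrow> complex) \<Rightarrow> complex" where
  "\<tau> k = Complex (\<Lambda> k) (- \<Lambda> (\<lambda>\<zeta>. \<i> * k \<zeta>))"

lemma Re_tau: "Re (\<tau> k) = \<Lambda> k" by (simp add: \<tau>_def)

lemma tau_add: 
  assumes "circ_bdd k" "circ_bdd l"
  shows "\<tau> (\<lambda>\<zeta>. k \<zeta> + l \<zeta>) = \<tau> k + \<tau> l"
  using add[OF assms] add[OF circ_bdd_mult[OF assms(1)] circ_bdd_mult[OF assms(2)], of \<i> \<i>]
  by (simp add: \<tau>_def complex_eq_iff distrib_left)

lemma tau_scale: 
  assumes "circ_bdd k"
  shows "\<tau> (\<lambda>\<zeta>. c * k \<zeta>) = c * \<tau> k"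
proof -
  have b: "circ_bdd (\<lambda>\<zeta>. of_real a * k \<zeta>)" "circ_bdd (\<lambda>\<zeta>. of_real a * (\<i> * k \<zeta>))" "circ_bdd (\<lambda>\<zeta>. \<i> * k \<zeta>)" for a
    using assms by (auto intro!: circ_bdd_mult)
  have e: "(\<lambda>\<zeta>. c * k \<zeta>) = (\<lambda>\<zeta>. of_real (Re c) * k \<zeta> + of_real (Im c) * (\<i> * k \<zeta>))"
    "(\<lambda>\<zeta>. \<i> * (c * k \<zeta>)) = (\<lambda>\<zeta>. of_real (Re c) * (\<i> * k \<zeta>) + of_real (- Im c) * k \<zeta>)"
    by (auto simp: complex_eq_iff algebra_simps)
  have "\<Lambda> (\<lambda>\<zeta>. c * k \<zeta>) = Re c * \<Lambda> k + Im c * \<Lambda> (\<lambda>\<zeta>. \<i> * k \<zeta>)"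
    unfolding e(1) by (simp only: add[OF b(1,2)] scale[OF assms] scale[OF b(3)])
  moreover have "\<Lambda> (\<lambda>\<zeta>. \<i> * (c * k \<zeta>)) = Re c * \<Lambda> (\<lambda>\<zeta>. \<i> * k \<zeta>) + - Im c * \<Lambda> k"
    unfolding e(2) by (simp only: add[OF b(2,1)] scale[OF assms] scale[OF b(3)])
  ultimately show ?thesis by (simp add: \<tau>_def complex_eq_iff)
qed

lemma tau_bound:
  assumes "circ_bdd k" "\<And>\<zeta>. cmod \<zeta> = 1 \<Longrightarrow> cmod (k \<zeta>) \<le> M"
  shows "cmod (\<tau> k) \<le> 2 * (B * M)"
proof -
  have "\<bar>\<Lambda> k\<bar> \<le> B * M" by (rule bound[OF assms])
  moreover have "\<bar>\<Lambda> (\<lambda>\<zeta>. \<i> * k \<zeta>)\<bar> \<le> B * M"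
    using assms by (intro bound circ_bdd_mult) (auto simp: norm_mult)
  ultimately show ?thesis using cmod_le[of "\<tau> k"] by (simp add: \<tau>_def)
qed

text \<open>The bound with M = 0, applied to the difference, shows that values off the circle are
  invisible.\<close>

lemma tau_cong:
  assumes "circ_bdd k" "circ_bdd l" "\<And>\<zeta>. cmod \<zeta> = 1 \<Longrightarrow> k \<zeta> = l \<zeta>"
  shows "\<tau> k = \<tau> l"
proof -
  have "cmod (\<tau> (\<lambda>\<zeta>. k \<zeta> + (-1) * l \<zeta>)) \<le> 2 * (B * 0)"
    using assms by (intro tau_bound circ_bdd_add circ_bdd_mult) auto
  then have "\<tau> (\<lambda>\<zeta>. k \<zeta> + (-1) * l \<zeta>) = 0" by simp
  then have "\<tau> k + (-1) * \<tau> l = 0"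
    by (simp only: tau_add[OF assms(1) circ_bdd_mult[OF assms(2)]] tau_scale[OF assms(2)])
  then show ?thesis by simp
qed

lemma circ_norm_ge: "cmod \<zeta> = 1 \<Longrightarrow> 1 - cmod \<eta> \<le> cmod (\<zeta> - \<eta>)"
  by (metis norm_triangle_ineq2)

text \<open>Differentiation of the Cauchy transform under the functional. The Cauchy kernel has an
  exact second order expansion whose remainder \<open>g h\<close> is bounded on the circle uniformly
  in small h, and the functional is continuous for uniform bounds.\<close>

lemma tau_cauchy_holomorphic: "(\<lambda>\<eta>. \<tau> (\<lambda>\<zeta>. \<zeta> / (\<zeta> - \<eta>))) holomorphic_on ball 0 1"
proof -
  have "((\<lambda>\<eta>. \<tau> (\<lambda>\<zeta>. \<zeta> / (\<zeta> - \<eta>))) has_field_derivative \<tau> (\<lambda>\<zeta>. \<zeta> / (\<zeta> - \<eta>)\<^sup>2)) (at \<eta>)" if \<eta>: "cmod \<eta> < 1" for \<eta>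
  proof -
    define d where "d = 1 - cmod \<eta>"
    have d: "d > 0" using \<eta> by (simp add: d_def)
    have ge: "d \<le> cmod (\<zeta> - \<eta>)" if "cmod \<zeta> = 1" for \<zeta> using circ_norm_ge[OF that] by (simp add: d_def)
    have ge2: "d / 2 \<le> cmod (\<zeta> - (\<eta> + h))" if "cmod \<zeta> = 1" "cmod h < d / 2" for \<zeta> h
      using ge[OF that(1)] that(2) norm_triangle_ineq2[of "\<zeta> - \<eta>" h] by (simp add: diff_diff_eq)
    define g where "g = (\<lambda>h \<zeta>. \<zeta> / ((\<zeta> - (\<eta> + h)) * (\<zeta> - \<eta>)\<^sup>2))"
    have b1: "circ_bdd (\<lambda>\<zeta>. \<zeta> / (\<zeta> - (\<eta> + h)))" if "cmod h < d / 2" for h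
      using ge2[OF _ that] d by (intro circ_bdd_continuous continuous_intros) fastforce
    have b2: "circ_bdd (\<lambda>\<zeta>. \<zeta> / (\<zeta> - \<eta>)\<^sup>2)"
      using ge d by (intro circ_bdd_continuous continuous_intros) fastforce
    have gb: "cmod (g h \<zeta>) \<le> 2 / d ^ 3" if "cmod \<zeta> = 1" "cmod h < d / 2" for h \<zeta>
    proof -
      have "d / 2 * d\<^sup>2 \<le> cmod (\<zeta> - (\<eta> + h)) * (cmod (\<zeta> - \<eta>))\<^sup>2"
        using ge2[OF that] ge[OF that(1)] d by (intro mult_mono power_mono) auto
      then have "1 / (cmod (\<zeta> - (\<eta> + h)) * (cmod (\<zeta> - \<eta>))\<^sup>2) \<le> 1 / (d / 2 * d\<^sup>2)"
        using d ge2[OF that] ge[OF that(1)] by (intro divide_left_mono mult_pos_pos) auto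
      then show ?thesis using that by (simp add: g_def norm_divide norm_mult norm_power power3_eq_cube power2_eq_square mult.assoc)
    qed
    have b3: "circ_bdd (g h)" if "cmod h < d / 2" for h
      using gb[OF _ that] by (rule circ_bddI)
    have ex: "\<tau> (\<lambda>\<zeta>. \<zeta> / (\<zeta> - (\<eta> + h))) = \<tau> (\<lambda>\<zeta>. \<zeta> / (\<zeta> - \<eta>)) + h * \<tau> (\<lambda>\<zeta>. \<zeta> / (\<zeta> - \<eta>)\<^sup>2) + h\<^sup>2 * \<tau> (g h)"
      if h: "cmod h < d / 2" for h
    proof -
      have b0: "circ_bdd (\<lambda>\<zeta>. \<zeta> / (\<zeta> - \<eta>))" using b1[of 0] d by simp
      have "\<tau> (\<lambda>\<zeta>. \<zeta> / (\<zeta> - (\<eta> + h))) = \<tau> (\<lambda>\<zeta>. (\<zeta> / (\<zeta> - \<eta>) + h * (\<zeta> / (\<zeta> - \<eta>)\<^sup>2)) + h\<^sup>2 * g h \<zeta>)"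
      proof (rule tau_cong)
        fix \<zeta> :: complex assume \<zeta>: "cmod \<zeta> = 1"
        have nz: "\<zeta> - (\<eta> + h) \<noteq> 0" "\<zeta> - \<eta> \<noteq> 0" using ge2[OF \<zeta> h] ge[OF \<zeta>] d by auto
        define u w where "u = \<zeta> - \<eta>" and "w = \<zeta> - (\<eta> + h)"
        have h: "h = u - w" "u \<noteq> 0" "w \<noteq> 0" using nz by (auto simp: u_def w_def)
        then have "\<zeta> / w = (\<zeta> / u + h * (\<zeta> / u\<^sup>2)) + h\<^sup>2 * (\<zeta> / (w * u\<^sup>2))"
          unfolding h(1) by (simp add: field_simps power2_eq_square)
        then show "\<zeta> / (\<zeta> - (\<eta> + h)) = \<zeta> / (\<zeta> - \<eta>) + h * (\<zeta> / (\<zeta> - \<eta>)\<^sup>2) + h\<^sup>2 * g h \<zeta>"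
          by (simp add: g_def u_def w_def)
      qed (intro circ_bdd_add circ_bdd_mult b0 b1 b2 b3 h)+
      also have "\<dots> = \<tau> (\<lambda>\<zeta>. \<zeta> / (\<zeta> - \<eta>)) + h * \<tau> (\<lambda>\<zeta>. \<zeta> / (\<zeta> - \<eta>)\<^sup>2) + h\<^sup>2 * \<tau> (g h)"
        by (simp only: tau_add[OF circ_bdd_add[OF b0 circ_bdd_mult[OF b2]] circ_bdd_mult[OF b3[OF h]]]
           tau_add[OF b0 circ_bdd_mult[OF b2]] tau_scale[OF b2] tau_scale[OF b3[OF h]])
      finally show ?thesis .
    qed
    define f where "f = (\<lambda>\<eta>. \<tau> (\<lambda>\<zeta>. \<zeta> / (\<zeta> - \<eta>)))"
    define D' where "D' = \<tau> (\<lambda>\<zeta>. \<zeta> / (\<zeta> - \<eta>)\<^sup>2)"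
    have "((\<lambda>h. (f (\<eta> + h) - f \<eta>) / h - D') \<longlongrightarrow> 0) (at 0)"
    proof (rule Lim_null_comparison)
      have "eventually (\<lambda>h. h \<in> ball 0 (d/2) \<and> h \<noteq> 0) (at (0::complex))"
        using d by (intro eventually_conj eventually_at_in_open' eventually_neq_at_within) auto
      then show "\<forall>\<^sub>F h in at 0. norm ((f (\<eta> + h) - f \<eta>) / h - D') \<le> cmod h * (2 * (B * (2 / d ^ 3)))"
      proof eventually_elim
        case (elim h)
        then have h: "cmod h < d / 2" "h \<noteq> 0" by auto
        have "(f (\<eta> + h) - f \<eta>) / h - D' = h * \<tau> (g h)"
          using h by (simp add: f_def D'_def ex[OF h(1)] field_simps power2_eq_square)
        moreover have "cmod (\<tau> (g h)) \<le> 2 * (B * (2 / d ^ 3))" by (rule tau_bound[OF b3[OF h(1)] gb[OF _ h(1)]])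
        ultimately show ?case by (simp only: norm_mult) (intro mult_left_mono norm_ge_zero)
      qed
      show "((\<lambda>h. cmod h * (2 * (B * (2 / d ^ 3)))) \<longlongrightarrow> 0) (at 0)"
        using d by (auto intro!: tendsto_eq_intros)
    qed
    then show ?thesis unfolding DERIV_def f_def[symmetric] D'_def[symmetric]
      by (subst (asm) LIM_zero_iff)
  qed
  then show ?thesis unfolding holomorphic_on_def
    by (meson field_differentiable_def has_field_derivative_at_within mem_ball_0)
qed

end

text \<open>Holomorphy beyond the closed disc makes the boundary values meaningful and bounded; the
  radius may depend on the map, and the class is still a linear space.\<close>

definition hol_nbhd :: "(complex \<Rightarrow> complex ^ 'n) \<Rightarrow> bool" where
  "hol_nbhd \<psi> \<longleftrightarrow> (\<exists>R>1. \<forall>i. (\<lambda>\<zeta>. \<psi> \<zeta> $ i) holomorphic_on ball 0 R)"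

lemma hol_nbhd_add:
  assumes "hol_nbhd \<psi>" "hol_nbhd \<psi>'"
  shows "hol_nbhd (\<lambda>\<zeta>. \<psi> \<zeta> + \<psi>' \<zeta>)"
proof -
  obtain R R' where R: "R > 1" "\<And>i. (\<lambda>\<zeta>. \<psi> \<zeta> $ i) holomorphic_on ball 0 R"
    "R' > 1" "\<And>i. (\<lambda>\<zeta>. \<psi>' \<zeta> $ i) holomorphic_on ball 0 R'"
    using assms unfolding hol_nbhd_def by blast
  have "(\<lambda>\<zeta>. (\<psi> \<zeta> + \<psi>' \<zeta>) $ i) holomorphic_on ball 0 (min R R')" for i
    unfolding vector_add_component
    by (intro holomorphic_intros holomorphic_on_subset[OF R(2)] holomorphic_on_subset[OF R(4)]) auto
  then show ?thesis unfolding hol_nbhd_def using R by (intro exI[of _ "min R R'"]) auto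
qed

lemma hol_nbhd_scaleR: "hol_nbhd \<psi> \<Longrightarrow> hol_nbhd (\<lambda>\<zeta>. c *\<^sub>R \<psi> \<zeta>)"
  unfolding hol_nbhd_def vector_scaleR_component scaleR_conv_of_real[where 'a = complex]
  by (elim exE conjE, intro exI conjI allI, assumption) (intro holomorphic_intros, blast)

lemma hol_nbhd_scalar:
  assumes "q holomorphic_on ball 0 R" "R > 1"
  shows "hol_nbhd (\<lambda>\<zeta>. q \<zeta> *s w)"
  unfolding hol_nbhd_def using assms by (auto intro!: exI[of _ R] holomorphic_intros)

lemma hol_nbhd_continuous:
  assumes "hol_nbhd \<psi>"
  shows "continuous_on (cball 0 1) \<psi>"
proof -
  obtain R where R: "R > 1" "\<And>i. (\<lambda>\<zeta>. \<psi> \<zeta> $ i) holomorphic_on ball 0 R"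
    using assms unfolding hol_nbhd_def by blast
  have "continuous_on (cball 0 1) (\<lambda>\<zeta>. \<chi> i. \<psi> \<zeta> $ i)"
    by (intro continuous_on_vec_lambda holomorphic_on_imp_continuous_on holomorphic_on_subset[OF R(2)])
      (use R in auto)
  then show ?thesis by simp
qed

lemma poisson_identity:
  assumes "cmod \<zeta> = 1" "cmod \<eta> < 1"
  defines "P \<equiv> (1 - (cmod \<eta>)\<^sup>2) / (cmod (\<zeta> - \<eta>))\<^sup>2"
  shows "of_real P = \<zeta> / (\<zeta> - \<eta>) + \<zeta> * (cnj \<eta> / (1 - cnj \<eta> * \<zeta>))"
    and "Re (2 * (\<zeta> / (\<zeta> - \<eta>)) - 1) = P" and "P > 0"
proof -
  define u where "u = 1 - \<eta> * cnj \<zeta>"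
  have z1: "\<zeta> * cnj \<zeta> = 1" using complex_norm_square[of \<zeta>] assms(1) by simp
  have z0: "\<zeta> \<noteq> 0" using assms(1) by auto
  have zu: "\<zeta> - \<eta> = \<zeta> * u" unfolding u_def using z1 by (simp add: algebra_simps)
  have cu: "1 - cnj \<eta> * \<zeta> = cnj u" by (simp add: u_def mult.commute)
  have u0: "u \<noteq> 0" using zu assms by force
  have nu: "cmod (\<zeta> - \<eta>) = cmod u" using zu assms(1) by (simp add: norm_mult)
  have u2: "u * cnj u = of_real ((cmod u)\<^sup>2)" using complex_norm_square[of u] by simp
  have e2: "of_real ((cmod \<eta>)\<^sup>2) = (1 - u) * (1 - cnj u)"
  proof -
    have "cmod (1 - u) = cmod \<eta>" using assms(1) by (simp add: u_def norm_mult)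
    then show ?thesis using complex_norm_square[of "1 - u"] by simp
  qed
  have P: "of_real P = (1 - (1 - u) * (1 - cnj u)) / (u * cnj u)"
    unfolding P_def nu of_real_divide u2[symmetric] of_real_diff e2[symmetric] by simp
  have a: "\<zeta> / (\<zeta> - \<eta>) = 1 / u" using zu z0 by simp
  have b: "\<zeta> * cnj \<eta> = 1 - cnj u" using cu by (simp add: mult.commute algebra_simps)
  show "of_real P = \<zeta> / (\<zeta> - \<eta>) + \<zeta> * (cnj \<eta> / (1 - cnj \<eta> * \<zeta>))"
    unfolding P a cu times_divide_eq_right b using u0 by (simp add: field_simps)
  have "of_real P = 1 / u + 1 / cnj u - 1" unfolding P using u0 by (simp add: field_simps)
  then have "P = Re (1 / u + 1 / cnj u - 1)" by (metis Re_complex_of_real)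
  moreover have "Re (1 / cnj u) = Re (1 / u)" by (metis complex_cnj_divide complex_cnj_one cnj.sel(1))
  moreover have "Re (2 * (1 / u)) = 2 * Re (1 / u)" by (simp only: mult_2 plus_complex.sel)
  ultimately show "Re (2 * (\<zeta> / (\<zeta> - \<eta>)) - 1) = P" unfolding a by simp
  have "(cmod \<eta>)\<^sup>2 < 1" using assms by (simp add: abs_square_less_1)
  then show "P > 0" unfolding P_def nu using u0 by simp
qed

text \<open>The separating functional is positive on the Poisson kernels
  \<open>\<zeta> / (\<zeta> - \<eta>) + cnj \<eta> * \<zeta> / (1 - cnj \<eta> * \<zeta>)\<close>; the two summands contribute \<open>A\<close> and,
  because the functional vanishes on admissible discs up to their value at \<open>\<alpha>\<close>, the term with \<open>m\<close>.\<close>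

lemma dual_functions:
  fixes D :: "(complex ^ 'n) set" and \<alpha> :: real
  assumes D: "open D" "convex D" "z \<in> D" and \<alpha>: "0 \<le> \<alpha>" "\<alpha> < 1"
    and none: "\<not> (\<exists>\<psi>. hol_nbhd \<psi> \<and> \<psi> \<alpha> = v \<and> (\<forall>\<zeta>. cmod \<zeta> = 1 \<longrightarrow> z + \<zeta> *s \<psi> \<zeta> \<in> D))"
  obtains A :: "complex \<Rightarrow> complex ^ 'n" and m G where
    "\<And>i. (\<lambda>\<eta>. A \<eta> $ i) holomorphic_on ball 0 1" "G holomorphic_on ball 0 1" "G 0 = 1" "Re (bilin v m) = 1"
    "\<And>w \<eta>. z + w \<in> D \<Longrightarrow> cmod \<eta> < 1 \<Longrightarrow>
       Re (bilin w (A \<eta>) + bilin w m * (cnj \<eta> / (1 - cnj \<eta> * \<alpha>))) < Re (G \<eta>)"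
proof -

  \<comment> \<open>The cone to be separated from -e\<close>
  define V where "V = {F :: complex \<Rightarrow> (complex ^ 'n) \<times> real. circ_bdd F}"
  \<comment> \<open>Homogenization: the extra real coordinate s records the scale, so that the
    convex set D - z becomes a convex cone.\<close>
  define K where "K = {F \<in> V. \<forall>\<zeta>. cmod \<zeta> = 1 \<longrightarrow> (\<exists>x s. s \<ge> 0 \<and> z + x \<in> D \<and> F \<zeta> = (s *\<^sub>R x, s))}"
  \<comment> \<open>The interpolation condition, homogenized with the same scale s. This is a linear
    space, so a functional nonnegative on it vanishes on it.\<close>
  define L where "L = {F. \<exists>\<psi> s. hol_nbhd \<psi> \<and> \<psi> \<alpha> = s *\<^sub>R v \<and> F = (\<lambda>\<zeta>. (\<zeta> *s \<psi> \<zeta>, s :: real))}"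
  define C where "C = {F. \<exists>k\<in>K. \<exists>l\<in>L. F = (\<lambda>\<zeta>. k \<zeta> + l \<zeta>)}"
  define e :: "complex \<Rightarrow> (complex ^ 'n) \<times> real" where "e = (\<lambda>_. (0, 1))"
  obtain \<rho> where \<rho>: "\<rho> > 0" "ball z \<rho> \<subseteq> D" using D openE by blast
  have V: "(\<lambda>_. 0) \<in> V" "\<And>F G. F \<in> V \<Longrightarrow> G \<in> V \<Longrightarrow> (\<lambda>x. F x + G x) \<in> V"
      "\<And>F c. F \<in> V \<Longrightarrow> (\<lambda>x. c *\<^sub>R F x) \<in> V"
    by (auto simp: V_def intro: circ_bdd_add circ_bdd_scaleR circ_bddI[of _ 0])
  have K_add: "(\<lambda>\<zeta>. k \<zeta> + l \<zeta>) \<in> K" if kl: "k \<in> K" "l \<in> K" for k l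
  proof -
    have "\<exists>x s. s \<ge> 0 \<and> z + x \<in> D \<and> k \<zeta> + l \<zeta> = (s *\<^sub>R x, s)" if "cmod \<zeta> = 1" for \<zeta>
    proof -
      obtain x s x' s' where *: "s \<ge> 0" "z + x \<in> D" "k \<zeta> = (s *\<^sub>R x, s)" "s' \<ge> 0" "z + x' \<in> D" "l \<zeta> = (s' *\<^sub>R x', s')"
        using kl \<open>cmod \<zeta> = 1\<close> unfolding K_def by blast
      show ?thesis
      proof (cases "s + s' = 0")
        case True
        then have "s = 0" "s' = 0" using * by auto
        then show ?thesis using * by (intro exI[of _ x] exI[of _ 0]) auto
      next
        case False
        then have p: "s + s' > 0" using * by auto
        define y where "y = (s / (s + s')) *\<^sub>R x + (s' / (s + s')) *\<^sub>R x'"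
        have one: "s / (s + s') + s' / (s + s') = 1" using p by (simp add: add_divide_distrib[symmetric])
        have "(s / (s + s')) *\<^sub>R (z + x) + (s' / (s + s')) *\<^sub>R (z + x') \<in> D"
          using p * one by (intro convexD[OF D(2)]) auto
        moreover have "(s / (s + s')) *\<^sub>R (z + x) + (s' / (s + s')) *\<^sub>R (z + x') = (s / (s + s') + s' / (s + s')) *\<^sub>R z + y"
          by (simp add: y_def algebra_simps)
        ultimately have "z + y \<in> D" using one by simp
        moreover have "(s + s') *\<^sub>R y = s *\<^sub>R x + s' *\<^sub>R x'" using p by (simp add: y_def scaleR_add_right)
        ultimately show ?thesis using * by (intro exI[of _ y] exI[of _ "s + s'"]) auto
      qed
    qed
    then show ?thesis using kl V(2) by (auto simp: K_def)
  qed
  have K_scale: "(\<lambda>\<zeta>. c *\<^sub>R k \<zeta>) \<in> K" if k: "k \<in> K" "c \<ge> 0" for k c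
  proof -
    have "\<exists>x s. s \<ge> 0 \<and> z + x \<in> D \<and> c *\<^sub>R k \<zeta> = (s *\<^sub>R x, s)" if "cmod \<zeta> = 1" for \<zeta>
    proof -
      obtain x s where *: "s \<ge> 0" "z + x \<in> D" "k \<zeta> = (s *\<^sub>R x, s)"
        using k \<open>cmod \<zeta> = 1\<close> unfolding K_def by blast
      then show ?thesis using k by (intro exI[of _ x] exI[of _ "c * s"]) auto
    qed
    then show ?thesis using k V(3) by (auto simp: K_def)
  qed
  have K0: "(\<lambda>_. 0) \<in> K" using V(1) D(3) by (auto simp: K_def zero_prod_def intro!: exI[of _ 0])
  have eK: "e \<in> K" using D(3) by (auto simp: K_def V_def e_def intro!: exI[of _ 0] circ_bddI[of _ 1])
  have L_add: "(\<lambda>\<zeta>. k \<zeta> + l \<zeta>) \<in> L" if kl: "k \<in> L" "l \<in> L" for k l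
  proof -
    obtain \<psi> s \<psi>' s' where "hol_nbhd \<psi>" "\<psi> \<alpha> = s *\<^sub>R v" "k = (\<lambda>\<zeta>. (\<zeta> *s \<psi> \<zeta>, s))"
      "hol_nbhd \<psi>'" "\<psi>' \<alpha> = s' *\<^sub>R v" "l = (\<lambda>\<zeta>. (\<zeta> *s \<psi>' \<zeta>, s'))" using kl unfolding L_def by blast
    then show ?thesis unfolding L_def
      by (intro CollectI exI[of _ "\<lambda>\<zeta>. \<psi> \<zeta> + \<psi>' \<zeta>"] exI[of _ "s + s'"])
        (auto simp: hol_nbhd_add scaleR_add_left vector_add_ldistrib)
  qed
  have L_scale: "(\<lambda>\<zeta>. c *\<^sub>R l \<zeta>) \<in> L" if l: "l \<in> L" for l c
  proof -
    obtain \<psi> s where "hol_nbhd \<psi>" "\<psi> \<alpha> = s *\<^sub>R v" "l = (\<lambda>\<zeta>. (\<zeta> *s \<psi> \<zeta>, s))" using l unfolding L_def by blast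
    then show ?thesis unfolding L_def
      by (intro CollectI exI[of _ "\<lambda>\<zeta>. c *\<^sub>R \<psi> \<zeta>"] exI[of _ "c * s"])
        (auto simp: hol_nbhd_scaleR vec_eq_iff)
  qed
  have zL: "(\<lambda>\<zeta>. (\<zeta> *s (q \<zeta> *s w), s)) \<in> L"
    if "q holomorphic_on ball 0 R" "R > 1" "q \<alpha> *s w = s *\<^sub>R v" for q w s R
    unfolding L_def using that hol_nbhd_scalar[OF that(1,2), of w]
    by (intro CollectI exI[of _ "\<lambda>\<zeta>. q \<zeta> *s w"] exI[of _ s] conjI) auto
  have L0: "(\<lambda>_. 0) \<in> L" using zL[of "\<lambda>_. 0" 2 0 0] by (simp add: zero_prod_def)
  have LV: "L \<subseteq> V"
  proof
    fix l assume "l \<in> L"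
    then obtain \<psi> s where *: "hol_nbhd \<psi>" "l = (\<lambda>\<zeta>. (\<zeta> *s \<psi> \<zeta>, s))" unfolding L_def by blast
    have "continuous_on (sphere 0 1) \<psi>" by (rule continuous_on_subset[OF hol_nbhd_continuous[OF *(1)]]) auto
    then have "circ_bdd l" unfolding *(2) vector_scalar_mult_def by (intro circ_bdd_continuous continuous_intros)
    then show "l \<in> V" by (simp add: V_def)
  qed
  have CI: "(\<lambda>\<zeta>. k \<zeta> + l \<zeta>) \<in> C" if "k \<in> K" "l \<in> L" for k l
    unfolding C_def by (rule CollectI) (intro bexI[of _ k] bexI[of _ l] refl that)
  have KC: "K \<subseteq> C" using CI[OF _ L0] by auto
  have LC: "L \<subseteq> C" using CI[OF K0] by auto
  have C_add: "(\<lambda>x. F x + G x) \<in> C" if FG: "F \<in> C" "G \<in> C" for F G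
  proof -
    obtain k l where 1: "k \<in> K" "l \<in> L" "F = (\<lambda>\<zeta>. k \<zeta> + l \<zeta>)"
      using FG(1) unfolding C_def by blast
    obtain k' l' where 2: "k' \<in> K" "l' \<in> L" "G = (\<lambda>\<zeta>. k' \<zeta> + l' \<zeta>)"
      using FG(2) unfolding C_def by blast
    note * = 1 2
    have "(\<lambda>x. F x + G x) = (\<lambda>x. (k x + k' x) + (l x + l' x))" unfolding * by (auto simp: algebra_simps)
    then show ?thesis using CI[OF K_add[OF *(1,4)] L_add[OF *(2,5)]] by (simp only:)
  qed
  have C_scale: "(\<lambda>x. c *\<^sub>R F x) \<in> C" if F: "F \<in> C" "c \<ge> 0" for F c
  proof -
    obtain k l where *: "k \<in> K" "l \<in> L" "F = (\<lambda>\<zeta>. k \<zeta> + l \<zeta>)" using F unfolding C_def by blast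
    have "(\<lambda>x. c *\<^sub>R F x) = (\<lambda>x. c *\<^sub>R k x + c *\<^sub>R l x)" unfolding * by (auto simp: algebra_simps)
    then show ?thesis using CI[OF K_scale[OF *(1) F(2)] L_scale[OF *(2)]] by (simp only:)
  qed
  \<comment> \<open>D contains the ball of radius \<rho> about z. After subtraction the scale
    coordinate is at least 2 M / \<rho> and the vector part at most M, so their quotient stays in
    that ball.\<close>
  have order_unit: "(\<lambda>x. (M * (1 + 2 / \<rho>)) *\<^sub>R e x - F x) \<in> K"
    if F: "F \<in> V" "\<And>\<zeta>. cmod \<zeta> = 1 \<Longrightarrow> norm (F \<zeta>) \<le> M" for F M
  proof -
    have "\<exists>x s. s \<ge> 0 \<and> z + x \<in> D \<and> (M * (1 + 2 / \<rho>)) *\<^sub>R e \<zeta> - F \<zeta> = (s *\<^sub>R x, s)" if \<zeta>: "cmod \<zeta> = 1" for \<zeta>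
    proof -
      define y t where "y = fst (F \<zeta>)" and "t = snd (F \<zeta>)"
      have n: "norm (F \<zeta>) \<le> M" by (rule F(2)[OF \<zeta>])
      have yt: "norm y \<le> M" "\<bar>t\<bar> \<le> M"
        using norm_fst_le[of "fst (F \<zeta>)" "snd (F \<zeta>)"] norm_snd_le[of "snd (F \<zeta>)" "fst (F \<zeta>)"] n
        by (auto simp: y_def t_def)
      define s where "s = M * (1 + 2 / \<rho>) - t"
      have s: "s \<ge> 2 * M / \<rho>" using yt by (simp add: s_def algebra_simps)
      have M: "M \<ge> 0" using yt norm_ge_zero[of y] by linarith
      then have s0: "s \<ge> 0" using s \<rho> by (smt (verit) divide_nonneg_pos)
      have eq: "(M * (1 + 2 / \<rho>)) *\<^sub>R e \<zeta> - F \<zeta> = (- y, s)" by (simp add: e_def s_def y_def t_def prod_eq_iff)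
      show ?thesis
      proof (cases "y = 0")
        case True
        then show ?thesis using s0 D(3) unfolding eq by (intro exI[of _ 0] exI[of _ s]) auto
      next
        case False
        then have "M > 0" using yt by (smt (verit) zero_less_norm_iff)
        then have "2 * M / \<rho> > 0" using \<rho> by simp
        then have sp: "s > 0" using s by linarith
        have "norm y \<le> s * \<rho> / 2" using yt s \<rho> by (simp add: field_simps)
        then have "norm (- ((1/s) *\<^sub>R y)) < \<rho>" using sp \<rho> by (simp add: field_simps) (smt (verit) mult_pos_pos)
        then have "z + - ((1/s) *\<^sub>R y) \<in> D" using \<rho>(2) by (auto simp: dist_norm)
        then show ?thesis using sp unfolding eq by (intro exI[of _ "- ((1/s) *\<^sub>R y)"] exI[of _ s]) auto
      qed
    qed
    moreover have "(\<lambda>x. (M * (1 + 2 / \<rho>)) *\<^sub>R e x - F x) \<in> V"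
      using V(2)[OF V(3)[of e "M * (1 + 2 / \<rho>)"] V(3)[OF F(1), of "-1"]] eK by (auto simp: K_def)
    ultimately show ?thesis by (simp add: K_def)
  qed
  \<comment> \<open>This is where \<open>none\<close> enters: from a representation of -e, dividing
    -\<psi> by 1 + \<sigma> gives an admissible disc, whose boundary points are convex combinations
    of z and of points of D.\<close>
  have me: "(\<lambda>x. - e x) \<notin> C"
  proof
    assume "(\<lambda>x. - e x) \<in> C"
    then obtain k \<psi> s where *: "k \<in> K" "hol_nbhd \<psi>" "\<psi> \<alpha> = s *\<^sub>R v" "(\<lambda>x. - e x) = (\<lambda>\<zeta>. k \<zeta> + (\<zeta> *s \<psi> \<zeta>, s))"
      unfolding C_def L_def by blast
    have k: "k \<zeta> = (- (\<zeta> *s \<psi> \<zeta>), - 1 - s)" for \<zeta> using fun_cong[OF *(4), of \<zeta>]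
      by (cases "k \<zeta>") (auto simp: e_def eq_neg_iff_add_eq_0)
    define \<sigma> where "\<sigma> = - 1 - s"
    have kx: "\<exists>x. \<sigma> \<ge> 0 \<and> z + x \<in> D \<and> - (\<zeta> *s \<psi> \<zeta>) = \<sigma> *\<^sub>R x" if "cmod \<zeta> = 1" for \<zeta>
      using *(1) that unfolding K_def k \<sigma>_def by auto
    have \<sigma>: "\<sigma> \<ge> 0" using kx[of 1] by auto
    define \<psi>' where "\<psi>' = (\<lambda>\<zeta>. (- 1 / (1 + \<sigma>)) *\<^sub>R \<psi> \<zeta>)"
    have "hol_nbhd \<psi>'" unfolding \<psi>'_def by (rule hol_nbhd_scaleR[OF *(2)])
    moreover have "\<psi>' \<alpha> = v" using *(3) \<sigma> by (simp add: \<psi>'_def \<sigma>_def)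
    moreover have "z + \<zeta> *s \<psi>' \<zeta> \<in> D" if \<zeta>: "cmod \<zeta> = 1" for \<zeta>
    proof -
      obtain x where x: "z + x \<in> D" "- (\<zeta> *s \<psi> \<zeta>) = \<sigma> *\<^sub>R x" using kx[OF \<zeta>] by blast
      have "(1 / (1 + \<sigma>)) *\<^sub>R z + (\<sigma> / (1 + \<sigma>)) *\<^sub>R (z + x) \<in> D"
        using \<sigma> D(3) x by (intro convexD[OF D(2)]) (auto simp: add_divide_distrib[symmetric])
      also have "(1 / (1 + \<sigma>)) *\<^sub>R z + (\<sigma> / (1 + \<sigma>)) *\<^sub>R (z + x) = (1 / (1 + \<sigma>) + \<sigma> / (1 + \<sigma>)) *\<^sub>R z + (1 / (1 + \<sigma>)) *\<^sub>R (\<sigma> *\<^sub>R x)"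
        by (simp add: algebra_simps)
      also have "1 / (1 + \<sigma>) + \<sigma> / (1 + \<sigma>) = 1" using \<sigma> by (simp add: add_divide_distrib[symmetric])
      also have "(1 / (1 + \<sigma>)) *\<^sub>R (\<sigma> *\<^sub>R x) = \<zeta> *s \<psi>' \<zeta>" 
        unfolding x(2)[symmetric] \<psi>'_def by (simp add: vec_eq_iff)
      finally show ?thesis by simp
    qed
    ultimately show False using none by blast
  qed
  obtain S :: "(complex \<Rightarrow> (complex ^ 'n) \<times> real) \<Rightarrow> real" where
    S: "\<And>F G. F \<in> V \<Longrightarrow> G \<in> V \<Longrightarrow> S (\<lambda>x. F x + G x) = S F + S G"
    "\<And>F c. F \<in> V \<Longrightarrow> S (\<lambda>x. c *\<^sub>R F x) = c * S F"
    "\<And>F. F \<in> C \<Longrightarrow> 0 \<le> S F" "S e = 1"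
  proof (rule Riesz_extension[of V C e])
    show "C \<subseteq> V"
    proof
      fix F assume "F \<in> C"
      then obtain k l where "k \<in> K" "l \<in> L" "F = (\<lambda>\<zeta>. k \<zeta> + l \<zeta>)" unfolding C_def by blast
      then show "F \<in> V" using V(2)[of k l] LV by (auto simp: K_def)
    qed
    show "(\<lambda>_. 0) \<in> C" "e \<in> C" using K0 eK KC by auto
    show "\<exists>t. (\<lambda>x. t *\<^sub>R e x - F x) \<in> C" if F: "F \<in> V" for F
    proof -
      obtain M where "\<And>\<zeta>. cmod \<zeta> = 1 \<Longrightarrow> norm (F \<zeta>) \<le> M"
        using F circ_bddE[of F] unfolding V_def by blast
      then show ?thesis using order_unit[OF F] KC by blast
    qed
  qed (use V C_add C_scale me in blast)+
  have eV: "e \<in> V" using eK by (simp add: K_def)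
  have S_bound: "\<bar>S F\<bar> \<le> M * (1 + 2 / \<rho>)" if F: "F \<in> V" "\<And>\<zeta>. cmod \<zeta> = 1 \<Longrightarrow> norm (F \<zeta>) \<le> M" for F M
  proof -
    have half: "S F \<le> M * (1 + 2 / \<rho>)" if F: "F \<in> V" "\<And>\<zeta>. cmod \<zeta> = 1 \<Longrightarrow> norm (F \<zeta>) \<le> M" for F
    proof -
      let ?t = "M * (1 + 2 / \<rho>)"
      have "0 \<le> S (\<lambda>x. ?t *\<^sub>R e x - F x)" using order_unit[OF F] KC by (intro S(3)) auto
      also have "\<dots> = S (\<lambda>x. ?t *\<^sub>R e x + (-1) *\<^sub>R F x)" by simp
      also have "\<dots> = ?t - S F"
        unfolding S(1)[OF V(3)[OF eV] V(3)[OF F(1)]] S(2)[OF eV] S(2)[OF F(1)] S(4) by simp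
      finally show ?thesis by simp
    qed
    have "S (\<lambda>x. (-1) *\<^sub>R F x) \<le> M * (1 + 2 / \<rho>)" using F(2) by (intro half V(3) F(1)) auto
    then show ?thesis using half[OF F] S(2)[OF F(1), of "-1"] by simp
  qed
  have S_L: "S l = 0" if l: "l \<in> L" for l
    using S(3)[OF subsetD[OF LC l]] S(3)[OF subsetD[OF LC L_scale[OF l, of "-1"]]] S(2)[OF subsetD[OF LV l], of "-1"] by simp

  \<comment> \<open>Transforms of the separating functional\<close>
  \<comment> \<open>With this sign, positivity of S on a pair (k w, k) of the cone reads
    \<open>\<Lambda> w k\<close> \<le> \<open>N k\<close>.\<close>
  define \<Lambda> where "\<Lambda> = (\<lambda>w k. - S (\<lambda>\<zeta>. (k \<zeta> *s w, 0)))"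
  define N where "N = (\<lambda>k. S (\<lambda>\<zeta>. (0, Re (k \<zeta>))))"
  have Vp: "(\<lambda>\<zeta>. (k \<zeta> *s w, g \<zeta>)) \<in> V" if kg: "circ_bdd k" "circ_bdd g" for k w g
  proof -
    obtain M M' where "M > 0" "\<And>\<zeta>. cmod \<zeta> = 1 \<Longrightarrow> norm (k \<zeta>) \<le> M" "\<And>\<zeta>. cmod \<zeta> = 1 \<Longrightarrow> norm (g \<zeta>) \<le> M'"
      using kg circ_bddE by metis
    then have "norm (k \<zeta> *s w, g \<zeta>) \<le> M * norm w + M'" if "cmod \<zeta> = 1" for \<zeta>
      using norm_Pair_le[of "k \<zeta> *s w" "g \<zeta>"] mult_right_mono[of "cmod (k \<zeta>)" M "norm w"] that
      by (fastforce simp: norm_vec_scale)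
    then show ?thesis unfolding V_def by (auto intro: circ_bddI)
  qed
  have b0: "circ_bdd (\<lambda>_. 0 :: 'a::real_normed_vector)" by (rule circ_bddI[of _ 0]) auto
  interpret T: circle_functional "\<Lambda> w" "norm w * (1 + 2 / \<rho>)" for w
  proof
    fix k l :: "complex \<Rightarrow> complex" and c M :: real
    assume k: "circ_bdd k"
    show "\<Lambda> w (\<lambda>\<zeta>. k \<zeta> + l \<zeta>) = \<Lambda> w k + \<Lambda> w l" if l: "circ_bdd l"
      using S(1)[OF Vp[OF k b0, of w] Vp[OF l b0, of w]] by (simp add: \<Lambda>_def vector_sadd_rdistrib)
    have "(\<lambda>\<zeta>. ((of_real c * k \<zeta>) *s w, 0 :: real)) = (\<lambda>\<zeta>. c *\<^sub>R (k \<zeta> *s w, 0))"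
      by (auto simp: vec_eq_iff scaleR_conv_of_real[where 'a = complex])
    then show "\<Lambda> w (\<lambda>\<zeta>. of_real c * k \<zeta>) = c * \<Lambda> w k"
      using S(2)[OF Vp[OF k b0, of w]] by (simp add: \<Lambda>_def)
    show "\<bar>\<Lambda> w k\<bar> \<le> norm w * (1 + 2 / \<rho>) * M" if "\<And>\<zeta>. cmod \<zeta> = 1 \<Longrightarrow> cmod (k \<zeta>) \<le> M"
    proof -
      have "\<bar>S (\<lambda>\<zeta>. (k \<zeta> *s w, 0))\<bar> \<le> (M * norm w) * (1 + 2 / \<rho>)"
        using that by (intro S_bound Vp k b0) (auto simp: norm_vec_scale mult_right_mono)
      then show ?thesis by (simp add: \<Lambda>_def mult_ac)
    qed
  qed
  have VN: "(\<lambda>\<zeta>. (0, g \<zeta>)) \<in> V" if "circ_bdd g" for g :: "complex \<Rightarrow> real"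
    using Vp[OF b0 that, of 0] by simp
  have bRe: "circ_bdd (\<lambda>\<zeta>. Re (k \<zeta>))" if k: "circ_bdd k" for k
  proof -
    obtain M where "\<And>\<zeta>. cmod \<zeta> = 1 \<Longrightarrow> norm (k \<zeta>) \<le> M" using circ_bddE[OF k] by blast
    then show ?thesis by (intro circ_bddI[of _ M]) (use abs_Re_le_cmod order_trans in \<open>fastforce\<close>)
  qed
  interpret N: circle_functional N "1 + 2 / \<rho>"
  proof
    fix k l :: "complex \<Rightarrow> complex" and c M :: real
    assume k: "circ_bdd k"
    show "N (\<lambda>\<zeta>. k \<zeta> + l \<zeta>) = N k + N l" if l: "circ_bdd l"
      using S(1)[OF VN[OF bRe[OF k]] VN[OF bRe[OF l]]] by (simp add: N_def)
    show "N (\<lambda>\<zeta>. of_real c * k \<zeta>) = c * N k"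
      using S(2)[OF VN[OF bRe[OF k]]] by (simp add: N_def)
    show "\<bar>N k\<bar> \<le> (1 + 2 / \<rho>) * M" if "\<And>\<zeta>. cmod \<zeta> = 1 \<Longrightarrow> cmod (k \<zeta>) \<le> M"
    proof -
      have "\<bar>S (\<lambda>\<zeta>. (0, Re (k \<zeta>)))\<bar> \<le> M * (1 + 2 / \<rho>)"
        using that abs_Re_le_cmod order_trans by (intro S_bound VN bRe k) fastforce
      then show ?thesis by (simp add: N_def mult.commute)
    qed
  qed
  have T_add: "T.\<tau> (w + w') k = T.\<tau> w k + T.\<tau> w' k" if k: "circ_bdd k" for w w' k
    using S(1)[OF Vp[OF k b0, of w] Vp[OF k b0, of w']]
      S(1)[OF Vp[OF circ_bdd_mult[OF k, of \<i>] b0, of w] Vp[OF circ_bdd_mult[OF k, of \<i>] b0, of w']]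
    unfolding T.\<tau>_def by (simp add: \<Lambda>_def vector_add_ldistrib complex_eq_iff)
  have T_scale: "T.\<tau> (c *s w) k = c * T.\<tau> w k" if k: "circ_bdd k" for c w k
  proof -
    have "T.\<tau> (c *s w) k = T.\<tau> w (\<lambda>\<zeta>. c * k \<zeta>)" unfolding T.\<tau>_def by (simp add: \<Lambda>_def mult_ac)
    then show ?thesis using T.tau_scale[OF k] by simp
  qed
  \<comment> \<open>Dependence on w is complex linear because a scalar can be moved from w to k. So
    one vector of transforms, A or m, serves all w at once.\<close>
  have T_bilin: "T.\<tau> w k = bilin w (\<chi> i. T.\<tau> (axis i 1) k)" if k: "circ_bdd k" for w k
  proof -
    have 0: "T.\<tau> 0 k = 0" using T_scale[OF k, of 0 0] by simp
    have "T.\<tau> (\<Sum>i\<in>I. w $ i *s axis i 1) k = (\<Sum>i\<in>I. w $ i * T.\<tau> (axis i 1) k)" if "finite I" for I :: "'n set"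
      using that by (induction I) (auto simp: 0 T_add[OF k] T_scale[OF k])
    from this[of UNIV] show ?thesis by (simp add: bilin_def basis_expansion)
  qed
  have bc: "circ_bdd (\<lambda>\<zeta>. \<zeta> / (\<zeta> - \<eta>))" if "cmod \<eta> < 1" for \<eta>
    using that by (intro circ_bdd_continuous continuous_intros) auto
  have bid: "circ_bdd (\<lambda>\<zeta>. \<zeta>)" and b1: "circ_bdd (\<lambda>_. 1 :: complex)" by (rule circ_bddI[of _ 1]; simp)+
  define A where "A = (\<lambda>\<eta>. \<chi> i. T.\<tau> (axis i 1) (\<lambda>\<zeta>. \<zeta> / (\<zeta> - \<eta>)))"
  define m where "m = (\<chi> i. T.\<tau> (axis i 1) (\<lambda>\<zeta>. \<zeta>))"
  define P where "P = (\<lambda>\<eta> \<zeta>. Re (2 * (\<zeta> / (\<zeta> - \<eta>)) - 1))"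
  define G where "G = (\<lambda>\<eta>. 2 * N.\<tau> (\<lambda>\<zeta>. \<zeta> / (\<zeta> - \<eta>)) - N.\<tau> (\<lambda>_. 1))"
  \<comment> \<open>Such a q times w has value 0 at \<alpha>, hence belongs to \<open>L\<close> with
    s = 0; multiplication by \<i> gives the imaginary part.\<close>
  have kill: "T.\<tau> w (\<lambda>\<zeta>. \<zeta> * q \<zeta>) = 0" if q: "q holomorphic_on ball 0 R" "R > 1" "q \<alpha> = 0" for q R w
  proof -
    have "(\<lambda>\<zeta>. \<i> * q \<zeta>) holomorphic_on ball 0 R" using q by (intro holomorphic_intros)
    then have "S (\<lambda>\<zeta>. (\<zeta> *s (q \<zeta> *s w), 0)) = 0" "S (\<lambda>\<zeta>. (\<zeta> *s ((\<i> * q \<zeta>) *s w), 0)) = 0"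
      using q by (intro S_L zL[of _ R]; simp)+
    then show ?thesis unfolding T.\<tau>_def by (simp add: \<Lambda>_def complex_eq_iff mult_ac)
  qed
  have S_add_pair: "S (\<lambda>\<zeta>. (k \<zeta> *s w, g \<zeta>)) = - \<Lambda> w k + S (\<lambda>\<zeta>. (0, g \<zeta>))" if "circ_bdd k" "circ_bdd g" for k w g
    using S(1)[OF Vp[OF that(1) b0, of w] VN[OF that(2)]] by (simp add: \<Lambda>_def)
  show ?thesis
  proof (rule that[of A G m])
    show "(\<lambda>\<eta>. A \<eta> $ i) holomorphic_on ball 0 1" for i
      using T.tau_cauchy_holomorphic[of "axis i 1"] by (simp add: A_def)
    show "G holomorphic_on ball 0 1"
      unfolding G_def by (intro holomorphic_intros N.tau_cauchy_holomorphic)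
    have "N.\<tau> (\<lambda>_. 1) = 1"
      using S(4) S(2)[OF V(1), of 0] unfolding N.\<tau>_def by (simp add: N_def e_def complex_eq_iff zero_prod_def)
    moreover have "N.\<tau> (\<lambda>\<zeta>. \<zeta> / (\<zeta> - 0)) = N.\<tau> (\<lambda>_. 1)"
      by (intro N.tau_cong bc b1) auto
    ultimately show "G 0 = 1" by (simp add: G_def)
    \<comment> \<open>The constant disc \<psi> = v with s = 1 yields the normalization of m.\<close>
    have "S (\<lambda>\<zeta>. (\<zeta> *s (1 *s v), 1)) = 0" by (intro S_L zL[of "\<lambda>_. 1" 2]) auto
    then have "\<Lambda> v (\<lambda>\<zeta>. \<zeta>) = 1"
      using S_add_pair[OF bid circ_bddI[of "\<lambda>_. 1" 1], of v] S(4) by (simp add: e_def)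
    then show "Re (bilin v m) = 1" using T.Re_tau[of v "\<lambda>\<zeta>. \<zeta>"] T_bilin[OF bid, of v] by (simp add: m_def)
    fix w \<eta> assume w: "z + w \<in> D" and \<eta>: "cmod \<eta> < 1"
    define c where "c = cnj \<eta> / (1 - cnj \<eta> * \<alpha>)"
    define q where "q = (\<lambda>\<zeta>. cnj \<eta> / (1 - cnj \<eta> * \<zeta>))"
    \<comment> \<open>Any radius between 1 and 1 / |\<eta>| would do: q has its pole at modulus 1 /
      |\<eta>|.\<close>
    define R where "R = 2 / (1 + cmod \<eta>)"
    have R: "R > 1" using \<eta> by (simp add: R_def field_simps add_pos_nonneg)
    have q: "q holomorphic_on ball 0 R"
    proof -
      have "1 - cnj \<eta> * \<zeta> \<noteq> 0" if "cmod \<zeta> < R" for \<zeta>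
      proof
        assume "1 - cnj \<eta> * \<zeta> = 0"
        then have "1 = cmod \<eta> * cmod \<zeta>" by (metis complex_mod_cnj eq_iff_diff_eq_0 norm_mult norm_one)
        also have "\<dots> \<le> cmod \<eta> * R" using that by (intro mult_left_mono) auto
        also have "\<dots> < 1" using \<eta> by (simp add: R_def field_simps add_pos_nonneg)
        finally show False by simp
      qed
      then show ?thesis unfolding q_def by (intro holomorphic_intros) auto
    qed
    have bq: "circ_bdd (\<lambda>\<zeta>. \<zeta> * q \<zeta>)"
      using R by (intro circ_bdd_continuous continuous_intros holomorphic_on_imp_continuous_on holomorphic_on_subset[OF q]) auto
    have "T.\<tau> w (\<lambda>\<zeta>. \<zeta> * (q \<zeta> - c)) = 0"
      using R by (intro kill[of _ R] holomorphic_intros q) (simp_all add: q_def c_def)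
    moreover have "T.\<tau> w (\<lambda>\<zeta>. \<zeta> * q \<zeta> + (- c) * \<zeta>) = T.\<tau> w (\<lambda>\<zeta>. \<zeta> * q \<zeta>) + (- c) * T.\<tau> w (\<lambda>\<zeta>. \<zeta>)"
      by (simp only: T.tau_add[OF bq circ_bdd_mult[OF bid]] T.tau_scale[OF bid])
    ultimately have cq: "T.\<tau> w (\<lambda>\<zeta>. \<zeta>) * c = T.\<tau> w (\<lambda>\<zeta>. \<zeta> * q \<zeta>)"
      by (simp add: algebra_simps)
    have pi: "complex_of_real (P \<eta> \<zeta>) = \<zeta> / (\<zeta> - \<eta>) + \<zeta> * q \<zeta>" "P \<eta> \<zeta> > 0"
      "P \<eta> \<zeta> = (1 - (cmod \<eta>)\<^sup>2) / (cmod (\<zeta> - \<eta>))\<^sup>2" if "cmod \<zeta> = 1" for \<zeta>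
      using poisson_identity[OF that \<eta>] by (auto simp: P_def q_def)
    have bP: "circ_bdd (\<lambda>\<zeta>. P \<eta> \<zeta>)" "circ_bdd (\<lambda>\<zeta>. complex_of_real (P \<eta> \<zeta>))"
      unfolding P_def using \<eta> by (intro circ_bdd_continuous continuous_intros; auto)+
    have "bilin w (A \<eta>) + bilin w m * c = T.\<tau> w (\<lambda>\<zeta>. \<zeta> / (\<zeta> - \<eta>)) + T.\<tau> w (\<lambda>\<zeta>. \<zeta> * q \<zeta>)"
      unfolding cq[symmetric] by (simp add: A_def m_def T_bilin[OF bc[OF \<eta>], of w] T_bilin[OF bid, of w])
    also have "\<dots> = T.\<tau> w (\<lambda>\<zeta>. \<zeta> / (\<zeta> - \<eta>) + \<zeta> * q \<zeta>)" by (rule T.tau_add[OF bc[OF \<eta>] bq, symmetric])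
    also have "\<dots> = T.\<tau> w (\<lambda>\<zeta>. of_real (P \<eta> \<zeta>))"
      by (intro T.tau_cong circ_bdd_add bc \<eta> bq bP) (simp only: pi(1))
    finally have lhs: "Re (bilin w (A \<eta>) + bilin w m * c) = \<Lambda> w (\<lambda>\<zeta>. of_real (P \<eta> \<zeta>))"
      using T.Re_tau by simp
    have "G \<eta> = N.\<tau> (\<lambda>\<zeta>. 2 * (\<zeta> / (\<zeta> - \<eta>)) + (-1) * 1)"
      by (simp only: N.tau_add[OF circ_bdd_mult[OF bc[OF \<eta>]] circ_bdd_mult[OF b1]] N.tau_scale[OF bc[OF \<eta>]] N.tau_scale[OF b1] G_def)
        simp
    then have rhs: "Re (G \<eta>) = S (\<lambda>\<zeta>. (0, P \<eta> \<zeta>))" using N.Re_tau by (simp add: N_def P_def)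
    \<comment> \<open>A lower bound of the Poisson kernel on the circle; it makes the right-hand
      side strictly positive.\<close>
    define c0 where "c0 = (1 - (cmod \<eta>)\<^sup>2) / 4"
    have c0: "c0 > 0" using \<eta> by (simp add: c0_def abs_square_less_1)
    have Pc: "c0 \<le> P \<eta> \<zeta>" if "cmod \<zeta> = 1" for \<zeta>
    proof -
      have "cmod (\<zeta> - \<eta>) \<le> 2" using that \<eta> norm_triangle_ineq4[of \<zeta> \<eta>] by simp
      then have "(cmod (\<zeta> - \<eta>))\<^sup>2 \<le> 2\<^sup>2" by (intro power_mono) auto
      moreover have "\<zeta> \<noteq> \<eta>" using that \<eta> by auto
      ultimately show ?thesis unfolding pi(3)[OF that] c0_def using c0 by (intro divide_left_mono) (auto simp: c0_def)
    qed
    have "(\<lambda>\<zeta>. (0, P \<eta> \<zeta> - c0)) \<in> K"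
      unfolding K_def using D(3) Pc VN[OF circ_bdd_add[OF bP(1) circ_bddI[of "\<lambda>_. - c0" "\<bar>c0\<bar>"]]]
      by (auto intro!: exI[of _ 0])
    then have "0 \<le> S (\<lambda>\<zeta>. (0, P \<eta> \<zeta> - c0))" by (rule S(3)[OF subsetD[OF KC]])
    also have "\<dots> = S (\<lambda>\<zeta>. (0, P \<eta> \<zeta>) + (- c0) *\<^sub>R e \<zeta>)" by (simp add: e_def)
    also have "\<dots> = S (\<lambda>\<zeta>. (0, P \<eta> \<zeta>)) - c0"
      unfolding S(1)[OF VN[OF bP(1)] V(3)[OF eV]] S(2)[OF eV] S(4) by simp
    finally have Np: "S (\<lambda>\<zeta>. (0, P \<eta> \<zeta>)) > 0" using c0 by simp
    \<comment> \<open>Openness of D gains the factor 1 + \<epsilon>, which together with positivity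
      of the right-hand side makes the final inequality strict.\<close>
    obtain \<epsilon> where \<epsilon>: "\<epsilon> > 0" "z + (1 + \<epsilon>) *\<^sub>R w \<in> D"
    proof -
      obtain r where r: "r > 0" "ball (z + w) r \<subseteq> D" using w D openE by blast
      define \<epsilon> where "\<epsilon> = r / (2 * (norm w + 1))"
      have "\<epsilon> > 0" using r by (simp add: \<epsilon>_def add_nonneg_pos)
      moreover have "\<epsilon> * (norm w + 1) = r / 2"
        using add_nonneg_pos[OF norm_ge_zero[of w] zero_less_one] by (simp add: \<epsilon>_def field_simps)
      then have "\<epsilon> * norm w < r" using r \<open>\<epsilon> > 0\<close> by (simp add: distrib_left)
      then have "z + (1 + \<epsilon>) *\<^sub>R w \<in> ball (z + w) r" using \<open>\<epsilon> > 0\<close> by (simp add: dist_norm scaleR_add_left)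
      ultimately show ?thesis using that r by blast
    qed
    have "(\<lambda>\<zeta>. (complex_of_real (P \<eta> \<zeta>) *s ((1 + \<epsilon>) *\<^sub>R w), P \<eta> \<zeta>)) \<in> K"
      unfolding K_def using \<epsilon> Vp[OF bP(2,1)] pi(2)
      by (auto intro!: exI[of _ "(1 + \<epsilon>) *\<^sub>R w"] less_imp_le simp: vec_eq_iff scaleR_conv_of_real[where 'a = complex])
    then have "0 \<le> - \<Lambda> ((1 + \<epsilon>) *\<^sub>R w) (\<lambda>\<zeta>. of_real (P \<eta> \<zeta>)) + S (\<lambda>\<zeta>. (0, P \<eta> \<zeta>))"
      unfolding S_add_pair[OF bP(2,1), symmetric] by (rule S(3)[OF subsetD[OF KC]])
    moreover have "\<Lambda> ((1 + \<epsilon>) *\<^sub>R w) (\<lambda>\<zeta>. of_real (P \<eta> \<zeta>)) = (1 + \<epsilon>) * \<Lambda> w (\<lambda>\<zeta>. of_real (P \<eta> \<zeta>))"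
    proof -
      have "(\<lambda>\<zeta>. (complex_of_real (P \<eta> \<zeta>) *s ((1 + \<epsilon>) *\<^sub>R w), 0 :: real)) = (\<lambda>\<zeta>. (1 + \<epsilon>) *\<^sub>R (complex_of_real (P \<eta> \<zeta>) *s w, 0))"
        by (auto simp: vec_eq_iff)
      then show ?thesis using S(2)[OF Vp[OF bP(2) b0, of w]] by (simp add: \<Lambda>_def)
    qed
    ultimately have "(1 + \<epsilon>) * \<Lambda> w (\<lambda>\<zeta>. of_real (P \<eta> \<zeta>)) \<le> S (\<lambda>\<zeta>. (0, P \<eta> \<zeta>))" by simp
    moreover have "a < b" if "(1 + \<epsilon>) * a \<le> b" "b > 0" for a b :: real
    proof (cases "a > 0")
      case True
      then have "\<epsilon> * a > 0" using \<epsilon>(1) by simp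
      then show ?thesis using that by (simp add: distrib_right)
    qed (use that in auto)
    ultimately have "\<Lambda> w (\<lambda>\<zeta>. of_real (P \<eta> \<zeta>)) < S (\<lambda>\<zeta>. (0, P \<eta> \<zeta>))" using Np by blast
    then show "Re (bilin w (A \<eta>) + bilin w m * (cnj \<eta> / (1 - cnj \<eta> * \<alpha>))) < Re (G \<eta>)"
      using lhs rhs by (simp add: c_def)
  qed
qed

section \<open>Lempert's theorem and complex geodesics\<close>

text \<open>Multiplying the inequality of \<open>dual_functions\<close> by
  \<open>(\<eta> - r\<^sup>2 * \<alpha>) * (1 - \<alpha> * \<eta>) / \<eta>\<close>, which is positive on \<open>cmod \<eta> = r\<close>, turns \<open>cnj \<eta>\<close> into
  \<open>r\<^sup>2 / \<eta>\<close> there. So \<open>f\<close> can be defined through the unique root of a holomorphic function depending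
  affinely on the point of \<open>D\<close>; the constant \<open>\<beta>\<close> places the root at \<open>r\<^sup>2 * \<alpha>\<close> for \<open>\<alpha> v\<close>.\<close>

lemma Lempert_alternative:
  fixes D :: "(complex ^ 'n) set" and \<alpha> r :: real
  assumes D: "open D" "convex D" "z \<in> D" and \<alpha>: "0 \<le> \<alpha>" "\<alpha> < 1" and r: "0 < r" "r < 1"
    and none: "\<not> (\<exists>\<psi>. hol_nbhd \<psi> \<and> \<psi> \<alpha> = v \<and> (\<forall>\<zeta>. cmod \<zeta> = 1 \<longrightarrow> z + \<zeta> *s \<psi> \<zeta> \<in> D))"
    and zv: "z + \<alpha> *\<^sub>R v \<in> D"
  obtains f where "f \<in> maps_to_disc D" "f z = 0" "f (z + \<alpha> *\<^sub>R v) = of_real (r * \<alpha>)"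
    "\<alpha> = 0 \<Longrightarrow> frechet_derivative f (at z) v = of_real r"
proof -
  obtain A :: "complex \<Rightarrow> complex ^ 'n" and m G where A: "\<And>i. (\<lambda>\<eta>. A \<eta> $ i) holomorphic_on ball 0 1" and G: "G holomorphic_on ball 0 1"
    and G0: "G 0 = 1" and m: "Re (bilin v m) = 1"
    and ineq: "\<And>w \<eta>. z + w \<in> D \<Longrightarrow> cmod \<eta> < 1 \<Longrightarrow>
       Re (bilin w (A \<eta>) + bilin w m * (cnj \<eta> / (1 - cnj \<eta> * \<alpha>))) < Re (G \<eta>)"
    by (rule dual_functions[OF D \<alpha> none], rule that)
  define W where "W = {w. z + w \<in> D}"
  have W: "open W"
  proof -
    have "W = (\<lambda>w. z + w) -` D" by (auto simp: W_def)
    then show ?thesis using D(1) by (auto intro!: open_vimage continuous_intros)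
  qed
  define K where "K = (\<lambda>\<eta>::complex. ((\<eta> - of_real (r\<^sup>2 * \<alpha>)) * (1 - \<alpha> * \<eta>)) *s A \<eta> + (of_real (r\<^sup>2) * (1 - \<alpha> * \<eta>)) *s m)"
  obtain t where t: "bilin v m = 1 + \<i> * complex_of_real t"
    using m by (intro that[of "Im (bilin v m)"]) (auto simp: complex_eq_iff)
  define \<beta> where "\<beta> = (1 - \<alpha>\<^sup>2 * r\<^sup>2) * t"
  define J where "J = (\<lambda>\<eta>::complex. G \<eta> * (\<eta> - of_real (r\<^sup>2 * \<alpha>)) * (1 - \<alpha> * \<eta>) + of_real (\<alpha> * r\<^sup>2) - \<alpha> * \<eta>\<^sup>2 + \<i> * \<beta> * \<eta>)"
  have bK: "bilin w (K \<eta>) = (\<eta> - of_real (r\<^sup>2 * \<alpha>)) * (1 - \<alpha> * \<eta>) * bilin w (A \<eta>) + of_real (r\<^sup>2) * (1 - \<alpha> * \<eta>) * bilin w m" for w and \<eta> :: complex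
    by (simp add: K_def bilin_add_right)
  have hK: "(\<lambda>\<eta>. K \<eta> $ i) holomorphic_on ball 0 1" for i
    unfolding K_def vector_add_component vector_smult_component by (intro holomorphic_intros A)
  have hJ: "J holomorphic_on ball 0 1" unfolding J_def by (intro holomorphic_intros G)
  have neg: "Re ((bilin w (K \<eta>) - J \<eta>) / \<eta>) < 0" if w: "w \<in> W" and \<eta>: "cmod \<eta> = r" for w and \<eta> :: complex
  proof -
    have e0: "\<eta> \<noteq> 0" using \<eta> r by auto
    have r2: "complex_of_real (r\<^sup>2) = \<eta> * cnj \<eta>" using \<eta> complex_norm_square[of \<eta>] by simp
    define q where "q = (1 - cnj \<eta> * \<alpha>) * (1 - \<alpha> * \<eta>)"
    have "cmod (cnj \<eta> * \<alpha>) < 1" using \<eta> r \<alpha> mult_right_mono[of r 1 \<alpha>] by (simp add: norm_mult)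
    then have c0: "1 - cnj \<eta> * \<alpha> \<noteq> 0" by (metis eq_iff_diff_eq_0 norm_one order_less_irrefl)
    have "q = (1 - cnj \<eta> * \<alpha>) * cnj (1 - cnj \<eta> * \<alpha>)" by (simp add: q_def mult.commute)
    then have q: "q = of_real ((cmod (1 - cnj \<eta> * \<alpha>))\<^sup>2)" by (simp only: complex_norm_square)
    have qpos: "(cmod (1 - cnj \<eta> * \<alpha>))\<^sup>2 > 0" using c0 by simp
    define c where "c = cnj \<eta> / (1 - cnj \<eta> * \<alpha>)"
    \<comment> \<open>Here q = |1 - \<alpha> \<eta>|^2 > 0. The two identities exhibit the
      coefficients of \<open>K\<close>, divided by \<eta>, as q times those of the dual
      inequality.\<close>
    have e1: "(\<eta> - of_real (r\<^sup>2 * \<alpha>)) * (1 - \<alpha> * \<eta>) = \<eta> * q" 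
      unfolding of_real_mult r2 q_def by (simp add: algebra_simps)
    have e2: "of_real (r\<^sup>2) * (1 - \<alpha> * \<eta>) = \<eta> * q * c"
      unfolding r2 q_def c_def using c0 by (simp add: field_simps)
    have "bilin w (K \<eta>) = \<eta> * q * bilin w (A \<eta>) + \<eta> * q * c * bilin w m"
      unfolding bK e1 e2 by simp
    moreover have "J \<eta> = G \<eta> * (\<eta> * q) + (of_real (\<alpha> * r\<^sup>2) - \<alpha> * \<eta>\<^sup>2 + \<i> * \<beta> * \<eta>)"
      unfolding e1[symmetric] by (simp add: J_def mult.assoc)
    ultimately have "bilin w (K \<eta>) - J \<eta> = \<eta> * (q * (bilin w (A \<eta>) + bilin w m * c - G \<eta>)) -
        (of_real (\<alpha> * r\<^sup>2) - \<alpha> * \<eta>\<^sup>2 + \<i> * \<beta> * \<eta>)"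
      by (simp only: ring_distribs mult_ac) (simp add: algebra_simps)
    also have "of_real (\<alpha> * r\<^sup>2) - \<alpha> * \<eta>\<^sup>2 + \<i> * \<beta> * \<eta> = \<eta> * (\<alpha> * (cnj \<eta> - \<eta>) + \<i> * \<beta>)"
      unfolding of_real_mult r2 by (simp add: algebra_simps power2_eq_square)
    finally have "(bilin w (K \<eta>) - J \<eta>) / \<eta> =
       q * (bilin w (A \<eta>) + bilin w m * c - G \<eta>) - (\<alpha> * (cnj \<eta> - \<eta>) + \<i> * \<beta>)"
      using e0 by (simp add: right_diff_distrib[symmetric])
    \<comment> \<open>The correction terms of \<open>J\<close> are imaginary after division by
      \<eta>, so they prescribe roots without affecting the sign.\<close>
    moreover have "Re (\<alpha> * (cnj \<eta> - \<eta>) + \<i> * \<beta>) = 0" by simp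
    moreover have "Re (bilin w (A \<eta>) + bilin w m * c - G \<eta>) < 0"
      using ineq[of w \<eta>] w \<eta> r by (simp add: W_def c_def)
    then have "Re (q * (bilin w (A \<eta>) + bilin w m * c - G \<eta>)) < 0"
      unfolding q using qpos by (simp only: times_complex.sel Re_complex_of_real Im_complex_of_real mult_zero_left diff_zero) (rule mult_pos_neg)
    ultimately show ?thesis by simp
  qed
  obtain f E where f: "\<And>w. w \<in> W \<Longrightarrow> cmod (f w) < r"
    "\<And>w \<eta>. w \<in> W \<Longrightarrow> cmod \<eta> \<le> r \<Longrightarrow> bilin w (K \<eta>) = J \<eta> \<Longrightarrow> f w = \<eta>"
    "\<And>w. w \<in> W \<Longrightarrow> (f has_derivative (\<lambda>x. - bilin x (K (f w)) / E w)) (at w)"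
    "\<And>w. w \<in> W \<Longrightarrow> ((\<lambda>\<eta>. bilin w (K \<eta>) - J \<eta>) has_field_derivative E w) (at (f w))"
  proof (rule root_family[OF hK hJ r W neg])
    fix f E
    assume "\<And>w. w \<in> W \<Longrightarrow> cmod (f w) < r"
      "\<And>w \<eta>. w \<in> W \<Longrightarrow> cmod \<eta> \<le> r \<Longrightarrow> bilin w (K \<eta>) = J \<eta> \<Longrightarrow> f w = \<eta>"
      "\<And>w. w \<in> W \<Longrightarrow> (f has_derivative (\<lambda>x. - bilin x (K (f w)) / E w)) (at w)"
      "\<And>w. w \<in> W \<Longrightarrow> ((\<lambda>\<eta>. bilin w (K \<eta>) - J \<eta>) has_field_derivative E w) (at (f w))"
    then show thesis by (rule that)
  qed
  have W0: "0 \<in> W" using D(3) by (simp add: W_def)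
  have f0: "f 0 = 0" using r by (intro f(2)[OF W0]) (auto simp: J_def G0)
  have "f (\<alpha> *\<^sub>R v) = of_real (r\<^sup>2 * \<alpha>)"
  proof (rule f(2))
    show "\<alpha> *\<^sub>R v \<in> W" using zv by (simp add: W_def)
    have "r * (r * \<alpha>) \<le> r * 1" using r \<alpha> by (intro mult_left_mono mult_le_one) auto
    then show "cmod (of_real (r\<^sup>2 * \<alpha>)) \<le> r" using \<alpha> by (simp add: norm_mult power2_eq_square norm_power)
    have "bilin (\<alpha> *\<^sub>R v) (K (of_real (r\<^sup>2 * \<alpha>))) = of_real (\<alpha> * r\<^sup>2 * (1 - \<alpha> * (r\<^sup>2 * \<alpha>))) * (1 + \<i> * complex_of_real t)"
      unfolding bK bilin_scaleR t by (simp add: algebra_simps)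
    also have "\<dots> = J (of_real (r\<^sup>2 * \<alpha>))"
      by (simp add: J_def \<beta>_def algebra_simps power2_eq_square)
    finally show "bilin (\<alpha> *\<^sub>R v) (K (of_real (r\<^sup>2 * \<alpha>))) = J (of_real (r\<^sup>2 * \<alpha>))" .
  qed
  \<comment> \<open>The roots lie in the disc of radius r, so rescaling stays within the unit disc
    and turns the value r^2 \<alpha> into r \<alpha>.\<close>
  define F where "F = (\<lambda>y. f (y - z) / of_real r)"
  have dF: "(F has_derivative (\<lambda>x. - bilin x (K (f (y - z))) / E (y - z) / of_real r)) (at y)" if y: "y \<in> D" for y
  proof -
    have "(f has_derivative (\<lambda>x. - bilin x (K (f (y - z))) / E (y - z))) (at (y - z))"
      using y by (intro f(3)) (simp add: W_def)
    moreover have "((\<lambda>y. y - z) has_derivative (\<lambda>x. x)) (at y)" by (auto intro!: derivative_eq_intros)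
    ultimately have "((f \<circ> (\<lambda>y. y - z)) has_derivative ((\<lambda>x. - bilin x (K (f (y - z))) / E (y - z)) \<circ> (\<lambda>x. x))) (at y)"
      by (intro diff_chain_at)
    then have "((\<lambda>y. f (y - z)) has_derivative (\<lambda>x. - bilin x (K (f (y - z))) / E (y - z))) (at y)" by (simp add: o_def)
    then show ?thesis unfolding F_def by (rule bounded_linear.has_derivative[OF bounded_linear_divide])
  qed
  show ?thesis
  proof (rule that[of F])
    have "cmod (F y) < 1" if "y \<in> D" for y
      using f(1)[of "y - z"] that r by (simp add: F_def W_def norm_divide)
    then show "F \<in> maps_to_disc D" using dF unfolding maps_to_disc_def by (fastforce simp: field_simps)
    show "F z = 0" by (simp add: F_def f0)
    show "F (z + \<alpha> *\<^sub>R v) = of_real (r * \<alpha>)"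
      using \<open>f (\<alpha> *\<^sub>R v) = of_real (r\<^sup>2 * \<alpha>)\<close> r by (simp add: F_def power2_eq_square)
    \<comment> \<open>Here both points coincide and the information sits in the derivative: G 0 = 1
      and the choice of \<open>\<beta>\<close> give E 0 = - bilin v m, which cancels against K 0 up
      to r^2.\<close>
    assume a0: "\<alpha> = 0"
    have mv: "bilin v m \<noteq> 0" using m by auto
    have "(J has_field_derivative (G 0 + \<i> * \<beta>)) (at 0)"
    proof -
      have "(G has_field_derivative deriv G 0) (at 0)" by (intro holomorphic_derivI[OF G]) auto
      then show ?thesis unfolding J_def a0 by (auto intro!: derivative_eq_intros)
    qed
    then have "((\<lambda>\<eta>. bilin 0 (K \<eta>) - J \<eta>) has_field_derivative - bilin v m) (at 0)"
      using G0 by (auto intro!: derivative_eq_intros simp: \<beta>_def a0 t)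
    then have E0: "E 0 = - bilin v m" using f(4)[OF W0] f0 DERIV_unique by metis
    have "frechet_derivative F (at z) = (\<lambda>x. - bilin x (K 0) / E 0 / of_real r)"
      using dF[OF D(3)] f0 by (simp add: frechet_derivative_at[symmetric])
    then show "frechet_derivative F (at z) v = of_real r"
      using mv r by (simp add: E0 bK a0 power2_eq_square)
  qed
qed

section \<open>Existence of discs in convex domains\<close>

lemma convex_supporting:
  fixes D :: "(complex ^ 'n) set"
  assumes D: "open D" "convex D" "D \<noteq> {}" and p: "p \<notin> D"
  obtains a where "a \<noteq> 0" "\<And>x. x \<in> D \<Longrightarrow> Re (cpair (x - p) a) < 0"
proof -
  have "\<exists>a b. a \<noteq> 0 \<and> (\<forall>x\<in>D. a \<bullet> x \<le> b) \<and> (\<forall>x\<in>{p}. a \<bullet> x \<ge> b)"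
    using D p by (intro separating_hyperplane_sets) auto
  then obtain a b where ab: "a \<noteq> 0" "\<And>x. x \<in> D \<Longrightarrow> a \<bullet> x \<le> b" "a \<bullet> p \<ge> b" by auto
  \<comment> \<open>Strict because x can still be moved a little in the direction a inside the open
    set D.\<close>
  have "Re (cpair (x - p) a) < 0" if x: "x \<in> D" for x
  proof -
    obtain r where r: "r > 0" "ball x r \<subseteq> D" using x D openE by blast
    define y where "y = x + (r / (2 * norm a)) *\<^sub>R a"
    have "norm ((r / (2 * norm a)) *\<^sub>R a) < r" using r ab(1) by simp
    then have "y \<in> D" using r by (auto simp: y_def dist_norm)
    then have "a \<bullet> y \<le> b" by (rule ab(2))
    moreover have "a \<bullet> y > a \<bullet> x" using r ab(1) by (simp add: y_def inner_add_right)
    ultimately show ?thesis using ab(3) by (simp add: Re_cpair inner_diff_right inner_commute[of _ a] del: cpair_diff)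
  qed
  then show ?thesis using that ab(1) by blast
qed

lemma cpair_vec_holomorphic:
  "(\<And>i. (\<lambda>\<zeta>. \<phi> \<zeta> $ i) holomorphic_on S) \<Longrightarrow> (\<lambda>\<zeta>. cpair (\<phi> \<zeta> - c) a) holomorphic_on S"
  unfolding cpair_def vector_minus_component by (intro holomorphic_intros)

text \<open>A value outside D would be cut off by a supporting functional whose real part is
  negative on the boundary circle, hence at that point too, where it is 0.\<close>

lemma disc_in_convex:
  fixes D :: "(complex ^ 'n) set"
  assumes D: "open D" "convex D" and hol: "\<And>i. (\<lambda>\<zeta>. \<phi> \<zeta> $ i) holomorphic_on ball 0 1"
    and cont: "continuous_on (cball 0 1) \<phi>" and bd: "\<And>\<zeta>. cmod \<zeta> = 1 \<Longrightarrow> \<phi> \<zeta> \<in> D"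
  shows "\<phi> \<in> disc_maps D"
proof -
  have "\<phi> \<zeta> \<in> D" if \<zeta>: "cmod \<zeta> < 1" for \<zeta>
  proof (rule ccontr)
    assume "\<phi> \<zeta> \<notin> D"
    moreover have "D \<noteq> {}" using bd[of 1] by auto
    ultimately obtain a where a: "\<And>x. x \<in> D \<Longrightarrow> Re (cpair (x - \<phi> \<zeta>) a) < 0"
      using convex_supporting[OF D] by metis
    have c: "continuous_on (cball 0 1) (\<lambda>\<xi>. cpair (\<phi> \<xi> - \<phi> \<zeta>) a)"
      using bounded_linear.continuous_on[OF bounded_linear_cpair continuous_on_diff[OF cont continuous_on_const]] .
    have "Re (cpair (\<phi> \<zeta> - \<phi> \<zeta>) a) < 0"
      by (rule Re_neg_maximum_principle[OF cpair_vec_holomorphic[OF hol] c])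
        (use \<zeta> a bd in auto)
    then show False by (simp add: cpair_def)
  qed
  then show ?thesis using hol by (auto simp: disc_maps_def)
qed

lemma hol_nbhd_disc:
  fixes D :: "(complex ^ 'n) set"
  assumes D: "open D" "convex D" and \<psi>: "hol_nbhd \<psi>" "\<And>\<zeta>. cmod \<zeta> = 1 \<Longrightarrow> z + \<zeta> *s \<psi> \<zeta> \<in> D"
  shows "(\<lambda>\<zeta>. z + \<zeta> *s \<psi> \<zeta>) \<in> disc_maps D" "disc_deriv (\<lambda>\<zeta>. z + \<zeta> *s \<psi> \<zeta>) 0 = \<psi> 0"
proof -
  obtain R where R: "R > 1" "\<And>i. (\<lambda>\<zeta>. \<psi> \<zeta> $ i) holomorphic_on ball 0 R"
    using \<psi>(1) unfolding hol_nbhd_def by blast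
  have h: "(\<lambda>\<zeta>. \<psi> \<zeta> $ i) holomorphic_on ball 0 1" for i
    using R by (intro holomorphic_on_subset[OF R(2)]) auto
  show "(\<lambda>\<zeta>. z + \<zeta> *s \<psi> \<zeta>) \<in> disc_maps D"
  proof (rule disc_in_convex[OF D])
    show "(\<lambda>\<zeta>. (z + \<zeta> *s \<psi> \<zeta>) $ i) holomorphic_on ball 0 1" for i
      unfolding vector_add_component vector_smult_component by (intro holomorphic_intros h)
    show "continuous_on (cball 0 1) (\<lambda>\<zeta>. z + \<zeta> *s \<psi> \<zeta>)"
      unfolding vector_scalar_mult_def using hol_nbhd_continuous[OF \<psi>(1)] by (intro continuous_intros)
  qed (rule \<psi>(2))
  have "((\<lambda>\<zeta>. (z + \<zeta> *s \<psi> \<zeta>) $ i) has_field_derivative \<psi> 0 $ i) (at 0)" for i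
  proof -
    have "((\<lambda>\<zeta>. \<psi> \<zeta> $ i) has_field_derivative deriv (\<lambda>\<zeta>. \<psi> \<zeta> $ i) 0) (at 0)"
      by (intro holomorphic_derivI[OF h]) auto
    then show ?thesis by (auto intro!: derivative_eq_intros)
  qed
  then show "disc_deriv (\<lambda>\<zeta>. z + \<zeta> *s \<psi> \<zeta>) 0 = \<psi> 0"
    by (simp add: disc_deriv_def vec_eq_iff DERIV_imp_deriv)
qed

text \<open>Without the disc, \<open>Lempert_alternative\<close> supplies for every r < 1 a function
  reaching r \<alpha> at w; letting r tend to 1 gives artanh \<alpha> \<le> c_D, contrary to
  hypothesis.\<close>

lemma Lempert_two_points:
  fixes D :: "(complex ^ 'n) set" and \<alpha> :: real
  assumes D: "open D" "convex D" and zw: "z \<in> D" "w \<in> D" and \<alpha>: "0 < \<alpha>" "\<alpha> < 1"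
    and c: "caratheodory_dist D z w < artanh \<alpha>"
  obtains \<phi> where "\<phi> \<in> disc_maps D" "\<phi> 0 = z" "\<phi> (of_real \<alpha>) = w"
proof -
  have conn: "connected D" using D by (simp add: convex_connected)
  define v where "v = (1 / \<alpha>) *\<^sub>R (w - z)"
  have v: "z + \<alpha> *\<^sub>R v = w" using \<alpha> by (simp add: v_def)
  have "\<exists>\<psi>. hol_nbhd \<psi> \<and> \<psi> \<alpha> = v \<and> (\<forall>\<zeta>. cmod \<zeta> = 1 \<longrightarrow> z + \<zeta> *s \<psi> \<zeta> \<in> D)"
  proof (rule ccontr)
    assume none: "\<not> ?thesis"
    have "artanh (r * \<alpha>) \<le> caratheodory_dist D z w" if r: "0 < r" "r < 1" for r
    proof -
      obtain f where f: "f \<in> maps_to_disc D" "f z = 0" "f (z + \<alpha> *\<^sub>R v) = of_real (r * \<alpha>)"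
        using Lempert_alternative[OF D zw(1) less_imp_le[OF \<alpha>(1)] \<alpha>(2) r none] zw v by metis
      have "rho (f z) (f w) \<le> caratheodory_dist D z w" by (rule rho_le_caratheodory[OF D(1) conn f(1) zw])
      then show ?thesis using f v \<alpha> r by (simp add: norm_mult)
    qed
    then have ev: "eventually (\<lambda>r. artanh (r * \<alpha>) \<le> caratheodory_dist D z w) (at_left 1)"
      by (intro eventually_at_leftI[of 0]) auto
    have "((\<lambda>r. artanh (r * \<alpha>)) \<longlongrightarrow> artanh (1 * \<alpha>)) (at_left 1)"
      using \<alpha> by (intro tendsto_intros) auto
    from tendsto_upperbound[OF this ev] show False using c by simp
  qed
  then obtain \<psi> where \<psi>: "hol_nbhd \<psi>" "\<psi> \<alpha> = v" "\<And>\<zeta>. cmod \<zeta> = 1 \<Longrightarrow> z + \<zeta> *s \<psi> \<zeta> \<in> D" by blast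
  have "of_real \<alpha> *s v = \<alpha> *\<^sub>R v" by (simp add: vec_eq_iff scaleR_conv_of_real[where 'a = complex])
  then show ?thesis using that[OF hol_nbhd_disc(1)[OF D \<psi>(1,3)]] \<psi>(2) v by simp
qed

text \<open>The same argument with \<alpha> = 0: the prescribed value v then becomes the derivative
  of the disc at its centre.\<close>

lemma Lempert_direction:
  fixes D :: "(complex ^ 'n) set" and t :: real
  assumes D: "open D" "convex D" and z: "z \<in> D" and t: "t > 0" "caratheodory_metric D z X < t"
  obtains \<phi> where "\<phi> \<in> disc_maps D" "\<phi> 0 = z" "disc_deriv \<phi> 0 = (1 / t) *\<^sub>R X"
proof -
  define v where "v = (1 / t) *\<^sub>R X"
  obtain \<rho> where \<rho>: "ball z \<rho> \<subseteq> D" "\<rho> > 0" using D z openE by blast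
  have "\<exists>\<psi>. hol_nbhd \<psi> \<and> \<psi> (of_real 0) = v \<and> (\<forall>\<zeta>. cmod \<zeta> = 1 \<longrightarrow> z + \<zeta> *s \<psi> \<zeta> \<in> D)"
  proof (rule ccontr)
    assume none: "\<not> ?thesis"
    have "r * t \<le> caratheodory_metric D z X" if r: "0 < r" "r < 1" for r
    proof -
      obtain f where f: "f \<in> maps_to_disc D" "frechet_derivative f (at z) v = of_real r"
        using Lempert_alternative[OF D z _ _ r none] z by auto
      obtain f' where f': "(f has_derivative f') (at z)" using f(1) z unfolding maps_to_disc_def by blast
      have "t *\<^sub>R v = X" using t by (simp add: v_def)
      then have "frechet_derivative f (at z) X = of_real (r * t)"
        using f(2) linear_scale[OF has_derivative_linear[OF f'], of t v] 
        by (simp add: frechet_derivative_at[OF f', symmetric] scaleR_conv_of_real[where 'a = complex])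
      then show ?thesis using caratheodory_metric_ge[OF \<rho> f(1), of X] t r by (simp add: norm_mult)
    qed
    then have ev: "eventually (\<lambda>r. r * t \<le> caratheodory_metric D z X) (at_left 1)"
      by (intro eventually_at_leftI[of 0]) auto
    have "((\<lambda>r. r * t) \<longlongrightarrow> 1 * t) (at_left 1)" by (intro tendsto_intros)
    from tendsto_upperbound[OF this ev] show False using t by simp
  qed
  then obtain \<psi> where \<psi>: "hol_nbhd \<psi>" "\<psi> 0 = v" "\<And>\<zeta>. cmod \<zeta> = 1 \<Longrightarrow> z + \<zeta> *s \<psi> \<zeta> \<in> D" by auto
  show ?thesis using that[OF hol_nbhd_disc(1)[OF D \<psi>(1,3)]] hol_nbhd_disc(2)[OF D \<psi>(1,3)] \<psi>(2) v_def by simp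
qed

section \<open>Normal families and extremal discs\<close>

lemma uniform_limit_subseq:
  assumes "uniform_limit K f g sequentially" "strict_mono r"
  shows "uniform_limit K (\<lambda>n. f (r n)) g sequentially"
  using filterlim_compose[OF assms(1) filterlim_subseq[OF assms(2)]] by simp

lemma Montel_finite:
  fixes F :: "nat \<Rightarrow> complex \<Rightarrow> complex ^ 'n"
  assumes I: "finite (I :: 'n set)" and hol: "\<And>n i. (\<lambda>\<zeta>. F n \<zeta> $ i) holomorphic_on ball 0 1"
    and bd: "\<And>n \<zeta>. cmod \<zeta> < 1 \<Longrightarrow> norm (F n \<zeta>) \<le> B"
  shows "\<exists>r g. strict_mono (r :: nat \<Rightarrow> nat) \<and> (\<forall>i\<in>I. g i holomorphic_on ball 0 1 \<and>
    (\<forall>K. compact K \<longrightarrow> K \<subseteq> ball 0 1 \<longrightarrow> uniform_limit K (\<lambda>n \<zeta>. F (r n) \<zeta> $ i) (g i) sequentially))"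
  using I
proof (induction I)
  case empty
  then show ?case by (auto intro!: exI[of _ id] simp: strict_mono_def)
next
  case (insert j I)
  then obtain r g where rg: "strict_mono (r :: nat \<Rightarrow> nat) \<and> (\<forall>i\<in>I. g i holomorphic_on ball 0 1 \<and>
    (\<forall>K. compact K \<longrightarrow> K \<subseteq> ball 0 1 \<longrightarrow> uniform_limit K (\<lambda>n \<zeta>. F (r n) \<zeta> $ i) (g i) sequentially))"
    by blast
  then have r: "strict_mono r" and g: "\<And>i. i \<in> I \<Longrightarrow> g i holomorphic_on ball 0 1"
    "\<And>i K. i \<in> I \<Longrightarrow> compact K \<Longrightarrow> K \<subseteq> ball 0 1 \<Longrightarrow> uniform_limit K (\<lambda>n \<zeta>. F (r n) \<zeta> $ i) (g i) sequentially"
    by blast+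
  define H where "H = {h. h holomorphic_on ball 0 1 \<and> (\<forall>\<zeta>. cmod \<zeta> < 1 \<longrightarrow> cmod (h \<zeta>) \<le> B)}"
  obtain h s where h: "h holomorphic_on ball 0 1" "strict_mono (s :: nat \<Rightarrow> nat)"
    "\<And>K. compact K \<Longrightarrow> K \<subseteq> ball 0 1 \<Longrightarrow> uniform_limit K ((\<lambda>n \<zeta>. F (r n) \<zeta> $ j) \<circ> s) h sequentially"
  proof (rule Montel[of "ball 0 1" H "\<lambda>n \<zeta>. F (r n) \<zeta> $ j"])
    show "\<exists>B. \<forall>h\<in>H. \<forall>z\<in>K. cmod (h z) \<le> B" if "compact K" "K \<subseteq> ball 0 1" for K
      using that by (intro exI[of _ B]) (auto simp: H_def subset_eq)
    have "cmod (F (r n) \<zeta> $ j) \<le> B" if "cmod \<zeta> < 1" for n \<zeta>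
      using bd[OF that, of "r n"] Finite_Cartesian_Product.norm_nth_le[of "F (r n) \<zeta>" j] by linarith
    then show "range (\<lambda>n \<zeta>. F (r n) \<zeta> $ j) \<subseteq> H" using hol by (auto simp: H_def)
  qed (auto simp: H_def)
  define g' where "g' = (\<lambda>i. if i = j then h else g i)"
  have "uniform_limit K (\<lambda>n \<zeta>. F ((r \<circ> s) n) \<zeta> $ i) (g' i) sequentially" if "i \<in> insert j I" "compact K" "K \<subseteq> ball 0 1" for i K
  proof (cases "i = j")
    case True
    then show ?thesis using h(3)[OF that(2,3)] by (simp add: g'_def o_def)
  next
    case False
    then show ?thesis using uniform_limit_subseq[OF g(2)[OF _ that(2,3)] h(2)] that by (simp add: g'_def)
  qed
  moreover have "g' i holomorphic_on ball 0 1" if "i \<in> insert j I" for i using that h(1) g(1) by (auto simp: g'_def)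
  ultimately show ?case using strict_mono_o[OF r h(2)] by blast
qed

text \<open>A limit of discs lies only in the closure. If it met the boundary, the exponential of a
  supporting functional would attain its maximum modulus inside, hence be constant, although it is
  strictly smaller at the centre.\<close>

lemma disc_limit_in_convex:
  fixes D :: "(complex ^ 'n) set"
  assumes D: "open D" "convex D" and hol: "\<And>i. (\<lambda>\<zeta>. \<phi> \<zeta> $ i) holomorphic_on ball 0 1"
    and cl: "\<And>\<zeta>. cmod \<zeta> < 1 \<Longrightarrow> \<phi> \<zeta> \<in> closure D" and 0: "\<phi> 0 \<in> D"
  shows "\<phi> \<in> disc_maps D"
proof -
  have "\<phi> \<xi> \<in> D" if \<xi>: "cmod \<xi> < 1" for \<xi>
  proof (rule ccontr)
    assume "\<phi> \<xi> \<notin> D"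
    then obtain a where a: "\<And>x. x \<in> D \<Longrightarrow> Re (cpair (x - \<phi> \<xi>) a) < 0"
      using convex_supporting[OF D] 0 by (metis empty_iff)
    define h where "h = (\<lambda>\<zeta>. exp (cpair (\<phi> \<zeta> - \<phi> \<xi>) a))"
    have h: "h holomorphic_on ball 0 1" unfolding h_def by (intro holomorphic_intros cpair_vec_holomorphic hol)
    have "closure D \<subseteq> {x. Re (cpair (x - \<phi> \<xi>) a) \<le> 0}"
    proof (rule closure_minimal)
      have "continuous_on UNIV (\<lambda>x. Re (cpair (x - \<phi> \<xi>) a))"
        unfolding Re_cpair by (intro continuous_intros)
      then show "closed {x. Re (cpair (x - \<phi> \<xi>) a) \<le> 0}" by (rule closed_Collect_le[OF _ continuous_on_const])
    qed (use a in force)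
    then have le: "cmod (h \<zeta>) \<le> cmod (h \<xi>)" if "\<zeta> \<in> ball 0 1" for \<zeta>
      using cl[of \<zeta>] that by (auto simp: h_def cpair_def)
    have "h constant_on ball 0 1"
    proof (rule maximum_modulus_principle[OF h open_ball connected_ball open_ball order.refl])
      show "\<xi> \<in> ball 0 1" using \<xi> by simp
      show "cmod (h \<zeta>) \<le> cmod (h \<xi>)" if "\<zeta> \<in> ball 0 1" for \<zeta> by (rule le[OF that])
    qed
    then obtain c where "\<And>\<zeta>. \<zeta> \<in> ball 0 1 \<Longrightarrow> h \<zeta> = c" unfolding constant_on_def by blast
    then have "h 0 = h \<xi>" using \<xi> by simp
    moreover have "cmod (h 0) < cmod (h \<xi>)" using a[OF 0] by (simp add: h_def)
    ultimately show False by simp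
  qed
  then show ?thesis using hol by (auto simp: disc_maps_def)
qed

text \<open>Convergence is claimed along moving points because the approximating discs hit the
  second point at varying parameters.\<close>

lemma disc_maps_normal:
  fixes D :: "(complex ^ 'n) set"
  assumes D: "open D" "convex D" "bounded D" and z: "z \<in> D"
    and F: "\<And>n. F n \<in> disc_maps D" "\<And>n. F n 0 = z"
  obtains \<phi> r where "\<phi> \<in> disc_maps D" "\<phi> 0 = z" "strict_mono (r :: nat \<Rightarrow> nat)"
    "\<And>\<alpha> a. cmod a < 1 \<Longrightarrow> \<alpha> \<longlonglongrightarrow> a \<Longrightarrow> (\<lambda>n. F (r n) (\<alpha> n)) \<longlonglongrightarrow> \<phi> a"
    "(\<lambda>n. disc_deriv (F (r n)) 0) \<longlonglongrightarrow> disc_deriv \<phi> 0"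
proof -
  obtain B where B: "\<And>x. x \<in> D \<Longrightarrow> norm x \<le> B" using D(3) bounded_iff by blast
  have hol: "(\<lambda>\<zeta>. F n \<zeta> $ i) holomorphic_on ball 0 1" for n i using F(1)[of n] by (simp add: disc_maps_def)
  have "norm (F n \<zeta>) \<le> B" if "cmod \<zeta> < 1" for n \<zeta> using B disc_maps_in[OF F(1) that] by blast
  then have "\<exists>r g. strict_mono (r :: nat \<Rightarrow> nat) \<and> (\<forall>i\<in>UNIV. g i holomorphic_on ball 0 1 \<and>
    (\<forall>K. compact K \<longrightarrow> K \<subseteq> ball 0 1 \<longrightarrow> uniform_limit K (\<lambda>n \<zeta>. F (r n) \<zeta> $ i) (g i) sequentially))"
    by (intro Montel_finite[OF finite hol])
  then obtain r g where rg: "strict_mono (r :: nat \<Rightarrow> nat) \<and> (\<forall>i\<in>UNIV. g i holomorphic_on ball 0 1 \<and>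
    (\<forall>K. compact K \<longrightarrow> K \<subseteq> ball 0 1 \<longrightarrow> uniform_limit K (\<lambda>n \<zeta>. F (r n) \<zeta> $ i) (g i) sequentially))"
    by blast
  then have r: "strict_mono r" and g: "\<And>i. g i holomorphic_on ball 0 1"
    "\<And>i K. compact K \<Longrightarrow> K \<subseteq> ball 0 1 \<Longrightarrow> uniform_limit K (\<lambda>n \<zeta>. F (r n) \<zeta> $ i) (g i) sequentially"
    by blast+
  define \<phi> where "\<phi> = (\<lambda>\<zeta>. \<chi> i. g i \<zeta>)"
  have lim: "(\<lambda>n. F (r n) (\<alpha> n)) \<longlonglongrightarrow> \<phi> a" if a: "cmod a < 1" "\<alpha> \<longlonglongrightarrow> a" for \<alpha> a
  proof (rule vec_tendstoI)
    fix i
    define s where "s = (1 + cmod a) / 2"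
    have s: "cmod a < s" "s < 1" using a by (auto simp: s_def)
    have K: "cball 0 s \<subseteq> ball (0::complex) 1" using s by auto
    have "\<forall>\<^sub>F n in sequentially. \<alpha> n \<in> ball 0 s" using a(2) s by (intro topological_tendstoD) auto
    then have ev: "\<forall>\<^sub>F n in sequentially. \<alpha> n \<in> cball 0 s" by eventually_elim auto
    have "((\<lambda>n. g i (\<alpha> n)) \<longlongrightarrow> g i a) sequentially"
      using g(1)[of i] a holomorphic_on_imp_continuous_on continuous_on_interior[of "ball 0 1" "g i" a]
      by (intro isCont_tendsto_compose[OF _ a(2)]) auto
    moreover have "((\<lambda>n. F (r n) (\<alpha> n) $ i - g i (\<alpha> n)) \<longlongrightarrow> 0) sequentially"
    proof (rule tendstoI)
      fix e :: real assume "e > 0"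
      with g(2)[OF compact_cball K, of i] have "\<forall>\<^sub>F n in sequentially. \<forall>\<zeta>\<in>cball 0 s. dist (F (r n) \<zeta> $ i) (g i \<zeta>) < e"
        by (simp add: uniform_limit_iff)
      with ev show "\<forall>\<^sub>F n in sequentially. dist (F (r n) (\<alpha> n) $ i - g i (\<alpha> n)) 0 < e"
        by eventually_elim (auto simp: dist_norm)
    qed
    ultimately have "((\<lambda>n. (F (r n) (\<alpha> n) $ i - g i (\<alpha> n)) + g i (\<alpha> n)) \<longlongrightarrow> 0 + g i a) sequentially"
      by (intro tendsto_add)
    then show "(\<lambda>n. F (r n) (\<alpha> n) $ i) \<longlonglongrightarrow> \<phi> a $ i" by (simp add: \<phi>_def)
  qed
  have cl: "\<phi> \<zeta> \<in> closure D" if "cmod \<zeta> < 1" for \<zeta>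
    using lim[OF that tendsto_const] disc_maps_in[OF F(1) that]
    unfolding closure_sequential by (intro exI[of _ "\<lambda>n. F (r n) \<zeta>"]) auto
  have "(\<lambda>n. F (r n) 0) \<longlonglongrightarrow> \<phi> 0" using lim[OF _ tendsto_const, of 0] by simp
  then have \<phi>0: "\<phi> 0 = z" using F(2) by (simp add: LIMSEQ_const_iff)
  have h\<phi>: "(\<lambda>\<zeta>. \<phi> \<zeta> $ i) holomorphic_on ball 0 1" for i using g(1) by (simp add: \<phi>_def)
  have m: "\<phi> \<in> disc_maps D" by (rule disc_limit_in_convex[OF D(1,2) h\<phi> cl]) (use \<phi>0 z in auto)
  have dl: "(\<lambda>n. disc_deriv (F (r n)) 0) \<longlonglongrightarrow> disc_deriv \<phi> 0"
  proof (rule vec_tendstoI)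
    fix i
    have "\<exists>g'. \<forall>x\<in>ball 0 1. (g i has_field_derivative g' x) (at x) \<and> (\<lambda>n. deriv (\<lambda>\<zeta>. F (r n) \<zeta> $ i) x) \<longlonglongrightarrow> g' x"
    proof (rule has_complex_derivative_uniform_sequence)
      show "((\<lambda>\<zeta>. F (r n) \<zeta> $ i) has_field_derivative deriv (\<lambda>\<zeta>. F (r n) \<zeta> $ i) x) (at x)" if "x \<in> ball 0 1" for n x
        using that by (intro holomorphic_derivI[OF hol]) auto
      show "\<exists>d>0. cball x d \<subseteq> ball 0 1 \<and> uniform_limit (cball x d) (\<lambda>n \<zeta>. F (r n) \<zeta> $ i) (g i) sequentially" if "x \<in> ball 0 1" for x
        using that open_contains_cball[of "ball (0::complex) 1"] g(2)[OF compact_cball] by (metis open_ball)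
    qed auto
    then obtain g' where "\<forall>x\<in>ball 0 1. (g i has_field_derivative g' x) (at x) \<and> (\<lambda>n. deriv (\<lambda>\<zeta>. F (r n) \<zeta> $ i) x) \<longlonglongrightarrow> g' x" ..
    from bspec[OF this, of 0] have "(g i has_field_derivative g' 0) (at 0)" "(\<lambda>n. deriv (\<lambda>\<zeta>. F (r n) \<zeta> $ i) 0) \<longlonglongrightarrow> g' 0" by auto
    then show "(\<lambda>n. disc_deriv (F (r n)) 0 $ i) \<longlonglongrightarrow> disc_deriv \<phi> 0 $ i"
      by (simp add: disc_deriv_def \<phi>_def DERIV_imp_deriv)
  qed
  show ?thesis
  proof (rule that[of \<phi> r])
    show "\<phi> \<in> disc_maps D" "\<phi> 0 = z" "strict_mono r" "(\<lambda>n. disc_deriv (F (r n)) 0) \<longlonglongrightarrow> disc_deriv \<phi> 0"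
      by (fact m \<phi>0 r dl)+
    show "(\<lambda>n. F (r n) (\<alpha> n)) \<longlonglongrightarrow> \<phi> a" if "cmod a < 1" "\<alpha> \<longlonglongrightarrow> a" for \<alpha> a
      using that by (rule lim)
  qed
qed

text \<open>A limit of the F n has equality in the Schwarz lemma and is therefore a rotation. It
  preserves \<open>rho\<close> for every pair, although extremality was known only at one point or
  for the derivative at 0.\<close>

lemma rotation_limit:
  assumes F: "\<And>n. F n holomorphic_on ball 0 1" "\<And>n \<zeta>. cmod \<zeta> < 1 \<Longrightarrow> cmod (F n \<zeta>) < 1" "\<And>n. F n 0 = 0"
    and ext: "(\<exists>\<alpha>. \<alpha> \<noteq> 0 \<and> cmod \<alpha> < 1 \<and> (\<lambda>n. cmod (F n \<alpha>)) \<longlonglongrightarrow> cmod \<alpha>) \<or> (\<lambda>n. cmod (deriv (F n) 0)) \<longlonglongrightarrow> 1"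
    and ab: "cmod a < 1" "cmod b < 1" and B: "\<And>n. rho (F n a) (F n b) \<le> B"
  shows "rho a b \<le> B"
proof -
  define H where "H = {h. h holomorphic_on ball 0 1 \<and> (\<forall>\<zeta>. cmod \<zeta> < 1 \<longrightarrow> cmod (h \<zeta>) \<le> 1)}"
  obtain G s where G: "G holomorphic_on ball 0 1" "strict_mono (s :: nat \<Rightarrow> nat)"
    "\<And>x. x \<in> ball 0 1 \<Longrightarrow> (\<lambda>n. F (s n) x) \<longlonglongrightarrow> G x"
    "\<And>K. compact K \<Longrightarrow> K \<subseteq> ball 0 1 \<Longrightarrow> uniform_limit K (F \<circ> s) G sequentially"
  proof (rule Montel[of "ball 0 1" H F])
    show "\<exists>B. \<forall>h\<in>H. \<forall>z\<in>K. cmod (h z) \<le> B" if "compact K" "K \<subseteq> ball 0 1" for K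
      using that by (intro exI[of _ 1]) (auto simp: H_def subset_eq)
    show "range F \<subseteq> H" using F by (auto simp: H_def less_imp_le)
  qed (auto simp: H_def)
  have G0: "G 0 = 0" using G(3)[of 0] F(3) by (simp add: LIMSEQ_const_iff)
  have Gle: "cmod (G \<zeta>) \<le> cmod \<zeta>" if "cmod \<zeta> < 1" for \<zeta>
  proof (rule tendsto_upperbound[OF tendsto_norm[OF G(3)]])
    show "\<forall>\<^sub>F n in sequentially. cmod (F (s n) \<zeta>) \<le> cmod \<zeta>"
      using Schwarz_Lemma(1)[OF F(1) F(3) F(2) that] by simp
  qed (use that in auto)
  have G1: "cmod (G \<zeta>) < 1" if "cmod \<zeta> < 1" for \<zeta> using Gle[OF that] that by simp
  have "(\<exists>\<zeta>. cmod \<zeta> < 1 \<and> \<zeta> \<noteq> 0 \<and> cmod (G \<zeta>) = cmod \<zeta>) \<or> cmod (deriv G 0) = 1"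
    using ext
  proof
    assume "\<exists>\<alpha>. \<alpha> \<noteq> 0 \<and> cmod \<alpha> < 1 \<and> (\<lambda>n. cmod (F n \<alpha>)) \<longlonglongrightarrow> cmod \<alpha>"
    then obtain \<alpha> where \<alpha>: "\<alpha> \<noteq> 0" "cmod \<alpha> < 1" "(\<lambda>n. cmod (F n \<alpha>)) \<longlonglongrightarrow> cmod \<alpha>" by blast
    have "(\<lambda>n. cmod (F (s n) \<alpha>)) \<longlonglongrightarrow> cmod \<alpha>" using LIMSEQ_subseq_LIMSEQ[OF \<alpha>(3) G(2)] by (simp add: o_def)
    moreover have "(\<lambda>n. cmod (F (s n) \<alpha>)) \<longlonglongrightarrow> cmod (G \<alpha>)" using tendsto_norm[OF G(3)] \<alpha> by simp
    ultimately have "cmod (G \<alpha>) = cmod \<alpha>" by (rule LIMSEQ_unique[symmetric])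
    then show ?thesis using \<alpha> by blast
  next
    assume d: "(\<lambda>n. cmod (deriv (F n) 0)) \<longlonglongrightarrow> 1"
    have "\<exists>g'. \<forall>x\<in>ball 0 1. (G has_field_derivative g' x) (at x) \<and> (\<lambda>n. deriv ((F \<circ> s) n) x) \<longlonglongrightarrow> g' x"
    proof (rule has_complex_derivative_uniform_sequence)
      show "((F \<circ> s) n has_field_derivative deriv ((F \<circ> s) n) x) (at x)" if "x \<in> ball 0 1" for n x
        using that holomorphic_derivI[OF F(1)] by auto
      show "\<exists>d>0. cball x d \<subseteq> ball 0 1 \<and> uniform_limit (cball x d) (F \<circ> s) G sequentially" if "x \<in> ball 0 1" for x
        using that open_contains_cball[of "ball (0::complex) 1"] G(4)[OF compact_cball] by (metis open_ball)
    qed auto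
    then obtain g' where "\<forall>x\<in>ball 0 1. (G has_field_derivative g' x) (at x) \<and> (\<lambda>n. deriv ((F \<circ> s) n) x) \<longlonglongrightarrow> g' x" ..
    from bspec[OF this, of 0] have g': "(G has_field_derivative g' 0) (at 0)" "(\<lambda>n. deriv (F (s n)) 0) \<longlonglongrightarrow> g' 0" by auto
    have "(\<lambda>n. cmod (deriv (F (s n)) 0)) \<longlonglongrightarrow> 1" using LIMSEQ_subseq_LIMSEQ[OF d G(2)] by (simp add: o_def)
    then have "cmod (g' 0) = 1" using LIMSEQ_unique[OF tendsto_norm[OF g'(2)]] by blast
    then show ?thesis using DERIV_imp_deriv[OF g'(1)] by simp
  qed
  then obtain \<beta> where \<beta>: "\<And>z. cmod z < 1 \<Longrightarrow> G z = \<beta> * z" "cmod \<beta> = 1"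
    using Schwarz_Lemma(3)[OF G(1) G0 G1, of 0] by auto
  have "\<beta> * cnj \<beta> = 1" using complex_norm_square[of \<beta>] \<beta>(2) by simp
  then have "cnj (\<beta> * a) * (\<beta> * b) = cnj a * b" by (simp add: mult_ac)
  then have "pdisc (\<beta> * a) (\<beta> * b) = pdisc a b"
    unfolding pdisc_def using \<beta>(2) by (simp only: norm_divide right_diff_distrib[symmetric] norm_mult mult_1)
  then have eq: "rho (G a) (G b) = rho a b" using \<beta> ab by (simp add: rho_def)
  have "(\<lambda>n. rho (F (s n) a) (F (s n) b)) \<longlonglongrightarrow> rho (G a) (G b)"
    unfolding rho_def pdisc_def
    using G(3)[of a] G(3)[of b] ab one_minus_cnj_mult_nonzero[OF G1 G1, of a b] pdisc_less_1[OF G1 G1, of a b] pdisc_nonneg[of "G a" "G b"]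
    by (intro tendsto_intros) (auto simp: pdisc_def intro: less_le_trans[of "-1" 0])
  from LIMSEQ_le_const2[OF this] B eq show ?thesis by auto
qed

definition cgeo :: "(complex ^ 'n) set \<Rightarrow> (complex \<Rightarrow> complex ^ 'n) \<Rightarrow> bool" where
  "cgeo D \<phi> \<longleftrightarrow> \<phi> \<in> disc_maps D \<and>
     (\<forall>a b. cmod a < 1 \<longrightarrow> cmod b < 1 \<longrightarrow> rho a b \<le> caratheodory_dist D (\<phi> a) (\<phi> b))"

text \<open>The chain rho \<le> c_D \<le> k_D \<le> rho closes up; only the first inequality is
  special to geodesics.\<close>

lemma cgeo_dist:
  assumes "open D" "connected D" "cgeo D \<phi>" "cmod a < 1" "cmod b < 1"
  shows "kobayashi_dist D (\<phi> a) (\<phi> b) = rho a b" "caratheodory_dist D (\<phi> a) (\<phi> b) = rho a b"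
proof -
  have \<phi>: "\<phi> \<in> disc_maps D" using assms(3) by (simp add: cgeo_def)
  have "kobayashi_dist D (\<phi> a) (\<phi> b) \<le> rho a b"
    by (rule kobayashi_le_rho[OF assms(1,2) \<phi> assms(4,5)])
  moreover have "caratheodory_dist D (\<phi> a) (\<phi> b) \<le> kobayashi_dist D (\<phi> a) (\<phi> b)"
    using assms disc_maps_in[OF \<phi>] by (intro caratheodory_le_kobayashi) auto
  moreover have "rho a b \<le> caratheodory_dist D (\<phi> a) (\<phi> b)" using assms by (simp add: cgeo_def)
  ultimately show "kobayashi_dist D (\<phi> a) (\<phi> b) = rho a b" "caratheodory_dist D (\<phi> a) (\<phi> b) = rho a b" by auto
qed

lemma cgeoI:
  fixes D :: "(complex ^ 'n) set"
  assumes D: "open D" "connected D" and \<phi>: "\<phi> \<in> disc_maps D"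
    and f: "\<And>n. f n \<in> maps_to_disc D" "\<And>n. f n (\<phi> 0) = 0"
    and ext: "(\<exists>\<alpha>. \<alpha> \<noteq> 0 \<and> cmod \<alpha> < 1 \<and> (\<lambda>n. cmod (f n (\<phi> \<alpha>))) \<longlonglongrightarrow> cmod \<alpha>) \<or>
      (\<lambda>n. cmod (frechet_derivative (f n) (at (\<phi> 0)) (disc_deriv \<phi> 0))) \<longlonglongrightarrow> 1"
  shows "cgeo D \<phi>"
  unfolding cgeo_def
proof (intro conjI allI impI \<phi>)
  fix a b assume ab: "cmod a < 1" "cmod b < 1"
  show "rho a b \<le> caratheodory_dist D (\<phi> a) (\<phi> b)"
  proof (rule rotation_limit[of "\<lambda>n. f n \<circ> \<phi>", OF _ _ _ _ ab])
    show "f n \<circ> \<phi> holomorphic_on ball 0 1" for n by (rule maps_to_disc_holomorphic[OF f(1) \<phi>])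
    show "cmod ((f n \<circ> \<phi>) \<zeta>) < 1" if "cmod \<zeta> < 1" for n \<zeta>
      using maps_to_disc_norm[OF f(1) disc_maps_in[OF \<phi> that]] by simp
    show "rho ((f n \<circ> \<phi>) a) ((f n \<circ> \<phi>) b) \<le> caratheodory_dist D (\<phi> a) (\<phi> b)" for n
      using rho_le_caratheodory[OF D f(1) disc_maps_in[OF \<phi> ab(1)] disc_maps_in[OF \<phi> ab(2)]] by simp
    have "deriv (f n \<circ> \<phi>) 0 = frechet_derivative (f n) (at (\<phi> 0)) (disc_deriv \<phi> 0)" for n
      by (rule DERIV_imp_deriv[OF maps_to_disc_compose_disc[OF f(1) \<phi>]]) simp
    then show "(\<exists>\<alpha>. \<alpha> \<noteq> 0 \<and> cmod \<alpha> < 1 \<and> (\<lambda>n. cmod ((f n \<circ> \<phi>) \<alpha>)) \<longlonglongrightarrow> cmod \<alpha>) \<or> (\<lambda>n. cmod (deriv (f n \<circ> \<phi>) 0)) \<longlonglongrightarrow> 1"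
      using ext by simp
  qed (use f in simp)
qed

text \<open>Discs through w at parameters decreasing to \<alpha> = tanh (c_D(z,w)) converge to a
  disc through w at \<alpha> itself. Functions nearly attaining c_D certify that it is a
  geodesic.\<close>

lemma cgeo_points:
  fixes D :: "(complex ^ 'n) set"
  assumes D: "open D" "convex D" "bounded D" and zw: "z \<in> D" "w \<in> D" "z \<noteq> w"
  obtains \<phi> \<alpha> where "cgeo D \<phi>" "cmod \<alpha> < 1" "\<phi> 0 = z" "\<phi> \<alpha> = w"
proof -
  have conn: "connected D" using D by (simp add: convex_connected)
  define c where "c = caratheodory_dist D z w"
  define \<alpha> where "\<alpha> = tanh c"
  obtain R where R: "D \<subseteq> ball 0 R" "R > 0" using bounded_subset_ballD[OF D(3)] by blast
  have "norm (z - w) / (2 * R) \<le> c" unfolding c_def by (rule caratheodory_lower[OF R(1) D(1) conn zw(1,2)])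
  moreover have "norm (z - w) / (2 * R) > 0" using zw R by simp
  ultimately have c: "c > 0" by linarith
  have \<alpha>: "0 < \<alpha>" "\<alpha> < 1" using c tanh_real_lt_1[of c] by (auto simp: \<alpha>_def)
  have ac: "artanh \<alpha> = c" by (simp add: \<alpha>_def artanh_tanh_real)
  \<comment> \<open>Strictly above \<alpha>, as \<open>Lempert_two_points\<close> demands; the
    second \<open>Suc\<close> keeps t 0 below 1.\<close>
  define t where "t = (\<lambda>n::nat. \<alpha> + (1 - \<alpha>) * inverse (real (Suc (Suc n))))"
  have t: "\<alpha> < t n" "t n < 1" for n
  proof -
    show "\<alpha> < t n" using \<alpha> by (simp add: t_def)
    have "inverse (real (Suc (Suc n))) < 1" by (simp add: field_simps)
    then have "(1 - \<alpha>) * inverse (real (Suc (Suc n))) < (1 - \<alpha>) * 1" using \<alpha> by (intro mult_strict_left_mono) auto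
    then show "t n < 1" by (simp add: t_def)
  qed
  have "(\<lambda>n. \<alpha> + (1 - \<alpha>) * inverse (real (Suc (Suc n)))) \<longlonglongrightarrow> \<alpha> + (1 - \<alpha>) * 0"
    by (intro tendsto_intros LIMSEQ_Suc[OF LIMSEQ_inverse_real_of_nat])
  then have tlim: "t \<longlonglongrightarrow> \<alpha>" by (simp add: t_def)
  have "\<exists>\<phi>. \<phi> \<in> disc_maps D \<and> \<phi> 0 = z \<and> \<phi> (of_real (t n)) = w" for n
  proof -
    have "artanh \<alpha> < artanh (t n)" using artanh_le_iff[of "t n" \<alpha>] t[of n] \<alpha> by (simp add: not_le[symmetric])
    then show ?thesis using Lempert_two_points[OF D(1,2) zw(1,2), of "t n"] t[of n] \<alpha> ac c_def by (metis order_less_trans)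
  qed
  then obtain F where F: "\<And>n. F n \<in> disc_maps D" "\<And>n. F n 0 = z" "\<And>n. F n (of_real (t n)) = w" by metis
  obtain \<phi> r where \<phi>: "\<phi> \<in> disc_maps D" "\<phi> 0 = z" "strict_mono (r :: nat \<Rightarrow> nat)"
    "\<And>\<alpha> a. cmod a < 1 \<Longrightarrow> \<alpha> \<longlonglongrightarrow> a \<Longrightarrow> (\<lambda>n. F (r n) (\<alpha> n)) \<longlonglongrightarrow> \<phi> a"
    by (rule disc_maps_normal[of D z F, OF D zw(1) F(1,2)]) blast
  have "(\<lambda>n. complex_of_real (t (r n))) \<longlonglongrightarrow> of_real \<alpha>"
    using LIMSEQ_subseq_LIMSEQ[OF tlim \<phi>(3)] by (intro tendsto_of_real) (simp add: o_def)
  from \<phi>(4)[OF _ this] have "(\<lambda>n. w) \<longlonglongrightarrow> \<phi> (of_real \<alpha>)" using \<alpha> by (simp add: F(3))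
  then have \<phi>w: "\<phi> (of_real \<alpha>) = w" by (simp add: LIMSEQ_const_iff)
  have "\<exists>f. f \<in> maps_to_disc D \<and> f z = 0 \<and> c - inverse (real (Suc n)) < artanh (cmod (f w))" for n
  proof -
    let ?S = "{artanh (cmod (f w)) | f. f \<in> maps_to_disc D \<and> f z = 0}"
    have "c - inverse (real (Suc n)) < Sup ?S" by (simp add: c_def caratheodory_dist_def)
    moreover have "?S \<noteq> {}" using zero_maps_to_disc by auto
    ultimately obtain x where "x \<in> ?S" "c - inverse (real (Suc n)) < x" using less_cSupE by blast
    then show ?thesis by auto
  qed
  then obtain f where f: "\<And>n. f n \<in> maps_to_disc D" "\<And>n. f n z = 0" "\<And>n. c - inverse (real (Suc n)) < artanh (cmod (f n w))" by metis
  have "(\<lambda>n. cmod (f n w)) \<longlonglongrightarrow> tanh c"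
  proof (rule tendsto_sandwich)
    have lt: "cmod (f n w) < 1" for n using maps_to_disc_norm[OF f(1) zw(2)] .
    have eq: "tanh (artanh (cmod (f n w))) = cmod (f n w)" for n using lt[of n] by (intro tanh_artanh) auto
    show "\<forall>\<^sub>F n in sequentially. tanh (c - inverse (real (Suc n))) \<le> cmod (f n w)"
      using f(3) eq by (intro always_eventually allI) (metis less_imp_le tanh_real_le_iff)
    have "artanh (cmod (f n w)) \<le> c" for n
      using rho_le_caratheodory[OF D(1) conn f(1) zw(1,2), of n] f(2)[of n] by (simp add: c_def)
    then show "\<forall>\<^sub>F n in sequentially. cmod (f n w) \<le> tanh c"
      using eq by (intro always_eventually allI) (metis tanh_real_le_iff)
    have "(\<lambda>n. tanh (c - inverse (real (Suc n)))) \<longlonglongrightarrow> tanh (c - 0)"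
      by (intro tendsto_intros LIMSEQ_inverse_real_of_nat) (simp add: cosh_real_nonzero)
    then show "(\<lambda>n. tanh (c - inverse (real (Suc n)))) \<longlonglongrightarrow> tanh c" by simp
  qed auto
  then have "(\<lambda>n. cmod (f n (\<phi> (of_real \<alpha>)))) \<longlonglongrightarrow> cmod (of_real \<alpha>)" using \<alpha> \<phi>w by (simp add: \<alpha>_def)
  then have "cgeo D \<phi>"
    using f \<phi>(2) \<alpha> by (intro cgeoI[OF D(1) conn \<phi>(1), of f] disjI1 exI[of _ "of_real \<alpha>"]) auto
  then show ?thesis using that[of \<phi> "of_real \<alpha>"] \<phi>(2) \<phi>w \<alpha> by simp
qed

lemma cgeo_direction:
  fixes D :: "(complex ^ 'n) set"
  assumes D: "open D" "convex D" "bounded D" and z: "z \<in> D" "X \<noteq> 0"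
  obtains \<phi> where "cgeo D \<phi>" "\<phi> 0 = z" "caratheodory_metric D z X *\<^sub>R disc_deriv \<phi> 0 = X"
proof -
  have conn: "connected D" using D by (simp add: convex_connected)
  define c where "c = caratheodory_metric D z X"
  obtain R where R: "D \<subseteq> ball 0 R" "R > 0" using bounded_subset_ballD[OF D(3)] by blast
  obtain \<rho> where \<rho>: "ball z \<rho> \<subseteq> D" "\<rho> > 0" using D z openE by blast
  have "norm X / R \<le> c" unfolding c_def by (rule caratheodory_metric_lower[OF R(1) \<rho>])
  moreover have "norm X / R > 0" using z R by simp
  ultimately have c: "c > 0" by linarith
  define t where "t = (\<lambda>n::nat. c + inverse (real (Suc n)))"
  have t: "t n > c" for n by (simp add: t_def)
  have "(\<lambda>n. c + inverse (real (Suc n))) \<longlonglongrightarrow> c + 0"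
    by (intro tendsto_intros LIMSEQ_inverse_real_of_nat)
  then have tlim: "t \<longlonglongrightarrow> c" by (simp add: t_def)
  have "\<exists>\<phi>. \<phi> \<in> disc_maps D \<and> \<phi> 0 = z \<and> disc_deriv \<phi> 0 = (1 / t n) *\<^sub>R X" for n
    using Lempert_direction[OF D(1,2) z(1), of "t n" X] t[of n] c c_def by (metis order_less_trans)
  then obtain F where F: "\<And>n. F n \<in> disc_maps D" "\<And>n. F n 0 = z" "\<And>n. disc_deriv (F n) 0 = (1 / t n) *\<^sub>R X" by metis
  obtain \<phi> r where \<phi>: "\<phi> \<in> disc_maps D" "\<phi> 0 = z" "strict_mono (r :: nat \<Rightarrow> nat)"
    "(\<lambda>n. disc_deriv (F (r n)) 0) \<longlonglongrightarrow> disc_deriv \<phi> 0"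
    by (rule disc_maps_normal[of D z F, OF D z(1) F(1,2)]) blast
  have "(\<lambda>n. t (r n)) \<longlonglongrightarrow> c" using LIMSEQ_subseq_LIMSEQ[OF tlim \<phi>(3)] by (simp add: o_def)
  then have "(\<lambda>n. (1 / t (r n)) *\<^sub>R X) \<longlonglongrightarrow> (1 / c) *\<^sub>R X" using c by (intro tendsto_intros) auto
  then have d\<phi>: "disc_deriv \<phi> 0 = (1 / c) *\<^sub>R X" using \<phi>(4) F(3) LIMSEQ_unique by (metis (no_types, lifting) ext)
  have "\<exists>f. f \<in> maps_to_disc D \<and> f z = 0 \<and> c - inverse (real (Suc n)) < cmod (frechet_derivative f (at z) X)" for n
  proof -
    let ?S = "{cmod (frechet_derivative f (at z) X) | f. f \<in> maps_to_disc D}"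
    have "c - inverse (real (Suc n)) < Sup ?S" by (simp add: c_def caratheodory_metric_def)
    moreover have "?S \<noteq> {}" using zero_maps_to_disc by auto
    ultimately obtain x where "x \<in> ?S" "c - inverse (real (Suc n)) < x" using less_cSupE by blast
    then obtain f where f: "f \<in> maps_to_disc D" "c - inverse (real (Suc n)) < cmod (frechet_derivative f (at z) X)" by auto
    obtain f' where f': "(f has_derivative f') (at z)" using f(1) z unfolding maps_to_disc_def by blast
    \<comment> \<open>The metric admits functions with f z \<noteq> 0 but \<open>cgeoI\<close> does
      not. Moving f z to 0 by an automorphism divides the derivative by 1 - |f z|^2 \<le> 1, so it
      cannot shrink.\<close>
    define w where "w = f z"
    have w: "cmod w < 1" using maps_to_disc_norm[OF f(1) z(1)] by (simp add: w_def)
    have nz: "1 - cnj w * w \<noteq> 0" using one_minus_cnj_mult_nonzero[OF w w] .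
    have "((\<lambda>z. (z - w) / (1 - cnj w * z)) has_field_derivative 1 / (1 - cnj w * w)) (at w)"
      using nz by (auto intro!: derivative_eq_intros)
    then have "(Moebius_function 0 w has_derivative (*) (1 / (1 - cnj w * w))) (at (f z))"
      by (simp add: Moebius_function_def[abs_def] w_def has_field_derivative_def)
    then have "(Moebius_function 0 w \<circ> f has_derivative (*) (1 / (1 - cnj w * w)) \<circ> f') (at z)"
      by (rule diff_chain_at[OF f'])
    then have "frechet_derivative (Moebius_function 0 w \<circ> f) (at z) X = 1 / (1 - cnj w * w) * f' X"
      by (simp add: frechet_derivative_at[symmetric])
    moreover have "1 - cnj w * w = of_real (1 - (cmod w)\<^sup>2)"
      using complex_norm_square[of w] by (simp add: mult.commute)
    moreover have "(cmod w)\<^sup>2 < 1" using w by (simp add: abs_square_less_1)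
    moreover define t where "t = 1 - (cmod w)\<^sup>2"
    ultimately have t: "0 < t" "t \<le> 1" "frechet_derivative (Moebius_function 0 w \<circ> f) (at z) X = 1 / of_real t * f' X"
      by simp_all
    have "cmod (f' X) \<le> cmod (frechet_derivative (Moebius_function 0 w \<circ> f) (at z) X)"
      unfolding t(3) using t(1,2) mult_right_mono[of t 1 "cmod (f' X)"] by (simp add: norm_mult norm_divide field_simps)
    moreover have "Moebius_function 0 w \<circ> f \<in> maps_to_disc D"
      using w by (intro maps_to_disc_postcompose[OF f(1)] Moebius_function_holomorphic Moebius_function_norm_lt_1) auto
    moreover have "(Moebius_function 0 w \<circ> f) z = 0" by (simp add: w_def Moebius_function_eq_zero)
    ultimately show ?thesis using f(2) by (metis frechet_derivative_at[OF f'] order_less_le_trans)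
  qed
  then obtain f where f: "\<And>n. f n \<in> maps_to_disc D" "\<And>n. f n z = 0"
    "\<And>n. c - inverse (real (Suc n)) < cmod (frechet_derivative (f n) (at z) X)" by metis
  have le: "cmod (frechet_derivative (f n) (at z) X) \<le> c" for n
    unfolding c_def by (rule caratheodory_metric_ge[OF \<rho> f(1)])
  have "(\<lambda>n. c - inverse (real (Suc n))) \<longlonglongrightarrow> c - 0"
    by (intro tendsto_intros LIMSEQ_inverse_real_of_nat)
  then have lim: "(\<lambda>n. c - inverse (real (Suc n))) \<longlonglongrightarrow> c" by simp
  have "(\<lambda>n. cmod (frechet_derivative (f n) (at z) X)) \<longlonglongrightarrow> c"
    by (rule tendsto_sandwich[OF always_eventually always_eventually lim tendsto_const]) (intro allI less_imp_le f(3), intro allI le)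
  then have "(\<lambda>n. cmod (frechet_derivative (f n) (at z) X) / c) \<longlonglongrightarrow> c / c" using c by (intro tendsto_intros) auto
  moreover have "cmod (frechet_derivative (f n) (at (\<phi> 0)) (disc_deriv \<phi> 0)) = cmod (frechet_derivative (f n) (at z) X) / c" for n
  proof -
    obtain f' where f': "(f n has_derivative f') (at z)" using f(1) z unfolding maps_to_disc_def by blast
    then have "f' ((1 / c) *\<^sub>R X) = (1 / c) *\<^sub>R f' X" using linear_scale[OF has_derivative_linear[OF f']] by blast
    then show ?thesis using c unfolding d\<phi> \<phi>(2) frechet_derivative_at[OF f', symmetric] by simp
  qed
  ultimately have ext: "(\<lambda>n. cmod (frechet_derivative (f n) (at (\<phi> 0)) (disc_deriv \<phi> 0))) \<longlonglongrightarrow> 1" using c by simp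
  show ?thesis
  proof (rule that[of \<phi>])
    show "cgeo D \<phi>"
      by (rule cgeoI[OF D(1) conn \<phi>(1) f(1) _ disjI2[OF ext]]) (simp add: f(2) \<phi>(2))
    show "caratheodory_metric D z X *\<^sub>R disc_deriv \<phi> 0 = X" unfolding d\<phi> c_def[symmetric] using c by simp
  qed (fact \<phi>(2))
qed

section \<open>Convex domains with Dini-smooth boundary\<close>

text \<open>Turns the local, defining-function notion of normal into the global supporting property
  available for convex domains.\<close>

lemma inner_unit_normal_convex:
  fixes D :: "'a::euclidean_space set"
  assumes D: "open D" "convex D" and p: "p \<in> frontier D" and n: "inner_unit_normal D p \<nu>"
  shows "norm \<nu> = 1" "\<And>y. y \<in> D \<Longrightarrow> (y - p) \<bullet> \<nu> > 0" "\<exists>s0>0. \<forall>s. 0 < s \<and> s < s0 \<longrightarrow> p + s *\<^sub>R \<nu> \<in> D"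
proof -
  obtain U r g where U: "p \<in> U" "open U" and r: "D \<inter> U = {x \<in> U. r x < 0}" and
    g: "\<And>x. x \<in> U \<Longrightarrow> g x \<noteq> 0" "\<And>x. x \<in> U \<Longrightarrow> (r has_derivative (\<lambda>v. g x \<bullet> v)) (at x)"
    and \<nu>: "\<nu> = - (g p /\<^sub>R norm (g p))"
    using n unfolding inner_unit_normal_def C1_defining_def by blast
  have gp: "g p \<noteq> 0" using g U by blast
  show "norm \<nu> = 1" using gp by (simp add: \<nu>)
  have pD: "p \<notin> D" using p D(1) by (simp add: frontier_def interior_open)
  have pc: "p \<in> closure D" using p by (simp add: frontier_def)
  have rp: "r p = 0"
  proof (rule antisym)
    show "0 \<le> r p" using pD r U by force
    have "isCont r p" using g(2)[OF U(1)] has_derivative_continuous by blast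
    obtain x where x: "\<And>n. x n \<in> D" "x \<longlonglongrightarrow> p" using pc unfolding closure_sequential by blast
    have "(\<lambda>n. r (x n)) \<longlonglongrightarrow> r p" using isCont_tendsto_compose[OF \<open>isCont r p\<close> x(2)] .
    moreover have "\<forall>\<^sub>F n in sequentially. x n \<in> U" using topological_tendstoD[OF x(2) U(2,1)] .
    then have "\<forall>\<^sub>F n in sequentially. r (x n) \<le> 0"
      by eventually_elim (use r x(1) in force)
    ultimately show "r p \<le> 0" by (rule tendsto_upperbound) simp
  qed
  have der: "((\<lambda>s. r (p + s *\<^sub>R v)) has_real_derivative (g p \<bullet> v)) (at 0)" for v
  proof -
    have "((\<lambda>s. p + s *\<^sub>R v) has_derivative (\<lambda>s. s *\<^sub>R v)) (at 0)" by (auto intro!: derivative_eq_intros)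
    moreover have "(r has_derivative (\<lambda>v. g p \<bullet> v)) (at (p + 0 *\<^sub>R v))" using g(2)[OF U(1)] by simp
    ultimately have "((r \<circ> (\<lambda>s. p + s *\<^sub>R v)) has_derivative ((\<lambda>v. g p \<bullet> v) \<circ> (\<lambda>s. s *\<^sub>R v))) (at 0)"
      by (rule diff_chain_at)
    then show ?thesis by (simp add: has_field_derivative_def o_def mult_commute_abs)
  qed
  have inU: "\<exists>d>0. \<forall>s. \<bar>s\<bar> < d \<longrightarrow> p + s *\<^sub>R v \<in> U" for v
  proof -
    obtain e where e: "e > 0" "ball p e \<subseteq> U" using U openE by blast
    show ?thesis
    proof (intro exI[of _ "e / (norm v + 1)"] conjI allI impI)
      show "e / (norm v + 1) > 0" using e by (simp add: add_nonneg_pos)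
      fix s assume "\<bar>s\<bar> < e / (norm v + 1)"
      then have "\<bar>s\<bar> * (norm v + 1) < e" by (simp add: pos_less_divide_eq add_nonneg_pos)
      then have "\<bar>s\<bar> * norm v < e" by (simp add: distrib_left)
      then show "p + s *\<^sub>R v \<in> U" using e by (auto simp: dist_norm)
    qed
  qed
  \<comment> \<open>Otherwise r would increase from r p = 0 on the way towards y, while convexity
    keeps the segment in D, where r < 0.\<close>
  have nneg: "(y - p) \<bullet> \<nu> \<ge> 0" if y: "y \<in> D" for y
  proof (rule ccontr)
    assume "\<not> ?thesis"
    then have pos: "g p \<bullet> (y - p) > 0" using gp by (auto simp: \<nu> inner_commute not_le zero_less_mult_iff)
    obtain d where d: "d > 0" "\<And>s. 0 < s \<Longrightarrow> s < d \<Longrightarrow> r p < r (p + s *\<^sub>R (y - p))"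
      using DERIV_pos_inc_right[OF der pos] by auto
    obtain d' where d': "d' > 0" "\<And>s. \<bar>s\<bar> < d' \<Longrightarrow> p + s *\<^sub>R (y - p) \<in> U" using inU[of "y - p"] by blast
    define s where "s = min (min d d') 1 / 2"
    have s: "0 < s" "s < d" "s < d'" "s < 1" using d(1) d'(1) by (auto simp: s_def)
    have "p + s *\<^sub>R (y - p) \<in> interior D"
    proof (rule in_interior_closure_convex_segment[OF D(2), of y p, THEN subsetD])
      show "y \<in> interior D" using y D(1) by (simp add: interior_open)
      show "p + s *\<^sub>R (y - p) \<in> open_segment y p"
        using s pD y by (auto simp: in_segment algebra_simps intro!: exI[of _ "1 - s"])
    qed (fact pc)
    then have "p + s *\<^sub>R (y - p) \<in> D" using interior_subset by blast
    then have "r (p + s *\<^sub>R (y - p)) < 0" using d'(2)[of s] s r by auto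
    then show False using d(2)[of s] s rp by simp
  qed
  show "(y - p) \<bullet> \<nu> > 0" if y: "y \<in> D" for y
  proof -
    obtain e where e: "e > 0" "ball y e \<subseteq> D" using y D openE by blast
    have "y - (e/2) *\<^sub>R \<nu> \<in> D" using e \<open>norm \<nu> = 1\<close> by (auto simp: dist_norm)
    from nneg[OF this] have "0 \<le> (y - p) \<bullet> \<nu> - e / 2 * (\<nu> \<bullet> \<nu>)" by (simp add: inner_diff_left algebra_simps)
    then show ?thesis using e \<open>norm \<nu> = 1\<close> by (simp add: dot_square_norm)
  qed
  have "g p \<bullet> \<nu> < 0" using gp by (simp add: \<nu> dot_square_norm power2_eq_square)
  then obtain d where d: "d > 0" "\<And>s. 0 < s \<Longrightarrow> s < d \<Longrightarrow> r (p + s *\<^sub>R \<nu>) < r p"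
    using DERIV_neg_dec_right[OF der] by auto
  obtain d' where d': "d' > 0" "\<And>s. \<bar>s\<bar> < d' \<Longrightarrow> p + s *\<^sub>R \<nu> \<in> U" using inU[of \<nu>] by blast
  show "\<exists>s0>0. \<forall>s. 0 < s \<and> s < s0 \<longrightarrow> p + s *\<^sub>R \<nu> \<in> D"
  proof (intro exI[of _ "min d d'"] conjI allI impI)
    fix s assume "0 < s \<and> s < min d d'"
    then show "p + s *\<^sub>R \<nu> \<in> D" using d(2)[of s] d'(2)[of s] rp r by auto
  qed (use d d' in auto)
qed

lemma bdist_ball:
  fixes D :: "'a::euclidean_space set"
  assumes "z \<in> D"
  shows "ball z (bdist D z) \<subseteq> D"
proof
  fix y assume y: "y \<in> ball z (bdist D z)"
  show "y \<in> D"
  proof (rule ccontr)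
    assume "y \<notin> D"
    then have "closed_segment z y \<inter> frontier D \<noteq> {}"
      using assms by (intro connected_Int_frontier) auto
    then obtain x where x: "x \<in> closed_segment z y" "x \<in> frontier D" by blast
    have "bdist D z \<le> dist z x" unfolding bdist_def by (rule infdist_le[OF x(2)])
    also have "\<dots> \<le> dist z y" using segment_bound(1)[OF x(1)] by (simp add: dist_norm norm_minus_commute)
    finally show False using y by simp
  qed
qed

lemma bdist_triangle: "bdist D z \<le> bdist D w + dist z w"
  unfolding bdist_def by (rule infdist_triangle)

definition modulus :: "'a::metric_space set \<Rightarrow> ('a \<Rightarrow> 'b::metric_space) \<Rightarrow> real \<Rightarrow> real" where
  "modulus S \<nu> t = enn2real (modulus_of_continuity S \<nu> t)"

section \<open>Boundary geometry controlled by the modulus of continuity of the normal\<close>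

locale dini_convex =
  fixes D :: "(complex ^ 'n) set" and \<nu> :: "complex ^ 'n \<Rightarrow> complex ^ 'n"
  assumes open_D: "open D" and convex_D: "convex D" and bounded_D: "bounded D" and D_ne: "D \<noteq> {}"
    and normal: "p \<in> frontier D \<Longrightarrow> inner_unit_normal D p (\<nu> p)"
    and dini: "Dini_continuous_on (frontier D) \<nu>"
begin

lemma conn_D: "connected D" using convex_D by (rule convex_connected)

lemmas nu_norm = inner_unit_normal_convex(1)[OF open_D convex_D _ normal]
lemmas nu_pos = inner_unit_normal_convex(2)[OF open_D convex_D _ normal]
lemmas nu_in = inner_unit_normal_convex(3)[OF open_D convex_D _ normal]

lemma nu_closure: 
  assumes p: "p \<in> frontier D" and y: "y \<in> closure D"
  shows "(y - p) \<bullet> \<nu> p \<ge> 0"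
proof -
  have "closure D \<subseteq> {y. (y - p) \<bullet> \<nu> p \<ge> 0}"
  proof (rule closure_minimal)
    show "D \<subseteq> {y. (y - p) \<bullet> \<nu> p \<ge> 0}" using nu_pos[OF p p] by (auto intro: less_imp_le)
    show "closed {y. (y - p) \<bullet> \<nu> p \<ge> 0}" by (intro closed_Collect_le continuous_intros)
  qed
  then show ?thesis using y by auto
qed

lemma frontier_ne: "frontier D \<noteq> {}"
  using open_D bounded_D D_ne frontier_not_empty not_bounded_UNIV by blast

lemma bdist_attained:
  obtains q where "q \<in> frontier D" "bdist D z = dist z q"
  using infdist_attains_inf[OF frontier_closed frontier_ne, of z] by (metis bdist_def)

lemma bdist_pos: assumes "z \<in> D" shows "bdist D z > 0"
proof -
  obtain q where q: "q \<in> frontier D" "bdist D z = dist z q" by (rule bdist_attained)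
  have "q \<notin> D" using q(1) open_D by (simp add: frontier_def interior_open)
  then show ?thesis using q assms by auto
qed

text \<open>The ball of radius \<delta>(w) about w lies in the supporting half-space at b.\<close>

lemma bdist_le_inner:
  assumes b: "b \<in> frontier D" and w: "w \<in> D"
  shows "bdist D w \<le> (w - b) \<bullet> \<nu> b"
proof (rule field_le_epsilon)
  fix e :: real assume e: "e > 0"
  define t where "t = bdist D w - min e (bdist D w)"
  have t: "t < bdist D w" "t \<ge> 0" "bdist D w - e \<le> t" using e bdist_pos[OF w] by (auto simp: t_def)
  have n: "norm (\<nu> b) = 1" by (rule nu_norm[OF b b])
  have "w - t *\<^sub>R \<nu> b \<in> ball w (bdist D w)" using t n by (simp add: dist_norm)
  then have "w - t *\<^sub>R \<nu> b \<in> D" using bdist_ball[OF w] by blast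
  from nu_pos[OF b b this] have "0 < (w - b) \<bullet> \<nu> b - t * (\<nu> b \<bullet> \<nu> b)" by (simp add: inner_diff_left algebra_simps)
  then show "bdist D w \<le> (w - b) \<bullet> \<nu> b + e" using t n by (simp add: dot_square_norm)
qed

text \<open>\<open>bdist_le_inner\<close> forces equality in Cauchy-Schwarz, so z - q is a multiple
  of the normal.\<close>

lemma nearest_point:
  assumes z: "z \<in> D" and q: "q \<in> frontier D" "bdist D z = dist z q"
  shows "z = q + bdist D z *\<^sub>R \<nu> q"
proof -
  have n: "norm (\<nu> q) = 1" by (rule nu_norm[OF q(1) q(1)])
  have "norm (z - q) \<le> (z - q) \<bullet> \<nu> q" using bdist_le_inner[OF q(1) z] q(2) by (simp add: dist_norm)
  then have "(z - q) \<bullet> \<nu> q = norm (z - q) * norm (\<nu> q)" using norm_cauchy_schwarz[of "z - q" "\<nu> q"] n by simp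
  then have "norm (z - q) *\<^sub>R \<nu> q = norm (\<nu> q) *\<^sub>R (z - q)" by (simp add: norm_cauchy_schwarz_eq)
  then show ?thesis using n q(2) by (simp add: dist_norm)
qed

text \<open>Comparison with the half-space at the point of the boundary nearest to z: the supporting
  functional followed by a Cayley transform vanishing at z is a function into the disc.\<close>

lemma kobayashi_lower_bdist:
  assumes zw: "z \<in> D" "w \<in> D"
  shows "ln (bdist D w / bdist D z) / 2 \<le> kobayashi_dist D z w"
proof (cases "bdist D z < bdist D w")
  case False
  have "bdist D w / bdist D z \<le> 1" "bdist D w / bdist D z > 0" using False bdist_pos[OF zw(1)] bdist_pos[OF zw(2)] by auto
  then have "ln (bdist D w / bdist D z) \<le> 0" by simp
  then show ?thesis using kobayashi_nonneg[OF open_D conn_D zw] by simp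
next
  case True
  obtain b where b: "b \<in> frontier D" "bdist D z = dist z b" by (rule bdist_attained)
  define d where "d = bdist D z"
  have d: "d > 0" using bdist_pos[OF zw(1)] by (simp add: d_def)
  define l where "l = (\<lambda>y. cpair (y - b) (\<nu> b))"
  have lpos: "Re (l y) > 0" if "y \<in> D" for y
    unfolding l_def Re_cpair by (rule nu_pos[OF b(1) b(1) that])
  have dl: "(l has_derivative (\<lambda>x. cpair x (\<nu> b))) (at y)" for y
    unfolding l_def cpair_diff by (auto intro!: derivative_eq_intros has_derivative_cpair)
  have n: "norm (\<nu> b) = 1" by (rule nu_norm[OF b(1) b(1)])
  have "z - b = d *\<^sub>R \<nu> b" using nearest_point[OF zw(1) b] by (simp add: d_def algebra_simps)
  then have lz: "l z = of_real d" by (simp only: l_def cpair_scaleR cpair_self n) simp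
  define f where "f = (\<lambda>y. (l y - of_real d) / (l y + of_real d))"
  have lt: "cmod (l y - of_real d) < cmod (l y + of_real d)" if "y \<in> D" for y
  proof -
    have "(cmod (l y + of_real d))\<^sup>2 - (cmod (l y - of_real d))\<^sup>2 = 4 * d * Re (l y)"
      unfolding cmod_power2 by (simp add: power2_eq_square algebra_simps)
    also have "\<dots> > 0" using d lpos[OF that] by simp
    finally show ?thesis by (simp add: power2_less_imp_less)
  qed
  have f: "f \<in> maps_to_disc D"
    unfolding maps_to_disc_def
  proof (intro CollectI conjI ballI)
    fix y assume y: "y \<in> D"
    have ne: "l y + of_real d \<noteq> 0" using lt[OF y] by auto
    have "(f has_derivative (\<lambda>x. (cpair x (\<nu> b) * (l y + of_real d) - (l y - of_real d) * cpair x (\<nu> b)) / ((l y + of_real d) * (l y + of_real d)))) (at y)"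
      unfolding f_def using ne by (auto intro!: derivative_eq_intros dl)
    then show "\<exists>f'. (f has_derivative f') (at y) \<and> (\<forall>c v. f' (c *s v) = c * f' v)"
      by (rule_tac exI, rule_tac conjI, assumption) (simp add: field_simps)
  next
    have "cmod (f y) < 1" if "y \<in> D" for y
    proof -
      have "cmod (l y + of_real d) > 0" using lt[OF that] norm_ge_zero[of "l y - of_real d"] by linarith
      then show ?thesis using lt[OF that] by (simp add: f_def norm_divide)
    qed
    then show "f ` D \<subseteq> ball 0 1" by auto
  qed
  define x where "x = Re (l w)"
  have xw: "bdist D w \<le> x" using bdist_le_inner[OF b(1) zw(2)] by (simp add: x_def l_def Re_cpair del: cpair_diff)
  have x: "x > d" using xw True by (simp add: d_def)
  \<comment> \<open>For a given real part x the distance from d in the right half-plane is least at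
    the real point x.\<close>
  have "((x - d) * cmod (l w + of_real d))\<^sup>2 \<le> ((x + d) * cmod (l w - of_real d))\<^sup>2"
  proof -
    have "((x + d) * cmod (l w - of_real d))\<^sup>2 - ((x - d) * cmod (l w + of_real d))\<^sup>2 = 4 * x * d * (Im (l w))\<^sup>2"
      unfolding power_mult_distrib cmod_power2 x_def by (simp add: power2_eq_square algebra_simps)
    also have "\<dots> \<ge> 0" using x d by simp
    finally show ?thesis by simp
  qed
  then have le: "(x - d) * cmod (l w + of_real d) \<le> (x + d) * cmod (l w - of_real d)"
    by (rule power2_le_imp_le) (use x d in auto)
  have ge: "(x - d) / (x + d) \<le> cmod (f w)"
  proof -
    have "cmod (l w + of_real d) > 0" using lt[OF zw(2)] norm_ge_zero[of "l w - of_real d"] by linarith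
    moreover have "x + d > 0" using x d by simp
    ultimately show ?thesis
      using le by (simp only: f_def norm_divide) (simp add: pos_divide_le_eq pos_le_divide_eq mult.commute)
  qed
  have "ln (bdist D w / bdist D z) / 2 \<le> ln (x / d) / 2"
    using xw x d True bdist_pos[OF zw(2)] by (simp add: d_def[symmetric] divide_right_mono)
  also have "\<dots> = artanh ((x - d) / (x + d))"
  proof -
    have "1 + (x - d) / (x + d) = 2 * x / (x + d)" "1 - (x - d) / (x + d) = 2 * d / (x + d)"
      using x d by (simp_all add: field_simps)
    then have "(1 + (x - d) / (x + d)) / (1 - (x - d) / (x + d)) = x / d" using x d by simp
    then show ?thesis by (simp add: artanh_def)
  qed
  also have "\<dots> \<le> artanh (cmod (f w))"
    using ge x d maps_to_disc_norm[OF f zw(2)] by (intro artanh_mono) auto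
  also have "\<dots> = rho (f z) (f w)" by (simp add: f_def lz)
  also have "\<dots> \<le> kobayashi_dist D z w" by (rule rho_le_kobayashi[OF open_D conn_D f zw])
  finally show ?thesis .
qed

abbreviation "\<omega> \<equiv> modulus (frontier D) \<nu>"

lemma omega_enn: "modulus_of_continuity (frontier D) \<nu> t = ennreal (\<omega> t)"
proof -
  have "dist (\<nu> x) (\<nu> y) \<le> 2" if "x \<in> frontier D" "y \<in> frontier D" for x y
    using norm_triangle_ineq4[of "\<nu> x" "\<nu> y"] nu_norm[OF that(1) that(1)] nu_norm[OF that(2) that(2)] by (simp add: dist_norm)
  then have "modulus_of_continuity (frontier D) \<nu> t \<le> ennreal 2"
    unfolding modulus_of_continuity_def by (intro Sup_least) (auto intro!: ennreal_leI simp del: ennreal_numeral)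
  then have "modulus_of_continuity (frontier D) \<nu> t < top" by (rule order_le_less_trans) simp
  then show ?thesis by (simp add: modulus_def)
qed

lemma omega_nonneg: "0 \<le> \<omega> t" by (simp add: modulus_def)

lemma omega_le:
  assumes "x \<in> frontier D" "y \<in> frontier D" "dist x y \<le> t"
  shows "dist (\<nu> x) (\<nu> y) \<le> \<omega> t"
proof -
  have "ennreal (dist (\<nu> x) (\<nu> y)) \<le> modulus_of_continuity (frontier D) \<nu> t"
    unfolding modulus_of_continuity_def using assms by (intro Sup_upper) blast
  then show ?thesis using omega_nonneg by (simp add: omega_enn)
qed

lemma omega_mono: assumes "s \<le> t" shows "\<omega> s \<le> \<omega> t"
proof -
  have "modulus_of_continuity (frontier D) \<nu> s \<le> modulus_of_continuity (frontier D) \<nu> t"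
    unfolding modulus_of_continuity_def using assms by (intro Sup_subset_mono) force
  then show ?thesis using omega_nonneg by (simp add: omega_enn)
qed

text \<open>Dyadic form of the Dini integral: on the k-th dyadic interval, of length (1/2)^Suc k,
  the integrand is at least \<omega>((1/2)^Suc k) 2^k, so the interval contributes half of the k-th
  term.\<close>

lemma omega_summable: "summable (\<lambda>k. \<omega> ((1/2) ^ Suc k))"
proof -
  define I where "I = (\<integral>\<^sup>+t\<in>{0<..1}. modulus_of_continuity (frontier D) \<nu> t / ennreal t \<partial>lborel)"
  have I: "I < \<infinity>" using dini unfolding Dini_continuous_on_def I_def .
  define J where "J = (\<lambda>k::nat. {(1/2)^Suc k <.. (1/2::real) ^ k})"
  define c where "c = (\<lambda>k::nat. \<omega> ((1/2) ^ Suc k) * 2 ^ k)"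
  have c0: "c k \<ge> 0" for k using omega_nonneg by (simp add: c_def)
  have disj: "J i \<inter> J j = {}" if "i < j" for i j
  proof -
    have "(1/2::real) ^ j \<le> (1/2) ^ Suc i" using that by (intro power_decreasing) auto
    then show ?thesis by (auto simp: J_def)
  qed
  have "(\<Sum>k<N. \<omega> ((1/2) ^ Suc k)) \<le> 2 * enn2real I" for N
  proof -
    have pt: "(\<Sum>k<N. ennreal (c k) * indicator (J k) t) \<le> modulus_of_continuity (frontier D) \<nu> t / ennreal t * indicator {0<..1} t" for t
    proof (cases "\<exists>k<N. t \<in> J k")
      case True
      then obtain k where k: "k < N" "t \<in> J k" by blast
      have "(\<Sum>j<N. ennreal (c j) * indicator (J j) t) = (\<Sum>j<N. if j = k then ennreal (c k) else 0)"
      proof (rule sum.cong)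
        fix j show "ennreal (c j) * indicator (J j) t = (if j = k then ennreal (c k) else 0)"
          using disj[of j k] disj[of k j] k(2) by (cases j k rule: linorder_cases) (auto simp: indicator_def)
      qed simp
      also have "\<dots> = ennreal (c k)" using k(1) by simp
      finally have eq: "(\<Sum>j<N. ennreal (c j) * indicator (J j) t) = ennreal (c k)" .
      have t: "(1/2)^Suc k < t" "t \<le> (1/2)^k" using k(2) by (auto simp: J_def)
      have t0: "t > 0" using t(1) by (rule le_less_trans[rotated]) simp
      have t1: "t \<le> 1" using t(2) power_le_one[of "1/2::real" k] by simp
      have "c k * t \<le> \<omega> ((1/2)^Suc k) * 2^k * (1/2)^k" unfolding c_def using t(2) omega_nonneg by (intro mult_left_mono) auto
      also have "\<dots> = \<omega> ((1/2)^Suc k)" by (simp add: power_one_over)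
      also have "\<dots> \<le> \<omega> t" using t(1) by (intro omega_mono) auto
      finally have "c k \<le> \<omega> t / t" using t0 by (simp add: field_simps)
      then have "ennreal (c k) \<le> ennreal (\<omega> t / t)" by (rule ennreal_leI)
      also have "\<dots> = modulus_of_continuity (frontier D) \<nu> t / ennreal t"
        using t0 omega_nonneg by (simp add: omega_enn divide_ennreal)
      finally show ?thesis using eq t0 t1 by simp
    next
      case False
      then have "(\<Sum>k<N. ennreal (c k) * indicator (J k) t) = 0" by (intro sum.neutral) (auto simp: indicator_def)
      then show ?thesis by simp
    qed
    have "(\<Sum>k<N. ennreal (c k) * emeasure lborel (J k)) = (\<Sum>k<N. \<integral>\<^sup>+t. ennreal (c k) * indicator (J k) t \<partial>lborel)"
      by (intro sum.cong refl) (simp add: J_def nn_integral_cmult_indicator)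
    also have "\<dots> = (\<integral>\<^sup>+t. (\<Sum>k<N. ennreal (c k) * indicator (J k) t) \<partial>lborel)"
      by (rule nn_integral_sum[symmetric]) (simp add: J_def)
    also have "\<dots> \<le> I" unfolding I_def by (rule nn_integral_mono[OF pt])
    also have "(\<Sum>k<N. ennreal (c k) * emeasure lborel (J k)) = ennreal (\<Sum>k<N. \<omega> ((1/2)^Suc k) / 2)"
    proof -
      have "ennreal (c k) * emeasure lborel (J k) = ennreal (\<omega> ((1/2)^Suc k) / 2)" for k
      proof -
        have le: "(1/2::real)^Suc k \<le> (1/2)^k" by (intro power_decreasing) auto
        have "emeasure lborel (J k) = ennreal ((1/2)^k - (1/2)^Suc k)" unfolding J_def using le by simp
        moreover have "c k * ((1/2)^k - (1/2)^Suc k) = \<omega> ((1/2)^Suc k) / 2"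
          by (simp add: c_def power_one_over field_simps)
        ultimately show ?thesis using c0 le by (simp add: ennreal_mult[symmetric])
      qed
      then show ?thesis using omega_nonneg by (simp add: sum_ennreal)
    qed
    finally have "ennreal (\<Sum>k<N. \<omega> ((1/2)^Suc k) / 2) \<le> ennreal (enn2real I)" using I by simp
    then have "(\<Sum>k<N. \<omega> ((1/2)^Suc k) / 2) \<le> enn2real I" by simp
    then show ?thesis by (simp add: sum_divide_distrib[symmetric])
  qed
  then show ?thesis using omega_nonneg by (intro summableI_nonneg_bounded) auto
qed

lemma omega_small: 
  assumes "e > 0"
  obtains t where "t > 0" "\<omega> t \<le> e"
proof -
  have "(\<lambda>k. \<omega> ((1/2) ^ Suc k)) \<longlonglongrightarrow> 0" by (rule summable_LIMSEQ_zero[OF omega_summable])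
  then have "\<forall>\<^sub>F k in sequentially. \<omega> ((1/2) ^ Suc k) < e" using assms by (rule order_tendstoD)
  then obtain k where "\<omega> ((1/2) ^ Suc k) < e" using eventually_happens trivial_limit_sequentially by blast
  then show ?thesis by (intro that[of "(1/2) ^ Suc k"]) auto
qed

lemma frontier_on_segment:
  assumes x: "x \<in> D" and y: "y \<notin> D"
  obtains b where "b \<in> frontier D" "b \<in> closed_segment x y"
proof -
  have "closed_segment x y \<inter> frontier D \<noteq> {}"
    using assms by (intro connected_Int_frontier) auto
  then show ?thesis using that by blast
qed

lemma inner_close:
  assumes "a \<in> frontier D" "b \<in> frontier D" "dist a b \<le> t" "\<omega> t \<le> 1/2"
  shows "\<nu> a \<bullet> \<nu> b \<ge> 1/2"
proof -
  have "dist (\<nu> a) (\<nu> b) \<le> 1/2" using omega_le[OF assms(1-3)] assms(4) by linarith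
  then have "(norm (\<nu> a - \<nu> b))\<^sup>2 \<le> (1/2)\<^sup>2" by (intro power_mono) (auto simp: dist_norm)
  moreover have "(norm (\<nu> a - \<nu> b))\<^sup>2 = 2 - 2 * (\<nu> a \<bullet> \<nu> b)"
  proof -
    have "\<nu> a \<bullet> \<nu> a = 1" "\<nu> b \<bullet> \<nu> b = 1"
      using nu_norm[OF assms(1) assms(1)] nu_norm[OF assms(2) assms(2)] by (simp_all add: dot_square_norm)
    then show ?thesis unfolding power2_norm_eq_inner by (simp add: inner_diff_left inner_diff_right inner_commute[of "\<nu> b" "\<nu> a"])
  qed
  ultimately show ?thesis by (simp add: power2_eq_square)
qed

text \<open>If the ray left D, it would meet the boundary at some b = q + c \<nu>(q) with c > 0
  whose normal is close to \<nu>(q); then q would be on the wrong side of the supporting hyperplane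
  at b.\<close>

lemma normal_ray:
  assumes q: "q \<in> frontier D" and t0: "\<omega> t0 \<le> 1/2" and s: "0 < s" "s \<le> t0"
  shows "q + s *\<^sub>R \<nu> q \<in> D"
proof (rule ccontr)
  assume no: "q + s *\<^sub>R \<nu> q \<notin> D"
  obtain s1 where s1: "s1 > 0" "\<And>s. 0 < s \<Longrightarrow> s < s1 \<Longrightarrow> q + s *\<^sub>R \<nu> q \<in> D" using nu_in[OF q q] by blast
  define s2 where "s2 = min s1 s / 2"
  have s2: "0 < s2" "s2 < s1" "s2 < s" using s1 s by (auto simp: s2_def)
  obtain b where b: "b \<in> frontier D" "b \<in> closed_segment (q + s2 *\<^sub>R \<nu> q) (q + s *\<^sub>R \<nu> q)"
    using frontier_on_segment[OF s1(2)[OF s2(1,2)] no] by blast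
  then obtain u where u: "0 \<le> u" "u \<le> 1" "b = (1 - u) *\<^sub>R (q + s2 *\<^sub>R \<nu> q) + u *\<^sub>R (q + s *\<^sub>R \<nu> q)"
    by (auto simp: in_segment)
  define c where "c = (1 - u) * s2 + u * s"
  have bq: "b = q + c *\<^sub>R \<nu> q" by (simp add: u(3) c_def algebra_simps)
  have "(1 - u) * s2 + u * s2 \<le> c" using u s2 by (auto simp: c_def intro!: mult_left_mono)
  then have c0: "c > 0" using s2 by (simp add: algebra_simps)
  have "c \<le> (1 - u) * s + u * s" using u s2 by (auto simp: c_def intro!: mult_left_mono)
  then have c1: "c \<le> s" by (simp add: algebra_simps)
  have "dist q b = c" using c0 nu_norm[OF q q] by (simp add: bq dist_norm)
  then have "\<nu> q \<bullet> \<nu> b \<ge> 1/2" using c1 s by (intro inner_close[OF q b(1) _ t0]) auto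
  moreover have "(q - b) \<bullet> \<nu> b \<ge> 0" using q by (intro nu_closure[OF b(1)]) (simp add: frontier_def)
  then have "c * (\<nu> q \<bullet> \<nu> b) \<le> 0" by (simp add: bq)
  ultimately show False using c0 by (simp add: mult_le_0_iff)
qed

text \<open>The distance to the nearest boundary point b is measured along \<nu>(b), and there the
  displacement s \<nu>(q) contributes at least s/2.\<close>

lemma normal_ray_depth:
  assumes q: "q \<in> frontier D" and t0: "\<omega> t0 \<le> 1/2" and s: "0 < s" "2 * s \<le> t0"
  shows "s / 2 \<le> bdist D (q + s *\<^sub>R \<nu> q)"
proof -
  define y where "y = q + s *\<^sub>R \<nu> q"
  have y: "y \<in> D" unfolding y_def using s by (intro normal_ray[OF q t0]) auto
  obtain b where b: "b \<in> frontier D" "bdist D y = dist y b" by (rule bdist_attained)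
  have yq: "dist y q = s" using s nu_norm[OF q q] by (simp add: y_def dist_norm)
  have "bdist D y \<le> dist y q" unfolding bdist_def by (rule infdist_le[OF q])
  then have "dist q b \<le> t0" using b(2) yq s dist_triangle[of q b y] by (simp add: dist_commute)
  then have c: "\<nu> q \<bullet> \<nu> b \<ge> 1/2" by (intro inner_close[OF q b(1) _ t0])
  have yb: "y - b = dist y b *\<^sub>R \<nu> b" using nearest_point[OF y b] b(2) by (simp add: algebra_simps)
  have "(y - b) \<bullet> \<nu> b = dist y b"
    unfolding yb using nu_norm[OF b(1) b(1)] by (simp add: dot_square_norm)
  moreover have "(y - b) \<bullet> \<nu> b = (q - b) \<bullet> \<nu> b + s * (\<nu> q \<bullet> \<nu> b)" by (simp add: y_def algebra_simps inner_diff_left inner_add_left)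
  moreover have "(q - b) \<bullet> \<nu> b \<ge> 0" using q by (intro nu_closure[OF b(1)]) (simp add: frontier_def)
  moreover have "s * (\<nu> q \<bullet> \<nu> b) \<ge> s * (1/2)" using s c by (intro mult_left_mono) auto
  ultimately show ?thesis using b(2) by (simp add: y_def)
qed

lemma inner_i_smult_self: "(\<i> *s v) \<bullet> v = 0" for v :: "complex ^ 'n"
  unfolding Re_cpair[symmetric] cpair_scale cpair_self by (simp del: of_real_power)

text \<open>In the complex normal line the direction \<i> \<nu>(q) is tangent to the boundary at q,
  and the boundary can rise along it only as fast as the normal turns, by about |Im c| \<omega>(2
  |Im c|).\<close>

lemma complex_normal_height:
  assumes q: "q \<in> frontier D" and t0: "\<omega> t0 \<le> 1/2"
    and c: "Re c > 0" "2 * (Re c + 3 * \<bar>Im c\<bar>) \<le> t0" "Re c > 2 * \<bar>Im c\<bar> * \<omega> (2 * \<bar>Im c\<bar>)"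
  shows "q + c *s \<nu> q \<in> D"
proof (rule ccontr)
  define X Y where "X = Re c" and "Y = Im c"
  define \<tau> where "\<tau> = \<i> *s \<nu> q"
  have n: "norm (\<nu> q) = 1" by (rule nu_norm[OF q q])
  have n\<tau>: "norm \<tau> = 1" by (simp add: \<tau>_def norm_vec_scale n)
  have "c = of_real X + of_real Y * \<i>" by (simp add: X_def Y_def complex_eq_iff)
  then have "c *s \<nu> q = of_real X *s \<nu> q + (of_real Y * \<i>) *s \<nu> q"
    by (simp only: vector_sadd_rdistrib)
  then have ceq: "c *s \<nu> q = X *\<^sub>R \<nu> q + Y *\<^sub>R \<tau>"
    by (simp add: \<tau>_def vec_eq_iff scaleR_conv_of_real[where 'a = complex])
  assume no: "q + c *s \<nu> q \<notin> D"
  have Y0: "Y \<noteq> 0"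
  proof
    assume "Y = 0"
    then have "q + c *s \<nu> q = q + X *\<^sub>R \<nu> q" using ceq by simp
    moreover have "q + X *\<^sub>R \<nu> q \<in> D" using c by (intro normal_ray[OF q t0]) (auto simp: X_def)
    ultimately show False using no by simp
  qed
  \<comment> \<open>Raised by 3 |Y|, the point is in D because the normal ray there has depth at
    least (X + s)/2 > |Y|. Going down from it, a boundary point b lies above the given one.\<close>
  define s where "s = 3 * \<bar>Y\<bar>"
  have s: "s > 0" using Y0 by (simp add: s_def)
  have X: "X > 0" "2 * (X + s) \<le> t0" using c by (auto simp: X_def s_def Y_def)
  define y where "y = q + (X + s) *\<^sub>R \<nu> q + Y *\<^sub>R \<tau>"
  have yD: "y \<in> D"
  proof -
    have "(X + s) / 2 \<le> bdist D (q + (X + s) *\<^sub>R \<nu> q)" using X s by (intro normal_ray_depth[OF q t0]) auto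
    moreover have "dist (q + (X + s) *\<^sub>R \<nu> q) y = \<bar>Y\<bar>" by (simp add: y_def dist_norm n\<tau>)
    moreover have "\<bar>Y\<bar> < (X + s) / 2" using X Y0 by (simp add: s_def)
    moreover have "q + (X + s) *\<^sub>R \<nu> q \<in> D" using X s by (intro normal_ray[OF q t0]) auto
    ultimately show ?thesis using bdist_ball[of "q + (X + s) *\<^sub>R \<nu> q" D] by auto
  qed
  obtain b where b: "b \<in> frontier D" "b \<in> closed_segment y (q + c *s \<nu> q)"
    using frontier_on_segment[OF yD no] by blast
  then obtain u where u: "0 \<le> u" "u \<le> 1" "b = (1 - u) *\<^sub>R y + u *\<^sub>R (q + c *s \<nu> q)" by (auto simp: in_segment)
  define e where "e = (1 - u) * s"
  have e: "0 \<le> e" "e \<le> s" using u s by (auto simp: e_def mult_le_cancel_right1)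
  have beq: "b = q + (X + e) *\<^sub>R \<nu> q + Y *\<^sub>R \<tau>"
    by (simp add: u(3) y_def ceq e_def algebra_simps)
  have dqb: "dist q b \<le> X + e + \<bar>Y\<bar>"
  proof -
    have "b - q = (X + e) *\<^sub>R \<nu> q + Y *\<^sub>R \<tau>" by (simp add: beq)
    then have "norm (b - q) \<le> norm ((X + e) *\<^sub>R \<nu> q) + norm (Y *\<^sub>R \<tau>)" by (simp only: norm_triangle_ineq)
    then show ?thesis using n n\<tau> X(1) e(1) by (simp add: dist_norm norm_minus_commute)
  qed
  have "X + e + \<bar>Y\<bar> \<le> t0" using X e s by (simp add: s_def)
  then have d1: "dist q b \<le> t0" using dqb by simp
  have c1: "\<nu> q \<bullet> \<nu> b \<ge> 1/2" by (rule inner_close[OF q b(1) d1 t0])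
  have key: "(X + e) / 2 \<le> \<bar>Y\<bar> * dist (\<nu> q) (\<nu> b)"
  proof -
    have "(q - b) \<bullet> \<nu> b \<ge> 0" using q by (intro nu_closure[OF b(1)]) (simp add: frontier_def)
    moreover have "(q - b) \<bullet> \<nu> b = - ((X + e) * (\<nu> q \<bullet> \<nu> b)) - Y * (\<tau> \<bullet> \<nu> b)"
      by (simp add: beq inner_diff_left inner_add_left algebra_simps)
    moreover have "(X + e) * (1/2) \<le> (X + e) * (\<nu> q \<bullet> \<nu> b)" using X e c1 by (intro mult_left_mono) auto
    moreover have "- (Y * (\<tau> \<bullet> \<nu> b)) \<le> \<bar>Y\<bar> * dist (\<nu> q) (\<nu> b)"
    proof -
      have "\<tau> \<bullet> \<nu> q = 0" unfolding \<tau>_def by (rule inner_i_smult_self)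
      then have "\<tau> \<bullet> \<nu> b = \<tau> \<bullet> (\<nu> b - \<nu> q)" by (simp add: inner_diff_right)
      then have "\<bar>\<tau> \<bullet> \<nu> b\<bar> \<le> dist (\<nu> q) (\<nu> b)"
        using Cauchy_Schwarz_ineq2[of \<tau> "\<nu> b - \<nu> q"] n\<tau> by (simp add: dist_norm norm_minus_commute)
      then have "\<bar>Y\<bar> * \<bar>\<tau> \<bullet> \<nu> b\<bar> \<le> \<bar>Y\<bar> * dist (\<nu> q) (\<nu> b)" by (intro mult_left_mono) auto
      then show ?thesis by (simp add: abs_mult[symmetric] abs_le_iff)
    qed
    ultimately show ?thesis by linarith
  qed
  \<comment> \<open>Bootstrapping: the crude bound 1/2 gives X + e \<le> |Y|, so b is within 2 |Y|
    of q, and the modulus may be taken at that scale.\<close>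
  have "dist (\<nu> q) (\<nu> b) \<le> 1/2" using omega_le[OF q b(1) d1] t0 by linarith
  then have "\<bar>Y\<bar> * dist (\<nu> q) (\<nu> b) \<le> \<bar>Y\<bar> * (1/2)" by (intro mult_left_mono) auto
  from order_trans[OF key this] have "dist q b \<le> 2 * \<bar>Y\<bar>" using dqb by simp
  then have "\<bar>Y\<bar> * dist (\<nu> q) (\<nu> b) \<le> \<bar>Y\<bar> * \<omega> (2 * \<bar>Y\<bar>)" by (intro mult_left_mono omega_le[OF q b(1)]) auto
  from order_trans[OF key this] have "X \<le> 2 * \<bar>Y\<bar> * \<omega> (2 * \<bar>Y\<bar>)" using e(1) by simp
  then show False using c(3) by (simp add: X_def Y_def)
qed

end

subsection \<open>Analytic discs in the normal direction\<close>

text \<open>The building block behaves like \<zeta> for small |\<zeta>|; once |\<zeta>| \<ge> 1/p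
  its real part is at least of order 1/p, however close \<zeta> is to the imaginary axis.\<close>

lemma Re_div_1_plus:
  assumes z: "Re \<zeta> > 0" and p: "p \<ge> 0"
  shows "1 \<le> cmod (1 + of_real p * \<zeta>)" "0 \<le> Re (\<zeta> / (1 + of_real p * \<zeta>))"
    "1 \<le> p * cmod \<zeta> \<Longrightarrow> 1 / (2 * p) \<le> Re (\<zeta> / (1 + of_real p * \<zeta>))"
proof -
  have "Re (1 + of_real p * \<zeta>) \<ge> 1" using z p by simp
  then show n1: "1 \<le> cmod (1 + of_real p * \<zeta>)" using complex_Re_le_cmod order_trans by blast
  define N where "N = (cmod (1 + of_real p * \<zeta>))\<^sup>2"
  have N: "N = 1 + 2 * p * Re \<zeta> + p\<^sup>2 * (cmod \<zeta>)\<^sup>2"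
    unfolding N_def cmod_power2 by (simp add: power2_eq_square algebra_simps)
  have N0: "N > 0" using zero_less_power[of "cmod (1 + of_real p * \<zeta>)" 2] n1 unfolding N_def by linarith
  have R: "Re (\<zeta> / (1 + of_real p * \<zeta>)) = (Re \<zeta> + p * (cmod \<zeta>)\<^sup>2) / N"
    unfolding Re_divide N_def cmod_power2 by (simp add: power2_eq_square algebra_simps)
  show "0 \<le> Re (\<zeta> / (1 + of_real p * \<zeta>))" unfolding R using z p N0 by simp
  assume pz: "1 \<le> p * cmod \<zeta>"
  have p0: "p > 0" using pz p by (cases "p = 0") auto
  have "1 \<le> (p * cmod \<zeta>)\<^sup>2" using pz by (simp add: one_le_power)
  then have "N \<le> 2 * p * (Re \<zeta> + p * (cmod \<zeta>)\<^sup>2)" by (simp add: N power_mult_distrib algebra_simps power2_eq_square)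
  then show "1 / (2 * p) \<le> Re (\<zeta> / (1 + of_real p * \<zeta>))" unfolding R using N0 p0 by (simp add: field_simps)
qed

text \<open>The \<open>k\<close>-th term contributes \<open>a k / p k\<close> to the real part once \<open>cmod \<zeta> \<ge> 1 / p k\<close>. With
  \<open>a k\<close> the modulus of continuity of the normal at a scale comparable to \<open>1 / p k\<close> this outweighs the deviation of the
  boundary from its tangent plane, and the Dini condition makes the sum finite.\<close>

definition dini_map :: "(nat \<Rightarrow> real) \<Rightarrow> (nat \<Rightarrow> real) \<Rightarrow> complex \<Rightarrow> complex" where
  "dini_map a p \<zeta> = \<zeta> + 16 * (\<Sum>k. of_real (a k) * (\<zeta> / (1 + of_real (p k) * \<zeta>)))"

lemma dini_series:
  fixes a p :: "nat \<Rightarrow> real"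
  assumes a: "\<And>k. a k \<ge> 0" "summable a" "16 * suminf a \<le> 1" and p: "\<And>k. p k \<ge> 0"
  defines "\<Phi> \<equiv> dini_map a p"
  shows "\<Phi> holomorphic_on {\<zeta>. Re \<zeta> > 0}"
    and "\<And>\<zeta>. Re \<zeta> > 0 \<Longrightarrow> cmod (\<Phi> \<zeta>) \<le> 2 * cmod \<zeta>"
    and "\<And>\<zeta> k. Re \<zeta> > 0 \<Longrightarrow> 1 \<le> p k * cmod \<zeta> \<Longrightarrow> Re \<zeta> + 8 * a k / p k \<le> Re (\<Phi> \<zeta>)"
    and "\<And>t. t > 0 \<Longrightarrow> \<exists>c. \<Phi> (of_real t) = of_real c \<and> t \<le> c \<and> c \<le> 2 * t"
proof -
  define u where "u = (\<lambda>k (\<zeta>::complex). of_real (a k) * (\<zeta> / (1 + of_real (p k) * \<zeta>)))"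
  have \<Phi>: "\<Phi> = (\<lambda>\<zeta>. \<zeta> + 16 * (\<Sum>k. u k \<zeta>))" by (simp add: \<Phi>_def u_def dini_map_def fun_eq_iff)
  have ub: "cmod (u k \<zeta>) \<le> a k * cmod \<zeta>" if "Re \<zeta> > 0" for k \<zeta>
  proof -
    have "cmod \<zeta> / cmod (1 + of_real (p k) * \<zeta>) \<le> cmod \<zeta> / 1"
      using Re_div_1_plus(1)[OF that p[of k]] by (intro divide_left_mono) auto
    from mult_left_mono[OF this a(1)[of k]] show ?thesis using a(1)[of k] by (simp add: u_def norm_mult norm_divide)
  qed
  have sa: "summable (\<lambda>k. a k * c)" for c using a(2) by (rule summable_mult2)
  have su: "summable (\<lambda>k. u k \<zeta>)" and nsu: "cmod (\<Sum>k. u k \<zeta>) \<le> suminf a * cmod \<zeta>" if "Re \<zeta> > 0" for \<zeta>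
  proof -
    show "summable (\<lambda>k. u k \<zeta>)" using ub[OF that] by (intro summable_comparison_test[OF _ sa]) auto
    have sn: "summable (\<lambda>k. cmod (u k \<zeta>))" using ub[OF that] by (intro summable_comparison_test[OF _ sa]) auto
    have "cmod (\<Sum>k. u k \<zeta>) \<le> (\<Sum>k. cmod (u k \<zeta>))" by (rule summable_norm[OF sn])
    also have "\<dots> \<le> (\<Sum>k. a k * cmod \<zeta>)" by (rule suminf_le[OF ub[OF that] sn sa])
    also have "\<dots> = suminf a * cmod \<zeta>" by (rule suminf_mult2[OF a(2), symmetric])
    finally show "cmod (\<Sum>k. u k \<zeta>) \<le> suminf a * cmod \<zeta>" .
  qed
  have op: "open {\<zeta>::complex. Re \<zeta> > 0}" by (rule open_halfspace_Re_gt)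
  have "(\<lambda>\<zeta>. \<Sum>k. u k \<zeta>) holomorphic_on {\<zeta>. Re \<zeta> > 0}"
  proof (rule holomorphic_uniform_sequence[OF op])
    have "u k holomorphic_on {\<zeta>. Re \<zeta> > 0}" for k
      unfolding u_def using Re_div_1_plus(1)[OF _ p[of k]] by (intro holomorphic_intros) force
    then show "(\<lambda>\<zeta>. \<Sum>k<n. u k \<zeta>) holomorphic_on {\<zeta>. Re \<zeta> > 0}" for n by (intro holomorphic_intros)
    fix x :: complex assume "x \<in> {\<zeta>. Re \<zeta> > 0}"
    then obtain d where d: "d > 0" "cball x d \<subseteq> {\<zeta>. Re \<zeta> > 0}" using op open_contains_cball by blast
    have "uniform_limit (cball x d) (\<lambda>n \<zeta>. \<Sum>k<n. u k \<zeta>) (\<lambda>\<zeta>. \<Sum>k. u k \<zeta>) sequentially"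
    proof (rule Weierstrass_m_test[OF _ sa[of "cmod x + d"]])
      fix n \<zeta> assume z: "\<zeta> \<in> cball x d"
      have "cmod \<zeta> \<le> cmod x + d" using z norm_triangle_sub[of \<zeta> x] by (simp add: dist_norm norm_minus_commute)
      then show "cmod (u n \<zeta>) \<le> a n * (cmod x + d)"
        using ub[of \<zeta> n] d z a(1)[of n] by (smt (verit, best) mem_Collect_eq mult_left_mono subset_eq)
    qed
    then show "\<exists>d>0. cball x d \<subseteq> {\<zeta>. 0 < Re \<zeta>} \<and>
         uniform_limit (cball x d) (\<lambda>n \<zeta>. \<Sum>k<n. u k \<zeta>) (\<lambda>\<zeta>. \<Sum>k. u k \<zeta>) sequentially" using d by blast
  qed
  then show "\<Phi> holomorphic_on {\<zeta>. Re \<zeta> > 0}" unfolding \<Phi> by (intro holomorphic_intros)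
  have n16: "cmod (16 * (\<Sum>k. u k \<zeta>)) \<le> cmod \<zeta>" if "Re \<zeta> > 0" for \<zeta>
  proof -
    have "cmod (16 * (\<Sum>k. u k \<zeta>)) \<le> (16 * suminf a) * cmod \<zeta>" using nsu[OF that] by (simp add: norm_mult)
    also have "\<dots> \<le> 1 * cmod \<zeta>" using a(3) by (intro mult_right_mono) auto
    finally show ?thesis by simp
  qed
  show "cmod (\<Phi> \<zeta>) \<le> 2 * cmod \<zeta>" if "Re \<zeta> > 0" for \<zeta>
    using n16[OF that] norm_triangle_ineq[of \<zeta> "16 * (\<Sum>k. u k \<zeta>)"] by (simp add: \<Phi>)
  have Reu: "0 \<le> Re (u k \<zeta>)" "1 \<le> p k * cmod \<zeta> \<Longrightarrow> a k / (2 * p k) \<le> Re (u k \<zeta>)" if "Re \<zeta> > 0" for k \<zeta>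
  proof -
    have e: "Re (u k \<zeta>) = a k * Re (\<zeta> / (1 + of_real (p k) * \<zeta>))" unfolding u_def by (simp only: times_complex.sel Re_complex_of_real Im_complex_of_real mult_zero_left diff_zero)
    show "0 \<le> Re (u k \<zeta>)" unfolding e using Re_div_1_plus(2)[OF that p[of k]] a(1)[of k] by (rule mult_nonneg_nonneg[rotated])
    show "a k / (2 * p k) \<le> Re (u k \<zeta>)" if "1 \<le> p k * cmod \<zeta>"
      unfolding e using mult_left_mono[OF Re_div_1_plus(3)[OF \<open>Re \<zeta> > 0\<close> p[of k] that] a(1)[of k]] by simp
  qed
  have Resum: "Re (\<Sum>k. u k \<zeta>) = (\<Sum>k. Re (u k \<zeta>))" "summable (\<lambda>k. Re (u k \<zeta>))" if "Re \<zeta> > 0" for \<zeta>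
    using su[OF that] by (simp_all add: Re_suminf summable_Re)
  show "Re \<zeta> + 8 * a k / p k \<le> Re (\<Phi> \<zeta>)" if z: "Re \<zeta> > 0" "1 \<le> p k * cmod \<zeta>" for \<zeta> k
  proof -
    have "Re (u k \<zeta>) = (\<Sum>j\<in>{k}. Re (u j \<zeta>))" by simp
    also have "\<dots> \<le> (\<Sum>j. Re (u j \<zeta>))" by (rule sum_le_suminf[OF Resum(2)[OF z(1)]]) (use Reu(1)[OF z(1)] in auto)
    finally have "a k / (2 * p k) \<le> Re (\<Sum>k. u k \<zeta>)" using Reu(2)[OF z] Resum(1)[OF z(1)] by simp
    then have "16 * (a k / (2 * p k)) \<le> 16 * Re (\<Sum>k. u k \<zeta>)" by simp
    then show ?thesis by (simp add: \<Phi>)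
  qed
  show "\<exists>c. \<Phi> (of_real t) = of_real c \<and> t \<le> c \<and> c \<le> 2 * t" if t: "t > 0" for t
  proof -
    have Rt: "Re (of_real t) > 0" using t by simp
    have ur: "u k (of_real t) = of_real (a k * (t / (1 + p k * t)))" for k by (simp add: u_def)
    have s: "summable (\<lambda>k. a k * (t / (1 + p k * t)))" using Resum(2)[OF Rt] by (simp add: ur del: of_real_mult of_real_divide)
    define c where "c = t + 16 * (\<Sum>k. a k * (t / (1 + p k * t)))"
    have "(\<Sum>k. u k (of_real t)) = of_real (\<Sum>k. a k * (t / (1 + p k * t)))" unfolding ur by (rule suminf_of_real[OF s, symmetric])
    then have e: "\<Phi> (of_real t) = of_real c" by (simp add: \<Phi> c_def)
    have "0 \<le> (\<Sum>k. a k * (t / (1 + p k * t)))"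
      using a(1) p t by (intro suminf_nonneg[OF s]) (simp add: add_nonneg_nonneg)
    then have "t \<le> c" by (simp add: c_def)
    moreover have "c - t \<le> t" using n16[OF Rt] e t unfolding \<Phi>
      by (metis Re_complex_of_real abs_of_pos add_diff_cancel_left' complex_Re_le_cmod minus_complex.sel(1) norm_of_real order_trans)
    ultimately show ?thesis using e by auto
  qed
qed

context dini_convex
begin

text \<open>At dyadic scale (1/2)^n \<le> |\<zeta>| < 2 (1/2)^n the term with p k = 2^n alone raises
  Re \<Phi> by more than 4 a k |\<zeta>|. This exceeds the height demanded by
  \<open>complex_normal_height\<close>, since |Im \<Phi>| \<le> 2 |\<zeta>|.\<close>

lemma normal_map:
  obtains R0 \<Phi> where "R0 > 0" "\<omega> (2 * R0) \<le> 1/2" "\<Phi> holomorphic_on {\<zeta>. Re \<zeta> > 0}"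
    "\<And>\<zeta>. Re \<zeta> > 0 \<Longrightarrow> cmod (\<Phi> \<zeta>) \<le> 2 * cmod \<zeta>"
    "\<And>t. t > 0 \<Longrightarrow> \<exists>c. \<Phi> (of_real t) = of_real c \<and> t \<le> c \<and> c \<le> 2 * t"
    "\<And>q \<zeta>. q \<in> frontier D \<Longrightarrow> Re \<zeta> > 0 \<Longrightarrow> cmod \<zeta> \<le> R0 \<Longrightarrow> q + \<Phi> \<zeta> *s \<nu> q \<in> D"
proof -
  obtain t0 where t0: "t0 > 0" "\<omega> t0 \<le> 1/2" using omega_small[of "1/2"] by auto
  obtain j0 where j0: "norm (\<Sum>k. \<omega> ((1/2) ^ Suc (k + j0))) < 1/16"
    using suminf_exist_split[OF _ omega_summable, of "1/16"] by auto
  define a where "a = (\<lambda>k. \<omega> ((1/2) ^ Suc (k + j0)))"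
  \<comment> \<open>The shift 4 makes a k equal to \<omega>(8 (1/2)^(k + k0)), the modulus at a
    scale above 2 |Im \<Phi>| < 8 (1/2)^n.\<close>
  define k0 where "k0 = j0 + 4"
  define p where "p = (\<lambda>k. 2 ^ (k + k0) :: real)"
  have a8: "a k = \<omega> (8 * (1/2) ^ (k + k0))" for k by (simp add: a_def k0_def power_add field_simps)
  have sa: "summable a" unfolding a_def using summable_ignore_initial_segment[OF omega_summable, of j0] by simp
  have a: "\<And>k. a k \<ge> 0" "summable a" "16 * suminf a \<le> 1" and p: "\<And>k. p k \<ge> 0"
    using j0 sa omega_nonneg by (auto simp: a_def p_def)
  define \<Phi> where "\<Phi> = dini_map a p"
  note ds = dini_series[of a p, OF a p, folded \<Phi>_def]
  \<comment> \<open>The factor 16 is 2 (2 + 3 * 2): both parts of \<Phi> are at most 2 |\<zeta>| in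
    the size condition of \<open>complex_normal_height\<close>.\<close>
  define R0 where "R0 = min ((1/2) ^ k0) (t0 / 16)"
  have R0: "R0 > 0" "R0 \<le> (1/2)^k0" "16 * R0 \<le> t0" using t0 by (auto simp: R0_def)
  show ?thesis
  proof (rule that[of R0 \<Phi>])
    have "\<omega> (2 * R0) \<le> \<omega> t0" using R0 by (intro omega_mono) auto
    then show "\<omega> (2 * R0) \<le> 1/2" using t0 by simp
    fix q \<zeta> assume q: "q \<in> frontier D" and z: "Re \<zeta> > 0" "cmod \<zeta> \<le> R0"
    have z0: "cmod \<zeta> > 0" using z(1) by auto
    obtain n0 where "(1/2::real) ^ n0 < cmod \<zeta>" using real_arch_pow_inv[OF z0, of "1/2"] by auto
    then have ex: "(1/2::real) ^ n0 \<le> cmod \<zeta>" by simp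
    define n where "n = (LEAST n. (1/2::real) ^ n \<le> cmod \<zeta>)"
    have n: "(1/2::real) ^ n \<le> cmod \<zeta>" unfolding n_def by (rule LeastI[where P = "\<lambda>n. (1/2::real) ^ n \<le> cmod \<zeta>", OF ex])
    have nk: "n \<ge> k0"
    proof (rule ccontr)
      assume "\<not> n \<ge> k0"
      then have "(1/2::real) ^ k0 < (1/2) ^ n" by (intro power_strict_decreasing) auto
      then show False using n z(2) R0(2) by linarith
    qed
    have n2: "cmod \<zeta> < 2 * (1/2) ^ n"
    proof -
      have "n > 0" using nk by (simp add: k0_def)
      then have "\<not> (1/2::real) ^ (n - 1) \<le> cmod \<zeta>" unfolding n_def using not_less_Least by (metis diff_less zero_less_one)
      moreover have "(1/2::real) ^ (n - 1) = 2 * (1/2) ^ n" using \<open>n > 0\<close> by (cases n) auto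
      ultimately show ?thesis by simp
    qed
    define k where "k = n - k0"
    have kn: "k + k0 = n" using nk by (simp add: k_def)
    have pk: "p k = 2 ^ n" by (simp add: p_def kn)
    have "1 = 2 ^ n * (1/2::real) ^ n" by (simp add: power_one_over)
    also have "\<dots> \<le> p k * cmod \<zeta>" unfolding pk using n by (intro mult_left_mono) auto
    finally have "1 \<le> p k * cmod \<zeta>" .
    then have lo: "Re \<zeta> + 8 * a k / p k \<le> Re (\<Phi> \<zeta>)" by (rule ds(3)[OF z(1)])
    have "8 * a k / p k = 4 * a k * (2 * (1/2)^n)" by (simp add: pk power_one_over)
    moreover have "4 * a k * cmod \<zeta> \<le> 4 * a k * (2 * (1/2)^n)" using n2 a(1)[of k] by (intro mult_left_mono) auto
    ultimately have lo2: "4 * a k * cmod \<zeta> < Re (\<Phi> \<zeta>)" using lo z(1) by linarith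
    have \<Phi>2: "cmod (\<Phi> \<zeta>) \<le> 2 * cmod \<zeta>" by (rule ds(2)[OF z(1)])
    have Im2: "\<bar>Im (\<Phi> \<zeta>)\<bar> \<le> 2 * cmod \<zeta>" using abs_Im_le_cmod[of "\<Phi> \<zeta>"] \<Phi>2 by simp
    have Re2: "Re (\<Phi> \<zeta>) \<le> 2 * cmod \<zeta>" using complex_Re_le_cmod[of "\<Phi> \<zeta>"] \<Phi>2 by simp
    have "\<omega> (2 * \<bar>Im (\<Phi> \<zeta>)\<bar>) \<le> a k" unfolding a8 kn using Im2 n2 by (intro omega_mono) auto
    then have "2 * \<bar>Im (\<Phi> \<zeta>)\<bar> * \<omega> (2 * \<bar>Im (\<Phi> \<zeta>)\<bar>) \<le> (4 * cmod \<zeta>) * a k"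
      using Im2 omega_nonneg by (rule_tac mult_mono) auto
    then have hi: "2 * \<bar>Im (\<Phi> \<zeta>)\<bar> * \<omega> (2 * \<bar>Im (\<Phi> \<zeta>)\<bar>) < Re (\<Phi> \<zeta>)" using lo2 by (simp add: mult_ac)
    have "0 \<le> 4 * a k * cmod \<zeta>" using a(1)[of k] by simp
    with lo2 have "Re (\<Phi> \<zeta>) > 0" by linarith
    then show "q + \<Phi> \<zeta> *s \<nu> q \<in> D"
      using hi Im2 Re2 R0 z(2) by (intro complex_normal_height[OF q t0(2)]) auto
  qed (use ds R0 in auto)
qed

text \<open>For the disc of radius r centred at r, the hyperbolic distance of the points t and s on
  the real axis. The extra factor 2 absorbs 2 r - t \<le> 2 r and 2 r - s \<ge> r.\<close>

lemma rho_real_le: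
  assumes "0 < t" "t \<le> s" "s \<le> r"
  shows "rho (of_real (t / r - 1)) (of_real (s / r - 1)) \<le> ln (2 * s / t) / 2"
proof -
  define x y where "x = t / r - 1" and "y = s / r - 1"
  have r: "r > 0" using assms by linarith
  have xy: "-1 < x" "x \<le> y" "y \<le> 0" using assms r by (auto simp: x_def y_def divide_right_mono)
  have "rho (of_real x) (of_real y) = \<bar>artanh x - artanh y\<bar>"
    using rho_tanh[of "artanh x" "artanh y"] xy by (simp add: tanh_artanh)
  also have "\<dots> = artanh y - artanh x" using artanh_le_iff[of x y] xy by simp
  also have "\<dots> = (ln (s / (2 * r - s)) - ln (t / (2 * r - t))) / 2"
  proof -
    have "(1 + y) / (1 - y) = s / (2 * r - s)" "(1 + x) / (1 - x) = t / (2 * r - t)"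
      using r assms by (simp_all add: x_def y_def field_simps)
    then show ?thesis by (simp add: artanh_def diff_divide_distrib)
  qed
  also have "\<dots> \<le> (ln (s / r) - ln (t / (2 * r))) / 2"
  proof -
    have "s / (2 * r - s) \<le> s / r" using assms by (intro divide_left_mono) auto
    moreover have "t / (2 * r) \<le> t / (2 * r - t)" using assms by (intro divide_left_mono) auto
    ultimately show ?thesis using assms r by (intro divide_right_mono diff_mono) auto
  qed
  also have "ln (s / r) - ln (t / (2 * r)) = ln (2 * s / t)"
    using assms r by (simp add: ln_div ln_mult)
  finally show ?thesis by (simp add: x_def y_def)
qed

text \<open>Restricting \<open>\<Phi>\<close> to a disc tangent to the imaginary axis at 0 gives an
  analytic disc containing a piece of the inner normal. Its size is controlled, so it fits into any
  \<Omega> that agrees with D near q.\<close>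

lemma normal_push:
  obtains R0 \<Psi> where "R0 > 0" "\<And>s::real. s > 0 \<Longrightarrow> s \<le> \<Psi> s \<and> \<Psi> s \<le> 2 * s" "continuous_on {0<..} \<Psi>"
    "\<And>q s. q \<in> frontier D \<Longrightarrow> 0 < s \<Longrightarrow> s \<le> R0 \<Longrightarrow> q + \<Psi> s *\<^sub>R \<nu> q \<in> D \<and> s / 2 \<le> bdist D (q + \<Psi> s *\<^sub>R \<nu> q)"
    "\<And>q \<Omega> r s t. q \<in> frontier D \<Longrightarrow> open \<Omega> \<Longrightarrow> connected \<Omega> \<Longrightarrow> D \<inter> ball q (5 * r) \<subseteq> \<Omega> \<Longrightarrow> r \<le> R0 \<Longrightarrow>
        0 < t \<Longrightarrow> t \<le> s \<Longrightarrow> s \<le> r \<Longrightarrow>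
        kobayashi_dist \<Omega> (q + \<Psi> t *\<^sub>R \<nu> q) (q + \<Psi> s *\<^sub>R \<nu> q) \<le> ln (2 * s / t) / 2"
proof -
  obtain R1 \<Phi> where R1: "R1 > 0" "\<omega> (2 * R1) \<le> 1/2" and \<Phi>: "\<Phi> holomorphic_on {\<zeta>. Re \<zeta> > 0}"
    "\<And>\<zeta>. Re \<zeta> > 0 \<Longrightarrow> cmod (\<Phi> \<zeta>) \<le> 2 * cmod \<zeta>"
    "\<And>t. t > 0 \<Longrightarrow> \<exists>c. \<Phi> (of_real t) = of_real c \<and> t \<le> c \<and> c \<le> 2 * t"
    "\<And>q \<zeta>. q \<in> frontier D \<Longrightarrow> Re \<zeta> > 0 \<Longrightarrow> cmod \<zeta> \<le> R1 \<Longrightarrow> q + \<Phi> \<zeta> *s \<nu> q \<in> D"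
    by (rule normal_map) blast
  define \<Psi> where "\<Psi> = (\<lambda>s. Re (\<Phi> (of_real s)))"
  have \<Psi>: "\<Phi> (of_real s) = of_real (\<Psi> s)" "s \<le> \<Psi> s" "\<Psi> s \<le> 2 * s" if "s > 0" for s :: real
    using \<Phi>(3)[OF that] by (auto simp: \<Psi>_def)
  have sc: "\<Phi> (of_real s) *s v = \<Psi> s *\<^sub>R v" if "s > 0" for s :: real and v :: "complex ^ 'n"
    using \<Psi>(1)[OF that] by (simp add: vec_eq_iff scaleR_conv_of_real[where 'a = complex])
  show ?thesis
  proof (rule that[of "R1 / 2" \<Psi>])
    show "R1 / 2 > 0" using R1 by simp
    show "s \<le> \<Psi> s \<and> \<Psi> s \<le> 2 * s" if "s > 0" for s using \<Psi>[OF that] by simp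
    have "continuous_on (complex_of_real ` {0<..}) \<Phi>"
      by (rule continuous_on_subset[OF holomorphic_on_imp_continuous_on[OF \<Phi>(1)]]) auto
    then show "continuous_on {0<..} \<Psi>" unfolding \<Psi>_def
      by (intro continuous_intros continuous_on_compose2[of "complex_of_real ` {0<..}" \<Phi> "{0<..}" complex_of_real]) auto
    fix q assume q: "q \<in> frontier D"
    show "q + \<Psi> s *\<^sub>R \<nu> q \<in> D \<and> s / 2 \<le> bdist D (q + \<Psi> s *\<^sub>R \<nu> q)" if s: "0 < s" "s \<le> R1 / 2" for s
    proof
      show "q + \<Psi> s *\<^sub>R \<nu> q \<in> D" using \<Phi>(4)[OF q, of "of_real s"] s sc[OF s(1)] R1 by simp
      have "\<Psi> s / 2 \<le> bdist D (q + \<Psi> s *\<^sub>R \<nu> q)" using \<Psi>[OF s(1)] s by (intro normal_ray_depth[OF q R1(2)]) auto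
      then show "s / 2 \<le> bdist D (q + \<Psi> s *\<^sub>R \<nu> q)" using \<Psi>[OF s(1)] by simp
    qed
    fix \<Omega> r s t assume \<Omega>: "open \<Omega>" "connected \<Omega>" "D \<inter> ball q (5 * r) \<subseteq> \<Omega>" and r: "r \<le> R1 / 2"
      and st: "0 < t" "t \<le> s" "s \<le> r"
    define \<phi> where "\<phi> = (\<lambda>\<xi>. q + \<Phi> (of_real r * (1 + \<xi>)) *s \<nu> q)"
    have r0: "r > 0" using st by linarith
    have re: "Re (of_real r * (1 + \<xi>)) > 0" "cmod (of_real r * (1 + \<xi>)) < 2 * r" if "cmod \<xi> < 1" for \<xi>
    proof -
      have "\<bar>Re \<xi>\<bar> < 1" using that abs_Re_le_cmod[of \<xi>] by simp
      then show "Re (of_real r * (1 + \<xi>)) > 0" using r0 by simp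
      have "cmod (1 + \<xi>) < 2" using that norm_triangle_ineq[of 1 \<xi>] by simp
      then show "cmod (of_real r * (1 + \<xi>)) < 2 * r" using r0 by (simp add: norm_mult)
    qed
    have "\<phi> \<in> disc_maps \<Omega>"
    proof -
      have h: "(\<lambda>\<xi>. \<Phi> (of_real r * (1 + \<xi>))) holomorphic_on ball 0 1"
        using re(1) by (intro holomorphic_on_compose_gen[OF _ \<Phi>(1), unfolded o_def] holomorphic_intros) auto
      have "\<phi> \<xi> \<in> D \<inter> ball q (5 * r)" if "cmod \<xi> < 1" for \<xi>
      proof
        show "\<phi> \<xi> \<in> D" unfolding \<phi>_def using re[OF that] r by (intro \<Phi>(4)[OF q]) auto
        have "dist q (\<phi> \<xi>) = cmod (\<Phi> (of_real r * (1 + \<xi>)))"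
          using nu_norm[OF q q] by (simp add: \<phi>_def dist_norm norm_vec_scale)
        also have "\<dots> \<le> 2 * cmod (of_real r * (1 + \<xi>))" by (rule \<Phi>(2)[OF re(1)[OF that]])
        also have "\<dots> < 5 * r" using re(2)[OF that] r0 by simp
        finally show "\<phi> \<xi> \<in> ball q (5 * r)" by simp
      qed
      then show ?thesis using \<Omega>(3) h unfolding disc_maps_def
        by (auto simp: \<phi>_def intro!: holomorphic_intros)
    qed
    moreover have "\<phi> (of_real (u / r - 1)) = q + \<Psi> u *\<^sub>R \<nu> q" if "u > 0" for u
    proof -
      have "of_real r * (1 + complex_of_real (u / r - 1)) = of_real u" using r0 by (simp add: field_simps)
      then show ?thesis unfolding \<phi>_def using sc[OF that, of "\<nu> q"] by metis
    qed
    moreover have lt: "cmod (of_real (u / r - 1)) < 1" if "0 < u" "u \<le> r" for u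
    proof -
      have "\<bar>u / r - 1\<bar> < 1" using that r0 by (simp add: abs_if)
      then show ?thesis by (simp only: norm_of_real)
    qed
    ultimately have "kobayashi_dist \<Omega> (q + \<Psi> t *\<^sub>R \<nu> q) (q + \<Psi> s *\<^sub>R \<nu> q) \<le> rho (of_real (t / r - 1)) (of_real (s / r - 1))"
      using kobayashi_le_rho[OF \<Omega>(1,2), of \<phi> "of_real (t / r - 1)" "of_real (s / r - 1)"] st by auto
    also have "\<dots> \<le> ln (2 * s / t) / 2" by (rule rho_real_le[OF st])
    finally show "kobayashi_dist \<Omega> (q + \<Psi> t *\<^sub>R \<nu> q) (q + \<Psi> s *\<^sub>R \<nu> q) \<le> ln (2 * s / t) / 2" .
  qed
qed

end

section \<open>Upper bounds for the Kobayashi distance by boundary distances\<close>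

lemma half_ln_sum:
  assumes "a > 0" "b > 0" "y > 0" "a * b * exp (2 * c) \<le> y\<^sup>2"
  shows "ln a / 2 + ln b / 2 + c \<le> ln (y::real)"
proof -
  have "ln (a * b * exp (2 * c)) \<le> ln (y\<^sup>2)" using assms by simp
  then show ?thesis using assms by (simp add: ln_mult ln_realpow)
qed

lemma artanh_le_ln:
  assumes "0 \<le> t" "t \<le> (1/2::real)"
  shows "artanh t \<le> ln (1 + 2 * t)"
proof -
  have "(1 + t) / (1 - t) \<le> (1 + 2 * t)\<^sup>2"
  proof -
    have "t * t \<le> 1/2 * (1/2)" using assms by (intro mult_mono) auto
    then have "0 \<le> t * (2 - 4 * (t * t))" using assms by (intro mult_nonneg_nonneg) auto
    then have "1 + t \<le> (1 + 2 * t)\<^sup>2 * (1 - t)" by (simp add: power2_eq_square algebra_simps)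
    then show ?thesis using assms by (simp add: divide_le_eq)
  qed
  then have "ln ((1 + t) / (1 - t)) \<le> ln ((1 + 2 * t)\<^sup>2)" using assms by (intro ln_mono) auto
  also have "\<dots> = 2 * ln (1 + 2 * t)" using assms by (simp add: ln_realpow)
  finally show ?thesis by (simp add: artanh_def)
qed

context dini_convex
begin

lemma bdist_bounded: obtains B where "B > 0" "\<And>z. z \<in> D \<Longrightarrow> bdist D z \<le> B"
proof -
  obtain R where R: "D \<subseteq> ball 0 R" "R > 0" using bounded_subset_ballD[OF bounded_D] by blast
  obtain q where q: "q \<in> frontier D" using frontier_ne by blast
  have "bdist D z \<le> R + norm q" if "z \<in> D" for z
  proof -
    have "bdist D z \<le> dist z q" unfolding bdist_def by (rule infdist_le[OF q])
    also have "\<dots> \<le> norm z + norm q" by (simp add: dist_norm norm_triangle_ineq4)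
    finally show ?thesis using R that by force
  qed
  then show ?thesis using that[of "R + norm q"] R by (simp add: add_pos_nonneg)
qed

text \<open>\<open>\<Psi>\<close> need not be monotone, but by the intermediate value theorem it
  takes the value \<delta>(z) at some t \<ge> \<delta>(z)/2, so z lies on the curve; this doubles
  the constant.\<close>

lemma normal_push_nearest:
  obtains R0 \<Psi> where "R0 > 0" "\<And>s::real. s > 0 \<Longrightarrow> s \<le> \<Psi> s \<and> \<Psi> s \<le> 2 * s"
    "\<And>q s. q \<in> frontier D \<Longrightarrow> 0 < s \<Longrightarrow> s \<le> R0 \<Longrightarrow> q + \<Psi> s *\<^sub>R \<nu> q \<in> D \<and> s / 2 \<le> bdist D (q + \<Psi> s *\<^sub>R \<nu> q)"
    "\<And>z q \<Omega> r s. z \<in> D \<Longrightarrow> q \<in> frontier D \<Longrightarrow> bdist D z = dist z q \<Longrightarrow> open \<Omega> \<Longrightarrow> connected \<Omega> \<Longrightarrow>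
        D \<inter> ball q (5 * r) \<subseteq> \<Omega> \<Longrightarrow> bdist D z \<le> s \<Longrightarrow> s \<le> r \<Longrightarrow> r \<le> R0 \<Longrightarrow>
        kobayashi_dist \<Omega> z (q + \<Psi> s *\<^sub>R \<nu> q) \<le> ln (4 * s / bdist D z) / 2"
proof -
  obtain R0 \<Psi> where R0: "R0 > 0" and \<Psi>: "\<And>s::real. s > 0 \<Longrightarrow> s \<le> \<Psi> s \<and> \<Psi> s \<le> 2 * s" "continuous_on {0<..} \<Psi>"
    "\<And>q s. q \<in> frontier D \<Longrightarrow> 0 < s \<Longrightarrow> s \<le> R0 \<Longrightarrow> q + \<Psi> s *\<^sub>R \<nu> q \<in> D \<and> s / 2 \<le> bdist D (q + \<Psi> s *\<^sub>R \<nu> q)"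
    and push: "\<And>q \<Omega> r s t. q \<in> frontier D \<Longrightarrow> open \<Omega> \<Longrightarrow> connected \<Omega> \<Longrightarrow> D \<inter> ball q (5 * r) \<subseteq> \<Omega> \<Longrightarrow> r \<le> R0 \<Longrightarrow>
        0 < t \<Longrightarrow> t \<le> s \<Longrightarrow> s \<le> r \<Longrightarrow>
        kobayashi_dist \<Omega> (q + \<Psi> t *\<^sub>R \<nu> q) (q + \<Psi> s *\<^sub>R \<nu> q) \<le> ln (2 * s / t) / 2"
    by (rule normal_push) blast
  have "kobayashi_dist \<Omega> z (q + \<Psi> s *\<^sub>R \<nu> q) \<le> ln (4 * s / bdist D z) / 2"
    if z: "z \<in> D" "q \<in> frontier D" "bdist D z = dist z q" and \<Omega>: "open \<Omega>" "connected \<Omega>" "D \<inter> ball q (5 * r) \<subseteq> \<Omega>"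
      and s: "bdist D z \<le> s" "s \<le> r" "r \<le> R0" for z q \<Omega> r s
  proof -
    define d where "d = bdist D z"
    have d: "d > 0" using bdist_pos[OF z(1)] by (simp add: d_def)
    have "continuous_on {d/2..d} \<Psi>" by (rule continuous_on_subset[OF \<Psi>(2)]) (use d in auto)
    moreover have "\<Psi> (d/2) \<le> d" "d \<le> \<Psi> d" using \<Psi>(1)[of "d/2"] \<Psi>(1)[of d] d by auto
    ultimately obtain t where t: "d/2 \<le> t" "t \<le> d" "\<Psi> t = d"
      using IVT'[of \<Psi> "d/2" d d] d by auto
    have "z = q + \<Psi> t *\<^sub>R \<nu> q" using nearest_point[OF z] t(3) d_def by simp
    then have "kobayashi_dist \<Omega> z (q + \<Psi> s *\<^sub>R \<nu> q) \<le> ln (2 * s / t) / 2"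
      using push[OF z(2) \<Omega> s(3), of t s] t d s by (simp add: d_def)
    also have "\<dots> \<le> ln (4 * s / d) / 2"
    proof -
      have s0: "s > 0" using s d by (simp add: d_def)
      have "2 * s / t \<le> 2 * s / (d/2)" using t d s0 by (intro divide_left_mono) auto
      moreover have "2 * s / t > 0" using t d s0 by (intro divide_pos_pos) auto
      ultimately show ?thesis by simp
    qed
    finally show ?thesis by (simp add: d_def)
  qed
  then show ?thesis using that[OF R0 \<Psi>(1,3)] by blast
qed

lemma kobayashi_depth:
  assumes U: "open U" "connected (D \<inter> U)" and d0: "d0 > 0" "\<And>z. z \<in> V \<Longrightarrow> ball z d0 \<subseteq> U"
  obtains K M where "compact K" "K \<subseteq> D \<inter> U" "M > 0"
    "\<And>z. z \<in> D \<inter> V \<Longrightarrow> \<exists>y\<in>K. kobayashi_dist (D \<inter> U) z y \<le> ln (M / bdist D z) / 2"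
proof -
  obtain R0 \<Psi> where R0: "R0 > 0" and \<Psi>: "\<And>s::real. s > 0 \<Longrightarrow> s \<le> \<Psi> s \<and> \<Psi> s \<le> 2 * s"
    "\<And>q s. q \<in> frontier D \<Longrightarrow> 0 < s \<Longrightarrow> s \<le> R0 \<Longrightarrow> q + \<Psi> s *\<^sub>R \<nu> q \<in> D \<and> s / 2 \<le> bdist D (q + \<Psi> s *\<^sub>R \<nu> q)"
    and push: "\<And>z q \<Omega> r s. z \<in> D \<Longrightarrow> q \<in> frontier D \<Longrightarrow> bdist D z = dist z q \<Longrightarrow> open \<Omega> \<Longrightarrow> connected \<Omega> \<Longrightarrow>
        D \<inter> ball q (5 * r) \<subseteq> \<Omega> \<Longrightarrow> bdist D z \<le> s \<Longrightarrow> s \<le> r \<Longrightarrow> r \<le> R0 \<Longrightarrow>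
        kobayashi_dist \<Omega> z (q + \<Psi> s *\<^sub>R \<nu> q) \<le> ln (4 * s / bdist D z) / 2"
    by (rule normal_push_nearest) blast
  obtain B where B: "B > 0" "\<And>z. z \<in> D \<Longrightarrow> bdist D z \<le> B" by (rule bdist_bounded) blast
  \<comment> \<open>A boundary point q closer to z than r has its ball of radius 5 r inside the ball
    of radius d0 about z.\<close>
  define r where "r = min R0 (d0 / 6)"
  have r: "r > 0" "r \<le> R0" "6 * r \<le> d0" using R0 d0 by (auto simp: r_def)
  define S where "S = {y \<in> D. r / 2 \<le> bdist D y \<and> (\<exists>z\<in>V. dist z y \<le> 3 * r)}"
  have "bounded S" using bounded_D by (rule bounded_subset) (auto simp: S_def)
  then have comp: "compact (closure S)" by (simp add: compact_closure)
  have sub: "closure S \<subseteq> D \<inter> U"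
  proof
    fix y assume "y \<in> closure S"
    then obtain y' where y': "y' \<in> S" "dist y' y < r / 2" using r closure_approachable[of y S] by (metis half_gt_zero)
    then obtain z where z: "z \<in> V" "dist z y' \<le> 3 * r" by (auto simp: S_def)
    have "y \<in> ball y' (bdist D y')" using y' by (auto simp: S_def)
    then have "y \<in> D" using bdist_ball[of y' D] y' by (auto simp: S_def)
    moreover have "dist z y < d0" using dist_triangle[of z y y'] z y' r by (simp add: dist_commute)
    then have "y \<in> U" using d0(2)[OF z(1)] by auto
    ultimately show "y \<in> D \<inter> U" by blast
  qed
  define M where "M = max (4 * r) B"
  have open_DU: "open (D \<inter> U)" using open_D U by blast
  show ?thesis
  proof (rule that[OF comp sub])
    show "M > 0" using B by (simp add: M_def)
    fix z assume z: "z \<in> D \<inter> V"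
    have zD: "z \<in> D" using z by blast
    have "z \<in> ball z d0" using d0(1) by simp
    then have zU: "z \<in> U" using d0(2)[of z] z by blast
    have dz: "bdist D z > 0" by (rule bdist_pos[OF zD])
    show "\<exists>y\<in>closure S. kobayashi_dist (D \<inter> U) z y \<le> ln (M / bdist D z) / 2"
    proof (cases "r \<le> bdist D z")
      case True
      have "dist z z \<le> 3 * r" using r by simp
      then have "\<exists>x\<in>V. dist x z \<le> 3 * r" using z by blast
      then have "z \<in> S" using True zD r by (simp add: S_def)
      moreover have "1 \<le> M / bdist D z" using B(2)[OF zD] dz by (simp add: M_def)
      then have "0 \<le> ln (M / bdist D z)" by (rule ln_ge_zero)
      then have "kobayashi_dist (D \<inter> U) z z \<le> ln (M / bdist D z) / 2"
        using kobayashi_refl[OF open_DU U(2), of z] zD zU by simp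
      ultimately show ?thesis by (intro bexI[of _ z] subsetD[OF closure_subset])
    next
      case False
      obtain q where q: "q \<in> frontier D" "bdist D z = dist z q" by (rule bdist_attained)
      have "ball q (5 * r) \<subseteq> ball z d0"
      proof
        fix x assume "x \<in> ball q (5 * r)"
        then show "x \<in> ball z d0" using dist_triangle[of z x q] q False r by simp
      qed
      then have sub: "D \<inter> ball q (5 * r) \<subseteq> D \<inter> U" using d0(2) z by blast
      define y where "y = q + \<Psi> r *\<^sub>R \<nu> q"
      have y: "y \<in> D" "r / 2 \<le> bdist D y" using \<Psi>(2)[OF q(1) r(1,2)] by (auto simp: y_def)
      have "z - y = (bdist D z - \<Psi> r) *\<^sub>R \<nu> q" using nearest_point[OF zD q] by (simp add: y_def algebra_simps)
      then have "dist z y = \<bar>bdist D z - \<Psi> r\<bar>" using nu_norm[OF q(1) q(1)] by (simp add: dist_norm)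
      then have "dist z y \<le> 3 * r" using \<Psi>(1)[OF r(1)] False dz by auto
      then have "\<exists>z\<in>V. dist z y \<le> 3 * r" using z by blast
      then have yS: "y \<in> closure S" using y by (intro subsetD[OF closure_subset]) (simp add: S_def)
      have "kobayashi_dist (D \<inter> U) z y \<le> ln (4 * r / bdist D z) / 2"
        unfolding y_def using False r by (intro push[OF zD q open_DU U(2) sub]) auto
      moreover have "ln (4 * r / bdist D z) \<le> ln (M / bdist D z)"
        using r dz by (intro ln_mono divide_right_mono divide_pos_pos) (auto simp: M_def)
      ultimately show ?thesis by (intro bexI[OF _ yS]) linarith
    qed
  qed
qed

text \<open>Three regimes for s = |z - w|: up to half a boundary distance an affine disc suffices;
  for moderate s both points are pushed inwards to height comparable to s, where they are close
  relative to their depth; for large s the path goes through a fixed compact set.\<close>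

lemma kobayashi_upper_bdist:
  obtains C where "C \<ge> 1" "\<And>z w. z \<in> D \<Longrightarrow> w \<in> D \<Longrightarrow>
    kobayashi_dist D z w \<le> ln (1 + C * (norm (z - w) / (sqrt (bdist D z) * sqrt (bdist D w))))"
proof -
  obtain R0 \<Psi> where R0: "R0 > 0" and \<Psi>: "\<And>s::real. s > 0 \<Longrightarrow> s \<le> \<Psi> s \<and> \<Psi> s \<le> 2 * s"
    "\<And>q s. q \<in> frontier D \<Longrightarrow> 0 < s \<Longrightarrow> s \<le> R0 \<Longrightarrow> q + \<Psi> s *\<^sub>R \<nu> q \<in> D \<and> s / 2 \<le> bdist D (q + \<Psi> s *\<^sub>R \<nu> q)"
    and push: "\<And>z q \<Omega> r s. z \<in> D \<Longrightarrow> q \<in> frontier D \<Longrightarrow> bdist D z = dist z q \<Longrightarrow> open \<Omega> \<Longrightarrow> connected \<Omega> \<Longrightarrow>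
        D \<inter> ball q (5 * r) \<subseteq> \<Omega> \<Longrightarrow> bdist D z \<le> s \<Longrightarrow> s \<le> r \<Longrightarrow> r \<le> R0 \<Longrightarrow>
        kobayashi_dist \<Omega> z (q + \<Psi> s *\<^sub>R \<nu> q) \<le> ln (4 * s / bdist D z) / 2"
    by (rule normal_push_nearest) blast
  obtain t1 where t1: "t1 > 0" "\<omega> t1 \<le> 1/16" using omega_small[of "1/16"] by auto
  \<comment> \<open>Allows pushing to height 40 s, and forces the two foot points, at most 5 s
    apart, to have normals differing by at most 1/16.\<close>
  define s1 where "s1 = min (R0 / 40) (t1 / 5)"
  have s1: "s1 > 0" "40 * s1 \<le> R0" "5 * s1 \<le> t1" using R0 t1 by (auto simp: s1_def)
  have cU: "connected (D \<inter> UNIV)" using conn_D by simp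
  obtain K M where K: "compact K" "K \<subseteq> D \<inter> UNIV" "M > 0"
    "\<And>z. z \<in> D \<inter> UNIV \<Longrightarrow> \<exists>y\<in>K. kobayashi_dist (D \<inter> UNIV) z y \<le> ln (M / bdist D z) / 2"
    by (rule kobayashi_depth[OF open_UNIV cU zero_less_one, of UNIV]) auto
  have K': "K \<subseteq> D" "\<And>z. z \<in> D \<Longrightarrow> \<exists>y\<in>K. kobayashi_dist D z y \<le> ln (M / bdist D z) / 2" using K by auto
  obtain B where B: "\<And>z w. z \<in> K \<Longrightarrow> w \<in> K \<Longrightarrow> kobayashi_dist D z w \<le> B"
    using kobayashi_bounded_compact[OF open_D conn_D K(1) K'(1)] by blast
  define C where "C = max 280 (M * exp B / s1)"
  note sym = kobayashi_sym[OF open_D conn_D] and tri = kobayashi_triangle[OF open_D conn_D]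
  have caseA: "kobayashi_dist D z w \<le> ln (1 + C * (norm (z - w) / (sqrt (bdist D z) * sqrt (bdist D w))))"
    if zw: "z \<in> D" "w \<in> D" and le: "norm (z - w) \<le> bdist D z / 2" for z w
  proof -
    define d d' s where "d = bdist D z" and "d' = bdist D w" and "s = norm (z - w)"
    have d: "d > 0" "d' > 0" using bdist_pos zw by (auto simp: d_def d'_def)
    have s: "0 \<le> s" "s \<le> d / 2" using le by (auto simp: s_def d_def)
    have "d' \<le> d + s" using bdist_triangle[of D w z] by (simp add: d_def d'_def s_def dist_norm norm_minus_commute)
    then have "d * d' \<le> d * (4 * d)" using s d by (intro mult_left_mono) auto
    then have "sqrt (d * d') \<le> sqrt ((2 * d)\<^sup>2)" by (intro real_sqrt_le_mono) (simp add: power2_eq_square)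
    then have sq: "sqrt d * sqrt d' \<le> 2 * d" using d by (simp add: real_sqrt_mult)
    have sd0: "sqrt d * sqrt d' > 0" using d by simp
    have "s / (2 * d) \<le> s / (sqrt d * sqrt d')" using sq sd0 s d by (intro divide_left_mono) auto
    then have sx: "s / d \<le> 2 * (s / (sqrt d * sqrt d'))" by simp
    have nw: "norm (w - z) = s" by (simp add: s_def norm_minus_commute)
    have "kobayashi_dist D z w \<le> artanh (s / d)"
      using kobayashi_ball[OF open_D conn_D bdist_ball[OF zw(1)], of w] s d by (simp add: nw d_def[symmetric])
    also have "\<dots> \<le> ln (1 + 2 * (s / d))" using s d by (intro artanh_le_ln) auto
    also have "\<dots> \<le> ln (1 + C * (s / (sqrt d * sqrt d')))"
    proof (rule ln_mono)
      have "2 * (s / d) \<le> 4 * (s / (sqrt d * sqrt d'))" using sx by simp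
      also have "\<dots> \<le> C * (s / (sqrt d * sqrt d'))" using s d by (intro mult_right_mono) (auto simp: C_def)
      finally show "1 + 2 * (s / d) \<le> 1 + C * (s / (sqrt d * sqrt d'))" by simp
    qed (use s d in \<open>simp add: add_pos_nonneg\<close>)
    finally show ?thesis by (simp add: d_def d'_def s_def)
  qed
  show ?thesis
  proof (rule that[of C])
    show "C \<ge> 1" by (simp add: C_def)
    fix z w assume zw: "z \<in> D" "w \<in> D"
    define d d' s where "d = bdist D z" and "d' = bdist D w" and "s = norm (z - w)"
    define x where "x = s / (sqrt d * sqrt d')"
    have d: "d > 0" "d' > 0" using bdist_pos zw by (auto simp: d_def d'_def)
    have x2: "x\<^sup>2 = s\<^sup>2 / (d * d')" using d by (simp add: x_def power_divide power_mult_distrib)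
    have s0: "s \<ge> 0" by (simp add: s_def)
    have "kobayashi_dist D z w \<le> ln (1 + C * x)"
    proof (cases "s \<le> d / 2 \<or> s \<le> d' / 2")
      case True
      then show ?thesis
      proof
        assume "s \<le> d / 2"
        then show ?thesis using caseA[OF zw] by (simp add: d_def d'_def s_def x_def)
      next
        assume "s \<le> d' / 2"
        then show ?thesis using caseA[OF zw(2,1)] sym[OF zw]
          by (simp add: d_def d'_def s_def x_def norm_minus_commute mult.commute)
      qed
    next
      case False
      then have sp: "s > 0" "d < 2 * s" "d' < 2 * s" using d by auto
      have xp: "x > 0" using sp d by (simp add: x_def)
      have "kobayashi_dist D z w \<le> ln (C * x)"
      proof (cases "s \<le> s1")
        case True
        \<comment> \<open>At this height the depth is at least 20 s, while the pushed points differ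
          by at most 5 s + 80 s / 16 = 10 s, so one ball joins them at cost artanh (1/2). The
          constant 280 in C comes from 3 * 160^2 < 280^2.\<close>
        define \<sigma> where "\<sigma> = 40 * s"
        have \<sigma>: "\<sigma> > 0" "\<sigma> \<le> R0" using sp True s1 by (auto simp: \<sigma>_def)
        obtain q where q: "q \<in> frontier D" "bdist D z = dist z q" by (rule bdist_attained)
        obtain q' where q': "q' \<in> frontier D" "bdist D w = dist w q'" by (rule bdist_attained)
        define y y' where "y = q + \<Psi> \<sigma> *\<^sub>R \<nu> q" and "y' = q' + \<Psi> \<sigma> *\<^sub>R \<nu> q'"
        have y: "y \<in> D" "\<sigma> / 2 \<le> bdist D y" "y' \<in> D"
          using \<Psi>(2)[OF q(1) \<sigma>] \<Psi>(2)[OF q'(1) \<sigma>] by (auto simp: y_def y'_def)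
        have k1: "kobayashi_dist D z y \<le> ln (4 * \<sigma> / d) / 2"
          unfolding y_def d_def using sp \<sigma> d_def by (intro push[OF zw(1) q open_D conn_D, of \<sigma>]) (auto simp: \<sigma>_def)
        have k2: "kobayashi_dist D w y' \<le> ln (4 * \<sigma> / d') / 2"
          unfolding y'_def d'_def using sp \<sigma> d'_def by (intro push[OF zw(2) q' open_D conn_D, of \<sigma>]) (auto simp: \<sigma>_def)
        have qq: "dist q q' \<le> 5 * s"
        proof -
          have "dist q q' \<le> dist q z + dist z w + dist w q'"
            using dist_triangle[of q q' z] dist_triangle[of z q' w] by linarith
          moreover have "dist q z = d" "dist z w = s" "dist w q' = d'" using q q' by (simp_all add: d_def d'_def s_def dist_norm norm_minus_commute)
          ultimately show ?thesis using sp by linarith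
        qed
        have "dist (\<nu> q) (\<nu> q') \<le> 1/16"
        proof -
          have "dist (\<nu> q) (\<nu> q') \<le> \<omega> t1" using qq True s1 by (intro omega_le[OF q(1) q'(1)]) auto
          then show ?thesis using t1 by linarith
        qed
        then have "\<Psi> \<sigma> * dist (\<nu> q) (\<nu> q') \<le> (2 * \<sigma>) * (1/16)" using \<Psi>(1)[OF \<sigma>(1)] \<sigma> by (intro mult_mono) auto
        moreover have "norm (y' - y) \<le> dist q q' + \<Psi> \<sigma> * dist (\<nu> q) (\<nu> q')"
        proof -
          have "y' - y = (q' - q) + \<Psi> \<sigma> *\<^sub>R (\<nu> q' - \<nu> q)" by (simp add: y_def y'_def algebra_simps)
          then have "norm (y' - y) \<le> norm (q' - q) + norm (\<Psi> \<sigma> *\<^sub>R (\<nu> q' - \<nu> q))" by (metis norm_triangle_ineq)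
          then show ?thesis using \<Psi>(1)[OF \<sigma>(1)] \<sigma> by (simp add: dist_norm norm_minus_commute)
        qed
        ultimately have yy: "norm (y' - y) \<le> 10 * s" using qq by (simp add: \<sigma>_def)
        have dpy: "20 * s \<le> bdist D y" using y(2) by (simp add: \<sigma>_def)
        have "kobayashi_dist D y y' \<le> artanh (norm (y' - y) / bdist D y)"
          using yy dpy sp by (intro kobayashi_ball[OF open_D conn_D bdist_ball[OF y(1)]]) linarith
        also have "\<dots> \<le> artanh (1/2)"
        proof (rule artanh_mono)
          have "norm (y' - y) \<le> bdist D y / 2" using yy dpy by linarith
          then show "norm (y' - y) / bdist D y \<le> 1 / 2" using dpy sp by (simp add: field_simps)
        qed (use dpy sp in auto)
        also have "artanh (1/2::real) = ln 3 / 2" by (simp add: artanh_def)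
        finally have k3: "kobayashi_dist D y y' \<le> ln 3 / 2" .
        have "kobayashi_dist D z w \<le> kobayashi_dist D z y + kobayashi_dist D y y' + kobayashi_dist D w y'"
          using tri[OF zw(1) y(1) zw(2)] tri[OF y(1,3) zw(2)] sym[OF zw(2) y(3)] by linarith
        also have "\<dots> \<le> ln (160 * s / d) / 2 + ln (160 * s / d') / 2 + ln 3 / 2"
          using k1 k2 k3 by (simp add: \<sigma>_def)
        also have "\<dots> \<le> ln (280 * x)"
        proof (rule half_ln_sum)
          have "160 * s / d * (160 * s / d') * exp (2 * (ln 3 / 2)) = 76800 * x\<^sup>2"
            unfolding x2 by (simp add: power2_eq_square)
          also have "\<dots> \<le> (280 * x)\<^sup>2" by (simp add: power_mult_distrib)
          finally show "160 * s / d * (160 * s / d') * exp (2 * (ln 3 / 2)) \<le> (280 * x)\<^sup>2" .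
        qed (use sp d xp in auto)
        also have "\<dots> \<le> ln (C * x)" using xp by (intro ln_mono mult_right_mono) (auto simp: C_def)
        finally show ?thesis .
      next
        case False
        obtain y where y: "y \<in> K" "kobayashi_dist D z y \<le> ln (M / d) / 2" using K'(2)[OF zw(1)] by (auto simp: d_def)
        obtain y' where y': "y' \<in> K" "kobayashi_dist D w y' \<le> ln (M / d') / 2" using K'(2)[OF zw(2)] by (auto simp: d'_def)
        have yD: "y \<in> D" "y' \<in> D" using y y' K' by auto
        have "kobayashi_dist D z w \<le> kobayashi_dist D z y + kobayashi_dist D y y' + kobayashi_dist D w y'"
          using tri[OF zw(1) yD(1) zw(2)] tri[OF yD zw(2)] sym[OF zw(2) yD(2)] by linarith
        also have "\<dots> \<le> ln (M / d) / 2 + ln (M / d') / 2 + B" using y y' B[OF y(1) y'(1)] by linarith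
        also have "\<dots> \<le> ln (M * exp B / s1 * x)"
        proof (rule half_ln_sum)
          have "exp (2 * B) = exp B * exp B" by (simp add: exp_add[symmetric])
          then have "M / d * (M / d') * exp (2 * B) = (M * exp B)\<^sup>2 * 1 / (d * d')"
            by (simp add: power2_eq_square)
          also have "\<dots> \<le> (M * exp B)\<^sup>2 * (s\<^sup>2 / s1\<^sup>2) / (d * d')"
          proof -
            have "s1\<^sup>2 \<le> s\<^sup>2" using False s1 by (intro power_mono) auto
            then have "1 \<le> s\<^sup>2 / s1\<^sup>2" using s1 by simp
            then show ?thesis using d by (intro divide_right_mono mult_left_mono) auto
          qed
          also have "\<dots> = (M * exp B / s1 * x)\<^sup>2"
            by (simp add: power_mult_distrib power_divide x2)
          finally show "M / d * (M / d') * exp (2 * B) \<le> (M * exp B / s1 * x)\<^sup>2" .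
        qed (use K(3) d xp s1 in auto)
        also have "\<dots> \<le> ln (C * x)" using xp K(3) s1 by (intro ln_mono mult_right_mono) (auto simp: C_def)
        finally show ?thesis .
      qed
      also have "\<dots> \<le> ln (1 + C * x)" using xp by (intro ln_mono) (auto simp: C_def)
      finally show ?thesis .
    qed
    then show "kobayashi_dist D z w \<le> ln (1 + C * (norm (z - w) / (sqrt (bdist D z) * sqrt (bdist D w))))"
      by (simp add: x_def d_def d'_def s_def)
  qed
qed

end

section \<open>The half-plane model\<close>

text \<open>The Poincare distance of the upper half-plane, normalized like
  \<open>rho\<close>.\<close>

definition rhoH :: "complex \<Rightarrow> complex \<Rightarrow> real" where
  "rhoH p q = artanh (cmod (p - q) / cmod (p - cnj q))"

lemma norm_minus_cnj_sq: "(cmod (p - cnj q))\<^sup>2 = (cmod (p - q))\<^sup>2 + 4 * Im p * Im q"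
  unfolding cmod_power2 by (simp add: power2_eq_square algebra_simps)

lemma halfplane_quotient:
  assumes "Im p > 0" "Im q > 0"
  shows "cmod (p - cnj q) > 0" "cmod (p - q) / cmod (p - cnj q) < 1"
proof -
  have lt: "(cmod (p - q))\<^sup>2 < (cmod (p - cnj q))\<^sup>2" using assms by (simp add: norm_minus_cnj_sq)
  then have "cmod (p - q) < cmod (p - cnj q)" by (rule power_less_imp_less_base) simp
  moreover then show "cmod (p - cnj q) > 0" using norm_ge_zero[of "p - q"] by linarith
  ultimately show "cmod (p - q) / cmod (p - cnj q) < 1" by simp
qed

lemma rhoH_nonneg: "Im p > 0 \<Longrightarrow> Im q > 0 \<Longrightarrow> 0 \<le> rhoH p q"
  unfolding rhoH_def using halfplane_quotient[of p q] by (intro artanh_nonneg) auto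

lemma cosh_rhoH:
  assumes "Im p > 0" "Im q > 0"
  shows "(cosh (rhoH p q))\<^sup>2 = (cmod (p - cnj q))\<^sup>2 / (4 * Im p * Im q)"
    "(sinh (rhoH p q))\<^sup>2 = (cmod (p - q))\<^sup>2 / (4 * Im p * Im q)"
proof -
  define T where "T = cmod (p - q) / cmod (p - cnj q)"
  have T: "0 \<le> T" "T < 1" using halfplane_quotient[OF assms] by (auto simp: T_def)
  have th: "tanh (rhoH p q) = T" using T by (simp add: rhoH_def T_def[symmetric] tanh_artanh)
  define c s where "c = cosh (rhoH p q)" and "s = sinh (rhoH p q)"
  have c0: "c > 0" by (simp add: c_def)
  have s: "s = T * c" using th c0 by (simp add: tanh_def s_def c_def field_simps)
  have "c\<^sup>2 - s\<^sup>2 = 1" by (simp add: c_def s_def hyperbolic_pythagoras)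
  then have c2: "c\<^sup>2 * (1 - T\<^sup>2) = 1" by (simp add: s power_mult_distrib algebra_simps)
  have n0: "(cmod (p - cnj q))\<^sup>2 > 0" using halfplane_quotient[OF assms] by simp
  have T2: "1 - T\<^sup>2 = 4 * Im p * Im q / (cmod (p - cnj q))\<^sup>2"
    using n0 norm_minus_cnj_sq[of p q] by (simp add: T_def power_divide field_simps)
  show c2': "(cosh (rhoH p q))\<^sup>2 = (cmod (p - cnj q))\<^sup>2 / (4 * Im p * Im q)"
  proof -
    define n X where "n = (cmod (p - cnj q))\<^sup>2" and "X = 4 * Im p * Im q"
    have "1 - T\<^sup>2 = X / n" unfolding n_def X_def by (fact T2)
    then have "c\<^sup>2 * (X / n) = 1" using c2 by (simp only:)
    moreover have "X > 0" "n > 0" using assms n0 by (auto simp: X_def n_def)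
    ultimately have "c\<^sup>2 = n / X" by (simp add: field_simps)
    then show ?thesis by (simp add: c_def n_def X_def)
  qed
  have "s\<^sup>2 = c\<^sup>2 - 1" using \<open>c\<^sup>2 - s\<^sup>2 = 1\<close> by simp
  also have "\<dots> = ((cmod (p - q))\<^sup>2 + 4 * Im p * Im q) / (4 * Im p * Im q) - 1"
    using c2' by (simp add: c_def norm_minus_cnj_sq)
  also have "\<dots> = (cmod (p - q))\<^sup>2 / (4 * Im p * Im q)" using assms by (simp add: add_divide_distrib)
  finally show "(sinh (rhoH p q))\<^sup>2 = (cmod (p - q))\<^sup>2 / (4 * Im p * Im q)" by (simp add: s_def)
qed

lemma sinh_ge: "(t::real) \<ge> 0 \<Longrightarrow> t \<le> sinh t"
proof -
  assume t: "t \<ge> 0"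
  have "sinh 0 - 0 \<le> sinh t - t"
  proof (rule DERIV_nonneg_imp_nondecreasing[OF t])
    fix x :: real
    have "((\<lambda>x. sinh x - x) has_real_derivative cosh x - 1) (at x)" by (auto intro!: derivative_eq_intros)
    then show "\<exists>y. ((\<lambda>x. sinh x - x) has_real_derivative y) (at x) \<and> 0 \<le> y"
      using cosh_real_ge_1[of x] by force
  qed
  then show ?thesis by simp
qed

lemma exp_cosh_bounds:
  assumes "(t::real) \<ge> 0"
  shows "exp t / 2 \<le> cosh t" "cosh t \<le> exp t"
  using assms by (auto simp: cosh_field_def)

subsection \<open>Half-discs\<close>

text \<open>A conformal map of the half-disc \<open>Im \<zeta> > 0, e * cmod \<zeta> < 1\<close> onto the upper half-plane.\<close>

definition hmap :: "real \<Rightarrow> complex \<Rightarrow> complex" where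
  "hmap e \<zeta> = \<zeta> / (1 + (of_real e * \<zeta>)\<^sup>2)"

text \<open>The inverse of \<open>hmap e\<close>: of the two solutions \<zeta> of w (1 + (e
  \<zeta>)^2) = \<zeta>, whose product is 1 / e^2, the one of modulus below 1 / e.\<close>

definition hinv :: "real \<Rightarrow> complex \<Rightarrow> complex" where
  "hinv e w = (1 - csqrt (1 - 4 * (of_real e * w)\<^sup>2)) / (2 * of_real e * (of_real e * w))"

lemma hmap_den:
  assumes "e * cmod \<zeta> < 1" "e > 0"
  shows "1 + (of_real e * \<zeta>)\<^sup>2 \<noteq> 0"
proof
  assume "1 + (of_real e * \<zeta>)\<^sup>2 = 0"
  then have "(of_real e * \<zeta>)\<^sup>2 = -1" by (simp add: add_eq_0_iff)
  then have "(e * cmod \<zeta>)\<^sup>2 = 1" using assms by (metis norm_minus_cancel norm_mult norm_of_real norm_one norm_power abs_of_pos)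
  moreover have "(e * cmod \<zeta>)\<^sup>2 < 1\<^sup>2" using assms by (intro power_strict_mono) auto
  ultimately show False by simp
qed

lemma hmap_diff:
  assumes e: "e > 0" and a: "e * cmod a < 1" and b: "e * cmod b < 1"
  shows "hmap e a - hmap e b = (a - b) * (1 - (of_real e)\<^sup>2 * a * b) / ((1 + (of_real e * a)\<^sup>2) * (1 + (of_real e * b)\<^sup>2))"
  using hmap_den[OF a e] hmap_den[OF b e] by (simp add: hmap_def field_simps power2_eq_square)

lemma Im_hmap:
  assumes e: "e > 0" and a: "e * cmod a < 1"
  shows "Im (hmap e a) = Im a * (1 - (e * cmod a)\<^sup>2) / (cmod (1 + (of_real e * a)\<^sup>2))\<^sup>2"
proof -
  have "Im (hmap e a) = (Im a * Re (1 + (of_real e * a)\<^sup>2) - Re a * Im (1 + (of_real e * a)\<^sup>2)) / (cmod (1 + (of_real e * a)\<^sup>2))\<^sup>2"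
    unfolding hmap_def Im_divide cmod_power2 ..
  also have "Im a * Re (1 + (of_real e * a)\<^sup>2) - Re a * Im (1 + (of_real e * a)\<^sup>2) = Im a * (1 - e\<^sup>2 * (cmod a)\<^sup>2)"
    unfolding cmod_power2 by (simp add: power2_eq_square algebra_simps)
  finally show ?thesis by (simp add: power_mult_distrib)
qed

lemma hmap_halfplane:
  assumes "e > 0" "e * cmod a < 1" "Im a > 0"
  shows "Im (hmap e a) > 0"
proof -
  have "(e * cmod a)\<^sup>2 < 1\<^sup>2" using assms by (intro power_strict_mono) auto
  then show ?thesis unfolding Im_hmap[OF assms(1,2)] using hmap_den[OF assms(2,1)] assms by simp
qed

text \<open>\<open>hmap\<close> is injective on the half-disc with explicit difference and height;
  the identity \<open>key\<close> separates the product A B, which cancels, from a multiple of |a -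
  cnj b|^2, which is cosh^2 again.\<close>

lemma hmap_sinh:
  assumes e: "e > 0" and a: "e * cmod a < 1" "Im a > 0" and b: "e * cmod b < 1" "Im b > 0"
  defines "Q \<equiv> 4 * e\<^sup>2 * Im a * Im b / ((1 - (e * cmod a)\<^sup>2) * (1 - (e * cmod b)\<^sup>2))"
  shows "(sinh (rhoH (hmap e a) (hmap e b)))\<^sup>2 = (sinh (rhoH a b))\<^sup>2 * (1 + Q * (cosh (rhoH a b))\<^sup>2)"
proof -
  define A B where "A = 1 - (e * cmod a)\<^sup>2" and "B = 1 - (e * cmod b)\<^sup>2"
  have "(e * cmod a)\<^sup>2 < 1" "(e * cmod b)\<^sup>2 < 1" using e a b by (simp_all add: abs_square_less_1 abs_mult)
  then have AB: "A > 0" "B > 0" by (auto simp: A_def B_def)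
  define na nb where "na = (cmod (1 + (of_real e * a)\<^sup>2))\<^sup>2" and "nb = (cmod (1 + (of_real e * b)\<^sup>2))\<^sup>2"
  have n0: "na > 0" "nb > 0" using hmap_den[OF a(1) e] hmap_den[OF b(1) e] by (auto simp: na_def nb_def)
  have I: "Im (hmap e a) = Im a * A / na" "Im (hmap e b) = Im b * B / nb"
    using Im_hmap[OF e a(1)] Im_hmap[OF e b(1)] by (auto simp: A_def B_def na_def nb_def)
  have d: "(cmod (hmap e a - hmap e b))\<^sup>2 = (cmod (a - b))\<^sup>2 * (cmod (1 - (of_real e)\<^sup>2 * a * b))\<^sup>2 / (na * nb)"
    unfolding hmap_diff[OF e a(1) b(1)] norm_divide norm_mult power_divide power_mult_distrib na_def nb_def ..
  have key: "(cmod (1 - (of_real e)\<^sup>2 * a * b))\<^sup>2 = A * B + e\<^sup>2 * (cmod (a - cnj b))\<^sup>2"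
  proof -
    define R where "R = Re (a * b)"
    have h0: "(1 - (of_real e)\<^sup>2 * a * b) = 1 - of_real (e\<^sup>2) * (a * b)" by simp
    have h1: "(cmod (1 - of_real (e\<^sup>2) * (a * b)))\<^sup>2 = 1 - 2 * e\<^sup>2 * R + (e\<^sup>2)\<^sup>2 * (cmod a)\<^sup>2 * (cmod b)\<^sup>2"
      unfolding cmod_power2 R_def by (simp add: power2_eq_square algebra_simps)
    have h2: "(cmod (a - cnj b))\<^sup>2 = (cmod a)\<^sup>2 + (cmod b)\<^sup>2 - 2 * R"
      unfolding cmod_power2 R_def by (simp add: power2_eq_square algebra_simps)
    have h3: "A * B = 1 - e\<^sup>2 * ((cmod a)\<^sup>2 + (cmod b)\<^sup>2) + (e\<^sup>2)\<^sup>2 * (cmod a)\<^sup>2 * (cmod b)\<^sup>2"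
      by (simp add: A_def B_def power_mult_distrib algebra_simps power2_eq_square)
    show ?thesis unfolding h0 h1 h2 h3 by (simp add: algebra_simps)
  qed
  have "(sinh (rhoH (hmap e a) (hmap e b)))\<^sup>2 = (cmod (hmap e a - hmap e b))\<^sup>2 / (4 * Im (hmap e a) * Im (hmap e b))"
    using hmap_halfplane[OF e] a b by (intro cosh_rhoH) auto
  also have "\<dots> = (cmod (a - b))\<^sup>2 * (A * B + e\<^sup>2 * (cmod (a - cnj b))\<^sup>2) / (4 * Im a * Im b * (A * B))"
    unfolding d I key using n0 AB a b by (simp add: field_simps)
  also have "\<dots> = (cmod (a - b))\<^sup>2 / (4 * Im a * Im b) * (1 + Q * ((cmod (a - cnj b))\<^sup>2 / (4 * Im a * Im b)))"
    unfolding Q_def A_def[symmetric] B_def[symmetric] using AB a b by (simp add: field_simps)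
  finally show ?thesis using cosh_rhoH[OF a(2) b(2)] by simp
qed

text \<open>From sinh^2 to the distance itself: sqrt (1 + 2 x) \<le> 1 + x, and sinh (u + t) \<ge>
  sinh u + t cosh u. The loss is proportional to Im a * Im b, which is what makes it of second
  order.\<close>

lemma rhoH_hmap_le:
  assumes e: "e > 0" and a: "e * cmod a < 1" "Im a > 0" and b: "e * cmod b < 1" "Im b > 0"
  defines "Q \<equiv> 4 * e\<^sup>2 * Im a * Im b / ((1 - (e * cmod a)\<^sup>2) * (1 - (e * cmod b)\<^sup>2))"
  shows "rhoH (hmap e a) (hmap e b) \<le> rhoH a b + Q / 2 * (sinh (rhoH a b) * cosh (rhoH a b))"
proof -
  define u v where "u = rhoH a b" and "v = rhoH (hmap e a) (hmap e b)"
  have u: "u \<ge> 0" "v \<ge> 0" using rhoH_nonneg a b hmap_halfplane[OF e] by (auto simp: u_def v_def)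
  have "(e * cmod a)\<^sup>2 < 1" "(e * cmod b)\<^sup>2 < 1" using e a b by (simp_all add: abs_square_less_1 abs_mult)
  then have Q: "Q \<ge> 0" using a b e by (auto simp: Q_def)
  have su: "sinh u \<ge> 0" "sinh v \<ge> 0" "cosh u > 0" using u by auto
  define t where "t = Q / 2 * (sinh u * cosh u)"
  have t: "t \<ge> 0" using Q su by (simp add: t_def)
  have "(sinh v)\<^sup>2 = (sinh u)\<^sup>2 * (1 + Q * (cosh u)\<^sup>2)" unfolding u_def v_def Q_def by (rule hmap_sinh[OF e a b])
  also have "\<dots> \<le> (sinh u)\<^sup>2 * (1 + Q / 2 * (cosh u)\<^sup>2)\<^sup>2"
  proof (rule mult_left_mono)
    have "0 \<le> (Q / 2 * (cosh u)\<^sup>2)\<^sup>2" by simp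
    then show "1 + Q * (cosh u)\<^sup>2 \<le> (1 + Q / 2 * (cosh u)\<^sup>2)\<^sup>2" unfolding power2_sum by simp
  qed simp
  also have "\<dots> = (sinh u * (1 + Q / 2 * (cosh u)\<^sup>2))\<^sup>2" by (simp add: power_mult_distrib)
  finally have "sinh v \<le> sinh u * (1 + Q / 2 * (cosh u)\<^sup>2)" by (rule power2_le_imp_le) (use su Q in auto)
  also have "\<dots> = sinh u + t * cosh u" by (simp add: t_def power2_eq_square algebra_simps)
  also have "\<dots> \<le> sinh u * cosh t + cosh u * sinh t"
  proof -
    have "sinh t \<ge> t" using t by (rule sinh_ge)
    from mult_left_mono[OF this, of "cosh u"] have "t * cosh u \<le> cosh u * sinh t" using su by (simp add: mult.commute)
    moreover have "sinh u * 1 \<le> sinh u * cosh t" using su cosh_real_ge_1[of t] by (intro mult_left_mono) auto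
    ultimately show ?thesis by linarith
  qed
  also have "\<dots> = sinh (u + t)" by (simp add: sinh_add)
  finally show ?thesis by (simp add: u_def v_def t_def)
qed

text \<open>The radicand avoids the cut of the square root, so the root s has Re s > 0. With x = e
  \<zeta> one has x^2 (1 + s) = 1 - s, which puts x into the unit disc, and \<open>Im_hmap\<close>
  then gives the half-plane.\<close>

lemma hinv:
  assumes e: "e > 0"
  shows "hinv e holomorphic_on {w. Im w > 0}"
    "\<And>w. Im w > 0 \<Longrightarrow> Im (hinv e w) > 0 \<and> e * cmod (hinv e w) < 1"
    "\<And>\<zeta>. Im \<zeta> > 0 \<Longrightarrow> e * cmod \<zeta> < 1 \<Longrightarrow> hinv e (hmap e \<zeta>) = \<zeta>"
proof -
  have slit: "1 - 4 * (of_real e * w)\<^sup>2 \<notin> \<real>\<^sub>\<le>\<^sub>0" if "Im w > 0" for w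
  proof
    assume *: "1 - 4 * (of_real e * w)\<^sup>2 \<in> \<real>\<^sub>\<le>\<^sub>0"
    then have "Re (1 - 4 * (of_real e * w)\<^sup>2) \<le> 0" "Im (1 - 4 * (of_real e * w)\<^sup>2) = 0"
      by (auto simp: complex_nonpos_Reals_iff)
    then have i: "Re w = 0" "1 \<le> 4 * ((e * Re w)\<^sup>2 - (e * Im w)\<^sup>2)" using that e
      by (auto simp: power2_eq_square algebra_simps)
    from i(2) have "1 \<le> - (4 * (e * Im w)\<^sup>2)" by (simp add: i(1))
    then show False using zero_le_power2[of "e * Im w"] by linarith
  qed
  have wne: "w \<noteq> 0" if "Im w > 0" for w :: complex using that by auto
  show "hinv e holomorphic_on {w. Im w > 0}"
    unfolding hinv_def using slit wne e by (intro holomorphic_intros) auto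
  have quad: "of_real e * hinv e w * (of_real e * w) * 2 = 1 - csqrt (1 - 4 * (of_real e * w)\<^sup>2)" if "Im w > 0" for w
    using wne[OF that] e by (simp add: hinv_def)
  show main: "Im (hinv e w) > 0 \<and> e * cmod (hinv e w) < 1" if w: "Im w > 0" for w
  proof -
    define W s where "W = of_real e * w" and "s = csqrt (1 - 4 * W\<^sup>2)"
    define x where "x = of_real e * hinv e w"
    have W: "Im W > 0" "W \<noteq> 0" using w e wne[OF w] by (auto simp: W_def)
    have s2: "s\<^sup>2 = 1 - 4 * W\<^sup>2" by (simp add: s_def)
    have Res: "Re s > 0"
    proof -
      have "Re s \<ge> 0" using csqrt_principal[of "1 - 4 * W\<^sup>2"] by (auto simp: s_def)
      moreover have "Re s \<noteq> 0"
      proof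
        assume "Re s = 0"
        then have "s\<^sup>2 \<in> \<real>\<^sub>\<le>\<^sub>0" by (simp add: complex_nonpos_Reals_iff power2_eq_square)
        then show False using slit[OF w] s2 by (simp add: W_def)
      qed
      ultimately show ?thesis by simp
    qed
    have x2: "2 * W * x = 1 - s" using quad[OF w] by (simp add: x_def W_def s_def mult_ac)
    have s1: "1 + s \<noteq> 0" using Res by (auto simp: complex_eq_iff)
    have "(2 * W * x) * (1 + s) = 1 - s\<^sup>2" unfolding x2 by (simp add: power2_eq_square algebra_simps)
    then have "(2 * W) * (x * (1 + s)) = (2 * W) * (2 * W)" unfolding s2 by (simp add: power2_eq_square algebra_simps)
    then have xs: "x * (1 + s) = 2 * W" using W by simp
    have "cmod (1 - s) < cmod (1 + s)"
    proof -
      have "(cmod (1 + s))\<^sup>2 - (cmod (1 - s))\<^sup>2 = 4 * Re s" unfolding cmod_power2 by (simp add: power2_eq_square algebra_simps)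
      then have "(cmod (1 - s))\<^sup>2 < (cmod (1 + s))\<^sup>2" using Res by simp
      then show ?thesis by (rule power_less_imp_less_base) simp
    qed
    moreover have "cmod x * cmod x * cmod (1 + s) = cmod (1 - s)"
    proof -
      have "x * (x * (1 + s)) = 1 - s" unfolding xs using x2 by (simp add: mult_ac)
      then show ?thesis by (metis norm_mult mult.assoc)
    qed
    ultimately have "(cmod x)\<^sup>2 < 1" using s1 by (smt (verit) mult_le_cancel_right1 norm_ge_zero power2_eq_square zero_less_norm_iff)
    then have x1: "cmod x < 1" by (simp add: abs_square_less_1)
    have "W * (1 + x\<^sup>2) = x"
    proof -
      have "1 + s = 2 - 2 * W * x" unfolding x2 by simp
      then have "x * (2 - 2 * W * x) = 2 * W" using xs by (simp only:)
      then have "2 * (W * (1 + x\<^sup>2)) = 2 * x" by (simp add: power2_eq_square algebra_simps)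
      then show ?thesis by simp
    qed
    moreover have "1 + x\<^sup>2 \<noteq> 0" using hmap_den[of 1 x] x1 by simp
    ultimately have "hmap 1 x = W" by (simp add: hmap_def field_simps)
    moreover have "Im (hmap 1 x) = Im x * (1 - (cmod x)\<^sup>2) / (cmod (1 + x\<^sup>2))\<^sup>2"
      using Im_hmap[of 1 x] x1 by simp
    ultimately have "Im x > 0" using W(1) \<open>(cmod x)\<^sup>2 < 1\<close> by (smt (verit, best) divide_nonpos_nonneg mult_nonpos_nonneg zero_le_power2)
    then show ?thesis using x1 e by (simp add: x_def norm_mult zero_less_mult_iff)
  qed
  show "hinv e (hmap e \<zeta>) = \<zeta>" if z: "Im \<zeta> > 0" "e * cmod \<zeta> < 1" for \<zeta>
  proof -
    define x where "x = of_real e * \<zeta>"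
    have x1: "cmod x < 1" using z e by (simp add: x_def norm_mult)
    have xd: "1 + x\<^sup>2 \<noteq> 0" using hmap_den[of 1 x] x1 by simp
    have x0: "x \<noteq> 0" using z e by (auto simp: x_def)
    have W: "of_real e * hmap e \<zeta> = x / (1 + x\<^sup>2)" by (simp add: hmap_def x_def)
    have "1 - 4 * (x / (1 + x\<^sup>2))\<^sup>2 = ((1 + x\<^sup>2)\<^sup>2 - 4 * x\<^sup>2) / (1 + x\<^sup>2)\<^sup>2"
      using xd by (simp add: power_divide diff_divide_distrib)
    also have "(1 + x\<^sup>2)\<^sup>2 - 4 * x\<^sup>2 = (1 - x\<^sup>2)\<^sup>2" by (simp add: power2_eq_square algebra_simps)
    finally have "1 - 4 * (x / (1 + x\<^sup>2))\<^sup>2 = ((1 - x\<^sup>2) / (1 + x\<^sup>2))\<^sup>2" by (simp add: power_divide)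
    moreover have "csqrt (((1 - x\<^sup>2) / (1 + x\<^sup>2))\<^sup>2) = (1 - x\<^sup>2) / (1 + x\<^sup>2)"
    proof (rule csqrt_square)
      have "(cmod x)\<^sup>2 < 1" using x1 by (simp add: abs_square_less_1)
      then have lt: "cmod (x\<^sup>2) < 1" by (simp add: norm_power)
      have "Re ((1 - w) * cnj (1 + w)) = 1 - (cmod w)\<^sup>2" for w
        unfolding cmod_power2 by (simp add: algebra_simps power2_eq_square)
      then have "Re ((1 - x\<^sup>2) * cnj (1 + x\<^sup>2)) = 1 - (cmod (x\<^sup>2))\<^sup>2" .
      also have "\<dots> > 0" using lt by (simp add: abs_square_less_1)
      finally show "0 < Re ((1 - x\<^sup>2) / (1 + x\<^sup>2)) \<or> Re ((1 - x\<^sup>2) / (1 + x\<^sup>2)) = 0 \<and> 0 \<le> Im ((1 - x\<^sup>2) / (1 + x\<^sup>2))"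
        using Re_complex_div_gt_0 by blast
    qed
    ultimately have "hinv e (hmap e \<zeta>) = (1 - (1 - x\<^sup>2) / (1 + x\<^sup>2)) / (2 * of_real e * (x / (1 + x\<^sup>2)))"
      by (simp only: hinv_def W)
    also have "1 - (1 - x\<^sup>2) / (1 + x\<^sup>2) = 2 * x * (x / (1 + x\<^sup>2))"
      using xd by (simp add: field_simps power2_eq_square)
    also have "2 * x * (x / (1 + x\<^sup>2)) / (2 * of_real e * (x / (1 + x\<^sup>2))) = \<zeta>"
      using xd x0 e by (simp add: x_def)
    finally show ?thesis .
  qed
qed

lemma DERIV_hmap:
  assumes "e > 0" "e * y < 1" "y > 0"
  defines "t \<equiv> (e * y)\<^sup>2"
  shows "(hmap e has_field_derivative of_real ((1 + t) / (1 - t)\<^sup>2)) (at (\<i> * of_real y))"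
    and "hmap e (\<i> * of_real y) = \<i> * of_real (y / (1 - t))" and "t < 1"
proof -
  have t1: "t < 1" using assms by (auto simp: t_def abs_square_less_1)
  then show "t < 1" .
  have sq: "(of_real e * (\<i> * of_real y))\<^sup>2 = - of_real t" by (simp add: t_def power_mult_distrib)
  have ne: "1 - complex_of_real t \<noteq> 0" using t1 by (metis diff_gt_0_iff_gt less_irrefl of_real_1 of_real_diff of_real_eq_0_iff)
  show "hmap e (\<i> * of_real y) = \<i> * of_real (y / (1 - t))" unfolding hmap_def sq by simp
  have "(hmap e has_field_derivative (1 * (1 + (of_real e * (\<i> * of_real y))\<^sup>2) - (\<i> * of_real y) * (2 * (of_real e * (\<i> * of_real y)) * of_real e)) /
     ((1 + (of_real e * (\<i> * of_real y))\<^sup>2) * (1 + (of_real e * (\<i> * of_real y))\<^sup>2))) (at (\<i> * of_real y))"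
    unfolding hmap_def[abs_def] using ne sq by (auto intro!: derivative_eq_intros)
  moreover have "(\<i> * of_real y) * (2 * (of_real e * (\<i> * of_real y)) * of_real e) = - 2 * of_real t"
    by (simp add: t_def power2_eq_square algebra_simps)
  ultimately show "(hmap e has_field_derivative of_real ((1 + t) / (1 - t)\<^sup>2)) (at (\<i> * of_real y))"
    unfolding sq by (simp add: power2_eq_square add.commute)
qed

section \<open>Disc automorphisms, visibility and half-plane parametrizations\<close>

lemma rho_Moebius:
  assumes w: "cmod w < 1" and ab: "cmod a < 1" "cmod b < 1"
  shows "rho (Moebius_function 0 w a) (Moebius_function 0 w b) = rho a b"
proof (rule antisym)
  let ?M = "Moebius_function 0 w" and ?N = "Moebius_function 0 (-w)"
  have lt: "cmod (?M z) < 1" "cmod (?N z) < 1" if "cmod z < 1" for z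
    using that w Moebius_function_norm_lt_1[of w z] Moebius_function_norm_lt_1[of "-w" z] by auto
  show "rho (?M a) (?M b) \<le> rho a b"
    using w ab lt by (intro rho_contract Moebius_function_holomorphic) auto
  have inv: "?N (?M z) = z" if "cmod z < 1" for z
    using that w by (intro Moebius_function_compose) auto
  have "rho (?N (?M a)) (?N (?M b)) \<le> rho (?M a) (?M b)"
    using w ab lt by (intro rho_contract Moebius_function_holomorphic) auto
  then show "rho a b \<le> rho (?M a) (?M b)" using inv ab by simp
qed

lemma rho_rotate:
  assumes "cmod \<theta> = 1"
  shows "rho (\<theta> * a) (\<theta> * b) = rho a b"
proof -
  have "\<theta> * cnj \<theta> = 1" using complex_norm_square[of \<theta>] assms by simp
  then have "cnj (\<theta> * a) * (\<theta> * b) = cnj a * b" by (simp add: mult_ac)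
  then have "pdisc (\<theta> * a) (\<theta> * b) = pdisc a b"
    unfolding pdisc_def using assms by (simp only: norm_divide right_diff_distrib[symmetric] norm_mult mult_1)
  then show ?thesis by (simp add: rho_def)
qed

text \<open>Visibility concerns real geodesics; the image of the hyperbolic segment from a to b,
  parametrized by arc length, is one. The point where it meets K lies on the segment, whence exact
  additivity.\<close>

lemma cgeo_segment_hits:
  fixes D :: "(complex ^ 'n) set"
  assumes D: "open D" "connected D" "bounded D" and \<phi>: "cgeo D \<phi>" and ab: "cmod a < 1" "cmod b < 1"
    and vis: "\<And>l u \<psi>. real_geodesic D l u \<psi> \<Longrightarrow> diameter (\<psi> ` {l..u}) > \<epsilon> \<Longrightarrow> \<psi> ` {l..u} \<inter> K \<noteq> {}"
    and far: "dist (\<phi> a) (\<phi> b) > \<epsilon>"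
  obtains m where "cmod m < 1" "\<phi> m \<in> K" "rho a b = rho a m + rho m b"
proof -
  define \<beta> where "\<beta> = Moebius_function 0 a b"
  have \<beta>1: "cmod \<beta> < 1" unfolding \<beta>_def using ab Moebius_function_norm_lt_1 by blast
  define L where "L = artanh (cmod \<beta>)"
  have L: "L \<ge> 0" "tanh L = cmod \<beta>" using \<beta>1 by (auto simp: L_def artanh_nonneg tanh_artanh)
  obtain \<theta> where \<theta>: "cmod \<theta> = 1" "\<theta> * of_real (cmod \<beta>) = \<beta>"
  proof (cases "\<beta> = 0")
    case True then show ?thesis using that[of 1] by simp
  next
    case False then show ?thesis using that[of "\<beta> / of_real (cmod \<beta>)"] by (simp add: norm_divide)
  qed
  let ?N = "Moebius_function 0 (-a)"
  define m where "m = (\<lambda>t::real. ?N (\<theta> * of_real (tanh t)))"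
  have lt: "cmod (\<theta> * of_real (tanh t)) < 1" for t :: real
    using norm_tanh_less_1[of t] \<theta>(1) by (simp add: norm_mult)
  have m1: "cmod (m t) < 1" for t unfolding m_def using ab lt Moebius_function_norm_lt_1[of "-a"] by simp
  have mrho: "rho (m s) (m t) = \<bar>s - t\<bar>" for s t
    unfolding m_def using rho_Moebius[of "-a" "\<theta> * of_real (tanh s)" "\<theta> * of_real (tanh t)"] ab lt
    by (simp add: rho_rotate[OF \<theta>(1)] rho_tanh)
  have m0: "m 0 = a" by (simp add: m_def Moebius_function_of_zero)
  have "m L = ?N \<beta>" by (simp add: m_def L(2) \<theta>(2))
  then have mL: "m L = b" unfolding \<beta>_def using ab Moebius_function_compose[of "-a" a b] by simp
  have \<phi>d: "\<phi> \<in> disc_maps D" using \<phi> by (simp add: cgeo_def)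
  define \<psi> where "\<psi> = (\<lambda>t. \<phi> (m t))"
  have contM: "continuous_on (ball 0 1) ?N" using ab by (intro holomorphic_on_imp_continuous_on Moebius_function_holomorphic) auto
  have cm: "continuous_on {0..L} m"
    unfolding m_def by (intro continuous_on_compose2[OF contM] continuous_intros) (use lt cosh_real_nonzero in auto)
  have c\<phi>: "continuous_on (ball 0 1) \<phi>"
    by (intro continuous_at_imp_continuous_on ballI has_derivative_continuous[OF disc_maps_has_derivative[OF \<phi>d]]) auto
  have c\<psi>: "continuous_on {0..L} \<psi>" unfolding \<psi>_def by (rule continuous_on_compose2[OF c\<phi> cm]) (use m1 in auto)
  have geo: "real_geodesic D 0 L \<psi>"
    unfolding real_geodesic_def using L c\<psi> disc_maps_in[OF \<phi>d m1] cgeo_dist(1)[OF D(1,2) \<phi> m1 m1] mrho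
    by (auto simp: \<psi>_def)
  have "bounded (\<psi> ` {0..L})" using D(3) disc_maps_in[OF \<phi>d m1] by (elim bounded_subset) (auto simp: \<psi>_def)
  then have "dist (\<psi> 0) (\<psi> L) \<le> diameter (\<psi> ` {0..L})" using L by (intro diameter_bounded_bound) auto
  then have "diameter (\<psi> ` {0..L}) > \<epsilon>" using far by (simp add: \<psi>_def m0 mL)
  from vis[OF geo this] obtain t where t: "0 \<le> t" "t \<le> L" "\<psi> t \<in> K" by auto
  have "rho a b = rho a (m t) + rho (m t) b" using mrho[of 0 L] mrho[of 0 t] mrho[of t L] t L by (simp add: m0 mL)
  then show ?thesis using that[of "m t"] m1 t(3) by (simp add: \<psi>_def)
qed

subsection \<open>Cayley transforms\<close>

text \<open>Inverse of the Cayley transform b \<mapsto> (b - a) / (b - cnj a).\<close>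

definition cayinv :: "complex \<Rightarrow> complex \<Rightarrow> complex" where
  "cayinv a u = (a - cnj a * u) / (1 - u)"

lemma cayinv:
  assumes a: "Im a > 0"
  shows "cayinv a holomorphic_on ball 0 1" "\<And>u. cmod u < 1 \<Longrightarrow> Im (cayinv a u) > 0" "cayinv a 0 = a"
    "\<And>b. Im b > 0 \<Longrightarrow> cayinv a ((b - a) / (b - cnj a)) = b"
    "\<And>u. cmod u < 1 \<Longrightarrow> (cayinv a u - a) / (cayinv a u - cnj a) = u"
    "(cayinv a has_field_derivative 2 * \<i> * of_real (Im a)) (at 0)"
proof -
  have aa: "a - cnj a = 2 * \<i> * of_real (Im a)" by (simp add: complex_eq_iff)
  have aa0: "a - cnj a \<noteq> 0" using a by (simp add: aa)
  have ne: "1 - u \<noteq> 0" if "cmod u < 1" for u using that by auto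
  show "cayinv a holomorphic_on ball 0 1" unfolding cayinv_def[abs_def] using ne by (intro holomorphic_intros) auto
  show "cayinv a 0 = a" by (simp add: cayinv_def)
  show "Im (cayinv a u) > 0" if u: "cmod u < 1" for u
  proof -
    have "(cmod u)\<^sup>2 < 1" using u by (simp add: abs_square_less_1)
    moreover have "Im (cayinv a u) = Im a * (1 - (cmod u)\<^sup>2) / (cmod (1 - u))\<^sup>2"
      unfolding cayinv_def Im_divide cmod_power2 by (simp add: power2_eq_square algebra_simps)
    ultimately show ?thesis using a ne[OF u] by simp
  qed
  show "cayinv a ((b - a) / (b - cnj a)) = b" if b: "Im b > 0" for b
  proof -
    have n: "b - cnj a \<noteq> 0" using a b by (auto simp: complex_eq_iff)
    have "1 - (b - a) / (b - cnj a) = (a - cnj a) / (b - cnj a)" using n by (simp add: field_simps)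
    moreover have "a - cnj a * ((b - a) / (b - cnj a)) = b * (a - cnj a) / (b - cnj a)" using n by (simp add: field_simps)
    ultimately show ?thesis unfolding cayinv_def using n aa0 by simp
  qed
  show "(cayinv a u - a) / (cayinv a u - cnj a) = u" if u: "cmod u < 1" for u
  proof -
    have "cayinv a u - a = u * (a - cnj a) / (1 - u)" "cayinv a u - cnj a = (a - cnj a) / (1 - u)"
      using ne[OF u] by (simp_all add: cayinv_def field_simps)
    then show ?thesis using ne[OF u] aa0 by simp
  qed
  have "(cayinv a has_field_derivative (- cnj a * (1 - 0) - (a - cnj a * 0) * (- 1)) / ((1 - 0) * (1 - 0))) (at 0)"
    unfolding cayinv_def[abs_def] by (auto intro!: derivative_eq_intros)
  then show "(cayinv a has_field_derivative 2 * \<i> * of_real (Im a)) (at 0)" by (simp add: aa[symmetric])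
qed

lemma rho_cayley:
  assumes "Im p > 0" "Im q > 0"
  shows "rho ((p - \<i>) / (p + \<i>)) ((q - \<i>) / (q + \<i>)) = rhoH p q" "cmod ((p - \<i>) / (p + \<i>)) < 1"
proof -
  have n: "p + \<i> \<noteq> 0" "q + \<i> \<noteq> 0" using assms by (auto simp: complex_eq_iff)
  have nc: "cnj p - \<i> \<noteq> 0" using assms by (auto simp: complex_eq_iff)
  have e1: "(p - \<i>) / (p + \<i>) - (q - \<i>) / (q + \<i>) = 2 * \<i> * (p - q) / ((p + \<i>) * (q + \<i>))"
    using n by (simp add: field_simps)
  have "1 - cnj ((p - \<i>) / (p + \<i>)) * ((q - \<i>) / (q + \<i>)) = 1 - (cnj p + \<i>) / (cnj p - \<i>) * ((q - \<i>) / (q + \<i>))"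
    by simp
  also have "\<dots> = ((cnj p - \<i>) * (q + \<i>) - (cnj p + \<i>) * (q - \<i>)) / ((cnj p - \<i>) * (q + \<i>))"
    unfolding times_divide_times_eq by (subst diff_divide_distrib, subst divide_self) (use n nc in auto)
  also have "(cnj p - \<i>) * (q + \<i>) - (cnj p + \<i>) * (q - \<i>) = 2 * \<i> * (cnj p - q)" by (simp add: algebra_simps)
  finally have e2: "1 - cnj ((p - \<i>) / (p + \<i>)) * ((q - \<i>) / (q + \<i>)) = 2 * \<i> * (cnj p - q) / ((cnj p - \<i>) * (q + \<i>))" .
  have m: "cmod (cnj p - \<i>) = cmod (p + \<i>)"
  proof -
    have "cnj p - \<i> = cnj (p + \<i>)" by simp
    then show ?thesis by (metis complex_mod_cnj)
  qed
  have m2: "cmod (cnj p - q) = cmod (p - cnj q)"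
  proof -
    have "cnj p - q = cnj (p - cnj q)" by simp
    then show ?thesis by (metis complex_mod_cnj)
  qed
  have "pdisc ((p - \<i>) / (p + \<i>)) ((q - \<i>) / (q + \<i>)) = cmod (p - q) / cmod (p - cnj q)"
    unfolding pdisc_def e1 e2 using n nc by (simp add: norm_divide norm_mult m m2)
  then show "rho ((p - \<i>) / (p + \<i>)) ((q - \<i>) / (q + \<i>)) = rhoH p q" by (simp add: rho_def rhoH_def)
  have "cmod (p - \<i>) / cmod (p - cnj \<i>) < 1" using assms by (intro halfplane_quotient) auto
  then show "cmod ((p - \<i>) / (p + \<i>)) < 1" by (simp add: norm_divide)
qed

definition disc_param :: "(complex \<Rightarrow> complex) \<Rightarrow> bool" where
  "disc_param c \<longleftrightarrow> c holomorphic_on {p. Im p > 0} \<and> (\<forall>p. Im p > 0 \<longrightarrow> cmod (c p) < 1) \<and>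
     (\<forall>p q. Im p > 0 \<longrightarrow> Im q > 0 \<longrightarrow> rho (c p) (c q) = rhoH p q) \<and>
     (\<forall>\<xi>. cmod \<xi> < 1 \<longrightarrow> (\<exists>p. Im p > 0 \<and> c p = \<xi>))"

lemma disc_param_exists:
  assumes \<xi>: "cmod \<xi> < 1" and a: "cmod a < 1"
  obtains c y where "disc_param c" "0 < y" "y \<le> 1" "c \<i> = \<xi>" "c (\<i> * of_real y) = a"
proof -
  define \<beta> where "\<beta> = Moebius_function 0 \<xi> a"
  have \<beta>1: "cmod \<beta> < 1" unfolding \<beta>_def using assms Moebius_function_norm_lt_1 by blast
  \<comment> \<open>Chosen so that the Cayley transform takes \<i> y to -|\<beta>|; the rotation by
    -\<theta> then takes that to \<beta>.\<close>
  define y where "y = (1 - cmod \<beta>) / (1 + cmod \<beta>)"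
  have n1: "1 + cmod \<beta> > 0" by (simp add: add_pos_nonneg)
  have y: "0 < y" "y \<le> 1" using \<beta>1 n1 by (auto simp: y_def)
  obtain \<theta> where \<theta>: "cmod \<theta> = 1" "\<theta> * of_real (cmod \<beta>) = \<beta>"
  proof (cases "\<beta> = 0")
    case True then show ?thesis using that[of 1] by simp
  next
    case False then show ?thesis using that[of "\<beta> / of_real (cmod \<beta>)"] by (simp add: norm_divide)
  qed
  let ?N = "Moebius_function 0 (-\<xi>)" and ?M = "Moebius_function 0 \<xi>"
  define c where "c = (\<lambda>p. ?N (- \<theta> * ((p - \<i>) / (p + \<i>))))"
  have th: "cmod (- \<theta>) = 1" using \<theta> by simp
  have lt: "cmod (- \<theta> * ((p - \<i>) / (p + \<i>))) < 1" if "Im p > 0" for p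
    using rho_cayley(2)[OF that that] th by (simp only: norm_mult mult_1)
  have hN: "?N holomorphic_on ball 0 1" using \<xi> by (intro Moebius_function_holomorphic) auto
  have c1: "cmod (c p) < 1" if "Im p > 0" for p
    unfolding c_def using lt[OF that] \<xi> Moebius_function_norm_lt_1[of "-\<xi>"] by simp
  have par: "disc_param c"
    unfolding disc_param_def
  proof (intro conjI allI impI)
    have "(\<lambda>p. - \<theta> * ((p - \<i>) / (p + \<i>))) holomorphic_on {p. Im p > 0}"
      by (intro holomorphic_intros) (auto simp: complex_eq_iff)
    then show "c holomorphic_on {p. Im p > 0}" unfolding c_def
      using lt by (intro holomorphic_on_compose_gen[OF _ hN, unfolded o_def]) auto
    show "cmod (c p) < 1" if "Im p > 0" for p by (rule c1[OF that])
    show "rho (c p) (c q) = rhoH p q" if "Im p > 0" "Im q > 0" for p q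
      unfolding c_def using rho_Moebius[of "-\<xi>", OF _ lt[OF that(1)] lt[OF that(2)]] \<xi>
      by (simp only: rho_rotate[OF th] rho_cayley[OF that] norm_minus_cancel)
    show "\<exists>p. Im p > 0 \<and> c p = \<zeta>" if z: "cmod \<zeta> < 1" for \<zeta>
    proof -
      define u where "u = - ?M \<zeta> / \<theta>"
      have M1: "cmod (?M \<zeta>) < 1" using z \<xi> Moebius_function_norm_lt_1 by blast
      then have u: "cmod u < 1" using \<theta> by (simp add: u_def norm_divide)
      have t0: "\<theta> \<noteq> 0" using \<theta> by auto
      have "(cayinv \<i> u - \<i>) / (cayinv \<i> u + \<i>) = u" using cayinv(5)[of \<i> u] u by simp
      then have "c (cayinv \<i> u) = ?N (?M \<zeta>)" unfolding c_def using t0 by (simp add: u_def)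
      also have "\<dots> = \<zeta>" using z \<xi> by (intro Moebius_function_compose) auto
      finally show ?thesis using cayinv(2)[of \<i> u] u by auto
    qed
  qed
  have ci: "c \<i> = \<xi>" by (simp add: c_def Moebius_function_of_zero)
  have "c (\<i> * of_real y) = a"
  proof -
    have y1: "(y - 1) / (y + 1) = - cmod \<beta>" using n1 \<beta>1 by (simp add: y_def field_simps)
    have "(\<i> * of_real y - \<i>) / (\<i> * of_real y + \<i>) = of_real ((y - 1) / (y + 1))"
    proof -
      have "\<i> * of_real y - \<i> = \<i> * of_real (y - 1)" "\<i> * of_real y + \<i> = \<i> * of_real (y + 1)" by (simp_all add: algebra_simps)
      then show ?thesis by (simp only: mult_divide_mult_cancel_left[OF complex_i_not_zero] of_real_divide)
    qed
    then have "c (\<i> * of_real y) = ?N \<beta>" unfolding c_def y1 using \<theta>(2) by simp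
    also have "\<dots> = a" unfolding \<beta>_def using \<xi> a by (intro Moebius_function_compose) auto
    finally show ?thesis .
  qed
  then show ?thesis using that[OF par y ci] by blast
qed

lemma disc_param_deriv:
  assumes c: "disc_param c" and y: "y > 0" "c (\<i> * of_real y) = 0"
  shows "(c has_field_derivative deriv c (\<i> * of_real y)) (at (\<i> * of_real y))"
    "cmod (deriv c (\<i> * of_real y)) = 1 / (2 * y)"
proof -
  define a where "a = \<i> * of_real y"
  have a: "Im a > 0" using y by (simp add: a_def)
  have op: "open {p. Im p > 0}" by (rule open_halfspace_Im_gt)
  have hol: "c holomorphic_on {p. Im p > 0}" using c by (simp add: disc_param_def)
  show D: "(c has_field_derivative deriv c (\<i> * of_real y)) (at (\<i> * of_real y))"
    using holomorphic_derivI[OF hol op] a by (simp add: a_def)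
  have eq: "cmod (c p) = cmod (a - p) / cmod (a - cnj p)" if p: "Im p > 0" for p
  proof -
    have "rho (c a) (c p) = rhoH a p" using c a p by (simp add: disc_param_def)
    then have "artanh (cmod (c p)) = artanh (cmod (a - p) / cmod (a - cnj p))"
      using y by (simp add: a_def rhoH_def)
    moreover have "cmod (c p) < 1" using c p by (simp add: disc_param_def)
    ultimately show ?thesis using halfplane_quotient(2)[OF a p] tanh_artanh
      by (metis abs_norm_cancel abs_of_nonneg divide_nonneg_nonneg norm_ge_zero)
  qed
  have "((\<lambda>p. cmod ((c p - c a) / (p - a))) \<longlongrightarrow> cmod (deriv c a)) (at a)"
    using D unfolding has_field_derivative_iff a_def[symmetric] by (rule tendsto_norm)
  moreover have "((\<lambda>p. cmod ((c p - c a) / (p - a))) \<longlongrightarrow> 1 / (2 * y)) (at a)"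
  proof (rule Lim_transform_eventually)
    have "cmod (a - cnj a) = 2 * y" using y by (simp add: a_def norm_mult)
    then show "((\<lambda>p. 1 / cmod (a - cnj p)) \<longlongrightarrow> 1 / (2 * y)) (at a)"
      using y by (auto intro!: tendsto_eq_intros)
    have "eventually (\<lambda>p. p \<in> {p. Im p > 0}) (at a)" using eventually_at_in_open'[OF op] a by simp
    moreover have "eventually (\<lambda>p. p \<noteq> a) (at a)" by (rule eventually_neq_at_within)
    ultimately show "\<forall>\<^sub>F p in at a. 1 / cmod (a - cnj p) = cmod ((c p - c a) / (p - a))"
    proof eventually_elim
      case (elim p)
      have "cmod (a - p) > 0" using elim by simp
      then show ?case using eq[of p] elim y by (simp add: a_def norm_divide norm_minus_commute)
    qed
  qed
  ultimately have "cmod (deriv c a) = 1 / (2 * y)" by (rule tendsto_unique[OF at_neq_bot])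
  then show "cmod (deriv c (\<i> * of_real y)) = 1 / (2 * y)" by (simp add: a_def)
qed

context
  fixes D U :: "(complex ^ 'n) set" and \<phi> :: "complex \<Rightarrow> complex ^ 'n" and c :: "complex \<Rightarrow> complex" and e :: real
  assumes \<phi>: "\<phi> \<in> disc_maps D" and c: "disc_param c" and e: "e > 0"
    and inU: "\<And>q. Im q > 0 \<Longrightarrow> e * cmod q < 1 \<Longrightarrow> \<phi> (c q) \<in> U"
begin

text \<open>The unit disc is sent to the half-plane, then by \<open>hinv e\<close> to the half-disc,
  and by c back into the unit disc, onto a part where \<phi> stays in U.\<close>

lemma halfdisc_map:
  assumes A: "Im A > 0"
  defines "m \<equiv> c \<circ> hinv e \<circ> cayinv A"
  shows "m holomorphic_on ball 0 1" "\<And>u. cmod u < 1 \<Longrightarrow> cmod (m u) < 1" "\<phi> \<circ> m \<in> disc_maps (D \<inter> U)"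
proof -
  have h: "(c \<circ> hinv e) holomorphic_on {p. Im p > 0}"
    using c hinv[OF e] by (intro holomorphic_on_compose_gen[where t = "{p. Im p > 0}"]) (auto simp: disc_param_def)
  show m: "m holomorphic_on ball 0 1" unfolding m_def
    using cayinv[OF A] by (intro holomorphic_on_compose_gen[OF _ h]) auto
  have q: "Im (hinv e (cayinv A u)) > 0" "e * cmod (hinv e (cayinv A u)) < 1" if "cmod u < 1" for u
    using hinv(2)[OF e cayinv(2)[OF A that]] by auto
  show m1: "cmod (m u) < 1" if "cmod u < 1" for u using q[OF that] c by (simp add: m_def disc_param_def)
  have "\<phi> \<circ> m \<in> disc_maps D" by (rule disc_maps_compose[OF \<phi> m m1])
  moreover have "(\<phi> \<circ> m) u \<in> U" if "cmod u < 1" for u using inU[OF q[OF that]] by (simp add: m_def)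
  ultimately show "\<phi> \<circ> m \<in> disc_maps (D \<inter> U)" by (auto simp: disc_maps_def)
qed

lemma halfdisc_kobayashi:
  assumes DU: "open (D \<inter> U)" "connected (D \<inter> U)"
    and a: "Im a > 0" "e * cmod a < 1" and b: "Im b > 0" "e * cmod b < 1"
  shows "kobayashi_dist (D \<inter> U) (\<phi> (c a)) (\<phi> (c b)) \<le> rhoH (hmap e a) (hmap e b)"
proof -
  define A B where "A = hmap e a" and "B = hmap e b"
  have AB: "Im A > 0" "Im B > 0" using hmap_halfplane[OF e] a b by (auto simp: A_def B_def)
  define u where "u = (B - A) / (B - cnj A)"
  have nu: "cmod u = cmod (A - B) / cmod (A - cnj B)"
  proof -
    have "B - cnj A = - cnj (A - cnj B)" by simp
    then have "cmod (B - cnj A) = cmod (A - cnj B)" by (metis complex_mod_cnj norm_minus_cancel)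
    then show ?thesis by (simp add: u_def norm_divide norm_minus_commute)
  qed
  then have u1: "cmod u < 1" using halfplane_quotient(2)[OF AB] by simp
  have m0: "(\<phi> \<circ> (c \<circ> hinv e \<circ> cayinv A)) 0 = \<phi> (c a)"
    using hinv(3)[OF e a] cayinv(3)[OF AB(1)] by (simp add: A_def)
  have mu: "(\<phi> \<circ> (c \<circ> hinv e \<circ> cayinv A)) u = \<phi> (c b)"
    using hinv(3)[OF e b] cayinv(4)[OF AB] by (simp add: u_def B_def)
  have "kobayashi_dist (D \<inter> U) (\<phi> (c a)) (\<phi> (c b)) \<le> rho 0 u"
    using kobayashi_le_rho[OF DU halfdisc_map(3)[OF AB(1)], of 0 u] m0 mu u1 by simp
  then show ?thesis using nu by (simp add: rhoH_def A_def B_def)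
qed

text \<open>The infinitesimal counterpart: by the chain rule the reparametrization has derivative of
  modulus (1 - t) / (1 + t) at 0, and the metric grows by the reciprocal.\<close>

lemma halfdisc_metric:
  assumes y: "y > 0" "e * y < 1" "c (\<i> * of_real y) = 0" and X: "of_real g *s disc_deriv \<phi> 0 = X" "g \<ge> 0"
  defines "t \<equiv> (e * y)\<^sup>2"
  shows "kobayashi_metric (D \<inter> U) (\<phi> 0) X \<le> g * ((1 + t) / (1 - t))"
proof -
  define a where "a = \<i> * of_real y"
  have a: "Im a > 0" "e * cmod a < 1" using y by (auto simp: a_def norm_mult)
  note dh = DERIV_hmap[OF e y(2) y(1), folded t_def a_def]
  have t0: "t \<ge> 0" by (simp add: t_def)
  define A where "A = hmap e a"
  have A: "Im A > 0" "Im A = y / (1 - t)" using dh(2) dh(3) y by (auto simp: A_def)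
  define m where "m = c \<circ> hinv e \<circ> cayinv A"
  define h' where "h' = deriv (hinv e) A"
  have dhi: "(hinv e has_field_derivative h') (at A)"
    unfolding h'_def using A holomorphic_derivI[OF hinv(1)[OF e] open_halfspace_Im_gt] by simp
  have h'1: "h' * of_real ((1 + t) / (1 - t)\<^sup>2) = 1"
  proof -
    have "((hinv e \<circ> hmap e) has_field_derivative h' * of_real ((1 + t) / (1 - t)\<^sup>2)) (at a)"
      using dhi dh(1) unfolding A_def by (rule DERIV_chain)
    moreover have "((hinv e \<circ> hmap e) has_field_derivative 1) (at a)"
    proof (rule has_field_derivative_transform_within_open[of "\<lambda>x. x" 1 a "{\<zeta>. Im \<zeta> > 0} \<inter> ball 0 (1 / e)"])
      show "open ({\<zeta>. Im \<zeta> > 0} \<inter> ball 0 (1 / e))" by (intro open_Int open_halfspace_Im_gt open_ball)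
      show "a \<in> {\<zeta>. Im \<zeta> > 0} \<inter> ball 0 (1 / e)" using a e by (simp add: field_simps)
      show "x = (hinv e \<circ> hmap e) x" if "x \<in> {\<zeta>. Im \<zeta> > 0} \<inter> ball 0 (1 / e)" for x
        using that hinv(3)[OF e, of x] e by (simp add: field_simps)
    qed (auto intro!: derivative_eq_intros)
    ultimately show ?thesis by (rule DERIV_unique)
  qed
  have "cmod h' * ((1 + t) / (1 - t)\<^sup>2) = 1"
  proof -
    have "cmod (h' * of_real ((1 + t) / (1 - t)\<^sup>2)) = 1" unfolding h'1 by simp
    moreover have "\<bar>(1 + t) / (1 - t)\<^sup>2\<bar> = (1 + t) / (1 - t)\<^sup>2" using t0 by (intro abs_of_nonneg divide_nonneg_nonneg) auto
    ultimately show ?thesis by (simp only: norm_mult norm_of_real)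
  qed
  moreover have "(1 - t)\<^sup>2 \<noteq> 0" "1 + t \<noteq> 0" using t0 dh(3) by auto
  ultimately have "cmod h' * (1 + t) = (1 - t)\<^sup>2" by (simp only: times_divide_eq_right divide_eq_eq if_True not_False_eq_True mult_1)
  then have nh: "cmod h' = (1 - t)\<^sup>2 / (1 + t)" using \<open>1 + t \<noteq> 0\<close> by (simp only: eq_divide_eq if_True not_False_eq_True)
  define k where "k = deriv c a * h' * (2 * \<i> * of_real (Im A))"
  have dm: "(m has_field_derivative k) (at 0)"
  proof -
    have 1: "hinv e A = a" unfolding A_def by (rule hinv(3)[OF e a])
    have "(c has_field_derivative deriv c a) (at (hinv e A))"
      unfolding 1 using disc_param_deriv(1)[OF c y(1,3)] by (simp add: a_def)
    then have "((c \<circ> hinv e) has_field_derivative deriv c a * h') (at A)" using dhi by (rule DERIV_chain)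
    then have "((c \<circ> hinv e) has_field_derivative deriv c a * h') (at (cayinv A 0))" by (simp add: cayinv(3)[OF A(1)])
    then show ?thesis unfolding m_def k_def using cayinv(6)[OF A(1)] by (rule DERIV_chain)
  qed
  have nk: "cmod k = (1 - t) / (1 + t)"
  proof -
    have "cmod k = cmod (deriv c a) * cmod h' * (2 * Im A)" using A(1) by (simp add: k_def norm_mult)
    also have "\<dots> = 1 / (2 * y) * ((1 - t)\<^sup>2 / (1 + t)) * (2 * (y / (1 - t)))"
      unfolding disc_param_deriv(2)[OF c y(1,3), folded a_def] nh A(2) by (rule refl)
    also have "\<dots> = (1 - t) / (1 + t)"
    proof -
      have "1 / (2 * y) * (s\<^sup>2 / u) * (2 * (y / s)) = s / u" if "s \<noteq> 0" for s u :: real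
        using that y(1) by (simp add: power2_eq_square)
      then show ?thesis using dh(3) by simp
    qed
    finally show ?thesis .
  qed
  have k0: "k \<noteq> 0" using nk t0 dh(3) by auto
  have m0: "m 0 = 0" using hinv(3)[OF e a] cayinv(3)[OF A(1)] y(3) by (simp add: m_def A_def a_def)
  have dd: "disc_deriv (\<phi> \<circ> m) 0 = k *s disc_deriv \<phi> 0"
  proof (rule disc_deriv_eq)
    have "(\<phi> has_derivative (\<lambda>h. h *s disc_deriv \<phi> 0)) (at (m 0))" using disc_maps_has_derivative[OF \<phi>, of 0] m0 by simp
    moreover have "(m has_derivative (\<lambda>h. k * h)) (at 0)" using dm by (simp add: has_field_derivative_def)
    ultimately have "(\<phi> \<circ> m has_derivative ((\<lambda>h. h *s disc_deriv \<phi> 0) \<circ> (\<lambda>h. k * h))) (at 0)" by (rule diff_chain_at[rotated])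
    then show "(\<phi> \<circ> m has_derivative (\<lambda>h. h *s (k *s disc_deriv \<phi> 0))) (at 0)" by (simp add: o_def mult.commute)
  qed
  have "kobayashi_metric (D \<inter> U) ((\<phi> \<circ> m) 0) X \<le> cmod (of_real g / k)"
  proof (rule kobayashi_metric_le)
    show "\<phi> \<circ> m \<in> disc_maps (D \<inter> U)" unfolding m_def by (rule halfdisc_map(3)[OF A(1)])
    show "(of_real g / k) *s disc_deriv (\<phi> \<circ> m) 0 = X" unfolding dd using k0 X(1) by simp
  qed
  also have "cmod (of_real g / k) = g * ((1 + t) / (1 - t))" using X(2) nk by (simp add: norm_divide)
  finally show ?thesis using m0 by simp
qed

end

section \<open>Hyperbolic estimates in the half-plane\<close>

lemma cosh_rhoH_sqrt:
  assumes "Im p > 0" "Im q > 0"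
  shows "cosh (rhoH p q) = cmod (p - cnj q) / (2 * (sqrt (Im p) * sqrt (Im q)))"
proof (rule power2_eq_imp_eq)
  show "(cosh (rhoH p q))\<^sup>2 = (cmod (p - cnj q) / (2 * (sqrt (Im p) * sqrt (Im q))))\<^sup>2"
    using assms by (simp add: cosh_rhoH(1) power_divide power_mult_distrib)
qed (use assms in auto)

text \<open>Bounding exp and cosh by each other turns the additive defect C into a multiplicative
  inequality between Euclidean quantities; the heights cancel.\<close>

lemma rhoH_almost_additive:
  assumes a: "Im a > 0" and q: "Im q > 0" and le: "rhoH a \<i> + rhoH \<i> q \<le> rhoH a q + C"
  shows "cmod (a + \<i>) * cmod (q + \<i>) \<le> 4 * exp C * cmod (a - cnj q)"
proof -
  define S where "S = sqrt (Im a) * sqrt (Im q)"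
  have S: "S > 0" using a q by (simp add: S_def)
  have i: "Im \<i> > 0" by simp
  have m: "cmod (\<i> - cnj q) = cmod (q + \<i>)"
  proof -
    have "\<i> - cnj q = - cnj (q + \<i>)" by simp
    then show ?thesis by (metis complex_mod_cnj norm_minus_cancel)
  qed
  have nn: "rhoH a \<i> \<ge> 0" "rhoH \<i> q \<ge> 0" "rhoH a q \<ge> 0" using rhoH_nonneg a q i by auto
  have "cmod (a + \<i>) * cmod (q + \<i>) / (4 * S) = cosh (rhoH a \<i>) * cosh (rhoH \<i> q)"
    unfolding cosh_rhoH_sqrt[OF a i] cosh_rhoH_sqrt[OF i q] m by (simp add: S_def)
  also have "\<dots> \<le> exp (rhoH a \<i>) * exp (rhoH \<i> q)" using nn by (intro mult_mono exp_cosh_bounds) auto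
  also have "\<dots> \<le> exp C * exp (rhoH a q)" using le by (simp add: exp_add[symmetric])
  also have "\<dots> \<le> exp C * (2 * cosh (rhoH a q))" using exp_cosh_bounds(1)[OF nn(3)] by (intro mult_left_mono) auto
  also have "\<dots> = 4 * exp C * cmod (a - cnj q) / (4 * S)" unfolding cosh_rhoH_sqrt[OF a q] by (simp add: S_def)
  finally have "cmod (a + \<i>) * cmod (q + \<i>) / (4 * S) * (4 * S) \<le> 4 * exp C * cmod (a - cnj q) / (4 * S) * (4 * S)"
    using S by (intro mult_right_mono) auto
  then show ?thesis using S by simp
qed

text \<open>If one point is not near 0, then N = |a - cnj b| \<ge> r/2 and |b + \<i>| \<le> (1 +
  2/r) N. The factor N^2 from the height bounds cancels against cosh^2 = N^2 / (4 y Im b).\<close>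

lemma rhoH_far:
  assumes y: "0 < y" "y \<le> 1" and b: "Im b > 0" and r: "r > 0" "r / 2 < y \<or> r / 2 < cmod b"
    and h: "h > 0" "y * h \<le> (y + 1)\<^sup>2 * d" "Im b * h \<le> (cmod (b + \<i>))\<^sup>2 * d'"
  shows "(h / (4 * (1 + 2 / r)))\<^sup>2 \<le> d * d' * exp (2 * rhoH (\<i> * of_real y) b)"
proof -
  define a where "a = \<i> * complex_of_real y"
  have a: "Im a > 0" "Im a = y" using y by (auto simp: a_def)
  define N where "N = cmod (a - cnj b)"
  have N1: "y \<le> N" using abs_Im_le_cmod[of "a - cnj b"] a b by (simp add: N_def)
  have "(cmod b)\<^sup>2 \<le> N\<^sup>2"
  proof -
    have "(Im b)\<^sup>2 \<le> (y + Im b)\<^sup>2" using y b by (intro power_mono) auto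
    then show ?thesis unfolding N_def cmod_power2 by (simp add: a_def)
  qed
  then have N2: "cmod b \<le> N" by (rule power2_le_imp_le) (simp add: N_def)
  have N: "1 \<le> 2 * N / r" using N1 N2 r by (auto simp: pos_le_divide_eq)
  have N0: "N > 0" using N1 y by simp
  have "cmod (b + \<i>) \<le> (1 + 2 / r) * N"
  proof -
    have "cnj (b + \<i>) = - (a - cnj b) + \<i> * of_real (y - 1)" by (simp add: a_def algebra_simps)
    then have "cmod (b + \<i>) = cmod (- (a - cnj b) + \<i> * of_real (y - 1))" by (metis complex_mod_cnj)
    also have "\<dots> \<le> cmod (- (a - cnj b)) + cmod (\<i> * of_real (y - 1))" by (rule norm_triangle_ineq)
    also have "\<dots> = N + \<bar>y - 1\<bar>" unfolding norm_minus_cancel N_def norm_mult norm_of_real by simp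
    also have "\<dots> \<le> N + 2 * N / r" using y N by auto
    finally show ?thesis by (simp add: algebra_simps)
  qed
  then have bN: "(cmod (b + \<i>))\<^sup>2 \<le> ((1 + 2 / r) * N)\<^sup>2" by (intro power_mono) auto
  have d: "d > 0"
  proof -
    have "0 < (y + 1)\<^sup>2 * d" using h(1,2) y mult_pos_pos[OF y(1) h(1)] by linarith
    then show ?thesis using y by (simp add: zero_less_mult_iff)
  qed
  have d': "d' > 0"
  proof -
    have "0 < (cmod (b + \<i>))\<^sup>2 * d'" using h(3) mult_pos_pos[OF b h(1)] by linarith
    then show ?thesis by (simp add: zero_less_mult_iff)
  qed
  have "y * h \<le> 4 * d"
  proof -
    have "(y + 1)\<^sup>2 \<le> 2\<^sup>2" using y by (intro power_mono) auto
    then have "(y + 1)\<^sup>2 * d \<le> 4 * d" using d by simp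
    then show ?thesis using h(2) by simp
  qed
  moreover have "Im b * h \<le> ((1 + 2 / r) * N)\<^sup>2 * d'" by (rule order_trans[OF h(3) mult_right_mono[OF bN]]) (use d' in simp)
  ultimately have "(y * h) * (Im b * h) \<le> (4 * d) * (((1 + 2 / r) * N)\<^sup>2 * d')"
    by (rule mult_mono) (use h(1) d b in auto)
  then have le: "y * Im b * h\<^sup>2 \<le> 4 * (1 + 2 / r)\<^sup>2 * N\<^sup>2 * (d * d')" by (simp add: power2_eq_square algebra_simps)
  have r2: "1 + 2 / r > 0" using r by (simp add: add_pos_pos)
  have "(h / (4 * (1 + 2 / r)))\<^sup>2 \<le> d * d' * (N\<^sup>2 / (4 * y * Im b))"
  proof -
    have "h\<^sup>2 / (16 * (1 + 2 / r)\<^sup>2) \<le> d * d' * N\<^sup>2 / (4 * y * Im b)"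
      using le r2 y b by (simp add: pos_divide_le_eq pos_le_divide_eq mult_ac)
    moreover have "(4 * (1 + 2 / r))\<^sup>2 = 16 * (1 + 2 / r)\<^sup>2" unfolding power_mult_distrib by simp
    ultimately show ?thesis by (simp only: power_divide times_divide_eq_right)
  qed
  also have "N\<^sup>2 / (4 * y * Im b) = (cosh (rhoH a b))\<^sup>2" using cosh_rhoH(1)[OF a(1) b] a(2) by (simp add: N_def)
  also have "\<dots> \<le> (exp (rhoH a b))\<^sup>2"
    using exp_cosh_bounds(2)[OF rhoH_nonneg[OF a(1) b]] by (intro power_mono) auto
  also have "\<dots> = exp (2 * rhoH a b)" by (simp add: exp_double)
  finally show ?thesis using d d' by (simp add: a_def)
qed

text \<open>Within half the radius the denominators in \<open>rhoH_hmap_le\<close> are at least 3/4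
  each, and the heights are at most 4 d / h and 4 d' / h; 64 rounds up 512/9.\<close>

lemma rhoH_near:
  assumes y: "0 < y" "y \<le> r / 2" and b: "Im b > 0" "cmod b \<le> r / 2" and r: "0 < r" "r \<le> 1"
    and h: "h > 0" "y * h \<le> (y + 1)\<^sup>2 * d" "Im b * h \<le> (cmod (b + \<i>))\<^sup>2 * d'"
  shows "rhoH (hmap (1 / r) (\<i> * of_real y)) (hmap (1 / r) b) \<le>
    rhoH (\<i> * of_real y) b + 64 / (r * h)\<^sup>2 * (d * d') * (sinh (rhoH (\<i> * of_real y) b) * cosh (rhoH (\<i> * of_real y) b))"
proof -
  define a where "a = \<i> * complex_of_real y"
  have a: "Im a > 0" "Im a = y" "cmod a = y" using y by (auto simp: a_def norm_mult)
  define Q where "Q = 4 * (1 / r)\<^sup>2 * Im a * Im b / ((1 - (1 / r * cmod a)\<^sup>2) * (1 - (1 / r * cmod b)\<^sup>2))"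
  have ea: "1 / r * cmod a \<le> 1 / 2" "1 / r * cmod b \<le> 1 / 2" using y b r a by (auto simp: field_simps)
  have sa: "1 - (1 / r * cmod a)\<^sup>2 \<ge> 3 / 4" "1 - (1 / r * cmod b)\<^sup>2 \<ge> 3 / 4"
  proof -
    have "(1 / r * cmod a)\<^sup>2 \<le> (1 / 2)\<^sup>2" "(1 / r * cmod b)\<^sup>2 \<le> (1 / 2)\<^sup>2"
      using ea r by (auto intro!: power_mono simp del: power_mult_distrib)
    then show "1 - (1 / r * cmod a)\<^sup>2 \<ge> 3 / 4" "1 - (1 / r * cmod b)\<^sup>2 \<ge> 3 / 4" by (auto simp: power2_eq_square)
  qed
  have ya: "y * h \<le> 4 * d"
  proof -
    have "0 < (y + 1)\<^sup>2 * d" using h(1,2) y mult_pos_pos[OF y(1) h(1)] by linarith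
    then have "d > 0" using y by (simp add: zero_less_mult_iff)
    moreover have "(y + 1)\<^sup>2 \<le> 2\<^sup>2" using y r by (intro power_mono) auto
    ultimately have "(y + 1)\<^sup>2 * d \<le> 4 * d" by simp
    then show ?thesis using h(2) by simp
  qed
  have yb: "Im b * h \<le> 4 * d'"
  proof -
    have "0 < (cmod (b + \<i>))\<^sup>2 * d'" using h(3) mult_pos_pos[OF b(1) h(1)] by linarith
    then have "d' > 0" by (simp add: zero_less_mult_iff)
    moreover have "(cmod (b + \<i>))\<^sup>2 \<le> 2\<^sup>2"
      using norm_triangle_ineq[of b \<i>] b r by (intro power_mono) auto
    ultimately have "(cmod (b + \<i>))\<^sup>2 * d' \<le> 4 * d'" by simp
    then show ?thesis using h(3) by simp
  qed
  have "(y * h) * (Im b * h) \<le> (4 * d) * (4 * d')" 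
  proof (rule mult_mono[OF ya yb])
    show "0 \<le> Im b * h" using b h(1) by simp
    have "0 \<le> y * h" using y h(1) by simp
    then show "0 \<le> 4 * d" using ya by linarith
  qed
  then have yy: "y * Im b \<le> 16 * (d * d') / h\<^sup>2" using h(1) by (simp add: pos_le_divide_eq power2_eq_square mult_ac)
  have Q: "Q / 2 \<le> 64 / (r * h)\<^sup>2 * (d * d')"
  proof -
    have "(3 / 4) * (3 / 4) \<le> (1 - (1 / r * cmod a)\<^sup>2) * (1 - (1 / r * cmod b)\<^sup>2)" using sa by (intro mult_mono) auto
    then have D: "9 / 16 \<le> (1 - (1 / r * cmod a)\<^sup>2) * (1 - (1 / r * cmod b)\<^sup>2)" by simp
    have "Q / 2 = 2 * (1 / r)\<^sup>2 * (y * Im b) / ((1 - (1 / r * cmod a)\<^sup>2) * (1 - (1 / r * cmod b)\<^sup>2))"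
      by (simp add: Q_def a(2))
    also have "\<dots> \<le> 2 * (1 / r)\<^sup>2 * (y * Im b) / (9 / 16)"
      using D y b by (intro divide_left_mono) auto
    also have "\<dots> \<le> 2 * (1 / r)\<^sup>2 * (16 * (d * d') / h\<^sup>2) / (9 / 16)"
      using yy by (intro divide_right_mono mult_left_mono) auto
    also have "\<dots> = (512 / 9) / (r * h)\<^sup>2 * (d * d')" by (simp add: power_mult_distrib power_divide)
    also have "\<dots> \<le> 64 / (r * h)\<^sup>2 * (d * d')"
    proof -
      have "0 \<le> 16 * (d * d') / h\<^sup>2" using yy y b mult_pos_pos[OF y(1) b(1)] by linarith
      then have "0 \<le> d * d'" using h(1) by (simp add: zero_le_divide_iff)
      then show ?thesis by (intro mult_right_mono divide_right_mono) auto
    qed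
    finally show ?thesis .
  qed
  have er: "1 / r > 0" using r by simp
  have lt: "1 / r * cmod a < 1" "1 / r * cmod b < 1" using ea by linarith+
  have "rhoH (hmap (1 / r) a) (hmap (1 / r) b) \<le> rhoH a b + Q / 2 * (sinh (rhoH a b) * cosh (rhoH a b))"
    unfolding Q_def by (rule rhoH_hmap_le[OF er lt(1) a(1) lt(2) b(1)])
  also have "\<dots> \<le> rhoH a b + 64 / (r * h)\<^sup>2 * (d * d') * (sinh (rhoH a b) * cosh (rhoH a b))"
    using Q rhoH_nonneg[OF a(1) b(1)] by (intro add_left_mono mult_right_mono) auto
  finally show ?thesis by (simp only: a_def)
qed

lemma sinh_cosh_le:
  assumes \<rho>: "0 < \<rho>" "\<rho> \<le> ln (1 + C * x)" and x: "0 < x" and C: "1 \<le> (C::real)"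
  shows "sinh \<rho> * cosh \<rho> \<le> C\<^sup>2 * (x * (1 + x))" "sinh \<rho> * cosh \<rho> / \<rho> \<le> C\<^sup>2 * h_fun x"
proof -
  define l where "l = ln (1 + C * x)"
  have Cx: "x \<le> C * x" using C x by simp
  have l: "0 < l" "\<rho> \<le> l" using \<rho> by (auto simp: l_def)
  have "0 < C * x" "1 + x \<le> 1 + C * x" using x C Cx by auto
  then have "ln (1 + x) \<le> ln (1 + C * x)" using x by (intro ln_mono) linarith+
  then have lx: "ln (1 + x) \<le> l" "0 < ln (1 + x)" using x unfolding l_def by simp_all
  have el: "exp l = 1 + C * x" using \<open>0 < C * x\<close> by (simp add: l_def)
  have sq: "(exp (2 * l) - 1) / 2 \<le> C\<^sup>2 * (x * (1 + x))"
  proof -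
    have "(exp (2 * l) - 1) / 2 = C * x + C * (C * x * x) / 2" unfolding exp_double el by (simp add: power2_eq_square algebra_simps)
    also have "\<dots> \<le> C * (C * x) + C * (C * x * x)" using C x by (intro add_mono) auto
    finally show ?thesis by (simp add: power2_eq_square algebra_simps)
  qed
  have sc: "sinh \<rho> * cosh \<rho> \<le> (exp (2 * \<rho>) - 1) / 2"
  proof -
    have "2 * (sinh \<rho> * cosh \<rho>) = sinh (2 * \<rho>)" by (simp add: sinh_double)
    moreover have "sinh (2 * \<rho>) \<le> exp (2 * \<rho>) - 1"
    proof -
      have "(exp \<rho> - exp (- \<rho>))\<^sup>2 \<ge> 0" by simp
      then have "exp (2 * \<rho>) + exp (- (2 * \<rho>)) \<ge> 2 * (exp \<rho> * exp (- \<rho>))"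
        by (simp add: power2_diff exp_double[symmetric] algebra_simps del: mult_exp_exp)
      then have "exp (2 * \<rho>) + exp (- (2 * \<rho>)) \<ge> 2" by (simp add: mult_exp_exp)
      then show ?thesis by (simp add: sinh_field_def)
    qed
    ultimately have "sinh \<rho> * cosh \<rho> * 2 \<le> exp (2 * \<rho>) - 1" by (simp only: mult.commute)
    then show ?thesis by (simp only: pos_le_divide_eq zero_less_numeral)
  qed
  have "(exp (2 * \<rho>) - 1) / 2 \<le> (exp (2 * l) - 1) / 2" using l by simp
  then show "sinh \<rho> * cosh \<rho> \<le> C\<^sup>2 * (x * (1 + x))" using sc sq by (meson order_trans)
  \<comment> \<open>By convexity (exp (2 \<rho>) - 1) / \<rho> increases with \<rho>, so \<rho> may
    be replaced by its upper bound l. Dividing by l \<ge> ln (1 + x) is what produces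
    \<open>h_fun\<close>.\<close>
  have "exp ((1 - \<rho> / l) *\<^sub>R 0 + (\<rho> / l) *\<^sub>R (2 * l)) \<le> (1 - \<rho> / l) * exp 0 + \<rho> / l * exp (2 * l)"
    using convex_onD[OF exp_convex, of "\<rho> / l" 0 "2 * l"] \<rho> l by simp
  then have "exp (2 * \<rho>) - 1 \<le> \<rho> / l * (exp (2 * l) - 1)" using l by (simp add: algebra_simps)
  then have "(exp (2 * \<rho>) - 1) / 2 \<le> \<rho> * ((exp (2 * l) - 1) / 2 / l)" by simp
  also have "\<dots> \<le> \<rho> * (C\<^sup>2 * (x * (1 + x)) / ln (1 + x))"
    using sq lx l \<rho> x C by (intro mult_left_mono frac_le) auto
  also have "\<dots> = \<rho> * (C\<^sup>2 * h_fun x)" by (simp add: h_fun_def)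
  finally have "sinh \<rho> * cosh \<rho> \<le> \<rho> * (C\<^sup>2 * h_fun x)" by (rule order_trans[OF sc])
  then show "sinh \<rho> * cosh \<rho> / \<rho> \<le> C\<^sup>2 * h_fun x" using \<rho> by (simp add: pos_divide_le_eq mult.commute)
qed

lemma h_fun_ge_1: "x > 0 \<Longrightarrow> 1 \<le> h_fun x"
  unfolding h_fun_def using ln_add_one_self_le_self[of x]
  by (auto simp: pos_le_divide_eq distrib_left intro: order_trans)

subsection \<open>Localization along complex geodesics\<close>

context dini_convex
begin

text \<open>The half-plane is normalized so that \<i> corresponds to a point \<xi> with image in K.
  The value of r is the threshold at which \<open>rhoH_almost_additive\<close> with defect 2 B
  breaks down: it would give 1 < 8 exp (2 B) r = 1.\<close>

lemma geodesic_localization: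
  assumes K: "K \<subseteq> D" "\<forall>x\<in>K. \<forall>y\<in>K. kobayashi_dist D x y \<le> B" "\<forall>x\<in>K. h \<le> bdist D x"
    and vis: "\<forall>l u \<psi>. real_geodesic D l u \<psi> \<longrightarrow> diameter (\<psi> ` {l..u}) > \<epsilon> \<longrightarrow> \<psi> ` {l..u} \<inter> K \<noteq> {}"
    and \<phi>: "cgeo D \<phi>" and U: "ball (\<phi> 0) d0 \<subseteq> U" "\<epsilon> < d0"
    and out: "\<not> (\<forall>q. cmod q < 1 \<longrightarrow> \<phi> q \<in> U)"
  defines "r \<equiv> exp (- 2 * B) / 8"
  obtains c y where "disc_param c" "0 < y" "y \<le> 1" "c (\<i> * of_real y) = 0"
    "\<And>q. y \<le> r \<Longrightarrow> Im q > 0 \<Longrightarrow> 1 / r * cmod q < 1 \<Longrightarrow> \<phi> (c q) \<in> U"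
    "\<And>q. Im q > 0 \<Longrightarrow> Im q * h \<le> (cmod (q + \<i>))\<^sup>2 * bdist D (\<phi> (c q))"
proof -
  have \<phi>d: "\<phi> \<in> disc_maps D" using \<phi> by (simp add: cgeo_def)
  note dist = cgeo_dist(1)[OF open_D conn_D \<phi>]
  have far: "dist (\<phi> 0) (\<phi> q) > \<epsilon>" if "\<phi> q \<notin> U" for q
  proof -
    have "\<phi> q \<notin> ball (\<phi> 0) d0" using that U(1) by auto
    then show ?thesis using U(2) by simp
  qed
  obtain q0 where q0: "cmod q0 < 1" "\<phi> q0 \<notin> U" using out by auto
  have z1: "cmod 0 < 1" by simp
  obtain \<xi> where \<xi>: "cmod \<xi> < 1" "\<phi> \<xi> \<in> K"
    using cgeo_segment_hits[OF open_D conn_D bounded_D \<phi> z1 q0(1) vis[rule_format] far[OF q0(2)]] by metis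
  obtain c y where c: "disc_param c" and y: "0 < y" "y \<le> 1" and ci: "c \<i> = \<xi>" and cy: "c (\<i> * of_real y) = 0"
    using disc_param_exists[OF \<xi>(1) z1] by metis
  have c1: "cmod (c p) < 1" if "Im p > 0" for p using c that by (simp add: disc_param_def)
  have rc: "rho (c p) (c q) = rhoH p q" if "Im p > 0" "Im q > 0" for p q using c that by (simp add: disc_param_def)
  have i: "Im \<i> > 0" by simp
  define a where "a = \<i> * complex_of_real y"
  have a: "Im a > 0" "cmod a = y" using y by (auto simp: a_def norm_mult)
  have ca: "c a = 0" using cy by (simp add: a_def)
  show thesis
  proof (rule that[OF c y cy])
    fix q assume yr: "y \<le> r" and q: "Im q > 0" "1 / r * cmod q < 1"
    have r0: "r > 0" by (simp add: r_def)
    show "\<phi> (c q) \<in> U"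
    proof (rule ccontr)
      assume nU: "\<phi> (c q) \<notin> U"
      obtain m where m: "cmod m < 1" "\<phi> m \<in> K" "rho 0 (c q) = rho 0 m + rho m (c q)"
        using cgeo_segment_hits[OF open_D conn_D bounded_D \<phi> z1 c1[OF q(1)] vis[rule_format] far[OF nU]] by metis
      \<comment> \<open>The segment to the point outside U meets K at its own m, not at \<xi>;
        replacing m by \<xi> costs B on either side.\<close>
      have mx: "rho m \<xi> \<le> B" using K(2)[rule_format, OF m(2) \<xi>(2)] dist[OF m(1) \<xi>(1)] by simp
      have "rho 0 \<xi> \<le> rho 0 m + rho m \<xi>" using m \<xi> by (intro rho_triangle) auto
      moreover have "rho \<xi> (c q) \<le> rho \<xi> m + rho m (c q)" using m \<xi> c1[OF q(1)] by (intro rho_triangle) auto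
      ultimately have "rho (c a) (c \<i>) + rho (c \<i>) (c q) \<le> rho (c a) (c q) + 2 * B"
        using m(3) mx rho_commute[of \<xi> m] by (simp add: ca ci)
      then have "cmod (a + \<i>) * cmod (q + \<i>) \<le> 4 * exp (2 * B) * cmod (a - cnj q)"
        unfolding rc[OF a(1) i] rc[OF i q(1)] rc[OF a(1) q(1)] by (rule rhoH_almost_additive[OF a(1) q(1)])
      moreover have "1 * 1 \<le> cmod (a + \<i>) * cmod (q + \<i>)"
        using abs_Im_le_cmod[of "a + \<i>"] abs_Im_le_cmod[of "q + \<i>"] a(1) q(1) by (intro mult_mono) auto
      moreover have "cmod (a - cnj q) < 2 * r"
        using norm_triangle_ineq4[of a "cnj q"] a(2) q(2) yr r0 by (simp add: pos_divide_less_eq)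
      moreover from this have "4 * exp (2 * B) * cmod (a - cnj q) < 4 * exp (2 * B) * (2 * r)"
        by (intro mult_strict_left_mono) auto
      ultimately have "1 < 4 * exp (2 * B) * (2 * r)" by linarith
      then show False by (simp add: r_def exp_minus)
    qed
  next
    fix q assume q: "Im q > 0"
    let ?w = "\<phi> (c q)"
    have w: "?w \<in> D" by (rule disc_maps_in[OF \<phi>d c1[OF q]])
    have x: "\<phi> \<xi> \<in> D" using \<xi> K by auto
    have pos: "bdist D ?w > 0" "bdist D (\<phi> \<xi>) > 0" using bdist_pos w x by auto
    have m: "cmod (q - cnj \<i>) = cmod (q + \<i>)" by simp
    \<comment> \<open>The half-space lower bound for k_D, seen from a point of depth at least h,
      converts heights in the half-plane into boundary distances.\<close>
    have "ln (bdist D (\<phi> \<xi>) / bdist D ?w) / 2 \<le> rhoH q \<i>"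
      using kobayashi_lower_bdist[OF w x] dist[OF c1[OF q] \<xi>(1)] rc[OF q i] ci by simp
    then have "ln (bdist D (\<phi> \<xi>) / bdist D ?w) \<le> 2 * rhoH q \<i>" by simp
    then have "bdist D (\<phi> \<xi>) / bdist D ?w \<le> exp (2 * rhoH q \<i>)"
      using pos by (metis divide_pos_pos exp_le_cancel_iff exp_ln)
    also have "\<dots> = (exp (rhoH q \<i>))\<^sup>2" by (simp add: exp_double)
    also have "\<dots> \<le> (2 * cosh (rhoH q \<i>))\<^sup>2"
      using exp_cosh_bounds(1)[OF rhoH_nonneg[OF q i]] by (intro power_mono) auto
    also have "\<dots> = (cmod (q + \<i>))\<^sup>2 / Im q"
      unfolding power_mult_distrib cosh_rhoH(1)[OF q i] m by simp
    finally have "bdist D (\<phi> \<xi>) * Im q \<le> (cmod (q + \<i>))\<^sup>2 * bdist D ?w"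
      using pos q by (simp add: pos_divide_le_eq pos_le_divide_eq divide_le_eq mult_ac)
    moreover have "h * Im q \<le> bdist D (\<phi> \<xi>) * Im q" using K(3)[rule_format, OF \<xi>(2)] q by (intro mult_right_mono) auto
    ultimately show "Im q * h \<le> (cmod (q + \<i>))\<^sup>2 * bdist D ?w" by (simp add: mult.commute)
  qed
qed

lemma caratheodory_eq_kobayashi:
  assumes "z \<in> D" "w \<in> D" "z \<noteq> w"
  shows "caratheodory_dist D z w = kobayashi_dist D z w"
proof -
  obtain \<phi> \<alpha> where "cgeo D \<phi>" "cmod \<alpha> < 1" "\<phi> 0 = z" "\<phi> \<alpha> = w"
    using cgeo_points[OF open_D convex_D bounded_D assms] .
  then show ?thesis using cgeo_dist[OF open_D conn_D, of \<phi> 0 \<alpha>] by simp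
qed

text \<open>For each pair the extremal disc of D either stays in U, costing nothing, or is cut down
  to a half-disc. The second alternative collects the parameters that are not within r/2 of 0, where
  cutting down gives nothing useful.\<close>

lemma localization:
  assumes vd: "visible_domain D"
    and U: "open U" "connected (D \<inter> U)" and d0: "d0 > 0" "\<And>z. z \<in> V \<Longrightarrow> ball z d0 \<subseteq> U"
  obtains C c0 where "C > 0" "c0 > 0"
    "\<And>z w. z \<in> D \<inter> V \<Longrightarrow> w \<in> D \<inter> V \<Longrightarrow> z \<noteq> w \<Longrightarrow>
      kobayashi_dist (D \<inter> U) z w \<le> kobayashi_dist D z w +
        C * (bdist D z * bdist D w) * (sinh (kobayashi_dist D z w) * cosh (kobayashi_dist D z w)) \<or>
      c0 \<le> bdist D z * bdist D w * exp (2 * kobayashi_dist D z w)"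
    "\<And>z X. z \<in> D \<inter> V \<Longrightarrow>
      kobayashi_metric (D \<inter> U) z X \<le> (1 + C * (bdist D z)\<^sup>2) * caratheodory_metric D z X \<or> c0 \<le> bdist D z"
proof -
  have "d0 / 2 > 0" using d0 by simp
  then obtain K where K: "compactly_contained K D"
    and vis: "\<forall>l u \<psi>. real_geodesic D l u \<psi> \<longrightarrow> diameter (\<psi> ` {l..u}) > d0 / 2 \<longrightarrow> \<psi> ` {l..u} \<inter> K \<noteq> {}"
    using vd unfolding visible_domain_def by blast
  have K': "compact (closure K)" "closure K \<subseteq> D" using K by (auto simp: compactly_contained_def)
  have KD: "K \<subseteq> D" using K'(2) closure_subset by blast
  obtain B0 where B0: "\<And>x y. x \<in> closure K \<Longrightarrow> y \<in> closure K \<Longrightarrow> kobayashi_dist D x y \<le> B0"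
    using kobayashi_bounded_compact[OF open_D conn_D K'] by metis
  define B where "B = max B0 0"
  have B: "\<forall>x\<in>K. \<forall>y\<in>K. kobayashi_dist D x y \<le> B" "B \<ge> 0"
    using B0 closure_subset[of K] by (fastforce simp: B_def)+
  obtain h where h: "h > 0" "(\<Union>x\<in>closure K. ball x h) \<subseteq> D"
    using compact_subset_open_imp_ball_epsilon_subset[OF K'(1) open_D K'(2)] .
  have hK: "\<forall>x\<in>K. h \<le> bdist D x"
  proof
    fix x assume x: "x \<in> K"
    obtain q where q: "q \<in> frontier D" "bdist D x = dist x q" by (rule bdist_attained)
    have "q \<notin> D" using q(1) open_D by (simp add: frontier_def interior_open)
    moreover have "ball x h \<subseteq> D" using h(2) x closure_subset[of K] by blast
    ultimately show "h \<le> bdist D x" using q(2) by (auto simp: not_less[symmetric])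
  qed
  define r where "r = exp (- 2 * B) / 8"
  have r: "0 < r" "r \<le> 1"
  proof -
    have "exp (- 2 * B) \<le> 1" using B(2) by simp
    then show "0 < r" "r \<le> 1" unfolding r_def by (simp, linarith)
  qed
  have DU: "open (D \<inter> U)" using open_D U by auto
  have er: "1 / r > 0" using r by simp
  have half: "d0 / 2 < d0" using d0 by simp
  note loc = geodesic_localization[OF KD B(1) hK vis _ _ half _, folded r_def]
  define C where "C = 64 / (r * h)\<^sup>2"
  have C: "C > 0" using r h by (simp add: C_def)
  define c0 where "c0 = min ((h / (4 * (1 + 2 / r)))\<^sup>2) (r * h / 8)"
  have c0: "c0 > 0" using r h by (simp add: c0_def add_pos_pos less_imp_neq[symmetric])
  show thesis
  proof (rule that[OF C c0])
    fix z w assume zw: "z \<in> D \<inter> V" "w \<in> D \<inter> V" "z \<noteq> w"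
    obtain \<phi> \<alpha> where \<phi>: "cgeo D \<phi>" "cmod \<alpha> < 1" "\<phi> 0 = z" "\<phi> \<alpha> = w"
      using cgeo_points[OF open_D convex_D bounded_D, of z w] zw by auto
    have \<phi>d: "\<phi> \<in> disc_maps D" using \<phi> by (simp add: cgeo_def)
    define k where "k = kobayashi_dist D z w"
    have k: "k = rho 0 \<alpha>" using cgeo_dist(1)[OF open_D conn_D \<phi>(1), of 0 \<alpha>] \<phi> by (simp add: k_def)
    have pos: "bdist D z > 0" "bdist D w > 0" using bdist_pos zw by auto
    have k0: "k \<ge> 0" unfolding k by (rule rho_nonneg) (use \<phi>(2) in auto)
    have "kobayashi_dist (D \<inter> U) z w \<le> k + C * (bdist D z * bdist D w) * (sinh k * cosh k) \<or>
      c0 \<le> bdist D z * bdist D w * exp (2 * k)"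
    proof (cases "\<forall>q. cmod q < 1 \<longrightarrow> \<phi> q \<in> U")
      case True
      have "\<phi> \<in> disc_maps (D \<inter> U)" using \<phi>d True by (auto simp: disc_maps_def)
      then have "kobayashi_dist (D \<inter> U) z w \<le> k"
        using kobayashi_le_rho[OF DU U(2), of \<phi> 0 \<alpha>] \<phi> k by simp
      also have "\<dots> \<le> k + C * (bdist D z * bdist D w) * (sinh k * cosh k)" using C pos k0 by simp
      finally show ?thesis ..
    next
      case False
      have bU: "ball (\<phi> 0) d0 \<subseteq> U" using d0(2) zw \<phi> by simp
      obtain c y where c: "disc_param c" and y: "0 < y" "y \<le> 1" and cy: "c (\<i> * of_real y) = 0"
        and inU: "\<And>q. y \<le> r \<Longrightarrow> Im q > 0 \<Longrightarrow> 1 / r * cmod q < 1 \<Longrightarrow> \<phi> (c q) \<in> U"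
        and hh: "\<And>q. Im q > 0 \<Longrightarrow> Im q * h \<le> (cmod (q + \<i>))\<^sup>2 * bdist D (\<phi> (c q))"
        using loc[OF \<phi>(1) bU False] by metis
      obtain b where b: "Im b > 0" "c b = \<alpha>" using c \<phi>(2) by (auto simp: disc_param_def)
      define a where "a = \<i> * complex_of_real y"
      have a: "Im a > 0" "cmod a = y" "c a = 0" using y cy by (auto simp: a_def norm_mult)
      have kab: "k = rhoH a b" using c a b k unfolding disc_param_def by metis
      have ha: "y * h \<le> (y + 1)\<^sup>2 * bdist D z"
      proof -
        have "a + \<i> = \<i> * of_real (y + 1)" by (simp add: a_def algebra_simps)
        then have "cmod (a + \<i>) = y + 1" using y by (simp only: norm_mult norm_of_real) simp
        then show ?thesis using hh[OF a(1)] a \<phi>(3) by (simp add: a_def)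
      qed
      have hb: "Im b * h \<le> (cmod (b + \<i>))\<^sup>2 * bdist D w" using hh[OF b(1)] b \<phi>(4) by simp
      show ?thesis
      proof (cases "r / 2 < y \<or> r / 2 < cmod b")
        case True
        have "c0 \<le> (h / (4 * (1 + 2 / r)))\<^sup>2" by (simp add: c0_def)
        also have "\<dots> \<le> bdist D z * bdist D w * exp (2 * k)"
          unfolding kab a_def by (rule rhoH_far[OF y b(1) r(1) True h(1) ha hb])
        finally show ?thesis ..
      next
        case False
        then have yb: "y \<le> r / 2" "cmod b \<le> r / 2" by auto
        have yr: "y \<le> r" using yb(1) r by simp
        have lt: "1 / r * cmod a < 1" "1 / r * cmod b < 1" using a yb r by (auto simp: field_simps)
        have "kobayashi_dist (D \<inter> U) (\<phi> (c a)) (\<phi> (c b)) \<le> rhoH (hmap (1 / r) a) (hmap (1 / r) b)"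
          by (rule halfdisc_kobayashi[OF \<phi>d c er inU[OF yr] DU U(2) a(1) lt(1) b(1) lt(2)])
        also have "\<dots> \<le> k + C * (bdist D z * bdist D w) * (sinh k * cosh k)"
          unfolding kab C_def a_def by (rule rhoH_near[OF y(1) yb(1) b(1) yb(2) r h(1) ha hb])
        finally show ?thesis using a b \<phi> by simp
      qed
    qed
    then show "kobayashi_dist (D \<inter> U) z w \<le> kobayashi_dist D z w +
        C * (bdist D z * bdist D w) * (sinh (kobayashi_dist D z w) * cosh (kobayashi_dist D z w)) \<or>
      c0 \<le> bdist D z * bdist D w * exp (2 * kobayashi_dist D z w)" unfolding k_def .
  next
    fix z X assume z: "z \<in> D \<inter> V"
    have d: "bdist D z > 0" using bdist_pos z by auto
    define g where "g = caratheodory_metric D z X"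
    have g0: "g \<ge> 0"
    proof -
      obtain R where R: "D \<subseteq> ball 0 R" "R > 0" using bounded_subset_ballD[OF bounded_D] by blast
      have "norm X / R \<le> g" unfolding g_def by (rule caratheodory_metric_lower[OF R(1) bdist_ball d]) (use z in auto)
      then show ?thesis using R(2) by (meson divide_nonneg_pos norm_ge_zero order_trans)
    qed
    have le: "g \<le> (1 + C * (bdist D z)\<^sup>2) * g" using g0 C by (simp add: algebra_simps)
    have "kobayashi_metric (D \<inter> U) z X \<le> (1 + C * (bdist D z)\<^sup>2) * g \<or> c0 \<le> bdist D z"
    proof (cases "X = 0")
      case True
      have "ball z (min (bdist D z) d0) \<subseteq> D \<inter> U" using bdist_ball[of z D] d0(2)[of z] z by auto
      then have "kobayashi_metric (D \<inter> U) z X \<le> 0"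
        using kobayashi_metric_ball[of z "min (bdist D z) d0" "D \<inter> U" X] d d0 True by simp
      then show ?thesis using le g0 by linarith
    next
      case False
      obtain \<phi> where \<phi>: "cgeo D \<phi>" "\<phi> 0 = z" "g *\<^sub>R disc_deriv \<phi> 0 = X"
        using cgeo_direction[OF open_D convex_D bounded_D _ False, of z] z unfolding g_def by auto
      have \<phi>d: "\<phi> \<in> disc_maps D" using \<phi> by (simp add: cgeo_def)
      have gX: "of_real g *s disc_deriv \<phi> 0 = X"
        using \<phi>(3) by (simp add: vec_eq_iff scaleR_conv_of_real[where 'a = complex])
      show ?thesis
      proof (cases "\<forall>q. cmod q < 1 \<longrightarrow> \<phi> q \<in> U")
        case True
        have "\<phi> \<in> disc_maps (D \<inter> U)" using \<phi>d True by (auto simp: disc_maps_def)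
        then have "kobayashi_metric (D \<inter> U) z X \<le> g"
          using kobayashi_metric_le[OF _ gX, of "D \<inter> U"] \<phi>(2) g0 by simp
        then show ?thesis using le by linarith
      next
        case False
        have bU: "ball (\<phi> 0) d0 \<subseteq> U" using d0(2) z \<phi> by simp
        obtain c y where c: "disc_param c" and y: "0 < y" "y \<le> 1" and cy: "c (\<i> * of_real y) = 0"
          and inU: "\<And>q. y \<le> r \<Longrightarrow> Im q > 0 \<Longrightarrow> 1 / r * cmod q < 1 \<Longrightarrow> \<phi> (c q) \<in> U"
          and hh: "\<And>q. Im q > 0 \<Longrightarrow> Im q * h \<le> (cmod (q + \<i>))\<^sup>2 * bdist D (\<phi> (c q))"
          using loc[OF \<phi>(1) bU False] by metis
        have yh: "y * h \<le> 4 * bdist D z"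
        proof -
          define a where "a = \<i> * complex_of_real y"
          have "a + \<i> = \<i> * of_real (y + 1)" by (simp add: a_def algebra_simps)
          then have "cmod (a + \<i>) = y + 1" using y by (simp only: norm_mult norm_of_real) simp
          then have "y * h \<le> (y + 1)\<^sup>2 * bdist D z" using hh[of a] y cy \<phi>(2) by (simp add: a_def)
          also have "\<dots> \<le> 2\<^sup>2 * bdist D z" using y d by (intro mult_right_mono power_mono) auto
          finally show ?thesis by simp
        qed
        show ?thesis
        proof (cases "y \<le> r / 2")
          case True
          have yr: "y \<le> r" "1 / r * y < 1" using True r by (auto simp: field_simps)
          define t where "t = (1 / r * y)\<^sup>2"
          have t: "0 \<le> t" "t \<le> 1 / 4"
          proof -
            have "1 / r * y \<le> 1 / 2" using True r by (simp add: field_simps)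
            then have "(1 / r * y)\<^sup>2 \<le> (1 / 2)\<^sup>2" using r y by (intro power_mono) auto
            then show "t \<le> 1 / 4" by (simp add: t_def power2_eq_square)
          qed (simp add: t_def)
          have "kobayashi_metric (D \<inter> U) (\<phi> 0) X \<le> g * ((1 + t) / (1 - t))"
            unfolding t_def by (rule halfdisc_metric[OF \<phi>d c er inU[OF yr(1)] y(1) yr(2) cy gX g0])
          also have "\<dots> \<le> g * (1 + C * (bdist D z)\<^sup>2)"
          proof (rule mult_left_mono[OF _ g0])
            have "(1 + t) / (1 - t) \<le> 1 + 4 * t"
            proof -
              have "1 + t \<le> (1 + 4 * t) * (1 - t)"
                using mult_left_mono[OF t(2,1)] t by (simp add: algebra_simps)
              then show ?thesis using t by (simp add: pos_divide_le_eq)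
            qed
            moreover have "4 * t \<le> C * (bdist D z)\<^sup>2"
            proof -
              have "y \<le> 4 * bdist D z / h" using yh h by (simp add: pos_le_divide_eq)
              then have "1 / r * y \<le> 1 / r * (4 * bdist D z / h)" using r by (intro mult_left_mono) auto
              then have "t \<le> (1 / r * (4 * bdist D z / h))\<^sup>2" unfolding t_def using r y by (intro power_mono) auto
              then show ?thesis by (simp add: C_def power_mult_distrib power_divide)
            qed
            ultimately show "(1 + t) / (1 - t) \<le> 1 + C * (bdist D z)\<^sup>2" by linarith
          qed
          finally show ?thesis using \<phi>(2) by (simp add: mult.commute)
        next
          case False
          have "r / 2 * h \<le> y * h" using False h by (intro mult_right_mono) auto
          then have "r * h / 8 \<le> bdist D z" using yh by simp
          then show ?thesis by (simp add: c0_def min_le_iff_disj)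
        qed
      qed
    qed
    then show "kobayashi_metric (D \<inter> U) z X \<le> (1 + C * (bdist D z)\<^sup>2) * caratheodory_metric D z X \<or> c0 \<le> bdist D z"
      unfolding g_def .
  qed
qed

section \<open>From localization to the estimates by f and g\<close>

lemma f_fun_g_fun:
  assumes "z \<in> D" "w \<in> D" "z \<noteq> w"
  defines "x \<equiv> norm (z - w) / (sqrt (bdist D z) * sqrt (bdist D w))"
  shows "x > 0" "norm (z - w) = x * sqrt (bdist D z * bdist D w)"
    "g_fun D z w = bdist D z * bdist D w * (x * (1 + x))" "f_fun D z w = bdist D z * bdist D w * h_fun x"
    "f_fun D z w = g_fun D z w / ln (1 + x)"
proof -
  define S where "S = sqrt (bdist D z) * sqrt (bdist D w)"
  have pos: "bdist D z > 0" "bdist D w > 0" using bdist_pos assms by auto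
  have S: "S > 0" "S\<^sup>2 = bdist D z * bdist D w" using pos by (simp_all add: S_def power_mult_distrib)
  have n: "norm (z - w) = x * S" using S by (simp add: x_def S_def[symmetric])
  show x: "x > 0" using S assms by (simp add: x_def S_def[symmetric])
  show "norm (z - w) = x * sqrt (bdist D z * bdist D w)" using n by (simp add: S_def real_sqrt_mult)
  show g: "g_fun D z w = bdist D z * bdist D w * (x * (1 + x))"
    unfolding g_fun_def S_def[symmetric] n S(2)[symmetric] by (simp add: power2_eq_square algebra_simps)
  show f: "f_fun D z w = bdist D z * bdist D w * h_fun x" by (simp add: f_fun_def x_def)
  show "f_fun D z w = g_fun D z w / ln (1 + x)" unfolding f g by (simp add: h_fun_def)
qed

text \<open>With S = sqrt (d d') the hypothesis reads c0 \<le> S exp \<rho>. Since S exp \<rho>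
  \<le> S + C2 s, either s or S is bounded below. In the former case L - \<rho> is bounded; in the
  latter both points are deep and L is at most a multiple of s.\<close>

lemma far_estimate:
  assumes U: "open U" "connected (D \<inter> U)" and d0: "d0 > 0" "\<And>z. z \<in> V \<Longrightarrow> ball z d0 \<subseteq> U" and c0: "c0 > 0"
  obtains C where "C > 0"
    "\<And>z w. z \<in> D \<inter> V \<Longrightarrow> w \<in> D \<inter> V \<Longrightarrow> z \<noteq> w \<Longrightarrow> c0\<^sup>2 \<le> bdist D z * bdist D w * exp (2 * kobayashi_dist D z w) \<Longrightarrow>
      kobayashi_dist (D \<inter> U) z w - kobayashi_dist D z w \<le> C * g_fun D z w \<and>
      (kobayashi_dist (D \<inter> U) z w - kobayashi_dist D z w) / kobayashi_dist D z w \<le> C * f_fun D z w"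
proof -
  have DU: "open (D \<inter> U)" using open_D U by auto
  obtain R where R: "D \<subseteq> ball 0 R" "R > 0" using bounded_subset_ballD[OF bounded_D] by blast
  obtain A where A: "A > 0" "\<And>z. z \<in> D \<Longrightarrow> bdist D z \<le> A" using bdist_bounded by metis
  obtain C2 where C2: "C2 \<ge> 1" "\<And>z w. z \<in> D \<Longrightarrow> w \<in> D \<Longrightarrow>
    kobayashi_dist D z w \<le> ln (1 + C2 * (norm (z - w) / (sqrt (bdist D z) * sqrt (bdist D w))))"
    using kobayashi_upper_bdist by metis
  obtain K M where K: "compact K" "K \<subseteq> D \<inter> U" "M > 0"
    "\<And>z. z \<in> D \<inter> V \<Longrightarrow> \<exists>y\<in>K. kobayashi_dist (D \<inter> U) z y \<le> ln (M / bdist D z) / 2"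
    using kobayashi_depth[OF U d0] by metis
  obtain B0 where B0: "\<And>x y. x \<in> K \<Longrightarrow> y \<in> K \<Longrightarrow> kobayashi_dist (D \<inter> U) x y \<le> B0"
    using kobayashi_bounded_compact[OF DU U(2) K(1,2)] by metis
  have depth: "kobayashi_dist (D \<inter> U) z w \<le> ln (M / bdist D z) / 2 + ln (M / bdist D w) / 2 + B0"
    if zw: "z \<in> D \<inter> V" "w \<in> D \<inter> V" for z w
  proof -
    obtain y where y: "y \<in> K" "kobayashi_dist (D \<inter> U) z y \<le> ln (M / bdist D z) / 2" using K(4)[OF zw(1)] by auto
    obtain y' where y': "y' \<in> K" "kobayashi_dist (D \<inter> U) w y' \<le> ln (M / bdist D w) / 2" using K(4)[OF zw(2)] by auto
    have "z \<in> U" "w \<in> U" using d0 zw by (auto simp: subset_iff)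
    then have m: "z \<in> D \<inter> U" "w \<in> D \<inter> U" "y \<in> D \<inter> U" "y' \<in> D \<inter> U" using zw y y' K by auto
    have "kobayashi_dist (D \<inter> U) z w \<le> kobayashi_dist (D \<inter> U) z y + kobayashi_dist (D \<inter> U) y w"
      by (rule kobayashi_triangle[OF DU U(2) m(1,3,2)])
    also have "kobayashi_dist (D \<inter> U) y w \<le> kobayashi_dist (D \<inter> U) y y' + kobayashi_dist (D \<inter> U) y' w"
      by (rule kobayashi_triangle[OF DU U(2) m(3,4,2)])
    also have "kobayashi_dist (D \<inter> U) y' w = kobayashi_dist (D \<inter> U) w y'" by (rule kobayashi_sym[OF DU U(2) m(4,2)])
    finally show ?thesis using y(2) y'(2) B0[OF y(1) y'(1)] by linarith
  qed
  define C3 where "C3 = \<bar>B0\<bar> + \<bar>ln (M / c0)\<bar>"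
  define C4 where "C4 = \<bar>ln ((A + 2 * R) / c0)\<bar>"
  define s1 where "s1 = c0 / (2 * C2)"
  define \<rho>0 where "\<rho>0 = s1 / (2 * R)"
  define c5 where "c5 = c0 / 2"
  define c6 where "c6 = c5\<^sup>2 / A"
  define e where "e = min c6 d0"
  define C6 where "C6 = 2 / e + 2 * (\<bar>B0\<bar> + \<bar>ln (M / c6)\<bar>) / e"
  have s1: "s1 > 0" using c0 C2 by (simp add: s1_def)
  have r0: "\<rho>0 > 0" using s1 R by (simp add: \<rho>0_def)
  have c5: "c5 > 0" using c0 by (simp add: c5_def)
  have c6: "c6 > 0" using c5 A by (simp add: c6_def)
  have e: "e > 0" "e \<le> c6" "e \<le> d0" using c6 d0 by (auto simp: e_def)
  have C6: "C6 > 0" using e by (simp add: C6_def add_pos_nonneg)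
  have C34: "C3 \<ge> 0" "C4 \<ge> 0" by (auto simp: C3_def C4_def)
  \<comment> \<open>One summand for each bound, by g and by f, in each of the two cases.\<close>
  define C where "C = C3 / s1\<^sup>2 + C3 * (1 + C4 / \<rho>0) / s1\<^sup>2 + C6 / c5 + 2 * R * C6 / c5\<^sup>2"
  have parts: "C3 / s1\<^sup>2 \<ge> 0" "C3 * (1 + C4 / \<rho>0) / s1\<^sup>2 \<ge> 0" "C6 / c5 > 0" "2 * R * C6 / c5\<^sup>2 \<ge> 0"
    using C34 r0 C6 c5 R by (auto intro!: divide_nonneg_nonneg mult_nonneg_nonneg)
  then have Cge: "C3 / s1\<^sup>2 \<le> C" "C3 * (1 + C4 / \<rho>0) / s1\<^sup>2 \<le> C" "C6 / c5 \<le> C" "2 * R * C6 / c5\<^sup>2 \<le> C" "C > 0"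
    unfolding C_def by linarith+
  show thesis
  proof (rule that[OF Cge(5)])
    fix z w assume zw: "z \<in> D \<inter> V" "w \<in> D \<inter> V" "z \<noteq> w"
      and far: "c0\<^sup>2 \<le> bdist D z * bdist D w * exp (2 * kobayashi_dist D z w)"
    define s \<rho> L d d' where "s = norm (z - w)" and "\<rho> = kobayashi_dist D z w" and "L = kobayashi_dist (D \<inter> U) z w"
      and "d = bdist D z" and "d' = bdist D w"
    define x where "x = s / (sqrt d * sqrt d')"
    define S where "S = sqrt (d * d')"
    have zD: "z \<in> D" "w \<in> D" using zw by auto
    note fg = f_fun_g_fun[OF zD zw(3), folded s_def d_def d'_def, folded x_def]
    have d: "0 < d" "0 < d'" "d \<le> A" "d' \<le> A" using bdist_pos A(2) zD by (auto simp: d_def d'_def)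
    have S: "S > 0" "S\<^sup>2 = d * d'" using d by (auto simp: S_def)
    have SA: "S \<le> A"
    proof -
      have "d * d' \<le> A * A" using d A by (intro mult_mono) auto
      then have "sqrt (d * d') \<le> sqrt (A * A)" by (rule real_sqrt_le_mono)
      then show ?thesis using A by (simp add: S_def)
    qed
    have sx: "s = x * S" using fg(2) by (simp add: S_def)
    have s: "s > 0" using zw by (simp add: s_def)
    have "norm z < R" "norm w < R" using zD R(1) by auto
    then have sR: "s < 2 * R" using norm_triangle_ineq4[of z w] unfolding s_def by linarith
    have g: "g_fun D z w = s * (s + S)" by (simp add: g_fun_def s_def S_def d_def d'_def real_sqrt_mult)
    have g0: "g_fun D z w > 0" using s S unfolding g by (intro mult_pos_pos) auto
    have rs: "s / (2 * R) \<le> \<rho>"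
      using caratheodory_lower[OF R(1) open_D conn_D zD] caratheodory_le_kobayashi[OF open_D conn_D zD] by (simp add: s_def \<rho>_def)
    have rpos: "\<rho> > 0" using rs s R by (smt (verit) divide_pos_pos)
    have rx: "exp \<rho> \<le> 1 + C2 * x"
    proof -
      have "\<rho> \<le> ln (1 + C2 * x)" using C2(2)[OF zD] by (simp add: \<rho>_def x_def s_def d_def d'_def)
      then have "exp \<rho> \<le> exp (ln (1 + C2 * x))" by simp
      also have "\<dots> = 1 + C2 * x" using fg(1) C2(1) by (intro exp_ln add_pos_pos mult_pos_pos) auto
      finally show ?thesis .
    qed
    have far': "c0 \<le> S * exp \<rho>"
    proof (rule power2_le_imp_le)
      show "c0\<^sup>2 \<le> (S * exp \<rho>)\<^sup>2" using far by (simp add: power_mult_distrib S(2) exp_double[symmetric] d_def d'_def \<rho>_def)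
    qed (use S in simp)
    have lnS: "ln (M / d) / 2 + ln (M / d') / 2 = ln (M / S)"
    proof -
      have "ln S = (ln d + ln d') / 2" using d by (simp add: S_def ln_sqrt ln_mult)
      then show ?thesis using d S K(3) by (simp add: ln_div field_simps)
    qed
    have LS: "L \<le> ln (M / S) + B0" using depth[OF zw(1,2)] lnS by (simp add: L_def d_def d'_def)
    have f: "f_fun D z w = g_fun D z w / ln (1 + x)" by (rule fg(5))
    have l0: "ln (1 + x) > 0" using fg(1) by simp
    consider (1) "s1 \<le> s" | (2) "c5 \<le> S"
    proof -
      have "c0 \<le> S * (1 + C2 * x)" using far' mult_left_mono[OF rx, of S] S(1) by linarith
      also have "\<dots> = S + C2 * s" by (simp add: sx algebra_simps)
      finally have "c0 / 2 \<le> S \<or> c0 / 2 \<le> C2 * s" by linarith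
      then show ?thesis using that C2(1) by (auto simp: c5_def s1_def pos_divide_le_eq mult_ac)
    qed
    then have "L - \<rho> \<le> C * g_fun D z w \<and> L - \<rho> \<le> C * f_fun D z w * \<rho>"
    proof cases
      case 1
      have gs: "s1\<^sup>2 \<le> g_fun D z w"
      proof -
        have "s1 * s1 \<le> s * (s + S)" using 1 s1 S by (intro mult_mono) auto
        then show ?thesis unfolding g by (simp add: power2_eq_square)
      qed
      have LC3: "L - \<rho> \<le> C3"
      proof -
        have "M / S \<le> M / c0 * exp \<rho>"
          using far' S c0 K(3) by (simp add: pos_divide_le_eq pos_le_divide_eq mult_ac)
        then have "ln (M / S) \<le> ln (M / c0 * exp \<rho>)" using K(3) S by (intro ln_mono) auto
        also have "\<dots> = ln (M / c0) + \<rho>" using K(3) c0 by (subst ln_mult) auto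
        finally show ?thesis using LS by (simp add: C3_def)
      qed
      have "C3 \<le> C3 / s1\<^sup>2 * g_fun D z w"
        using mult_left_mono[OF gs, of "C3 / s1\<^sup>2"] parts(1) s1 by simp
      also have "\<dots> \<le> C * g_fun D z w" using Cge(1) g0 by (intro mult_right_mono) auto
      finally have 1: "L - \<rho> \<le> C * g_fun D z w" using LC3 by simp
      \<comment> \<open>As f = g / ln (1 + x), the relative bound needs ln (1 + x) at most a
        multiple of \<rho>; the additive constant is absorbed because \<rho> \<ge> \<rho>0 for
        separated points.\<close>
      have "ln (1 + x) \<le> \<rho> + C4"
      proof -
        have "(1 + x) * S \<le> A + 2 * R" using SA sR sx by (simp add: algebra_simps)
        also have "\<dots> \<le> (A + 2 * R) / c0 * (S * exp \<rho>)"
          using mult_left_mono[OF far', of "(A + 2 * R) / c0"] A R c0 by simp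
        finally have "(1 + x) * S \<le> ((A + 2 * R) / c0 * exp \<rho>) * S" by (simp add: mult_ac)
        then have "1 + x \<le> (A + 2 * R) / c0 * exp \<rho>" using S(1) by (simp only: mult_le_cancel_right_pos)
        then have "ln (1 + x) \<le> ln ((A + 2 * R) / c0 * exp \<rho>)" using fg(1) by (intro ln_mono) auto
        also have "\<dots> = ln ((A + 2 * R) / c0) + \<rho>" using A R c0 by (intro trans[OF ln_mult]) (auto simp: ln_mult)
        finally show ?thesis by (simp add: C4_def)
      qed
      also have "\<dots> \<le> \<rho> + C4 / \<rho>0 * \<rho>"
      proof -
        have "\<rho>0 \<le> s / (2 * R)" unfolding \<rho>0_def using 1 R \<open>s1 \<le> s\<close> by (intro divide_right_mono) auto
        then have "\<rho>0 \<le> \<rho>" using rs by linarith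
        then have "C4 / \<rho>0 * \<rho>0 \<le> C4 / \<rho>0 * \<rho>" using C34 r0 by (intro mult_left_mono) auto
        then show ?thesis using r0 by simp
      qed
      also have "\<dots> = (1 + C4 / \<rho>0) * \<rho>" by (simp add: algebra_simps)
      finally have "C3 * ln (1 + x) \<le> C3 * ((1 + C4 / \<rho>0) * \<rho>)" using C34 by (intro mult_left_mono) auto
      also have "\<dots> = C3 * (1 + C4 / \<rho>0) / s1\<^sup>2 * s1\<^sup>2 * \<rho>" using s1 by simp
      also have "\<dots> \<le> C * g_fun D z w * \<rho>"
        using Cge(2) gs rpos parts(2) Cge(5) by (intro mult_right_mono mult_mono) auto
      finally have "C3 \<le> C * g_fun D z w * \<rho> / ln (1 + x)" using l0 by (simp add: pos_le_divide_eq)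
      also have "\<dots> = C * f_fun D z w * \<rho>" by (simp add: f)
      finally show ?thesis using 1 LC3 by simp
    next
      case 2
      have dd: "c6 \<le> d" "c6 \<le> d'"
      proof -
        have "c5\<^sup>2 \<le> d * d'" using 2 c5 unfolding S(2)[symmetric] by (intro power_mono) auto
        moreover have "d * d' \<le> d * A" "d * d' \<le> A * d'" using d by (auto intro: mult_left_mono mult_right_mono)
        ultimately show "c6 \<le> d" "c6 \<le> d'" using A(1) by (auto simp: c6_def pos_divide_le_eq mult_ac)
      qed
      \<comment> \<open>Nearby points share a ball of fixed radius e in D \<inter> U; for the others
        L is bounded and s > e/2.\<close>
      have LC6: "L \<le> C6 * s"
      proof (cases "s \<le> e / 2")
        case True
        have "ball z e \<subseteq> D \<inter> U" using bdist_ball[OF zD(1)] d0(2)[of z] zw(1) e dd(1) by (auto simp: d_def subset_iff)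
        moreover have nw: "norm (w - z) = s" by (simp add: s_def norm_minus_commute)
        ultimately have "L \<le> artanh (s / e)"
          using kobayashi_ball[OF DU U(2), of z e w] True e unfolding L_def by simp
        also have "\<dots> \<le> ln (1 + 2 * (s / e))" using True e s by (intro artanh_le_ln) (auto simp: field_simps)
        also have "\<dots> \<le> 2 * (s / e)" using s e by (intro ln_add_one_self_le_self) auto
        also have "\<dots> \<le> C6 * s"
          unfolding C6_def distrib_right using s e by simp
        finally show ?thesis .
      next
        case False
        have "ln (M / d) \<le> ln (M / c6)" "ln (M / d') \<le> ln (M / c6)"
          using dd d K(3) c6 by (auto intro!: ln_mono divide_left_mono)
        then have "L \<le> \<bar>B0\<bar> + \<bar>ln (M / c6)\<bar>" using LS lnS by linarith
        also have "\<dots> = 2 * (\<bar>B0\<bar> + \<bar>ln (M / c6)\<bar>) / e * (e / 2)" using e by simp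
        also have "\<dots> \<le> 2 * (\<bar>B0\<bar> + \<bar>ln (M / c6)\<bar>) / e * s" using False e by (intro mult_left_mono) auto
        also have "\<dots> \<le> C6 * s" unfolding C6_def using s e by (intro mult_right_mono) auto
        finally show ?thesis .
      qed
      have "C6 * s = C6 / c5 * (s * c5)" using c5 by simp
      also have "\<dots> \<le> C6 / c5 * g_fun D z w"
        unfolding g using 2 s parts(3) by (intro mult_left_mono) auto
      also have "\<dots> \<le> C * g_fun D z w" using Cge(3) g0 by (intro mult_right_mono) auto
      finally have 1: "L - \<rho> \<le> C * g_fun D z w" using LC6 rpos by simp
      have fc: "c5\<^sup>2 \<le> f_fun D z w"
      proof -
        have "c5\<^sup>2 * 1 \<le> S\<^sup>2 * h_fun x" using 2 c5 h_fun_ge_1[OF fg(1)] by (intro mult_mono power_mono) auto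
        then show ?thesis using fg(4) S(2) by simp
      qed
      have "C6 * s = 2 * R * C6 / c5\<^sup>2 * c5\<^sup>2 * (s / (2 * R))" using c5 R by simp
      also have "\<dots> \<le> C * f_fun D z w * \<rho>"
        using Cge(4,5) rs s R parts(4) order_trans[OF zero_le_power2 fc] by (intro mult_mono fc) (auto intro!: mult_nonneg_nonneg)
      finally show ?thesis using 1 LC6 rpos by simp
    qed
    then have "L - \<rho> \<le> C * g_fun D z w" "(L - \<rho>) / \<rho> \<le> C * f_fun D z w" using rpos by (auto simp: pos_divide_le_eq)
    then show "kobayashi_dist (D \<inter> U) z w - kobayashi_dist D z w \<le> C * g_fun D z w \<and>
      (kobayashi_dist (D \<inter> U) z w - kobayashi_dist D z w) / kobayashi_dist D z w \<le> C * f_fun D z w"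
      by (simp add: L_def \<rho>_def)
  qed
qed

text \<open>On D the two distances agree, so both claims concern k_{D \<inter> U} - k_D.
  \<open>sinh_cosh_le\<close> turns the loss from \<open>localization\<close> into g, and after
  division by k_D into f.\<close>

lemma distance_estimate:
  assumes vd: "visible_domain D"
    and U: "open U" "connected (D \<inter> U)" and d0: "d0 > 0" "\<And>z. z \<in> V \<Longrightarrow> ball z d0 \<subseteq> U"
  obtains C where "C > 0"
    "\<And>z w. z \<in> D \<inter> V \<Longrightarrow> w \<in> D \<inter> V \<Longrightarrow> z \<noteq> w \<Longrightarrow>
      kobayashi_dist (D \<inter> U) z w / caratheodory_dist D z w \<le> 1 + C * f_fun D z w \<and>
      kobayashi_dist (D \<inter> U) z w - caratheodory_dist D z w \<le> C * g_fun D z w"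
    "\<And>z X. z \<in> D \<inter> V \<Longrightarrow>
      kobayashi_metric (D \<inter> U) z X \<le> (1 + C * (bdist D z)\<^sup>2) * caratheodory_metric D z X \<and>
      (1 + C * (bdist D z)\<^sup>2) * caratheodory_metric D z X \<le> caratheodory_metric D z X + C * bdist D z * norm X"
proof -
  obtain C1 c0 where C1: "C1 > 0" "c0 > 0"
    and loc: "\<And>z w. z \<in> D \<inter> V \<Longrightarrow> w \<in> D \<inter> V \<Longrightarrow> z \<noteq> w \<Longrightarrow>
      kobayashi_dist (D \<inter> U) z w \<le> kobayashi_dist D z w +
        C1 * (bdist D z * bdist D w) * (sinh (kobayashi_dist D z w) * cosh (kobayashi_dist D z w)) \<or>
      c0 \<le> bdist D z * bdist D w * exp (2 * kobayashi_dist D z w)"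
    and locm: "\<And>z X. z \<in> D \<inter> V \<Longrightarrow>
      kobayashi_metric (D \<inter> U) z X \<le> (1 + C1 * (bdist D z)\<^sup>2) * caratheodory_metric D z X \<or> c0 \<le> bdist D z"
    using localization[OF vd U d0] by metis
  have "sqrt c0 > 0" using C1 by simp
  then obtain C3 where C3: "C3 > 0"
    and far: "\<And>z w. z \<in> D \<inter> V \<Longrightarrow> w \<in> D \<inter> V \<Longrightarrow> z \<noteq> w \<Longrightarrow>
      (sqrt c0)\<^sup>2 \<le> bdist D z * bdist D w * exp (2 * kobayashi_dist D z w) \<Longrightarrow>
      kobayashi_dist (D \<inter> U) z w - kobayashi_dist D z w \<le> C3 * g_fun D z w \<and>
      (kobayashi_dist (D \<inter> U) z w - kobayashi_dist D z w) / kobayashi_dist D z w \<le> C3 * f_fun D z w"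
    using far_estimate[OF U d0] by metis
  obtain C2 where C2: "C2 \<ge> 1" "\<And>z w. z \<in> D \<Longrightarrow> w \<in> D \<Longrightarrow>
    kobayashi_dist D z w \<le> ln (1 + C2 * (norm (z - w) / (sqrt (bdist D z) * sqrt (bdist D w))))"
    using kobayashi_upper_bdist by metis
  obtain R where R: "D \<subseteq> ball 0 R" "R > 0" using bounded_subset_ballD[OF bounded_D] by blast
  define e where "e = min c0 d0"
  have e: "e > 0" using C1 d0 by (simp add: e_def)
  define C where "C = C1 * C2\<^sup>2 + C3 + C1 + R / (e * c0\<^sup>2)"
  have parts: "C1 * C2\<^sup>2 \<ge> 0" "R / (e * c0\<^sup>2) \<ge> 0" using C1 R e by auto
  have C: "C > 0" "C1 * C2\<^sup>2 \<le> C" "C3 \<le> C" "C1 \<le> C" "R / (e * c0\<^sup>2) \<le> C"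
    using parts C1 C3 unfolding C_def by linarith+
  show thesis
  proof (rule that[OF C(1)])
    fix z w assume zw: "z \<in> D \<inter> V" "w \<in> D \<inter> V" "z \<noteq> w"
    then have zD: "z \<in> D" "w \<in> D" by auto
    define k L where "k = kobayashi_dist D z w" and "L = kobayashi_dist (D \<inter> U) z w"
    define x where "x = norm (z - w) / (sqrt (bdist D z) * sqrt (bdist D w))"
    note fg = f_fun_g_fun[OF zD zw(3), folded x_def]
    have cd: "caratheodory_dist D z w = k" using caratheodory_eq_kobayashi[OF zD zw(3)] by (simp add: k_def)
    have dpos: "bdist D z * bdist D w > 0" using bdist_pos zD by simp
    have kpos: "k > 0"
    proof -
      have "0 < norm (z - w) / (2 * R)" using zw(3) R(2) by simp
      then show ?thesis using caratheodory_lower[OF R(1) open_D conn_D zD] cd by linarith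
    qed
    have g0: "g_fun D z w \<ge> 0" using fg(1,3) dpos by simp
    have f0: "f_fun D z w \<ge> 0" using g0 fg(1,5) by simp
    have "L - k \<le> C * g_fun D z w \<and> (L - k) / k \<le> C * f_fun D z w"
      using loc[OF zw, folded k_def L_def]
    proof (elim disjE)
      assume le: "L \<le> k + C1 * (bdist D z * bdist D w) * (sinh k * cosh k)"
      have kx: "k \<le> ln (1 + C2 * x)" using C2(2)[OF zD] by (simp add: k_def x_def)
      note sc = sinh_cosh_le[OF kpos kx fg(1) C2(1)]
      have m: "C1 * (bdist D z * bdist D w) \<ge> 0" using C1 dpos by simp
      have "L - k \<le> C1 * (bdist D z * bdist D w) * (C2\<^sup>2 * (x * (1 + x)))"
        using le mult_left_mono[OF sc(1) m] by linarith
      also have "\<dots> = C1 * C2\<^sup>2 * g_fun D z w" by (simp add: fg(3))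
      also have "\<dots> \<le> C * g_fun D z w" by (rule mult_right_mono[OF C(2) g0])
      finally have 1: "L - k \<le> C * g_fun D z w" .
      have "(L - k) / k \<le> C1 * (bdist D z * bdist D w) * (sinh k * cosh k) / k"
        using le kpos by (intro divide_right_mono) auto
      also have "\<dots> \<le> C1 * (bdist D z * bdist D w) * (C2\<^sup>2 * h_fun x)"
        using mult_left_mono[OF sc(2) m] by simp
      also have "\<dots> = C1 * C2\<^sup>2 * f_fun D z w" by (simp add: fg(4))
      also have "\<dots> \<le> C * f_fun D z w" by (rule mult_right_mono[OF C(2) f0])
      finally show ?thesis using 1 by simp
    next
      assume "c0 \<le> bdist D z * bdist D w * exp (2 * k)"
      then have "(sqrt c0)\<^sup>2 \<le> bdist D z * bdist D w * exp (2 * kobayashi_dist D z w)" using C1 by (simp add: k_def)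
      from far[OF zw this] have "L - k \<le> C3 * g_fun D z w" "(L - k) / k \<le> C3 * f_fun D z w" by (auto simp: k_def L_def)
      then show ?thesis using mult_right_mono[OF C(3) g0] mult_right_mono[OF C(3) f0] by linarith
    qed
    then show "kobayashi_dist (D \<inter> U) z w / caratheodory_dist D z w \<le> 1 + C * f_fun D z w \<and>
      kobayashi_dist (D \<inter> U) z w - caratheodory_dist D z w \<le> C * g_fun D z w"
      using kpos unfolding cd L_def[symmetric] by (simp add: diff_divide_distrib)
  next
    fix z X assume z: "z \<in> D \<inter> V"
    define \<gamma> d where "\<gamma> = caratheodory_metric D z X" and "d = bdist D z"
    have d: "d > 0" "ball z d \<subseteq> D" using bdist_pos bdist_ball[of z D] z by (auto simp: d_def)
    have lower: "norm X / R \<le> \<gamma>" unfolding \<gamma>_def by (rule caratheodory_metric_lower[OF R(1) d(2,1)])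
    have upper: "\<gamma> \<le> norm X / d" unfolding \<gamma>_def by (rule caratheodory_metric_le_ball[OF d(2,1)])
    have \<gamma>0: "\<gamma> \<ge> 0" using lower R(2) by (meson divide_nonneg_pos norm_ge_zero order_trans)
    have "kobayashi_metric (D \<inter> U) z X \<le> (1 + C1 * d\<^sup>2) * \<gamma> \<or> c0 \<le> d" using locm[OF z] by (simp add: \<gamma>_def d_def)
    then have "kobayashi_metric (D \<inter> U) z X \<le> (1 + C * d\<^sup>2) * \<gamma>"
    proof (elim disjE)
      assume "kobayashi_metric (D \<inter> U) z X \<le> (1 + C1 * d\<^sup>2) * \<gamma>"
      also have "\<dots> \<le> (1 + C * d\<^sup>2) * \<gamma>" using C(4) \<gamma>0 by (intro mult_right_mono add_left_mono) auto
      finally show ?thesis .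
    next
      assume cd: "c0 \<le> d"
      \<comment> \<open>For deep points both metrics are comparable to |X|, and d \<ge> c0 lets the
        term C d^2 absorb the ratio.\<close>
      have "ball z e \<subseteq> D \<inter> U" using d(2) d0(2)[of z] z cd by (auto simp: e_def subset_iff)
      then have "kobayashi_metric (D \<inter> U) z X \<le> norm X / e" by (rule kobayashi_metric_ball[OF _ e])
      also have "\<dots> = R / (e * c0\<^sup>2) * c0\<^sup>2 * (norm X / R)" using R C1 e by simp
      also have "\<dots> \<le> C * d\<^sup>2 * \<gamma>"
        using C(1,5) parts(2) cd C1 lower R(2) by (intro mult_mono power_mono) auto
      also have "\<dots> \<le> (1 + C * d\<^sup>2) * \<gamma>" using \<gamma>0 by (intro mult_right_mono) auto
      finally show ?thesis .
    qed
    moreover have "(1 + C * d\<^sup>2) * \<gamma> \<le> \<gamma> + C * d * norm X"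
    proof -
      have "C * d\<^sup>2 * \<gamma> \<le> C * d\<^sup>2 * (norm X / d)" using upper C(1) by (intro mult_left_mono) auto
      also have "\<dots> = C * d * norm X" using d by (simp add: power2_eq_square)
      finally show ?thesis by (simp add: algebra_simps)
    qed
    ultimately show "kobayashi_metric (D \<inter> U) z X \<le> (1 + C * (bdist D z)\<^sup>2) * caratheodory_metric D z X \<and>
      (1 + C * (bdist D z)\<^sup>2) * caratheodory_metric D z X \<le> caratheodory_metric D z X + C * bdist D z * norm X"
      by (simp add: \<gamma>_def d_def)
  qed
qed

end

theorem proposition3:
  fixes D U V :: "(complex ^ 'n) set" and p :: "complex ^ 'n"
  assumes "domain_on D" and "bounded D" and "convex D" and "visible_domain D"
    and "Dini_smooth_boundary D"
    and "p \<in> frontier D"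
    and "open U" and "open V" and "p \<in> V" and "compactly_contained V U"
    and "connected (D \<inter> U)"
  shows "\<exists>C>0. \<forall>z\<in>D \<inter> V. \<forall>w\<in>D \<inter> V. \<forall>X. z \<noteq> w \<longrightarrow>
           kobayashi_dist (D \<inter> U) z w / caratheodory_dist D z w \<le> 1 + C * f_fun D z w \<and>
           kobayashi_dist (D \<inter> U) z w - caratheodory_dist D z w \<le> C * g_fun D z w \<and>
           kobayashi_metric (D \<inter> U) z X
             \<le> (1 + C * (bdist D z)\<^sup>2) * caratheodory_metric D z X \<and>
           (1 + C * (bdist D z)\<^sup>2) * caratheodory_metric D z X
             \<le> caratheodory_metric D z X + C * bdist D z * norm X"
proof -
  obtain \<nu> where \<nu>: "\<forall>p\<in>frontier D. inner_unit_normal D p (\<nu> p)" "Dini_continuous_on (frontier D) \<nu>"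
    using assms(5) unfolding Dini_smooth_boundary_def by blast
  interpret dini_convex D \<nu>
    by unfold_locales (use assms(1-3) \<nu> in \<open>auto simp: domain_on_def\<close>)
  have cV: "compact (closure V)" "closure V \<subseteq> U" using assms(10) by (auto simp: compactly_contained_def)
  \<comment> \<open>A radius uniform over V is the form in which all estimates use the relation
    between V and U.\<close>
  obtain d0 where d0: "d0 > 0" "(\<Union>x\<in>closure V. ball x d0) \<subseteq> U"
    using compact_subset_open_imp_ball_epsilon_subset[OF cV(1) assms(7) cV(2)] .
  have ball: "ball z d0 \<subseteq> U" if "z \<in> V" for z using d0(2) that closure_subset[of V] by blast
  show ?thesis
    by (rule distance_estimate[OF assms(4,7,11) d0(1) ball]) blast+
qed

end
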